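(* Let $T>0$, $I=(0,1)$, and let $G\subset[0,T]\times I$ be a (Lebesgue) measurable set. (Dirichlet) The following two properties are equivalent: (1) there is a constant $C>0$ such that every weak solution $u$ of the Dirichlet problem $\partial_t^2u-\partial_x^2u=0$ on $[0,T]\times I$, $u(t,0)=u(t,1)=0$, $(u,\partial_tu)|_{t=0}=(u_0,u_1)\in H_0^1(I)\times L^2(I)$, satisfies $$\|\partial_xu_0\|_{L^2(I)}^2+\|u_1\|_{L^2(I)}^2\le C\iint_G|\partial_tu(t,x)|^2\,dx\,dt;$$ (2) $G$ satisfies both (OSC-D) and (GCC). (Neumann) The following two properties are equivalent: (1) there is a constant $C>0$ such that every weak solution $u$ of the Neumann problem $\partial_t^2u-\partial_x^2u=0$ on $[0,T]\times I$, $\partial_xu(t,0)=\partial_xu(t,1)=0$, $(u,\partial_tu)|_{t=0}=(u_0,u_1)\in H^1(I)\times L^2(I)$, satisfies the same inequality $$\|\partial_xu_0\|_{L^2(I)}^2+\|u_1\|_{L^2(I)}^2\le C\iint_G|\partial_tu(t,x)|^2\,dx\,dt;$$ (2) $G$ satisfies both (OSC-N) and (GCC).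
   Context: Weak solutions are taken in $C([0,T];H_0^1(I))\cap C^1([0,T];L^2(I))$ in the Dirichlet case and in $C([0,T];H^1(I))\cap C^1([0,T];L^2(I))$ in the Neumann case. Labelled double cover. $\widetilde I=I\times\{\xi,\eta\}$ with the natural Lebesgue measure $|\cdot|$, so $|\widetilde I|=2$. Its points are written $[x;\sigma]$, $x\in I$, $\sigma\in\{\xi,\eta\}$. Characteristics. $L_{[x;\xi]}$ (resp. $L_{[x;\eta]}$) is the characteristic line in $\{t\ge0\}$ starting from $(t,x)=(0,x)$ and moving initially to the right (resp. left) with unit speed, reflecting at the boundary points $x=0$ and $x=1$. Explicitly, with the $2$-periodic folding map $\pi:\mathbb R\to[0,1]$, $\pi(s)=s$ for $0\le s\le1$ and $\pi(s)=2-s$ for $1<s<2$, the point of $L_{[x;\xi]}$ at time $s$ is $L_{[x;\xi]}(s)=(s,\pi(x+s))$ and that of $L_{[x;\eta]}$ is $L_{[x;\eta]}(s)=(s,\pi(x-s))$, $s\ge0$. (GCC). $G$ satisfies (GCC) if there is $c_0>0$ such that for almost every $x\in[0,1]$ both $\mathcal H^1(G\cap\{L_{[x;\eta]}(s):s\in[0,T]\})\ge c_0$ and $\mathcal H^1(G\cap\{L_{[x;\xi]}(s):s\in[0,T]\})\ge c_0$, where $\mathcal H^1$ is one-dimensional Hausdorff measure. Intersection sets. For $\widetilde A\subset\widetilde I$, $$\mathcal M_{\widetilde A}=\{(t,x)\in[0,\infty)\times I:\ \exists\text{ distinct }\widetilde y,\widetilde z\in\widetilde A\text{ with }(t,x)\in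 L_{\widetilde y}\cap L_{\widetilde z}\},\qquad \mathcal M_{\widetilde A}(\tau)=\mathcal M_{\widetilde A}\cap\{t\le\tau\}.$$ For disjoint $\widetilde E,\widetilde F\subset\widetilde I$, $$\mathcal W_{\widetilde E,\widetilde F}=\{(t,x)\in[0,\infty)\times I:\ \exists\,\widetilde y\in\widetilde E,\ \widetilde z\in\widetilde F,\ \widetilde y\ne\widetilde z,\text{ with }(t,x)\in L_{\widetilde y}\cap L_{\widetilde z}\},\qquad \mathcal W_{\widetilde E,\widetilde F}(\tau)=\mathcal W_{\widetilde E,\widetilde F}\cap\{t\le\tau\}.$$ (OSC-D). For measurable $\widetilde A\subset\widetilde I$, $G$ is $(\widetilde A;T)$-observable symmetric if $G\setminus(\mathcal M_{\widetilde A}(T)\cup\mathcal M_{\widetilde I\setminus\widetilde A}(T))$ has two-dimensional Lebesgue measure $0$. $\widetilde A$ is trivial if $|\widetilde A|=0$ or $|\widetilde A|=2$, and nontrivial otherwise. $G$ satisfies (OSC-D) if for every nontrivial measurable $\widetilde A\subset\widetilde I$, $G$ is not $(\widetilde A;T)$-observable symmetric. (OSC-N). For disjoint measurable $\widetilde E,\widetilde F\subset\widetilde I$, $G$ is $(\widetilde E,\widetilde F;T)$-observable symmetric if $G\setminus(\mathcal W_{\widetilde E,\widetilde F}(T)\cup\mathcal M_{\widetilde I\setminus(\widetilde E\cup\widetilde F)}(T))$ has two-dimensional Lebesgue measure $0$. The pair $(\widetilde E,\widetilde F)$ is trivial if $|\widetilde E|=0$ or $|\widetilde F|=0$, and nontrivial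 otherwise. $G$ satisfies (OSC-N) if for every nontrivial pair of disjoint measurable sets $(\widetilde E,\widetilde F)$, $G$ is not $(\widetilde E,\widetilde F;T)$-observable symmetric. *)

theory Defs
  imports "HOL-Analysis.Analysis"
begin

abbreviation unit_iv :: "real set"
  where "unit_iv \<equiv> {0<..<1}"

section \<open>Sobolev spaces on the unit interval\<close>

text \<open>
  Elements of $L^2(I)$ and $H^1(I)$ are represented by functions on \<open>\<real>\<close>, whose values outside
  \<open>unit_iv\<close> are irrelevant; all notions below are invariant under changes on null sets.
\<close>

definition L2 :: "(real \<Rightarrow> real) set"
  where "L2 = {f \<in> borel_measurable (lebesgue_on unit_iv).
                 integrable (lebesgue_on unit_iv) (\<lambda>x. (f x)\<^sup>2)}"

definition l2_inner :: "(real \<Rightarrow> real) \<Rightarrow> (real \<Rightarrow> real) \<Rightarrow> real"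
  where "l2_inner f g = (\<integral>x. f x * g x \<partial>lebesgue_on unit_iv)"

definition l2_norm :: "(real \<Rightarrow> real) \<Rightarrow> real"
  where "l2_norm f = sqrt (\<integral>x. (f x)\<^sup>2 \<partial>lebesgue_on unit_iv)"

text \<open>The functions of class $C_c^\infty(S)$, extended by zero.\<close>

definition test_functions :: "real set \<Rightarrow> (real \<Rightarrow> real) set"
  where "test_functions S = {\<phi>. (\<forall>n x. (deriv ^^ n) \<phi> differentiable (at x)) \<and>
                                compact (closure {x. \<phi> x \<noteq> 0}) \<and> closure {x. \<phi> x \<noteq> 0} \<subseteq> S}"

definition is_weak_deriv :: "(real \<Rightarrow> real) \<Rightarrow> (real \<Rightarrow> real) \<Rightarrow> bool"
  where "is_weak_deriv f g \<longleftrightarrow>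
           (\<forall>\<phi>\<in>test_functions unit_iv. l2_inner f (deriv \<phi>) = - l2_inner g \<phi>)"

definition H1 :: "(real \<Rightarrow> real) set"
  where "H1 = {f \<in> L2. \<exists>g\<in>L2. is_weak_deriv f g}"

text \<open>For \<open>f \<in> H1\<close> the chosen function is unique up to a null set.\<close>

definition weak_deriv :: "(real \<Rightarrow> real) \<Rightarrow> real \<Rightarrow> real"
  where "weak_deriv f = (SOME g. g \<in> L2 \<and> is_weak_deriv f g)"

definition h1_norm :: "(real \<Rightarrow> real) \<Rightarrow> real"
  where "h1_norm f = sqrt ((l2_norm f)\<^sup>2 + (l2_norm (weak_deriv f))\<^sup>2)"

definition H10 :: "(real \<Rightarrow> real) set"
  where "H10 = {f \<in> H1. \<forall>\<epsilon>>0. \<exists>\<phi>\<in>test_functions unit_iv. h1_norm (\<lambda>x. f x - \<phi> x) < \<epsilon>}"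

section \<open>Weak solutions of the wave equation\<close>

definition continuous_curve :: "((real \<Rightarrow> real) \<Rightarrow> real) \<Rightarrow> real \<Rightarrow> (real \<Rightarrow> real \<Rightarrow> real) \<Rightarrow> bool"
  where "continuous_curve nrm T u \<longleftrightarrow>
           (\<forall>t\<in>{0..T}. ((\<lambda>s. nrm (\<lambda>x. u s x - u t x)) \<longlongrightarrow> 0) (at t within {0..T}))"

definition l2_curve_deriv :: "real \<Rightarrow> (real \<Rightarrow> real \<Rightarrow> real) \<Rightarrow> (real \<Rightarrow> real \<Rightarrow> real) \<Rightarrow> bool"
  where "l2_curve_deriv T u v \<longleftrightarrow>
           (\<forall>t\<in>{0..T}. ((\<lambda>s. l2_norm (\<lambda>x. (u s x - u t x) / (s - t) - v t x)) \<longlongrightarrow> 0)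
                          (at t within {0..T}))"

text \<open>
  \<open>weak_wave_solution V T u0 u1 u v\<close>: the curve \<open>u\<close> in $C([0,T];V) \cap C^1([0,T];L^2(I))$ with
  $\partial_t u = v$ is a weak solution of the wave equation with data \<open>(u0, u1)\<close>; \<open>V = H10\<close>
  gives the Dirichlet problem and \<open>V = H1\<close> the Neumann problem, whose boundary condition
  is the natural one of the variational formulation.

  As a continuous curve in $L^2(I)$, $\partial_t u$ is an element of $L^2([0,T]\times I)$; the joint
  measurability of \<open>v\<close> says that \<open>v\<close> is a representative of that element (it is then determined
  by \<open>u\<close> up to a null set of $[0,T]\times I$), so that space-time integrals of it make sense.
\<close>

definition weak_wave_solution ::
    "(real \<Rightarrow> real) set \<Rightarrow> real \<Rightarrow> (real \<Rightarrow> real) \<Rightarrow> (real \<Rightarrow> real) \<Rightarrow>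
     (real \<Rightarrow> real \<Rightarrow> real) \<Rightarrow> (real \<Rightarrow> real \<Rightarrow> real) \<Rightarrow> bool"
  where "weak_wave_solution V T u0 u1 u v \<longleftrightarrow>
           u0 \<in> V \<and> u1 \<in> L2 \<and>
           (\<forall>t\<in>{0..T}. u t \<in> V) \<and> continuous_curve h1_norm T u \<and>
           (\<forall>t\<in>{0..T}. v t \<in> L2) \<and> continuous_curve l2_norm T v \<and>
           l2_curve_deriv T u v \<and>
           (\<lambda>(t, x). v t x) \<in> borel_measurable (lebesgue_on ({0..T} \<times> unit_iv)) \<and>
           (AE x in lebesgue_on unit_iv. u 0 x = u0 x) \<and>
           (AE x in lebesgue_on unit_iv. v 0 x = u1 x) \<and>
           (\<forall>\<psi>\<in>V. \<forall>\<theta>\<in>test_functions {0<..<T}.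
              (\<integral>t. - l2_inner (v t) \<psi> * deriv \<theta> t
                   + l2_inner (weak_deriv (u t)) (weak_deriv \<psi>) * \<theta> t \<partial>lebesgue_on {0..T}) = 0)"

section \<open>Labelled double cover and characteristics\<close>

datatype label = Xi | Eta

instance label :: countable
  by countable_datatype

lemma UNIV_label: "UNIV = {Xi, Eta}"
  using label.exhaust by auto

definition cover :: "(real \<times> label) measure"
  where "cover = lebesgue_on unit_iv \<Otimes>\<^sub>M count_space UNIV"

lemma space_cover: "space cover = unit_iv \<times> UNIV"
  by (simp add: cover_def space_pair_measure)

lemma emeasure_space_cover: "emeasure cover (space cover) = 2"
proof -
  interpret sigma_finite_measure "count_space (UNIV :: label set)"
    by (rule sigma_finite_measure_count_space)
  have "emeasure cover (unit_iv \<times> UNIV) =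
        emeasure (lebesgue_on unit_iv) unit_iv * emeasure (count_space (UNIV :: label set)) UNIV"
    unfolding cover_def by (rule emeasure_pair_measure_Times) auto
  also have "emeasure (count_space (UNIV :: label set)) UNIV = 2"
    by (simp add: UNIV_label)
  also have "emeasure (lebesgue_on unit_iv) unit_iv = 1"
    by (simp add: emeasure_restrict_space)
  finally show ?thesis
    by (simp add: space_cover)
qed

definition fold_unit :: "real \<Rightarrow> real"
  where "fold_unit s = (let r = s - 2 * of_int \<lfloor>s / 2\<rfloor> in if r \<le> 1 then r else 2 - r)"

fun char_point :: "real \<times> label \<Rightarrow> real \<Rightarrow> real \<times> real"
  where
    "char_point (x, Xi) s = (s, fold_unit (x + s))"
  | "char_point (x, Eta) s = (s, fold_unit (x - s))"

definition char_line :: "real \<times> label \<Rightarrow> (real \<times> real) set"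
  where "char_line y = char_point y ` {0..}"

section \<open>One-dimensional Hausdorff measure\<close>

text \<open>The outer measure, hence defined on all subsets.\<close>

definition hausdorff1_pre :: "real \<Rightarrow> 'a::metric_space set \<Rightarrow> ennreal"
  where "hausdorff1_pre \<delta> S =
           (INF U \<in> {U :: nat \<Rightarrow> 'a set. (\<forall>i. bounded (U i) \<and> diameter (U i) \<le> \<delta>) \<and> S \<subseteq> (\<Union>i. U i)}.
              \<Sum>i. ennreal (diameter (U i)))"

definition hausdorff1 :: "'a::metric_space set \<Rightarrow> ennreal"
  where "hausdorff1 S = (SUP \<delta>\<in>{0<..}. hausdorff1_pre \<delta> S)"

section \<open>Geometric conditions on the observation set\<close>

definition GCC :: "real \<Rightarrow> (real \<times> real) set \<Rightarrow> bool"
  where "GCC T G \<longleftrightarrow>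
           (\<exists>c0>0. AE x in lebesgue_on {0..1}.
              hausdorff1 (G \<inter> char_point (x, Eta) ` {0..T}) \<ge> ennreal c0 \<and>
              hausdorff1 (G \<inter> char_point (x, Xi) ` {0..T}) \<ge> ennreal c0)"

definition M_set :: "(real \<times> label) set \<Rightarrow> (real \<times> real) set"
  where "M_set A = {p \<in> {0..} \<times> unit_iv.
           \<exists>y\<in>A. \<exists>z\<in>A. y \<noteq> z \<and> p \<in> char_line y \<inter> char_line z}"

definition M_set_upto :: "(real \<times> label) set \<Rightarrow> real \<Rightarrow> (real \<times> real) set"
  where "M_set_upto A \<tau> = M_set A \<inter> {(t, x). t \<le> \<tau>}"

definition W_set :: "(real \<times> label) set \<Rightarrow> (real \<times> label) set \<Rightarrow> (real \<times> real) set"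
  where "W_set E F = {p \<in> {0..} \<times> unit_iv.
           \<exists>y\<in>E. \<exists>z\<in>F. y \<noteq> z \<and> p \<in> char_line y \<inter> char_line z}"

definition W_set_upto :: "(real \<times> label) set \<Rightarrow> (real \<times> label) set \<Rightarrow> real \<Rightarrow> (real \<times> real) set"
  where "W_set_upto E F \<tau> = W_set E F \<inter> {(t, x). t \<le> \<tau>}"

text \<open>
  Having measure zero is expressed by \<open>null_sets lebesgue\<close>, since \<open>emeasure\<close> also vanishes on
  non-measurable sets.
\<close>

definition observable_symmetric :: "(real \<times> label) set \<Rightarrow> real \<Rightarrow> (real \<times> real) set \<Rightarrow> bool"
  where "observable_symmetric A T G \<longleftrightarrow>
           G - (M_set_upto A T \<union> M_set_upto (space cover - A) T) \<in> null_sets lebesgue"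

definition trivial_set :: "(real \<times> label) set \<Rightarrow> bool"
  where "trivial_set A \<longleftrightarrow> emeasure cover A = 0 \<or> emeasure cover A = 2"

definition OSC_D :: "real \<Rightarrow> (real \<times> real) set \<Rightarrow> bool"
  where "OSC_D T G \<longleftrightarrow>
           (\<forall>A\<in>sets cover. \<not> trivial_set A \<longrightarrow> \<not> observable_symmetric A T G)"

definition observable_symmetric_pair ::
    "(real \<times> label) set \<Rightarrow> (real \<times> label) set \<Rightarrow> real \<Rightarrow> (real \<times> real) set \<Rightarrow> bool"
  where "observable_symmetric_pair E F T G \<longleftrightarrow>
           G - (W_set_upto E F T \<union> M_set_upto (space cover - (E \<union> F)) T) \<in> null_sets lebesgue"

definition trivial_pair :: "(real \<times> label) set \<Rightarrow> (real \<times> label) set \<Rightarrow> bool"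
  where "trivial_pair E F \<longleftrightarrow> emeasure cover E = 0 \<or> emeasure cover F = 0"

definition OSC_N :: "real \<Rightarrow> (real \<times> real) set \<Rightarrow> bool"
  where "OSC_N T G \<longleftrightarrow>
           (\<forall>E\<in>sets cover. \<forall>F\<in>sets cover. E \<inter> F = {} \<and> \<not> trivial_pair E F \<longrightarrow>
              \<not> observable_symmetric_pair E F T G)"

end

theory Submission
  imports Defs
begin

text \<open>
  By d'Alembert's formula the time derivative of a solution is \<open>p (t + x) + \<epsilon> * p (t - x)\<close> for a
  2-periodic \<open>p\<close>, with \<open>\<epsilon> = 1\<close> in the Neumann case and \<open>\<epsilon> = -1\<close>, \<open>p\<close> of mean zero, in the
  Dirichlet case; the energy is \<open>2 * \<integral>p\<^sup>2\<close> over a period. The circle of length 2 on which \<open>p\<close> lives is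
  the labelled double cover, so (GCC) bounds from below the time \<open>\<tau> c\<close> that the characteristic
  through almost every \<open>c\<close> spends in \<open>G\<close>. The observation is \<open>\<integral>\<tau> * p\<^sup>2\<close> plus a cross term
  which is a compact quadratic form. Under (GCC) a failure of observability therefore produces, as the
  weak limit of an almost unobserved sequence, some \<open>p \<noteq> 0\<close> with \<open>p (t + x) = - \<epsilon> * p (t - x)\<close>
  almost everywhere on \<open>G\<close>. In the Dirichlet case the set \<open>p > 0\<close>, in the Neumann case the pair
  \<open>p > 0\<close>, \<open>p < 0\<close>, is then observable symmetric, and nontrivial because \<open>p\<close> has mean zero,
  respectively because a \<open>p\<close> of constant sign would vanish on the characteristics meeting \<open>G\<close>.

  Conversely, an observable symmetric set \<open>A\<close> makes \<open>indicator A\<close> minus its mean invisible on \<open>G\<close>,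
  a pair \<open>(E, F)\<close> makes \<open>indicator E - indicator F\<close> invisible, and functions supported on the
  characteristics that spend little time in \<open>G\<close> violate the inequality if (GCC) fails. These
  bounded functions are reached from explicit trigonometric solutions by density.
\<close>

section \<open>Smooth cutoffs and test functions\<close>

text \<open>A weak solution comes without a formula, so it is identified mode by mode: tested with
  an eigenfunction, the weak formulation is a scalar oscillator equation, and completeness of the
  sines (Dirichlet) or cosines (Neumann) lets the coefficients determine the time derivative.
  Boundary values are never evaluated for general elements of \<open>H10\<close>; integration by
  parts between \<open>H1\<close> and \<open>H10\<close> replaces them, and its lowest mode is the
  mean-zero condition on \<open>p\<close>.

  The obstacle to a lower bound is the cross term. In the coordinates t + x and t - x its kernel is
  the indicator of a bounded set, so finitely many linear functionals control it up to a small
  multiple of the squared norm. Once these converge along an almost unobserved sequence, (GCC) makes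
  the sequence Cauchy in norm; the limit is a strong one, and this is why it is not 0.

  Fubini is applied to Borel sets, so the estimates concern a Borel subset of full measure in
  \<open>G\<close>. (GCC) speaks of \<open>G\<close> itself, but almost every characteristic spends
  no time in the difference. Hausdorff measure and time agree up to a factor 2, harmless where only
  some positive constant is asked for.\<close>

definition smooth :: "(real \<Rightarrow> real) \<Rightarrow> bool"
  where "smooth f \<longleftrightarrow> (\<forall>n x. (deriv ^^ n) f differentiable (at x))"

text \<open>Coinduction: a family of differentiable functions closed under \<open>deriv\<close>
  contains every iterated derivative of its members. Afterwards only an invariant family has to be
  found, never a formula for a higher derivative.\<close>

lemma smooth_coinduct:
  assumes "f \<in> F"
    and "\<And>g. g \<in> F \<Longrightarrow> (\<forall>x. g differentiable (at x)) \<and> deriv g \<in> F"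
  shows "smooth f"
proof -
  have "(deriv ^^ n) f \<in> F" for n
    by (induction n) (use assms in auto)
  then show ?thesis
    using assms by (auto simp: smooth_def)
qed

lemma smooth_deriv: "smooth f \<Longrightarrow> smooth (deriv f)"
  unfolding smooth_def by (metis funpow_Suc_right o_apply)

lemma smooth_has_deriv: "smooth f \<Longrightarrow> (f has_real_derivative deriv f x) (at x within S)"
  unfolding smooth_def
  by (metis funpow_0 DERIV_deriv_iff_real_differentiable has_field_derivative_at_within)

lemma smooth_isCont: "smooth f \<Longrightarrow> isCont f x"
  using smooth_has_deriv DERIV_isCont by blast

lemma smooth_continuous_on: "smooth f \<Longrightarrow> continuous_on S f"
  by (simp add: continuous_at_imp_continuous_on smooth_isCont)

lemma smooth_borel [measurable_dest]: "smooth f \<Longrightarrow> f \<in> borel_measurable borel"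
  by (simp add: borel_measurable_continuous_onI smooth_continuous_on)

lemma deriv_eqI: "(\<And>x. (f has_real_derivative g x) (at x)) \<Longrightarrow> deriv f = g"
  by (rule ext) (rule DERIV_imp_deriv)

lemma smooth_antiderivative:
  assumes "smooth g" "\<And>x. (f has_real_derivative g x) (at x)"
  shows "smooth f"
proof -
  have 1: "deriv f = g"
    using assms(2) by (rule deriv_eqI)
  show ?thesis
    unfolding smooth_def
  proof (intro allI)
    fix n x
    show "(deriv ^^ n) f differentiable (at x)"
    proof (cases n)
      case 0
      then show ?thesis using assms(2) real_differentiable_def by auto
    next
      case (Suc m)
      then have "(deriv ^^ n) f = (deriv ^^ m) g"
        by (simp add: funpow_Suc_right 1 del: funpow.simps)
      then show ?thesis using assms(1) by (simp add: smooth_def)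
    qed
  qed
qed

lemma smooth_const: "smooth (\<lambda>x. c)"
  by (rule smooth_coinduct[of _ "range (\<lambda>c x. c)"]) auto

text \<open>By the Leibniz rule, products of smooth functions alone are not an invariant family for
  \<open>deriv\<close>, but their finite sums are; this is the family fed to
  \<open>smooth_coinduct\<close>.\<close>

inductive_set sum_prod_smooth :: "(real \<Rightarrow> real) set" where
  prod: "smooth f \<Longrightarrow> smooth g \<Longrightarrow> (\<lambda>x. f x * g x) \<in> sum_prod_smooth"
| sum: "f \<in> sum_prod_smooth \<Longrightarrow> g \<in> sum_prod_smooth \<Longrightarrow> (\<lambda>x. f x + g x) \<in> sum_prod_smooth"

lemma smooth_sum_prod:
  assumes "f \<in> sum_prod_smooth" shows "smooth f"
proof (rule smooth_coinduct[OF assms])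
  fix g assume "g \<in> sum_prod_smooth"
  then show "(\<forall>x. g differentiable (at x)) \<and> deriv g \<in> sum_prod_smooth"
  proof induction
    case (prod f g)
    have D: "((\<lambda>x. f x * g x) has_real_derivative deriv f x * g x + f x * deriv g x) (at x)" for x
      using DERIV_mult[OF smooth_has_deriv[OF prod(1)] smooth_has_deriv[OF prod(2)], of x UNIV]
      by (simp add: algebra_simps)
    have "deriv (\<lambda>x. f x * g x) = (\<lambda>x. deriv f x * g x + f x * deriv g x)"
      using D by (rule deriv_eqI)
    then show ?case
      using D prod by (auto intro!: sum_prod_smooth.intros smooth_deriv
          simp: real_differentiable_def)
  next
    case (sum f g)
    have D: "((\<lambda>x. f x + g x) has_real_derivative deriv f x + deriv g x) (at x)" for x
      using sum.IH by (intro DERIV_add) (auto simp: DERIV_deriv_iff_real_differentiable)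
    have "deriv (\<lambda>x. f x + g x) = (\<lambda>x. deriv f x + deriv g x)"
      using D by (rule deriv_eqI)
    then show ?case
      using D sum by (auto intro!: sum_prod_smooth.intros(2) simp: real_differentiable_def)
  qed
qed

lemma smooth_mult: "smooth f \<Longrightarrow> smooth g \<Longrightarrow> smooth (\<lambda>x. f x * g x)"
  by (rule smooth_sum_prod) (rule sum_prod_smooth.prod)

lemma smooth_add:
  assumes "smooth f" "smooth g" shows "smooth (\<lambda>x. f x + g x)"
  using smooth_sum_prod[OF sum_prod_smooth.sum[OF sum_prod_smooth.prod[OF assms(1) smooth_const[of 1]]
        sum_prod_smooth.prod[OF assms(2) smooth_const[of 1]]]] by simp

lemma smooth_cmult: "smooth f \<Longrightarrow> smooth (\<lambda>x. c * f x)"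
  by (intro smooth_mult smooth_const)

lemma smooth_diff: "smooth f \<Longrightarrow> smooth g \<Longrightarrow> smooth (\<lambda>x. f x - g x)"
  using smooth_add[of f "\<lambda>x. (-1) * g x"] smooth_cmult[of g "-1"] by simp

lemma smooth_sum: "(\<And>i. i \<in> A \<Longrightarrow> smooth (f i)) \<Longrightarrow> smooth (\<lambda>x. \<Sum>i\<in>A. f i x)"
  by (induction A rule: infinite_finite_induct) (auto intro: smooth_const smooth_add)

lemma smooth_affine:
  assumes "smooth f" shows "smooth (\<lambda>x. f (a * x + b))"
\<comment> \<open>The free factor \<open>c\<close> absorbs the powers of \<open>a\<close> produced
  by the chain rule.\<close>
proof (rule smooth_coinduct[of _ "{\<lambda>x. c * g (a * x + b) |c g. smooth g}"])
  show "(\<lambda>x. f (a * x + b)) \<in> {\<lambda>x. c * g (a * x + b) |c g. smooth g}"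
    using assms by (intro CollectI exI[of _ 1] exI[of _ f]) auto
next
  fix h assume "h \<in> {\<lambda>x. c * g (a * x + b) |c g. smooth g}"
  then obtain c g where h: "h = (\<lambda>x. c * g (a * x + b))" "smooth g" by auto
  have D: "(h has_real_derivative (c * a) * deriv g (a * x + b)) (at x)" for x
  proof -
    have "((\<lambda>x. g (a * x + b)) has_real_derivative deriv g (a * x + b) * a) (at x)"
      by (rule DERIV_chain2[OF smooth_has_deriv[OF h(2)]]) (auto intro!: derivative_eq_intros)
    from DERIV_cmult[OF this, of c] show ?thesis
      unfolding h(1) by (simp add: algebra_simps)
  qed
  have "deriv h = (\<lambda>x. (c * a) * deriv g (a * x + b))"
    using D by (rule deriv_eqI)
  then show "(\<forall>x. h differentiable (at x)) \<and> deriv h \<in> {\<lambda>x. c * g (a * x + b) |c g. smooth g}"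
    using D smooth_deriv[OF h(2)] by (auto simp: real_differentiable_def)
qed

lemma smooth_sin_cos: "smooth (\<lambda>x. a * sin (k * x) + b * cos (k * x))"
proof (rule smooth_coinduct[of _ "{\<lambda>x. a * sin (k * x) + b * cos (k * x) |a b. True}"])
  fix h assume "h \<in> {\<lambda>x. a * sin (k * x) + b * cos (k * x) |a b. True}"
  then obtain a b where h: "h = (\<lambda>x. a * sin (k * x) + b * cos (k * x))" by auto
  have D: "(h has_real_derivative (- b * k) * sin (k * x) + (a * k) * cos (k * x)) (at x)" for x
    unfolding h by (auto intro!: derivative_eq_intros simp: algebra_simps)
  have "deriv h = (\<lambda>x. (- b * k) * sin (k * x) + (a * k) * cos (k * x))"
    using D by (rule deriv_eqI)
  then show "(\<forall>x. h differentiable (at x)) \<and>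
      deriv h \<in> {\<lambda>x. a * sin (k * x) + b * cos (k * x) |a b. True}"
    using D unfolding real_differentiable_def by blast
qed auto

lemma smooth_sin: "smooth (\<lambda>x. sin (k * x))" and smooth_cos: "smooth (\<lambda>x. cos (k * x))"
  using smooth_sin_cos[of 1 k 0] smooth_sin_cos[of 0 k 1] by auto

section \<open>The flat function exp(-1/x), bump and cutoff functions\<close>

lemma tendsto_poly_times_exp_minus:
  "((\<lambda>x::real. poly q x * exp (- x)) \<longlongrightarrow> 0) at_top"
proof -
  have "((\<lambda>x::real. \<Sum>i\<le>degree q. coeff q i * (x ^ i / exp x)) \<longlongrightarrow>
      (\<Sum>i\<le>degree q. coeff q i * 0)) at_top"
    by (intro tendsto_sum tendsto_mult tendsto_const tendsto_power_div_exp_0)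
  moreover have "(\<Sum>i\<le>degree q. coeff q i * (x ^ i / exp x)) = poly q x * exp (- x)" for x :: real
    by (simp add: poly_altdef exp_minus field_simps sum_divide_distrib)
  ultimately show ?thesis by simp
qed

text \<open>This is exp(-1/x) with a polynomial in 1/x in front. The polynomial is carried along
  because every derivative of exp(-1/x) has this shape.\<close>

definition flat_poly :: "real poly \<Rightarrow> real \<Rightarrow> real"
  where "flat_poly q x = (if x > 0 then poly q (inverse x) * exp (- inverse x) else 0)"

text \<open>With y = 1/x one has dy/dx = -y^2, and q(y) exp(-y) has y-derivative (q' - q)(y)
  exp(-y); this explains the new polynomial. At 0 the right difference quotient is y q(y) exp(-y),
  which tends to 0 as y grows.\<close>

lemma flat_poly_has_deriv:
  "(flat_poly q has_real_derivative flat_poly ((q - pderiv q) * [:0, 0, 1:]) x) (at x)"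
proof (cases "x = 0")
  case False
  show ?thesis
  proof (cases "x > 0")
    case True
    have D: "((\<lambda>x. poly q (inverse x) * exp (- inverse x)) has_real_derivative
        flat_poly ((q - pderiv q) * [:0, 0, 1:]) x) (at x)"
      using True
      by (auto intro!: derivative_eq_intros DERIV_chain2[OF poly_DERIV]
          simp: flat_poly_def algebra_simps power2_eq_square)
    show ?thesis
      by (rule has_field_derivative_transform_within_open[OF D, of "{0<..}"])
        (use True in \<open>auto simp: flat_poly_def\<close>)
  next
    case neg: False
    have D: "((\<lambda>x. 0) has_real_derivative flat_poly ((q - pderiv q) * [:0, 0, 1:]) x) (at x)"
      using neg by (simp add: flat_poly_def)
    show ?thesis
      by (rule has_field_derivative_transform_within_open[OF D, of "{..<0}"])
        (use False neg in \<open>auto simp: flat_poly_def\<close>)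
  qed
next
  case True
  have "((\<lambda>h. flat_poly q h / h) \<longlongrightarrow> 0) (at_right 0)"
  proof -
    have "((\<lambda>x::real. poly ([:0, 1:] * q) (inverse x) * exp (- inverse x)) \<longlongrightarrow> 0) (at_right 0)"
      by (rule filterlim_compose[OF tendsto_poly_times_exp_minus filterlim_inverse_at_top_right])
    then show ?thesis
    proof (rule Lim_transform_eventually)
      show "\<forall>\<^sub>F x in at_right 0. poly ([:0, 1:] * q) (inverse x) * exp (- inverse x)
          = flat_poly q x / x"
        by (rule eventually_at_rightI[of 0 1]) (auto simp: flat_poly_def divide_simps)
    qed
  qed
  moreover have "((\<lambda>h. flat_poly q h / h) \<longlongrightarrow> 0) (at_left 0)"
    by (rule Lim_transform_eventually[OF tendsto_const])
      (rule eventually_at_leftI[of "-1"], auto simp: flat_poly_def)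
  ultimately have "((\<lambda>h. flat_poly q h / h) \<longlongrightarrow> 0) (at 0)"
    by (simp add: filterlim_at_split)
  then show ?thesis
    using True by (simp add: has_field_derivative_iff flat_poly_def)
qed

lemma smooth_flat_poly: "smooth (flat_poly q)"
proof (rule smooth_coinduct[of _ "range flat_poly"])
  fix g assume "g \<in> range flat_poly"
  then show "(\<forall>x. g differentiable (at x)) \<and> deriv g \<in> range flat_poly"
    using flat_poly_has_deriv deriv_eqI[OF flat_poly_has_deriv] by (auto simp: real_differentiable_def)
qed auto

definition bump :: "real \<Rightarrow> real"
  where "bump x = flat_poly 1 x * flat_poly 1 (1 - x)"

lemma smooth_bump: "smooth bump"
proof -
  have "smooth (\<lambda>x. flat_poly 1 x * flat_poly 1 (-1 * x + 1))"
    by (intro smooth_mult smooth_flat_poly smooth_affine)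
  then show ?thesis
    by (simp add: bump_def[abs_def])
qed

lemma bump_nonneg: "bump x \<ge> 0"
  by (simp add: bump_def flat_poly_def)

lemma bump_pos: "0 < x \<Longrightarrow> x < 1 \<Longrightarrow> bump x > 0"
  by (simp add: bump_def flat_poly_def)

lemma bump_eq_0: "x \<le> 0 \<or> x \<ge> 1 \<Longrightarrow> bump x = 0"
  by (auto simp add: bump_def flat_poly_def)

definition mollifier :: "real \<Rightarrow> real"
  where "mollifier x = bump x / integral {0..1} bump"

lemma integral_bump_pos: "integral {0..1} bump > 0"
proof -
  have "integral {0..1} bump \<noteq> 0"
  proof
    assume "integral {0..1} bump = 0"
    then have "bump (1/2) = 0"
      using integral_eq_0_iff[of 0 1 bump] smooth_continuous_on[OF smooth_bump] bump_nonneg by force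
    then show False using bump_pos[of "1/2"] by simp
  qed
  moreover have "integral {0..1} bump \<ge> 0"
    by (rule integral_nonneg)
      (auto intro!: integrable_continuous_interval smooth_continuous_on smooth_bump bump_nonneg)
  ultimately show ?thesis by simp
qed

lemma smooth_mollifier: "smooth mollifier"
  using smooth_cmult[OF smooth_bump, of "1 / integral {0..1} bump"]
  by (simp add: mollifier_def[abs_def])

lemma mollifier_nonneg: "mollifier x \<ge> 0"
  using integral_bump_pos bump_nonneg by (simp add: mollifier_def)

lemma mollifier_eq_0: "x \<le> 0 \<or> x \<ge> 1 \<Longrightarrow> mollifier x = 0"
  by (auto simp: mollifier_def bump_eq_0)

lemma integral_mollifier: "integral {0..1} mollifier = 1"
proof -
  have "integral {0..1} (\<lambda>x. bump x * inverse (integral {0..1} bump)) = 1"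
    using integral_bump_pos by (subst integral_mult_left) auto
  then show ?thesis
    by (simp add: mollifier_def[abs_def] divide_inverse)
qed

definition smooth_step :: "real \<Rightarrow> real"
  where "smooth_step x = (if x \<le> 0 then 0 else integral {0..x} mollifier)"

lemma mollifier_integrable: "mollifier integrable_on {a..b}"
  by (intro integrable_continuous_interval smooth_continuous_on smooth_mollifier)

text \<open>The mollifier vanishes left of 0, so the lower limit can be moved to the left. With a
  lower limit strictly below the point in question, the one-sided derivative of the indefinite
  integral becomes two-sided.\<close>

lemma smooth_step_eq:
  assumes "a \<le> 0" "a \<le> x" shows "smooth_step x = integral {a..x} mollifier"
proof (cases "x \<le> 0")
  case True
  have "integral {a..x} mollifier = integral {a..x} (\<lambda>x. 0)"
    by (rule integral_cong) (use True in \<open>auto intro!: mollifier_eq_0\<close>)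
  then show ?thesis using True by (simp add: smooth_step_def)
next
  case False
  have "integral {a..0} mollifier + integral {0..x} mollifier = integral {a..x} mollifier"
    by (rule Henstock_Kurzweil_Integration.integral_combine) (use assms False mollifier_integrable in auto)
  moreover have "integral {a..0} mollifier = integral {a..0} (\<lambda>x. 0)"
    by (rule integral_cong) (auto intro!: mollifier_eq_0)
  ultimately show ?thesis using False by (simp add: smooth_step_def)
qed

lemma smooth_step_has_deriv: "(smooth_step has_real_derivative mollifier x) (at x)"
proof -
  define a where "a = min 0 (x - 1) - 1"
  have D: "((\<lambda>u. integral {a..u} mollifier) has_real_derivative mollifier x) (at x within {a..x+1})"
    by (rule integral_has_real_derivative)
      (auto simp: a_def intro: smooth_continuous_on smooth_mollifier)
  then have "((\<lambda>u. integral {a..u} mollifier) has_real_derivative mollifier x) (at x)"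
    by (subst (asm) at_within_Icc_at) (auto simp: a_def)
  then show ?thesis
    by (rule has_field_derivative_transform_within_open[of _ _ _ "{a<..}"])
      (auto simp: a_def intro!: smooth_step_eq[symmetric])
qed

lemma smooth_smooth_step: "smooth smooth_step"
  by (rule smooth_antiderivative[OF smooth_mollifier smooth_step_has_deriv])

lemma smooth_step_0: "x \<le> 0 \<Longrightarrow> smooth_step x = 0"
  by (simp add: smooth_step_def)

lemma smooth_step_mono: "x \<le> y \<Longrightarrow> smooth_step x \<le> smooth_step y"
  by (rule DERIV_nonneg_imp_nondecreasing[where f = smooth_step])
    (use smooth_step_has_deriv mollifier_nonneg in blast)+

lemma smooth_step_1:
  assumes "x \<ge> 1" shows "smooth_step x = 1"
proof -
  have "integral {0..1} mollifier + integral {1..x} mollifier = integral {0..x} mollifier"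
    by (rule Henstock_Kurzweil_Integration.integral_combine) (use assms mollifier_integrable in auto)
  moreover have "integral {1..x} mollifier = integral {1..x} (\<lambda>x. 0)"
    by (rule integral_cong) (auto intro!: mollifier_eq_0)
  ultimately show ?thesis using assms by (simp add: smooth_step_def integral_mollifier)
qed

lemma smooth_step_bounds: "0 \<le> smooth_step x" "smooth_step x \<le> 1"
  using smooth_step_mono[of "min x 0" x] smooth_step_0[of "min x 0"]
    smooth_step_mono[of x "max x 1"] smooth_step_1[of "max x 1"] by auto

text \<open>For n > 0 the shifts by -1 keep the support in [1/n, 1 - 1/n], hence compact in the open
  interval, while the value is 1 at distance at least 2/n from both endpoints.\<close>

definition cutoff :: "nat \<Rightarrow> real \<Rightarrow> real"
  where "cutoff n x = smooth_step (real n * x - 1) * smooth_step (real n * (1 - x) - 1)"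

lemma smooth_cutoff: "smooth (cutoff n)"
proof -
  have "smooth (\<lambda>x. smooth_step (real n * x + (-1)) * smooth_step ((- real n) * x + (real n - 1)))"
    by (intro smooth_mult smooth_affine smooth_smooth_step)
  then show ?thesis
    by (simp add: cutoff_def[abs_def] algebra_simps)
qed

lemma cutoff_bounds: "0 \<le> cutoff n x" "cutoff n x \<le> 1"
  unfolding cutoff_def using smooth_step_bounds by (auto simp: mult_le_one)

lemma cutoff_eq_0: "real n * x \<le> 1 \<or> real n * (1 - x) \<le> 1 \<Longrightarrow> cutoff n x = 0"
  unfolding cutoff_def by (auto simp: smooth_step_0)

lemma cutoff_tendsto:
  assumes "0 < x" "x < 1" shows "(\<lambda>n. cutoff n x) \<longlonglongrightarrow> 1"
proof -
  obtain N1 where N1: "real N1 * x > 2" using reals_Archimedean3 assms by blast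
  obtain N2 where N2: "real N2 * (1 - x) > 2" using reals_Archimedean3[of "1-x"] assms by auto
  have "cutoff n x = 1" if "n \<ge> max N1 N2" for n
  proof -
    have "real N1 * x \<le> real n * x" "real N2 * (1 - x) \<le> real n * (1 - x)"
      using that assms by (auto intro!: mult_right_mono)
    then show ?thesis using N1 N2 by (simp add: cutoff_def smooth_step_1)
  qed
  then show ?thesis
    by (intro tendsto_eventually eventually_sequentiallyI[of "max N1 N2"]) auto
qed

section \<open>Test functions supported in an open interval\<close>

lemma test_functionsI:
  assumes "smooth \<phi>" "\<And>x. x \<notin> {a..b} \<Longrightarrow> \<phi> x = 0" "{a..b} \<subseteq> S"
  shows "\<phi> \<in> test_functions S"
proof -
  have "closure {x. \<phi> x \<noteq> 0} \<subseteq> {a..b}"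
    by (rule closure_minimal) (use assms(2) in \<open>blast | simp\<close>)+
  moreover from this have "compact (closure {x. \<phi> x \<noteq> 0})"
    unfolding compact_closure
    by (meson bounded_closed_interval bounded_subset closure_subset order_trans)
  ultimately show ?thesis
    using assms by (auto simp: test_functions_def smooth_def)
qed

lemma test_functions_smooth: "\<phi> \<in> test_functions S \<Longrightarrow> smooth \<phi>"
  by (simp add: test_functions_def smooth_def)

lemma test_functions_support:
  assumes "\<phi> \<in> test_functions {c<..<d}" "c < d"
  obtains a b where "c < a" "a \<le> b" "b < d" "\<And>x. x \<notin> {a..b} \<Longrightarrow> \<phi> x = 0"
proof -
  let ?K = "closure {x. \<phi> x \<noteq> 0}"
  have K: "compact ?K" "?K \<subseteq> {c<..<d}" using assms by (auto simp: test_functions_def)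
  show ?thesis
  proof (cases "?K = {}")
    case True
    then have "\<phi> x = 0" for x using closure_subset by blast
    then show ?thesis using that[of "(c+d)/2" "(c+d)/2"] assms by auto
  next
    case False
    obtain a b where "a \<in> ?K" "b \<in> ?K" "\<forall>x\<in>?K. a \<le> x \<and> x \<le> b"
      using compact_attains_inf[OF K(1) False] compact_attains_sup[OF K(1) False] by blast
    moreover have "\<phi> x = 0" if "x \<notin> {a..b}" for x
      using calculation that closure_subset[of "{x. \<phi> x \<noteq> 0}"] by force
    ultimately show ?thesis using that[of a b] K(2) by (metis greaterThanLessThan_iff subsetD)
  qed
qed

lemma test_functions_mult:
  assumes "\<phi> \<in> test_functions {c<..<d}" "c < d" "smooth f"
  shows "(\<lambda>x. f x * \<phi> x) \<in> test_functions {c<..<d}"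
proof -
  obtain a b where ab: "c < a" "a \<le> b" "b < d" "\<And>x. x \<notin> {a..b} \<Longrightarrow> \<phi> x = 0"
    using test_functions_support[OF assms(1,2)] by blast
  show ?thesis
    by (rule test_functionsI[of _ a b])
      (use ab assms(3) test_functions_smooth[OF assms(1)] smooth_mult in auto)
qed

lemma cutoff_test: "cutoff n \<in> test_functions unit_iv"
proof (cases "n = 0")
  case True
  then have "cutoff n x = 0" for x by (simp add: cutoff_eq_0)
  then show ?thesis
    by (intro test_functionsI[of _ "1/2" "1/3"] smooth_cutoff) auto
next
  case False
  show ?thesis
    by (rule test_functionsI[of _ "1/n" "1-1/n", OF smooth_cutoff])
     (use False in \<open>auto intro!: cutoff_eq_0 simp: field_simps\<close>,
      (smt (verit) mult_nonneg_nonpos mult.commute of_nat_0_le_iff mult_left_le mult_le_cancel_left1)+)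
qed

lemma test_functions_add:
  assumes "\<phi> \<in> test_functions {c<..<d}" "\<psi> \<in> test_functions {c<..<d}" "c < d"
  shows "(\<lambda>x. \<phi> x + \<psi> x) \<in> test_functions {c<..<d}"
proof -
  obtain a b where ab: "c < a" "a \<le> b" "b < d" "\<And>x. x \<notin> {a..b} \<Longrightarrow> \<phi> x = 0"
    using test_functions_support[OF assms(1,3)] by blast
  obtain a' b' where ab': "c < a'" "a' \<le> b'" "b' < d" "\<And>x. x \<notin> {a'..b'} \<Longrightarrow> \<psi> x = 0"
    using test_functions_support[OF assms(2,3)] by blast
  show ?thesis
  proof (rule test_functionsI[of _ "min a a'" "max b b'"])
    show "smooth (\<lambda>x. \<phi> x + \<psi> x)"
      using assms by (intro smooth_add) (auto dest: test_functions_smooth)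
    show "\<phi> x + \<psi> x = 0" if "x \<notin> {min a a'..max b b'}" for x
      using ab(4)[of x] ab'(4)[of x] that by (auto simp: min_def max_def split: if_splits)
    show "{min a a'..max b b'} \<subseteq> {c<..<d}"
      using ab ab' by auto
  qed
qed

lemma test_functions_cmult:
  "\<phi> \<in> test_functions {c<..<d} \<Longrightarrow> c < d \<Longrightarrow> (\<lambda>x. k * \<phi> x) \<in> test_functions {c<..<d}"
  by (rule test_functions_mult[of \<phi> c d "\<lambda>x. k"]) (auto intro: smooth_const)

text \<open>The primitive from \<open>c\<close> is 0 to the left of the support of \<open>w\<close>
  and equals the total integral to its right, so mean zero is exactly what makes it a test
  function.\<close>

lemma test_function_antiderivative:
  assumes w: "w \<in> test_functions {c<..<d}" "c < d" and z: "integral {c..d} w = 0"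
  obtains \<phi> where "\<phi> \<in> test_functions {c<..<d}" "deriv \<phi> = w"
    "\<And>x. x \<in> {c..d} \<Longrightarrow> \<phi> x = integral {c..x} w"
proof -
  obtain a b where ab: "c < a" "a \<le> b" "b < d" "\<And>x. x \<notin> {a..b} \<Longrightarrow> w x = 0"
    using test_functions_support[OF w] by blast
  have I: "w integrable_on {s..t}" for s t
    by (intro integrable_continuous_interval smooth_continuous_on test_functions_smooth[OF w(1)])
  define \<phi> where "\<phi> x = (if x \<le> c then 0 else integral {c..x} w)" for x
  have eq: "\<phi> x = integral {e..x} w" if "e \<le> c" "e \<le> x" for x e
  proof (cases "x \<le> c")
    case True
    have "integral {e..x} w = integral {e..x} (\<lambda>x. 0)"
      by (rule integral_cong) (use True ab in auto)
    then show ?thesis using True by (simp add: \<phi>_def)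
  next
    case False
    have "integral {e..c} w + integral {c..x} w = integral {e..x} w"
      by (rule Henstock_Kurzweil_Integration.integral_combine) (use that False I in auto)
    moreover have "integral {e..c} w = integral {e..c} (\<lambda>x. 0)"
      by (rule integral_cong) (use ab in auto)
    ultimately show ?thesis using False by (simp add: \<phi>_def)
  qed
  have D: "(\<phi> has_real_derivative w x) (at x)" for x
  proof -
    define e where "e = min c (x - 1) - 1"
    have D: "((\<lambda>u. integral {e..u} w) has_real_derivative w x) (at x within {e..x+1})"
      by (rule integral_has_real_derivative)
        (auto simp: e_def intro: smooth_continuous_on test_functions_smooth[OF w(1)])
    then have "((\<lambda>u. integral {e..u} w) has_real_derivative w x) (at x)"
      by (subst (asm) at_within_Icc_at) (auto simp: e_def)
    then show ?thesis
      by (rule has_field_derivative_transform_within_open[of _ _ _ "{e<..}"])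
        (auto simp: e_def intro!: eq[symmetric])
  qed
  have s: "smooth \<phi>"
    by (rule smooth_antiderivative[OF test_functions_smooth[OF w(1)] D])
  have "\<phi> x = 0" if "x \<notin> {a..b}" for x
  proof (cases "x < a")
    case True
    have "\<phi> x = integral {min c x..x} w" using eq by auto
    also have "\<dots> = integral {min c x..x} (\<lambda>x. 0)"
      by (rule integral_cong) (use True ab in auto)
    finally show ?thesis by simp
  next
    case False
    then have xb: "x > b" using that by auto
    have 1: "\<phi> (max x d) = integral {c..max x d} w" using eq[of c] assms by auto
    have "integral {c..d} w + integral {d..max x d} w = integral {c..max x d} w"
      by (rule Henstock_Kurzweil_Integration.integral_combine) (use assms I in auto)
    moreover have "integral {d..max x d} w = integral {d..max x d} (\<lambda>x. 0)"
      by (rule integral_cong) (use ab in auto)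
    moreover have "integral {c..x} w + integral {x..max x d} w = integral {c..max x d} w"
      by (rule Henstock_Kurzweil_Integration.integral_combine) (use ab xb I in auto)
    moreover have "integral {x..max x d} w = integral {x..max x d} (\<lambda>x. 0)"
      by (rule integral_cong) (use ab xb in auto)
    moreover have "\<phi> x = integral {c..x} w"
      using ab xb by (intro eq) auto
    ultimately show ?thesis using z by simp
  qed
  then have "\<phi> \<in> test_functions {c<..<d}"
    using s ab by (intro test_functionsI[of _ a b]) auto
  moreover have "deriv \<phi> = w" using D by (rule deriv_eqI)
  moreover have "\<phi> x = integral {c..x} w" if "x \<in> {c..d}" for x
    using that eq[of c x] by auto
  ultimately show ?thesis using that by blast
qed

section \<open>Square-integrable functions and trigonometric bases\<close>

text \<open>Generic in the measure because it serves the unit interval, the circle, the line and the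
  plane.\<close>

definition sq_integrable :: "'a measure \<Rightarrow> ('a \<Rightarrow> real) \<Rightarrow> bool"
  where "sq_integrable M f \<longleftrightarrow> f \<in> borel_measurable M \<and> integrable M (\<lambda>x. (f x)\<^sup>2)"

lemma sq_integrable_measurable [measurable_dest]: "sq_integrable M f \<Longrightarrow> f \<in> borel_measurable M"
  by (simp add: sq_integrable_def)

lemma sq_integrable_sq: "sq_integrable M f \<Longrightarrow> integrable M (\<lambda>x. (f x)\<^sup>2)"
  by (simp add: sq_integrable_def)

lemma sq_integrable_mult:
  assumes "sq_integrable M f" "sq_integrable M g"
  shows "integrable M (\<lambda>x. f x * g x)"
proof (rule Bochner_Integration.integrable_bound)
  show "integrable M (\<lambda>x. (f x)\<^sup>2 + (g x)\<^sup>2)"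
    using assms by (auto simp: sq_integrable_def)
  show "(\<lambda>x. f x * g x) \<in> borel_measurable M"
    using assms by (auto simp: sq_integrable_def)
  have "\<bar>a * b\<bar> \<le> a\<^sup>2 + b\<^sup>2" for a b :: real
  proof -
    have "2 * \<bar>a\<bar> * \<bar>b\<bar> \<le> a\<^sup>2 + b\<^sup>2"
      using sum_squares_bound[of "\<bar>a\<bar>" "\<bar>b\<bar>"] by simp
    moreover have "\<bar>a\<bar> * \<bar>b\<bar> \<ge> 0" by simp
    ultimately show ?thesis unfolding abs_mult by linarith
  qed
  then show "AE x in M. norm (f x * g x) \<le> norm ((f x)\<^sup>2 + (g x)\<^sup>2)"
    by auto
qed

lemma sq_integrable_cmult: "sq_integrable M f \<Longrightarrow> sq_integrable M (\<lambda>x. c * f x)"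
  by (auto simp: sq_integrable_def power_mult_distrib)

lemma sq_integrable_add:
  assumes "sq_integrable M f" "sq_integrable M g"
  shows "sq_integrable M (\<lambda>x. f x + g x)"
proof -
  have "integrable M (\<lambda>x. (f x)\<^sup>2 + (g x)\<^sup>2 + 2 * (f x * g x))"
    using assms sq_integrable_mult[OF assms] by (auto simp: sq_integrable_def)
  then show ?thesis
    using assms by (auto simp: sq_integrable_def power2_sum mult.assoc)
qed

lemma sq_integrable_diff:
  "sq_integrable M f \<Longrightarrow> sq_integrable M g \<Longrightarrow> sq_integrable M (\<lambda>x. f x - g x)"
  using sq_integrable_add[of M f "\<lambda>x. (-1) * g x"] sq_integrable_cmult[of M g "-1"] by simp

lemma sq_integrable_bounded:
  assumes "finite_measure M" "f \<in> borel_measurable M" "AE x in M. \<bar>f x\<bar> \<le> B"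
  shows "sq_integrable M f"
  unfolding sq_integrable_def
proof (intro conjI finite_measure.integrable_const_bound[OF assms(1)])
  show "AE x in M. norm ((f x)\<^sup>2) \<le> B\<^sup>2"
    using assms(3)
  proof eventually_elim
    case (elim x)
    then have "\<bar>f x\<bar>\<^sup>2 \<le> B\<^sup>2" by (intro power_mono) auto
    then show ?case by simp
  qed
qed (use assms in auto)

lemma sq_integrable_integrable:
  assumes "finite_measure M" "sq_integrable M f"
  shows "integrable M f"
  using sq_integrable_mult[OF assms(2) sq_integrable_bounded[OF assms(1), of "\<lambda>x. 1" 1]] by simp

lemma sq_integrable_cong_AE:
  assumes "sq_integrable M f" "g \<in> borel_measurable M" "AE x in M. f x = g x"
  shows "sq_integrable M g"
  unfolding sq_integrable_def
proof
  have [measurable]: "f \<in> borel_measurable M" "g \<in> borel_measurable M"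
    using assms by (auto simp: sq_integrable_def)
  have "integrable M (\<lambda>x. (f x)\<^sup>2) \<longleftrightarrow> integrable M (\<lambda>x. (g x)\<^sup>2)"
    by (rule integrable_cong_AE) (use assms(3) in auto)
  then show "integrable M (\<lambda>x. (g x)\<^sup>2)"
    using assms by (simp add: sq_integrable_def)
qed fact

lemma integral_sq_add_le:
  assumes "sq_integrable M f" "sq_integrable M g"
  shows "(\<integral>x. (f x + g x)\<^sup>2 \<partial>M) \<le> 2 * (\<integral>x. (f x)\<^sup>2 \<partial>M) + 2 * (\<integral>x. (g x)\<^sup>2 \<partial>M)"
proof -
  have "(a + b)\<^sup>2 \<le> 2 * a\<^sup>2 + 2 * b\<^sup>2" for a b :: real
    using sum_squares_bound[of a b] by (simp add: power2_sum)
  then have "(\<integral>x. (f x + g x)\<^sup>2 \<partial>M) \<le> (\<integral>x. 2 * (f x)\<^sup>2 + 2 * (g x)\<^sup>2 \<partial>M)"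
    using assms sq_integrable_add[OF assms] by (intro integral_mono) (auto simp: sq_integrable_def)
  also have "\<dots> = 2 * (\<integral>x. (f x)\<^sup>2 \<partial>M) + 2 * (\<integral>x. (g x)\<^sup>2 \<partial>M)"
    using assms by (simp add: sq_integrable_def)
  finally show ?thesis .
qed

lemma integral_Cauchy_Schwarz:
  assumes "sq_integrable M f" "sq_integrable M g"
  shows "(\<integral>x. f x * g x \<partial>M)\<^sup>2 \<le> (\<integral>x. (f x)\<^sup>2 \<partial>M) * (\<integral>x. (g x)\<^sup>2 \<partial>M)"
proof -
  define F X H where "F = (\<integral>x. (f x)\<^sup>2 \<partial>M)" "X = (\<integral>x. f x * g x \<partial>M)" "H = (\<integral>x. (g x)\<^sup>2 \<partial>M)"
  have *: "0 \<le> F - 2 * a * X + a\<^sup>2 * H" for a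
  proof -
    have "0 \<le> (\<integral>x. (f x - a * g x)\<^sup>2 \<partial>M)" by simp
    also have "\<dots> = (\<integral>x. (f x)\<^sup>2 - 2 * a * (f x * g x) + a\<^sup>2 * (g x)\<^sup>2 \<partial>M)"
      by (intro Bochner_Integration.integral_cong) (auto simp: power2_diff power_mult_distrib)
    also have "\<dots> = F - 2 * a * X + a\<^sup>2 * H"
      using assms sq_integrable_mult[OF assms] by (simp add: sq_integrable_def F_X_H_def)
    finally show ?thesis .
  qed
  have H: "H \<ge> 0" by (simp add: F_X_H_def)
  have "X\<^sup>2 \<le> F * H"
  proof (cases "H = 0")
    case True
    have "X = 0"
    proof (rule ccontr)
      assume "X \<noteq> 0"
      \<comment> \<open>With \<open>H = 0\<close> the quadratic is affine in \<open>a\<close>, and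
        at this point its value is -1.\<close>
      then show False using *[of "(F + 1) / (2 * X)"] True by (simp add: field_simps)
    qed
    then show ?thesis using True by simp
  next
    case False
    have "0 \<le> (F - 2 * (X / H) * X + (X / H)\<^sup>2 * H) * H"
      using *[of "X / H"] H by (intro mult_nonneg_nonneg) auto
    also have "\<dots> = F * H - X\<^sup>2"
      using False by (simp add: field_simps power2_eq_square)
    finally show ?thesis by simp
  qed
  then show ?thesis by (simp add: F_X_H_def)
qed

text \<open>A subsequence whose consecutive differences have squared norm below 4^-k has differences
  summable in L1, since the measure is finite; hence it converges almost everywhere. Fatou's lemma
  turns the Cauchy condition into norm convergence of the whole sequence.\<close>

lemma Riesz_Fischer:
  fixes f :: "nat \<Rightarrow> 'a \<Rightarrow> real"
  assumes fin: "finite_measure M" and f: "\<And>n. sq_integrable M (f n)"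
    and C: "\<And>e. e > 0 \<Longrightarrow> \<exists>N. \<forall>m\<ge>N. \<forall>n\<ge>N. (\<integral>x. (f m x - f n x)\<^sup>2 \<partial>M) < e"
  obtains g where "sq_integrable M g" "(\<lambda>n. \<integral>x. (f n x - g x)\<^sup>2 \<partial>M) \<longlonglongrightarrow> 0"
proof -
  interpret finite_measure M by fact
  have fm [measurable]: "f n \<in> borel_measurable M" for n
    using f by (simp add: sq_integrable_def)
  have "\<exists>N. \<forall>m\<ge>N. \<forall>n\<ge>N. (\<integral>x. (f m x - f n x)\<^sup>2 \<partial>M) < (1/4) ^ k" for k
    by (rule C) simp
  then obtain N where N: "\<And>k m n. m \<ge> N k \<Longrightarrow> n \<ge> N k \<Longrightarrow> (\<integral>x. (f m x - f n x)\<^sup>2 \<partial>M) < (1/4) ^ k"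
    by metis
  \<comment> \<open>Summing all earlier thresholds makes both \<open>r k\<close> and
    \<open>r (Suc k)\<close> at least \<open>N k\<close>; the extra summand \<open>k\<close> makes
    \<open>r\<close> unbounded.\<close>
  define r where "r k = (\<Sum>i\<le>k. N i) + k" for k
  have r: "r k \<ge> N k" "r (Suc k) \<ge> N k" "r k \<ge> k" for k
  proof -
    have "N k \<le> sum N {..k}" by (intro member_le_sum) auto
    then show "r k \<ge> N k" "r (Suc k) \<ge> N k" "r k \<ge> k" by (auto simp: r_def)
  qed
  define d where "d k x = \<bar>f (r (Suc k)) x - f (r k) x\<bar>" for k x
  define \<mu> where "\<mu> = measure M (space M)"
  have sqd: "sq_integrable M (\<lambda>x. f m x - f n x)" for m n
    using f by (intro sq_integrable_diff)
  have dint: "integrable M (d k)" for k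
    unfolding d_def using sq_integrable_integrable[OF fin sqd] by auto
  have dm [measurable]: "d k \<in> borel_measurable M" for k
    unfolding d_def by measurable
  have dle: "(\<integral>x. d k x \<partial>M) \<le> (1/2) ^ k * (\<mu> + 1)" for k
  proof -
    \<comment> \<open>Inequality of the means with weight 2^k: the linear term is traded for a
      constant 2^-k and a square, whose integral is below 4^-k.\<close>
    have "d k x \<le> (1/2) ^ k + 2 ^ k * (f (r (Suc k)) x - f (r k) x)\<^sup>2" for x
    proof -
      have "2 * ((1/2)^k) * (2 ^ k * d k x) \<le> (1/2)^k * 1 + 2 ^ k * (d k x)\<^sup>2 * 1 "
      proof -
        have "0 \<le> (1/2)^k * (1 - 2 ^ k * d k x)\<^sup>2" by simp
        also have "\<dots> = (1/2)^k - 2 * ((1/2)^k * 2^k) * d k x + ((1/2)^k * 2^k) * 2 ^ k * (d k x)\<^sup>2"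
          by (simp add: power2_eq_square algebra_simps)
        also have "(1/2::real)^k * 2^k = 1" by (simp add: power_divide)
        finally show ?thesis by (simp add: power_divide)
      qed
      then have "2 * d k x \<le> (1/2)^k + 2 ^ k * (d k x)\<^sup>2"
        by (simp add: power_divide)
      moreover have "d k x \<ge> 0" by (simp add: d_def)
      ultimately have "d k x \<le> (1/2)^k + 2 ^ k * (d k x)\<^sup>2" by linarith
      then show ?thesis by (simp add: d_def)
    qed
    then have "(\<integral>x. d k x \<partial>M) \<le> (\<integral>x. (1/2) ^ k + 2 ^ k * (f (r (Suc k)) x - f (r k) x)\<^sup>2 \<partial>M)"
      using sqd dint by (intro integral_mono) (auto simp: sq_integrable_def)
    also have "\<dots> = (1/2)^k * \<mu> + 2 ^ k * (\<integral>x. (f (r (Suc k)) x - f (r k) x)\<^sup>2 \<partial>M)"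
      using sqd by (simp add: sq_integrable_def \<mu>_def)
    also have "\<dots> \<le> (1/2)^k * \<mu> + 2 ^ k * (1/4) ^ k"
      using N[of k "r (Suc k)" "r k"] r by (intro add_left_mono mult_left_mono) auto
    also have "2 ^ k * (1/4) ^ k = (1/2::real) ^ k"
      by (simp flip: power_mult_distrib)
    finally show ?thesis by (simp add: algebra_simps)
  qed
  have "(\<integral>\<^sup>+x. (\<Sum>k. ennreal (d k x)) \<partial>M) = (\<Sum>k. \<integral>\<^sup>+x. ennreal (d k x) \<partial>M)"
    by (rule nn_integral_suminf) measurable
  also have "\<dots> = (\<Sum>k. ennreal (\<integral>x. d k x \<partial>M))"
    by (intro suminf_cong nn_integral_eq_integral dint) (simp add: d_def)
  also have "\<dots> \<le> (\<Sum>k. ennreal ((1/2) ^ k * (\<mu> + 1)))"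
    using dle by (intro suminf_le ennreal_leI) auto
  also have "\<dots> = ennreal (\<Sum>k. (1/2) ^ k * (\<mu> + 1))"
    by (intro suminf_ennreal2) (auto simp: \<mu>_def intro!: summable_mult2 summable_geometric)
  also have "\<dots> < \<infinity>" by simp
  finally have "AE x in M. (\<Sum>k. ennreal (d k x)) \<noteq> \<infinity>"
    by (intro nn_integral_PInf_AE) auto
  then have conv: "AE x in M. convergent (\<lambda>k. f (r k) x)"
  proof eventually_elim
    case (elim x)
    then have "summable (\<lambda>k. d k x)"
      by (intro summable_suminf_not_top) (auto simp: d_def top.not_eq_extremum)
    then have "summable (\<lambda>k. f (r (Suc k)) x - f (r k) x)"
      unfolding d_def by (rule summable_rabs_cancel)
    then have "convergent (\<lambda>n. \<Sum>k<n. f (r (Suc k)) x - f (r k) x)"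
      by (simp add: summable_iff_convergent)
    then have "convergent (\<lambda>n. f (r n) x - f (r 0) x)"
      using sum_lessThan_telescope[of "\<lambda>k. f (r k) x"] by simp
    then have "convergent (\<lambda>n. (f (r n) x - f (r 0) x) + f (r 0) x)"
      by (intro convergent_add convergent_const)
    then show ?case by simp
  qed
  define g where "g x = lim (\<lambda>k. f (r k) x)" for x
  have gm [measurable]: "g \<in> borel_measurable M"
    unfolding g_def by measurable
  have lim: "AE x in M. (\<lambda>k. f (r k) x) \<longlonglongrightarrow> g x"
    using conv by eventually_elim (simp add: g_def convergent_LIMSEQ_iff)
  \<comment> \<open>Here \<open>n\<close> stays fixed while the other index runs along the
    subsequence, so the bound reaches every \<open>f n\<close> and not only members of the
    subsequence.\<close>
  have fatou: "(\<integral>\<^sup>+x. ennreal ((f n x - g x)\<^sup>2) \<partial>M) \<le> ennreal e"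
    if n: "n \<ge> K" and K: "\<And>m. m \<ge> K \<Longrightarrow> (\<integral>x. (f n x - f m x)\<^sup>2 \<partial>M) < e" for n e K
  proof -
    have "(\<integral>\<^sup>+x. ennreal ((f n x - g x)\<^sup>2) \<partial>M)
        = (\<integral>\<^sup>+x. liminf (\<lambda>k. ennreal ((f n x - f (r k) x)\<^sup>2)) \<partial>M)"
    proof (rule nn_integral_cong_AE)
      show "AE x in M. ennreal ((f n x - g x)\<^sup>2) = liminf (\<lambda>k. ennreal ((f n x - f (r k) x)\<^sup>2))"
        using lim
      proof eventually_elim
        case (elim x)
        then have "(\<lambda>k. ennreal ((f n x - f (r k) x)\<^sup>2)) \<longlonglongrightarrow> ennreal ((f n x - g x)\<^sup>2)"
          by (intro tendsto_ennrealI tendsto_intros)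
        then show ?case by (rule lim_imp_Liminf[symmetric, rotated]) simp
      qed
    qed
    also have "\<dots> \<le> liminf (\<lambda>k. \<integral>\<^sup>+x. ennreal ((f n x - f (r k) x)\<^sup>2) \<partial>M)"
      by (rule nn_integral_liminf) measurable
    also have "\<dots> \<le> liminf (\<lambda>k. ennreal e)"
    proof (rule Liminf_mono, rule eventually_sequentiallyI[of K])
      fix k assume "k \<ge> K"
      then have "r k \<ge> K" using r(3)[of k] by linarith
      then show "(\<integral>\<^sup>+x. ennreal ((f n x - f (r k) x)\<^sup>2) \<partial>M) \<le> ennreal e"
        using sqd K[of "r k"] by (subst nn_integral_eq_integral) (auto simp: sq_integrable_def intro!: ennreal_leI)
    qed
    also have "\<dots> = ennreal e" by (simp add: Liminf_const)
    finally show ?thesis .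
  qed
  have sq: "sq_integrable M (\<lambda>x. f (N 0) x - g x)"
    unfolding sq_integrable_def
  proof
    show "integrable M (\<lambda>x. (f (N 0) x - g x)\<^sup>2)"
    proof (rule integrableI_bounded)
      have "(\<integral>\<^sup>+x. ennreal ((f (N 0) x - g x)\<^sup>2) \<partial>M) \<le> ennreal 1"
        using N[of 0 "N 0"] by (intro fatou[of "N 0"]) auto
      then show "(\<integral>\<^sup>+x. ennreal (norm ((f (N 0) x - g x)\<^sup>2)) \<partial>M) < \<infinity>"
        by (simp add: order_le_less_trans)
    qed measurable
  qed measurable
  have sg: "sq_integrable M g"
    using sq_integrable_diff[OF f[of "N 0"] sq] by simp
  have "(\<lambda>n. \<integral>x. (f n x - g x)\<^sup>2 \<partial>M) \<longlonglongrightarrow> 0"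
  proof (rule LIMSEQ_I)
    fix e :: real assume "e > 0"
    then obtain K where K: "\<forall>m\<ge>K. \<forall>n\<ge>K. (\<integral>x. (f m x - f n x)\<^sup>2 \<partial>M) < e / 2"
      using C[of "e / 2"] by auto
    have "norm ((\<integral>x. (f n x - g x)\<^sup>2 \<partial>M) - 0) < e" if "n \<ge> K" for n
    proof -
      have "(\<integral>\<^sup>+x. ennreal ((f n x - g x)\<^sup>2) \<partial>M) \<le> ennreal (e / 2)"
        using that K by (intro fatou[of K]) auto
      then have "(\<integral>x. (f n x - g x)\<^sup>2 \<partial>M) \<le> e / 2"
        using sq_integrable_diff[OF f[of n] sg] \<open>e > 0\<close>
        by (subst (asm) nn_integral_eq_integral) (auto simp: sq_integrable_def)
      moreover have "0 \<le> (\<integral>x. (f n x - g x)\<^sup>2 \<partial>M)" by simp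
      ultimately show ?thesis using \<open>e > 0\<close> by (simp only: real_norm_def diff_0_right abs_of_nonneg)
    qed
    then show "\<exists>no. \<forall>n\<ge>no. norm ((\<integral>x. (f n x - g x)\<^sup>2 \<partial>M) - 0) < e" by blast
  qed
  then show ?thesis using sg that by blast
qed

abbreviation \<mu>I :: "real measure" where "\<mu>I \<equiv> lebesgue_on unit_iv"

lemma finite_measure_\<mu>I: "finite_measure \<mu>I"
  by (intro finite_measure_lebesgue_on) simp

lemma borel_measurable_\<mu>I: "f \<in> borel_measurable borel \<Longrightarrow> f \<in> borel_measurable \<mu>I"
  by (intro measurable_restrict_space1 measurable_completion) simp

lemma continuous_on_sq_integrable:
  fixes f :: "real \<Rightarrow> real"
  assumes "continuous_on {0..1} f"
  shows "sq_integrable \<mu>I f"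
proof -
  obtain B where "\<And>x. x \<in> {0..1} \<Longrightarrow> \<bar>f x\<bar> \<le> B"
    using compact_imp_bounded[OF compact_continuous_image[OF assms compact_Icc]]
    by (metis bounded_iff image_eqI real_norm_def)
  moreover have "f \<in> borel_measurable \<mu>I"
    by (rule continuous_imp_measurable_on_sets_lebesgue)
      (auto intro: continuous_on_subset[OF assms])
  ultimately show ?thesis
    by (intro sq_integrable_bounded[OF finite_measure_\<mu>I, of _ B]) (auto intro!: AE_I2)
qed

lemma smooth_sq_integrable: "smooth f \<Longrightarrow> sq_integrable \<mu>I f"
  by (intro continuous_on_sq_integrable smooth_continuous_on)

text \<open>An inductive span rather than a set of finite sums, so that closure under multiplication
  by a cosine or sine is a rule induction; \<open>span_of_sum_form\<close> recovers
  coefficients.\<close>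

inductive_set span_of :: "(nat \<Rightarrow> real \<Rightarrow> real) \<Rightarrow> (real \<Rightarrow> real) set" for e where
  base: "e k \<in> span_of e"
| add: "f \<in> span_of e \<Longrightarrow> g \<in> span_of e \<Longrightarrow> (\<lambda>x. f x + g x) \<in> span_of e"
| cmult: "f \<in> span_of e \<Longrightarrow> (\<lambda>x. c * f x) \<in> span_of e"

text \<open>The coefficients can be taken to vanish beyond some index, so every larger length works
  too. This lets two combinations be added termwise, and later lets cosine and sine parts share one
  length.\<close>

lemma span_of_sum_form:
  assumes "f \<in> span_of e"
  shows "\<exists>N a. \<forall>M\<ge>N. \<forall>x. f x = (\<Sum>k<M. a k * e k x)"
  using assms
proof induction
  case (base k)
  show ?case
    by (rule exI[of _ "Suc k"], rule exI[of _ "\<lambda>j. if j = k then 1 else 0"])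
      (simp add: if_distrib[of "\<lambda>c. c * _"] cong: if_cong)
next
  case (add f g)
  then obtain N1 a1 N2 a2 where
    "\<forall>M\<ge>N1. \<forall>x. f x = (\<Sum>k<M. a1 k * e k x)" "\<forall>M\<ge>N2. \<forall>x. g x = (\<Sum>k<M. a2 k * e k x)" by blast
  then have "f x = (\<Sum>k<M. a1 k * e k x)" "g x = (\<Sum>k<M. a2 k * e k x)"
    if "M \<ge> max N1 N2" for M x
    using that by (meson max.boundedE)+
  then have "f x + g x = (\<Sum>k<M. (a1 k + a2 k) * e k x)" if "M \<ge> max N1 N2" for M x
    using that by (simp only: distrib_right sum.distrib)
  then show ?case by (intro exI allI impI)
next
  case (cmult f c)
  then obtain N a where "\<forall>M\<ge>N. \<forall>x. f x = (\<Sum>k<M. a k * e k x)" by blast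
  then have "c * f x = (\<Sum>k<M. (c * a k) * e k x)" if "M \<ge> N" for M x
    using that by (simp add: sum_distrib_left mult.assoc)
  then show ?case by (intro exI allI impI)
qed

lemma span_of_smooth:
  assumes "f \<in> span_of e" "\<And>k. smooth (e k)" shows "smooth f"
  using assms(1) by induction (auto intro: assms(2) smooth_add smooth_cmult)

section \<open>The cosine and sine systems: density and completeness\<close>

definition cosb :: "nat \<Rightarrow> real \<Rightarrow> real" where "cosb k x = cos (real k * pi * x)"

definition sinb :: "nat \<Rightarrow> real \<Rightarrow> real" where "sinb k x = sin (real k * pi * x)"

lemma smooth_cosb: "smooth (cosb k)" and smooth_sinb: "smooth (sinb k)"
  unfolding cosb_def[abs_def] sinb_def[abs_def] by (rule smooth_cos smooth_sin)+

lemma cos_mult_span: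
  assumes "f \<in> span_of cosb" shows "(\<lambda>x. cos (pi * x) * f x) \<in> span_of cosb"
  using assms
proof induction
  case (base k)
  show ?case
  proof (cases k)
    case 0
    then have "(\<lambda>x. cos (pi * x) * cosb k x) = cosb 1" by (simp add: cosb_def fun_eq_iff)
    then show ?thesis by (simp add: span_of.base)
  next
    case (Suc j)
    have "cos (pi * x) * cosb k x = (1/2) * (cosb (Suc k) x + cosb j x)" for x
      using cos_times_cos[of "pi * x" "real k * pi * x"]
        cos_minus[of "pi * x - real k * pi * x"]
      by (simp add: cosb_def Suc algebra_simps)
    then have "(\<lambda>x. cos (pi * x) * cosb k x) = (\<lambda>x. (1/2) * (cosb (Suc k) x + cosb j x))"
      by blast
    then show ?thesis by (simp only: span_of.intros)
  qed
next
  case (add f g)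
  then show ?case by (simp add: distrib_left span_of.add)
next
  case (cmult f c)
  then show ?case using span_of.cmult[of _ cosb c] by (simp add: mult.left_commute)
qed

text \<open>Product-to-sum formulas. As the factor is positive on the open interval, completeness
  and density pass from the cosines to the sines through this lemma.\<close>

lemma sin_mult_span:
  assumes "f \<in> span_of cosb" shows "(\<lambda>x. sin (pi * x) * f x) \<in> span_of sinb"
  using assms
proof induction
  case (base k)
  show ?case
  proof (cases k)
    case 0
    then have "(\<lambda>x. sin (pi * x) * cosb k x) = sinb 1" by (simp add: cosb_def sinb_def fun_eq_iff)
    then show ?thesis by (simp add: span_of.base)
  next
    case (Suc j)
    have "sin (pi * x) * cosb k x = (1/2) * (sinb (Suc k) x + (-1) * sinb j x)" for x
      using sin_times_cos[of "pi * x" "real k * pi * x"]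
        sin_minus[of "pi * x - real k * pi * x"]
      by (simp add: cosb_def sinb_def Suc algebra_simps)
    then have "(\<lambda>x. sin (pi * x) * cosb k x) = (\<lambda>x. (1/2) * (sinb (Suc k) x + (-1) * sinb j x))"
      by blast
    then show ?thesis by (simp only: span_of.intros)
  qed
next
  case (add f g)
  then show ?case by (simp add: distrib_left span_of.add)
next
  case (cmult f c)
  then show ?case using span_of.cmult[of _ sinb c] by (simp add: mult.left_commute)
qed

lemma cos_power_span: "(\<lambda>x. cos (pi * x) ^ i) \<in> span_of cosb"
proof (induction i)
  case 0
  have "(\<lambda>x. cos (pi * x) ^ 0) = cosb 0" by (simp add: cosb_def fun_eq_iff)
  then show ?case by (simp only: span_of.base)
next
  case (Suc i)
  then show ?case using cos_mult_span by simp
qed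

lemma cos_poly_span: "(\<lambda>x. \<Sum>i\<le>n. a i * cos (pi * x) ^ i) \<in> span_of cosb"
proof (induction n)
  case 0
  then show ?case using span_of.cmult[OF cos_power_span[of 0]] by simp
next
  case (Suc n)
  then show ?case using span_of.add[OF Suc span_of.cmult[OF cos_power_span[of "Suc n"]]] by simp
qed

text \<open>Weierstrass' theorem in the variable \<open>cos (pi * x)\<close>.\<close>

lemma cos_span_uniformly_dense:
  assumes "continuous_on {0..1} f" "e > 0"
  obtains q where "q \<in> span_of cosb" "\<And>x. x \<in> {0..1} \<Longrightarrow> \<bar>f x - q x\<bar> < e"
proof -
  have 1: "continuous_on {-1..1} (\<lambda>y. f (arccos y / pi))"
  proof (rule continuous_on_compose2[OF assms(1)])
    show "continuous_on {-1..1} (\<lambda>y. arccos y / pi)"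
      by (intro continuous_intros) auto
    show "(\<lambda>y. arccos y / pi) ` {- 1..1} \<subseteq> {0..1}"
      using arccos_lbound arccos_ubound by (auto simp: field_simps)
  qed
  obtain g where g: "real_polynomial_function g"
    "\<And>y. y \<in> {-1..1} \<Longrightarrow> \<bar>f (arccos y / pi) - g y\<bar> < e"
    using Stone_Weierstrass_real_polynomial_function[OF compact_Icc 1 assms(2)] by blast
  obtain a n where an: "g = (\<lambda>x. \<Sum>i\<le>n. a i * x ^ i)"
    using g(1) real_polynomial_function_iff_sum by blast
  show ?thesis
  proof
    show "(\<lambda>x. \<Sum>i\<le>n. a i * cos (pi * x) ^ i) \<in> span_of cosb" by (rule cos_poly_span)
    fix x :: real assume x: "x \<in> {0..1}"
    have "arccos (cos (pi * x)) = pi * x"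
      using x by (intro arccos_cos) (auto simp: mult_left_le)
    then show "\<bar>f x - (\<Sum>i\<le>n. a i * cos (pi * x) ^ i)\<bar> < e"
      using g(2)[of "cos (pi * x)"] by (simp add: an)
  qed
qed

text \<open>A Lebesgue measurable function is almost everywhere a limit of continuous ones.
  Truncating these at level \<open>B\<close> keeps the limit and gives a uniform bound; uniform
  approximation within 1/(n + 1) then costs at most 1 in that bound.\<close>

lemma cos_span_pointwise_dense:
  assumes b: "b \<in> borel_measurable \<mu>I" and B: "\<And>x. x \<in> unit_iv \<Longrightarrow> \<bar>b x\<bar> \<le> B"
  obtains q where "\<And>n. q n \<in> span_of cosb" "\<And>n x. x \<in> unit_iv \<Longrightarrow> \<bar>q n x\<bar> \<le> B + 1"
    "AE x in \<mu>I. (\<lambda>n. q n x) \<longlonglongrightarrow> b x"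
proof -
  have "(\<lambda>x. if x \<in> unit_iv then b x else 0) \<in> borel_measurable lebesgue"
    using b by (subst borel_measurable_if) simp_all
  then have "(\<lambda>x. if x \<in> unit_iv then b x else 0) measurable_on UNIV"
    by (rule lebesgue_measurable_imp_measurable_on_real) simp
  then obtain N g where N: "negligible N" and g: "\<And>n. continuous_on UNIV (g n)"
    and lim: "\<And>x. x \<notin> N \<Longrightarrow> (\<lambda>n. g n x) \<longlonglongrightarrow> (if x \<in> unit_iv then b x else 0)"
    unfolding measurable_on_def by auto
  have B0: "B \<ge> 0" using B[of "1/2"] by simp
  define h where "h n x = max (- B) (min B (g n x))" for n x
  have "continuous_on {0..1} (h n)" for n
    unfolding h_def by (intro continuous_intros continuous_on_subset[OF g]) auto
  then have "\<exists>q\<in>span_of cosb. \<forall>x\<in>{0..1}. \<bar>h n x - q x\<bar> < 1 / Suc n" for n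
    using cos_span_uniformly_dense[of "h n" "1 / Suc n"] by (metis divide_pos_pos of_nat_0_less_iff zero_less_Suc zero_less_one)
  then obtain q where q: "\<And>n. q n \<in> span_of cosb" "\<And>n x. x \<in> {0..1} \<Longrightarrow> \<bar>h n x - q n x\<bar> < 1 / Suc n"
    by metis
  show ?thesis
  proof
    fix n and x :: real assume "x \<in> unit_iv"
    then have "\<bar>h n x - q n x\<bar> < 1 / Suc n" by (intro q) auto
    also have "\<dots> \<le> 1" by simp
    finally show "\<bar>q n x\<bar> \<le> B + 1" using B0 by (auto simp: h_def min_def max_def split: if_splits)
  next
    have "AE x in lebesgue. x \<notin> N"
      using N by (intro AE_not_in) (simp add: negligible_iff_null_sets)
    then have "AE x in lebesgue. x \<in> unit_iv \<longrightarrow> (\<lambda>n. q n x) \<longlonglongrightarrow> b x"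
    proof eventually_elim
      case (elim x)
      show ?case
      proof
        assume x: "x \<in> unit_iv"
        then have "(\<lambda>n. g n x) \<longlonglongrightarrow> b x" using lim[OF elim] by simp
        then have "(\<lambda>n. h n x) \<longlonglongrightarrow> max (- B) (min B (b x))"
          unfolding h_def by (intro tendsto_max tendsto_min tendsto_const)
        then have 1: "(\<lambda>n. h n x) \<longlonglongrightarrow> b x" using B[OF x] by (simp add: max_absorb2 min_absorb2 abs_le_iff)
        have 2: "(\<lambda>n. h n x - q n x) \<longlonglongrightarrow> 0"
        proof (rule Lim_null_comparison)
          show "\<forall>\<^sub>F n in sequentially. norm (h n x - q n x) \<le> inverse (real (Suc n))"
            using q(2)[of x] x by (auto simp: divide_inverse intro!: always_eventually less_imp_le)
          show "(\<lambda>n. inverse (real (Suc n))) \<longlonglongrightarrow> 0" by (rule LIMSEQ_inverse_real_of_nat)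
        qed
        show "(\<lambda>n. q n x) \<longlonglongrightarrow> b x" using tendsto_diff[OF 1 2] by simp
      qed
    qed
    then show "AE x in \<mu>I. (\<lambda>n. q n x) \<longlonglongrightarrow> b x"
      by (subst AE_restrict_space_iff) auto
  qed (rule q)
qed

lemma integrable_mult_smooth:
  assumes h: "integrable \<mu>I h" and "smooth f"
  shows "integrable \<mu>I (\<lambda>x. h x * f x)"
proof -
  have "continuous_on {0..1} f" using assms by (intro smooth_continuous_on)
  then obtain B where B: "\<And>x. x \<in> {0..1} \<Longrightarrow> \<bar>f x\<bar> \<le> B"
    using compact_imp_bounded[OF compact_continuous_image[OF _ compact_Icc]]
    by (metis bounded_iff image_eqI real_norm_def)
  have "integrable \<mu>I (\<lambda>x. B * h x)" using assms(1) by simp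
  then show ?thesis
  proof (rule Bochner_Integration.integrable_bound)
    show "(\<lambda>x. h x * f x) \<in> borel_measurable \<mu>I"
      using assms(1) borel_measurable_\<mu>I[OF smooth_borel[OF assms(2)]] by auto
    show "AE x in \<mu>I. norm (h x * f x) \<le> norm (B * h x)"
    proof (rule AE_I2)
      fix x assume "x \<in> space \<mu>I"
      then have "\<bar>f x\<bar> * \<bar>h x\<bar> \<le> \<bar>B\<bar> * \<bar>h x\<bar>" using B[of x] by (intro mult_right_mono) auto
      then show "norm (h x * f x) \<le> norm (B * h x)" by (simp add: abs_mult mult.commute)
    qed
  qed
qed

lemma integral_span_eq_0:
  assumes h: "integrable \<mu>I h" and e: "\<And>k. smooth (e k)" "\<And>k. (\<integral>x. h x * e k x \<partial>\<mu>I) = 0"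
    and "f \<in> span_of e"
  shows "(\<integral>x. h x * f x \<partial>\<mu>I) = 0"
  using assms(4)
proof induction
  case (base k)
  then show ?case using e by simp
next
  case (add f g)
  then show ?case using integrable_mult_smooth[OF h] span_of_smooth[OF _ e(1)]
    by (simp add: distrib_left)
next
  case (cmult f c)
  then show ?case by (simp add: mult.left_commute)
qed

text \<open>Approximating the sign of \<open>h\<close> by uniformly bounded elements of the span
  makes integrals that all vanish converge to the integral of |h|.\<close>

lemma cos_complete:
  assumes h: "integrable \<mu>I h" and z: "\<And>k. (\<integral>x. h x * cosb k x \<partial>\<mu>I) = 0"
  shows "AE x in \<mu>I. h x = 0"
proof -
  have hm [measurable]: "h \<in> borel_measurable \<mu>I" using h by auto
  have sm [measurable]: "(\<lambda>x. sgn (h x)) \<in> borel_measurable \<mu>I"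
    using measurable_comp[OF hm borel_measurable_sgn] by (simp add: o_def)
  then obtain q where q: "\<And>n. q n \<in> span_of cosb" "\<And>n x. x \<in> unit_iv \<Longrightarrow> \<bar>q n x\<bar> \<le> 1 + 1"
    "AE x in \<mu>I. (\<lambda>n. q n x) \<longlonglongrightarrow> sgn (h x)"
    using cos_span_pointwise_dense[of "\<lambda>x. sgn (h x)" 1] by (auto simp: abs_sgn_eq)
  have i: "integrable \<mu>I (\<lambda>x. h x * q n x)" "(\<integral>x. h x * q n x \<partial>\<mu>I) = 0" for n
    using integral_span_eq_0[OF h smooth_cosb z q(1)]
      integrable_mult_smooth[OF h span_of_smooth[OF q(1) smooth_cosb]] by auto
  have "(\<lambda>n. \<integral>x. h x * q n x \<partial>\<mu>I) \<longlonglongrightarrow> (\<integral>x. h x * sgn (h x) \<partial>\<mu>I)"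
  proof (rule integral_dominated_convergence)
    show "(\<lambda>x. h x * sgn (h x)) \<in> borel_measurable \<mu>I" by measurable
    show "(\<lambda>x. h x * q n x) \<in> borel_measurable \<mu>I" for n using i by auto
    show "integrable \<mu>I (\<lambda>x. 2 * \<bar>h x\<bar>)" using h by simp
    show "AE x in \<mu>I. (\<lambda>n. h x * q n x) \<longlonglongrightarrow> h x * sgn (h x)"
      using q(3) by eventually_elim (intro tendsto_intros)
    show "AE x in \<mu>I. norm (h x * q n x) \<le> 2 * \<bar>h x\<bar>" for n
    proof (rule AE_I2)
      fix x assume "x \<in> space \<mu>I"
      then have "\<bar>q n x\<bar> * \<bar>h x\<bar> \<le> 2 * \<bar>h x\<bar>" using q(2)[of x n] by (intro mult_right_mono) auto
      then show "norm (h x * q n x) \<le> 2 * \<bar>h x\<bar>" by (simp add: abs_mult mult.commute)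
    qed
  qed
  then have "(\<integral>x. \<bar>h x\<bar> \<partial>\<mu>I) = 0"
    using i by (simp add: LIMSEQ_const_iff abs_sgn)
  then have "AE x in \<mu>I. \<bar>h x\<bar> = 0"
    using h by (subst (asm) integral_nonneg_eq_0_iff_AE) auto
  then show ?thesis by simp
qed

lemma sin_pi_pos: "x \<in> unit_iv \<Longrightarrow> sin (pi * x) > 0"
  by (intro sin_gt_zero) auto

text \<open>Since sin(pi x) times a cosine is a combination of sines, \<open>h\<close> times sin(pi
  x) is orthogonal to every cosine; the positive factor is then divided out.\<close>

lemma sin_complete:
  assumes h: "integrable \<mu>I h" and z: "\<And>k. (\<integral>x. h x * sinb k x \<partial>\<mu>I) = 0"
  shows "AE x in \<mu>I. h x = 0"
proof -
  have "integrable \<mu>I (\<lambda>x. h x * sin (pi * x))"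
    by (rule integrable_mult_smooth[OF h smooth_sin])
  moreover have "(\<integral>x. (h x * sin (pi * x)) * cosb k x \<partial>\<mu>I) = 0" for k
    using integral_span_eq_0[OF h smooth_sinb z sin_mult_span[OF span_of.base[of cosb k]]]
    by (simp add: mult.assoc)
  ultimately have "AE x in \<mu>I. h x * sin (pi * x) = 0"
    by (rule cos_complete)
  moreover have "AE x in \<mu>I. sin (pi * x) > 0"
    by (rule AE_I2) (auto intro: sin_pi_pos)
  ultimately show ?thesis by eventually_elim auto
qed

lemma cos_span_L2_dense:
  assumes b: "b \<in> borel_measurable \<mu>I" and B: "\<And>x. x \<in> unit_iv \<Longrightarrow> \<bar>b x\<bar> \<le> B" and "e > 0"
  obtains q where "q \<in> span_of cosb" "(\<integral>x. (b x - q x)\<^sup>2 \<partial>\<mu>I) < e"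
proof -
  obtain q where q: "\<And>n. q n \<in> span_of cosb" "\<And>n x. x \<in> unit_iv \<Longrightarrow> \<bar>q n x\<bar> \<le> B + 1"
    "AE x in \<mu>I. (\<lambda>n. q n x) \<longlonglongrightarrow> b x"
    using cos_span_pointwise_dense[OF b B] by blast
  have qm: "q n \<in> borel_measurable \<mu>I" for n
    using smooth_sq_integrable[OF span_of_smooth[OF q(1) smooth_cosb]] by (simp add: sq_integrable_def)
  interpret finite_measure \<mu>I by (rule finite_measure_\<mu>I)
  have "(\<lambda>n. \<integral>x. (b x - q n x)\<^sup>2 \<partial>\<mu>I) \<longlonglongrightarrow> (\<integral>x. (b x - b x)\<^sup>2 \<partial>\<mu>I)"
  proof (rule integral_dominated_convergence)
    show "(\<lambda>x. (b x - b x)\<^sup>2) \<in> borel_measurable \<mu>I" by simp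
    show "(\<lambda>x. (b x - q n x)\<^sup>2) \<in> borel_measurable \<mu>I" for n using qm b by measurable
    show "integrable \<mu>I (\<lambda>x. (2 * B + 1)\<^sup>2)" by simp
    show "AE x in \<mu>I. (\<lambda>n. (b x - q n x)\<^sup>2) \<longlonglongrightarrow> (b x - b x)\<^sup>2"
      using q(3) by eventually_elim (intro tendsto_intros)
    show "AE x in \<mu>I. norm ((b x - q n x)\<^sup>2) \<le> (2 * B + 1)\<^sup>2" for n
    proof (rule AE_I2)
      fix x assume "x \<in> space \<mu>I"
      then have "\<bar>b x - q n x\<bar> \<le> 2 * B + 1" using B[of x] q(2)[of x n] by auto
      then have "\<bar>b x - q n x\<bar>\<^sup>2 \<le> (2 * B + 1)\<^sup>2" by (intro power_mono) auto
      then show "norm ((b x - q n x)\<^sup>2) \<le> (2 * B + 1)\<^sup>2" by simp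
    qed
  qed
  then have "\<forall>\<^sub>F n in sequentially. (\<integral>x. (b x - q n x)\<^sup>2 \<partial>\<mu>I) < e"
    using \<open>e > 0\<close> by (intro order_tendstoD) auto
  then show ?thesis using q(1) that by (meson eventually_sequentially order_refl)
qed

text \<open>After removal of the region where sin(pi x) < 1/m, the quotient by sin(pi x) is still
  bounded and can be approximated by cosines. Multiplying back lands in the sine span and does not
  increase the error, because the factor is at most 1. Two errors below e/4, doubled when the square
  of a sum is split, stay below e.\<close>

lemma sin_span_L2_dense:
  assumes b: "b \<in> borel_measurable \<mu>I" and B: "\<And>x. x \<in> unit_iv \<Longrightarrow> \<bar>b x\<bar> \<le> B" and "e > 0"
  obtains q where "q \<in> span_of sinb" "(\<integral>x. (b x - q x)\<^sup>2 \<partial>\<mu>I) < e"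
proof -
  define c where "c m x = (if sin (pi * x) * real m \<ge> 1 then b x else 0)" for m x
  have [measurable]: "(\<lambda>x. sin (pi * x)) \<in> borel_measurable \<mu>I"
    by (intro borel_measurable_\<mu>I) simp
  have cm [measurable]: "c m \<in> borel_measurable \<mu>I" for m
    unfolding c_def using b by measurable
  have cB: "\<bar>c m x\<bar> \<le> B" "\<bar>b x - c m x\<bar> \<le> B" if "x \<in> unit_iv" for m x
    using B[OF that] by (auto simp: c_def)
  interpret finite_measure \<mu>I by (rule finite_measure_\<mu>I)
  have "(\<lambda>m. \<integral>x. (b x - c m x)\<^sup>2 \<partial>\<mu>I) \<longlonglongrightarrow> (\<integral>x. (0::real) \<partial>\<mu>I)"
  proof (rule integral_dominated_convergence)
    show "(\<lambda>x. (b x - c m x)\<^sup>2) \<in> borel_measurable \<mu>I" for m using cm b by measurable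
    show "integrable \<mu>I (\<lambda>x. B\<^sup>2)" by simp
    show "AE x in \<mu>I. (\<lambda>m. (b x - c m x)\<^sup>2) \<longlonglongrightarrow> 0"
    proof (rule AE_I2)
      fix x assume "x \<in> space \<mu>I"
      then have s: "sin (pi * x) > 0" by (simp add: sin_pi_pos)
      then obtain n where n: "real n * sin (pi * x) > 1" using reals_Archimedean3 by blast
      have "(b x - c m x)\<^sup>2 = 0" if "m \<ge> n" for m
      proof -
        have "sin (pi * x) * real n \<le> sin (pi * x) * real m"
          using that s by (intro mult_left_mono) auto
        then show ?thesis using n by (simp add: c_def mult.commute)
      qed
      then show "(\<lambda>m. (b x - c m x)\<^sup>2) \<longlonglongrightarrow> 0"
        by (intro tendsto_eventually eventually_sequentiallyI[of n])
    qed
    show "AE x in \<mu>I. norm ((b x - c m x)\<^sup>2) \<le> B\<^sup>2" for m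
      using cB(2) power_mono[of "\<bar>b x - c m x\<bar>" B 2 for x] by (auto intro!: AE_I2)
  qed simp
  then have "\<forall>\<^sub>F m in sequentially. (\<integral>x. (b x - c m x)\<^sup>2 \<partial>\<mu>I) < e / 4"
    using \<open>e > 0\<close> by (intro order_tendstoD) auto
  then obtain m where m: "(\<integral>x. (b x - c m x)\<^sup>2 \<partial>\<mu>I) < e / 4"
    by (meson eventually_sequentially order_refl)
  have "(\<lambda>x. c m x / sin (pi * x)) \<in> borel_measurable \<mu>I" by measurable
  moreover have "\<bar>c m x / sin (pi * x)\<bar> \<le> B * real m" if "x \<in> unit_iv" for x
  proof (cases "sin (pi * x) * real m \<ge> 1")
    case True
    have "\<bar>c m x / sin (pi * x)\<bar> = \<bar>c m x\<bar> * (1 / sin (pi * x))"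
      using sin_pi_pos[OF that] by simp
    also have "\<dots> \<le> B * real m"
      using cB(1)[OF that, of m] True sin_pi_pos[OF that]
      by (intro mult_mono) (auto simp: field_simps)
    finally show ?thesis .
  next
    case False
    then show ?thesis using cB[OF that, of m] by (simp add: c_def)
  qed
  ultimately obtain q where q: "q \<in> span_of cosb" "(\<integral>x. (c m x / sin (pi * x) - q x)\<^sup>2 \<partial>\<mu>I) < e / 4"
    using cos_span_L2_dense[of "\<lambda>x. c m x / sin (pi * x)" "B * real m" "e / 4"] \<open>e > 0\<close> by auto
  have sm: "smooth (\<lambda>x. sin (pi * x) * q x)"
    by (intro smooth_mult smooth_sin span_of_smooth[OF q(1)] smooth_cosb)
  have S1: "sq_integrable \<mu>I (\<lambda>x. b x - c m x)"
    using b cm cB(2) by (intro sq_integrable_bounded[of _ _ B] finite_measure_\<mu>I) (auto intro!: AE_I2)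
  have S2: "sq_integrable \<mu>I (\<lambda>x. c m x - sin (pi * x) * q x)"
    using cm cB(1) by (intro sq_integrable_diff sq_integrable_bounded[of _ _ B] finite_measure_\<mu>I
      smooth_sq_integrable[OF sm]) (auto intro!: AE_I2)
  have S3: "sq_integrable \<mu>I (\<lambda>x. c m x / sin (pi * x) - q x)"
  proof (intro sq_integrable_diff smooth_sq_integrable[OF span_of_smooth[OF q(1) smooth_cosb]])
    show "sq_integrable \<mu>I (\<lambda>x. c m x / sin (pi * x))"
      using \<open>\<And>x. x \<in> unit_iv \<Longrightarrow> \<bar>c m x / sin (pi * x)\<bar> \<le> B * real m\<close>
      by (intro sq_integrable_bounded[of _ _ "B * real m"] finite_measure_\<mu>I) (auto intro!: AE_I2)
  qed
  have "(\<integral>x. (c m x - sin (pi * x) * q x)\<^sup>2 \<partial>\<mu>I) \<le> (\<integral>x. (c m x / sin (pi * x) - q x)\<^sup>2 \<partial>\<mu>I)"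
  proof (rule integral_mono)
    fix x assume "x \<in> space \<mu>I"
    then have s: "sin (pi * x) > 0" using sin_pi_pos by simp
    have "(c m x - sin (pi * x) * q x)\<^sup>2 = (sin (pi * x))\<^sup>2 * (c m x / sin (pi * x) - q x)\<^sup>2"
      using s by (simp add: field_simps flip: power_mult_distrib)
    also have "\<dots> \<le> 1 * (c m x / sin (pi * x) - q x)\<^sup>2"
      by (intro mult_right_mono) (auto simp: sin_squared_eq)
    finally show "(c m x - sin (pi * x) * q x)\<^sup>2 \<le> (c m x / sin (pi * x) - q x)\<^sup>2" by simp
  qed (use S2 S3 in \<open>auto simp: sq_integrable_def\<close>)
  then have "(\<integral>x. (b x - sin (pi * x) * q x)\<^sup>2 \<partial>\<mu>I) < e"
    using integral_sq_add_le[OF S1 S2] m q(2) by simp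
  then show ?thesis using that[OF sin_mult_span[OF q(1)]] by blast
qed

text \<open>A cosine times a cutoff is a test function; letting the cutoff tend to 1 shows that
  every cosine coefficient of \<open>g\<close> vanishes.\<close>

lemma test_functions_dense:
  assumes g: "sq_integrable \<mu>I g" and z: "\<And>\<phi>. \<phi> \<in> test_functions unit_iv \<Longrightarrow> l2_inner g \<phi> = 0"
  shows "AE x in \<mu>I. g x = 0"
proof (rule cos_complete)
  show gi: "integrable \<mu>I g" by (rule sq_integrable_integrable[OF finite_measure_\<mu>I g])
  fix k
  have m: "cosb k \<in> borel_measurable \<mu>I" "cutoff n \<in> borel_measurable \<mu>I" for n
    by (intro borel_measurable_\<mu>I smooth_borel smooth_cosb smooth_cutoff)+
  note [measurable] = m
  have [measurable]: "g \<in> borel_measurable \<mu>I" using gi by auto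
  have "(\<lambda>n. \<integral>x. g x * (cosb k x * cutoff n x) \<partial>\<mu>I) \<longlonglongrightarrow> (\<integral>x. g x * cosb k x \<partial>\<mu>I)"
  proof (rule integral_dominated_convergence)
    show "integrable \<mu>I (\<lambda>x. \<bar>g x\<bar>)" using gi by simp
    show "AE x in \<mu>I. (\<lambda>n. g x * (cosb k x * cutoff n x)) \<longlonglongrightarrow> g x * cosb k x"
    proof (rule AE_I2)
      fix x assume "x \<in> space \<mu>I"
      then have "(\<lambda>n. cutoff n x) \<longlonglongrightarrow> 1" by (intro cutoff_tendsto) auto
      then have "(\<lambda>n. g x * (cosb k x * cutoff n x)) \<longlonglongrightarrow> g x * (cosb k x * 1)"
        by (intro tendsto_intros)
      then show "(\<lambda>n. g x * (cosb k x * cutoff n x)) \<longlonglongrightarrow> g x * cosb k x" by simp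
    qed
    show "AE x in \<mu>I. norm (g x * (cosb k x * cutoff n x)) \<le> \<bar>g x\<bar>" for n
    proof (rule AE_I2)
      fix x
      have "\<bar>cosb k x\<bar> * \<bar>cutoff n x\<bar> \<le> 1"
        using cutoff_bounds[of n x] by (intro mult_le_one) (auto simp: cosb_def)
      then show "norm (g x * (cosb k x * cutoff n x)) \<le> \<bar>g x\<bar>"
        by (simp add: abs_mult mult_left_le)
    qed
  qed measurable
  moreover have "(\<integral>x. g x * (cosb k x * cutoff n x) \<partial>\<mu>I) = 0" for n
    using z[OF test_functions_mult[OF cutoff_test _ smooth_cosb]] by (simp add: l2_inner_def)
  ultimately show "(\<integral>x. g x * cosb k x \<partial>\<mu>I) = 0" by (simp add: LIMSEQ_const_iff)
qed

section \<open>Weak derivatives on the unit interval\<close>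

lemma sq_integrable_bound:
  assumes "sq_integrable M f" "g \<in> borel_measurable M" "AE x in M. \<bar>g x\<bar> \<le> \<bar>f x\<bar>"
  shows "sq_integrable M g"
  unfolding sq_integrable_def
proof
  show "integrable M (\<lambda>x. (g x)\<^sup>2)"
  proof (rule Bochner_Integration.integrable_bound[OF sq_integrable_sq[OF assms(1)]])
    show "AE x in M. norm ((g x)\<^sup>2) \<le> norm ((f x)\<^sup>2)"
      using assms(3) by eventually_elim (simp add: abs_le_square_iff)
  qed (use assms(2) in measurable)
qed fact

lemma L2_iff: "f \<in> L2 \<longleftrightarrow> sq_integrable \<mu>I f"
  by (simp add: L2_def sq_integrable_def)

lemma l2_norm_sq: "(l2_norm f)\<^sup>2 = (\<integral>x. (f x)\<^sup>2 \<partial>\<mu>I)"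
  by (simp add: l2_norm_def)

lemma l2_norm_nonneg: "0 \<le> l2_norm f"
  by (simp add: l2_norm_def)

lemma l2_inner_commute: "l2_inner f g = l2_inner g f"
  by (simp add: l2_inner_def mult.commute)

lemma l2_inner_le:
  assumes "sq_integrable \<mu>I f" "sq_integrable \<mu>I g"
  shows "\<bar>l2_inner f g\<bar> \<le> l2_norm f * l2_norm g"
proof -
  have "(l2_inner f g)\<^sup>2 \<le> (l2_norm f * l2_norm g)\<^sup>2"
    using integral_Cauchy_Schwarz[OF assms] by (simp add: power_mult_distrib l2_norm_sq l2_inner_def)
  then show ?thesis
    by (rule abs_le_square_iff[THEN iffD2, THEN order_trans]) (simp add: l2_norm_nonneg)
qed

lemma l2_inner_diff:
  assumes "sq_integrable \<mu>I f" "sq_integrable \<mu>I g" "sq_integrable \<mu>I h"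
  shows "l2_inner (\<lambda>x. f x - g x) h = l2_inner f h - l2_inner g h"
  using sq_integrable_mult[OF assms(1,3)] sq_integrable_mult[OF assms(2,3)]
  by (simp add: l2_inner_def left_diff_distrib)

lemma l2_inner_cmult: "l2_inner (\<lambda>x. c * f x) h = c * l2_inner f h"
  by (simp add: l2_inner_def mult.assoc)

lemma l2_inner_sum:
  assumes "\<And>i. i \<in> A \<Longrightarrow> sq_integrable \<mu>I (f i)" "sq_integrable \<mu>I h"
  shows "l2_inner (\<lambda>x. \<Sum>i\<in>A. f i x) h = (\<Sum>i\<in>A. l2_inner (f i) h)"
  using sq_integrable_mult[OF assms(1) assms(2)]
  by (simp add: l2_inner_def sum_distrib_right Bochner_Integration.integral_sum)

lemma l2_inner_cong_AE:
  assumes "sq_integrable \<mu>I f" "sq_integrable \<mu>I g" "sq_integrable \<mu>I h" "AE x in \<mu>I. f x = g x"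
  shows "l2_inner f h = l2_inner g h"
  unfolding l2_inner_def
proof (rule integral_cong_AE)
  show "(\<lambda>x. f x * h x) \<in> borel_measurable \<mu>I" "(\<lambda>x. g x * h x) \<in> borel_measurable \<mu>I"
    using sq_integrable_mult assms by auto
  show "AE x in \<mu>I. f x * h x = g x * h x"
    using assms(4) by eventually_elim simp
qed

lemma l2_norm_cong_AE:
  assumes "f \<in> borel_measurable \<mu>I" "g \<in> borel_measurable \<mu>I" "AE x in \<mu>I. f x = g x"
  shows "l2_norm f = l2_norm g"
  unfolding l2_norm_def
  by (intro arg_cong[of _ _ sqrt] integral_cong_AE) (use assms in auto)

lemma test_sq_integrable: "\<phi> \<in> test_functions S \<Longrightarrow> sq_integrable \<mu>I \<phi>"
  by (intro smooth_sq_integrable test_functions_smooth)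

lemma test_deriv_sq_integrable: "\<phi> \<in> test_functions S \<Longrightarrow> sq_integrable \<mu>I (deriv \<phi>)"
  by (intro smooth_sq_integrable smooth_deriv test_functions_smooth)

lemma is_weak_deriv_unique:
  assumes "sq_integrable \<mu>I g" "sq_integrable \<mu>I h" "is_weak_deriv f g" "is_weak_deriv f h"
  shows "AE x in \<mu>I. g x = h x"
proof -
  have "AE x in \<mu>I. g x - h x = 0"
  proof (rule test_functions_dense)
    show "sq_integrable \<mu>I (\<lambda>x. g x - h x)" using assms by (intro sq_integrable_diff)
    fix \<phi> assume \<phi>: "\<phi> \<in> test_functions unit_iv"
    have "l2_inner (\<lambda>x. g x - h x) \<phi> = l2_inner g \<phi> - l2_inner h \<phi>"
      by (intro l2_inner_diff assms test_sq_integrable[OF \<phi>])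
    moreover have "l2_inner f (deriv \<phi>) = - l2_inner g \<phi>" "l2_inner f (deriv \<phi>) = - l2_inner h \<phi>"
      using assms \<phi> unfolding is_weak_deriv_def by blast+
    ultimately show "l2_inner (\<lambda>x. g x - h x) \<phi> = 0" by simp
  qed
  then show ?thesis by simp
qed

lemma H1_weak_deriv:
  assumes "f \<in> H1"
  shows "sq_integrable \<mu>I (weak_deriv f)" "is_weak_deriv f (weak_deriv f)" "sq_integrable \<mu>I f"
proof -
  have "\<exists>g. g \<in> L2 \<and> is_weak_deriv f g" using assms by (auto simp: H1_def)
  from someI_ex[OF this] show "sq_integrable \<mu>I (weak_deriv f)" "is_weak_deriv f (weak_deriv f)"
    by (auto simp: weak_deriv_def L2_iff)
  show "sq_integrable \<mu>I f" using assms by (simp add: H1_def L2_iff)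
qed

lemma weak_deriv_AE_eq:
  assumes "sq_integrable \<mu>I f" "sq_integrable \<mu>I g" "is_weak_deriv f g"
  shows "f \<in> H1" "AE x in \<mu>I. weak_deriv f x = g x"
proof -
  show "f \<in> H1" using assms by (auto simp: H1_def L2_iff)
  from is_weak_deriv_unique[OF H1_weak_deriv(1)[OF this] assms(2) H1_weak_deriv(2)[OF this] assms(3)]
  show "AE x in \<mu>I. weak_deriv f x = g x" .
qed

lemma is_weak_deriv_diff:
  assumes "sq_integrable \<mu>I f" "sq_integrable \<mu>I g" "is_weak_deriv f g"
    "sq_integrable \<mu>I f'" "sq_integrable \<mu>I g'" "is_weak_deriv f' g'"
  shows "is_weak_deriv (\<lambda>x. f x - f' x) (\<lambda>x. g x - g' x)"
  unfolding is_weak_deriv_def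
proof
  fix \<phi> assume \<phi>: "\<phi> \<in> test_functions unit_iv"
  show "l2_inner (\<lambda>x. f x - f' x) (deriv \<phi>) = - l2_inner (\<lambda>x. g x - g' x) \<phi>"
    using assms(3,6) \<phi>
    by (simp add: l2_inner_diff assms test_sq_integrable[OF \<phi>] test_deriv_sq_integrable[OF \<phi>] is_weak_deriv_def)
qed

lemma H1_diff:
  assumes "f \<in> H1" "g \<in> H1"
  shows "(\<lambda>x. f x - g x) \<in> H1"
    "AE x in \<mu>I. weak_deriv (\<lambda>x. f x - g x) x = weak_deriv f x - weak_deriv g x"
proof -
  note F = H1_weak_deriv[OF assms(1)] and G = H1_weak_deriv[OF assms(2)]
  note * = weak_deriv_AE_eq[OF sq_integrable_diff[OF F(3) G(3)] sq_integrable_diff[OF F(1) G(1)]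
      is_weak_deriv_diff[OF F(3,1,2) G(3,1,2)]]
  show "(\<lambda>x. f x - g x) \<in> H1"
    "AE x in \<mu>I. weak_deriv (\<lambda>x. f x - g x) x = weak_deriv f x - weak_deriv g x"
    by (rule *)+
qed

section \<open>Smooth functions as elements of H1 and H10\<close>

lemma integral_\<mu>I_eq_integral:
  assumes "sq_integrable \<mu>I f"
  shows "(\<integral>x. f x \<partial>\<mu>I) = integral {0..1} f"
proof -
  have "(\<integral>x. f x \<partial>\<mu>I) = integral unit_iv f"
    by (rule lebesgue_integral_eq_integral[OF sq_integrable_integrable[OF finite_measure_\<mu>I assms]]) simp
  then show ?thesis using integral_open_interval[of 0 1 f] by simp
qed

lemma integral_deriv_smooth:
  assumes "smooth F" shows "(\<integral>x. deriv F x \<partial>\<mu>I) = F 1 - F 0"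
proof -
  have "(deriv F has_integral F 1 - F 0) {0..1}"
    using smooth_has_deriv[OF assms]
    by (intro fundamental_theorem_of_calculus) (auto simp flip: has_real_derivative_iff_has_vector_derivative)
  then show ?thesis
    using integral_\<mu>I_eq_integral[OF smooth_sq_integrable[OF smooth_deriv[OF assms]]] by (simp add: integral_unique)
qed

lemma deriv_mult_smooth:
  assumes "smooth f" "smooth g"
  shows "deriv (\<lambda>x. f x * g x) = (\<lambda>x. deriv f x * g x + f x * deriv g x)"
proof (rule deriv_eqI)
  show "((\<lambda>x. f x * g x) has_real_derivative deriv f x * g x + f x * deriv g x) (at x)" for x
    using DERIV_mult[OF smooth_has_deriv[OF assms(1)] smooth_has_deriv[OF assms(2)], of x UNIV]
    by (simp add: algebra_simps)
qed

lemma deriv_diff_smooth: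
  assumes "smooth f" "smooth g"
  shows "deriv (\<lambda>x. f x - g x) = (\<lambda>x. deriv f x - deriv g x)"
  by (intro deriv_eqI DERIV_diff smooth_has_deriv assms)

lemma smooth_integral_by_parts:
  assumes "smooth f" "smooth g"
  shows "l2_inner f (deriv g) = f 1 * g 1 - f 0 * g 0 - l2_inner (deriv f) g"
proof -
  have i: "integrable \<mu>I (\<lambda>x. deriv f x * g x)" "integrable \<mu>I (\<lambda>x. f x * deriv g x)"
    using assms by (auto intro!: sq_integrable_mult smooth_sq_integrable smooth_deriv)
  have "f 1 * g 1 - f 0 * g 0 = (\<integral>x. deriv f x * g x + f x * deriv g x \<partial>\<mu>I)"
    using integral_deriv_smooth[OF smooth_mult[OF assms]] by (simp add: deriv_mult_smooth assms)
  also have "\<dots> = l2_inner (deriv f) g + l2_inner f (deriv g)"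
    using i by (simp add: l2_inner_def)
  finally show ?thesis by simp
qed

lemma test_functions_boundary: "\<phi> \<in> test_functions unit_iv \<Longrightarrow> \<phi> 0 = 0 \<and> \<phi> 1 = 0"
  by (rule test_functions_support[of \<phi> 0 1]) auto

lemma smooth_weak_deriv:
  assumes "smooth F"
  shows "F \<in> H1" "AE x in \<mu>I. weak_deriv F x = deriv F x" "is_weak_deriv F (deriv F)"
proof -
  show w: "is_weak_deriv F (deriv F)"
    unfolding is_weak_deriv_def
  proof
    fix \<phi> assume \<phi>: "\<phi> \<in> test_functions unit_iv"
    show "l2_inner F (deriv \<phi>) = - l2_inner (deriv F) \<phi>"
      using smooth_integral_by_parts[OF assms test_functions_smooth[OF \<phi>]] test_functions_boundary[OF \<phi>]
      by simp
  qed
  show "F \<in> H1" "AE x in \<mu>I. weak_deriv F x = deriv F x"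
    using weak_deriv_AE_eq[OF smooth_sq_integrable[OF assms] smooth_sq_integrable[OF smooth_deriv[OF assms]] w]
    by auto
qed

text \<open>D(x) is the integral of D' against the indicator of [0, x]; Cauchy-Schwarz gives the
  constant 1 because the interval has length 1.\<close>

lemma Poincare_smooth:
  assumes D: "smooth D" "D 0 = 0"
  shows "(\<integral>x. (D x)\<^sup>2 \<partial>\<mu>I) \<le> (\<integral>x. (deriv D x)\<^sup>2 \<partial>\<mu>I)"
proof -
  interpret finite_measure \<mu>I by (rule finite_measure_\<mu>I)
  have sd: "sq_integrable \<mu>I (deriv D)" by (intro smooth_sq_integrable smooth_deriv D)
  have 1: "(\<integral>x. (1::real) \<partial>\<mu>I) = 1" by (simp add: measure_restrict_space)
  have *: "(D x)\<^sup>2 \<le> (\<integral>x. (deriv D x)\<^sup>2 \<partial>\<mu>I)" if x: "x \<in> unit_iv" for x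
  proof -
    have m: "(\<lambda>t. indicator {..x} t :: real) \<in> borel_measurable \<mu>I"
      by (intro borel_measurable_\<mu>I) simp
    have si: "sq_integrable \<mu>I (\<lambda>t. indicator {..x} t)"
      by (intro sq_integrable_bounded[OF finite_measure_\<mu>I m, of 1]) (auto simp: indicator_def)
    have "(deriv D has_integral D x - D 0) {0..x}"
      using smooth_has_deriv[OF D(1)] x
      by (intro fundamental_theorem_of_calculus) (auto simp flip: has_real_derivative_iff_has_vector_derivative)
    then have "D x = integral {0..x} (deriv D)" using D by (simp add: integral_unique)
    also have "\<dots> = integral {0..1} (\<lambda>t. if t \<in> {0..x} then deriv D t else 0)"
      using x by (subst integral_restrict_Int) (auto simp: min_def)
    also have "\<dots> = integral {0..1} (\<lambda>t. indicator {..x} t * deriv D t)"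
      by (rule integral_cong) (auto simp: indicator_def)
    also have "\<dots> = (\<integral>t. indicator {..x} t * deriv D t \<partial>\<mu>I)"
    proof (rule integral_\<mu>I_eq_integral[symmetric])
      show "sq_integrable \<mu>I (\<lambda>t. indicator {..x} t * deriv D t)"
        by (rule sq_integrable_bound[OF sd]) (use m sq_integrable_measurable[OF sd] in \<open>auto simp: indicator_def\<close>)
    qed
    finally have "(D x)\<^sup>2 \<le> (\<integral>t. (indicator {..x} t)\<^sup>2 \<partial>\<mu>I) * (\<integral>t. (deriv D t)\<^sup>2 \<partial>\<mu>I)"
      using integral_Cauchy_Schwarz[OF si sd] by simp
    also have "\<dots> \<le> (\<integral>x. (1::real) \<partial>\<mu>I) * (\<integral>t. (deriv D t)\<^sup>2 \<partial>\<mu>I)"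
      by (intro mult_right_mono integral_mono sq_integrable_sq[OF si]) (auto simp: indicator_def)
    finally show ?thesis by (simp only: 1 mult_1)
  qed
  have "(\<integral>x. (D x)\<^sup>2 \<partial>\<mu>I) \<le> (\<integral>y. (\<integral>x. (deriv D x)\<^sup>2 \<partial>\<mu>I) \<partial>\<mu>I)"
    using * sq_integrable_sq[OF smooth_sq_integrable[OF D(1)]] by (intro integral_mono) auto
  also have "\<dots> = (\<integral>x. (deriv D x)\<^sup>2 \<partial>\<mu>I)" by (simp add: measure_restrict_space)
  finally show ?thesis .
qed

lemma h1_norm_smooth:
  assumes "smooth D" shows "h1_norm D = sqrt ((\<integral>x. (D x)\<^sup>2 \<partial>\<mu>I) + (\<integral>x. (deriv D x)\<^sup>2 \<partial>\<mu>I))"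
proof -
  have "l2_norm (weak_deriv D) = l2_norm (deriv D)"
    by (rule l2_norm_cong_AE[OF sq_integrable_measurable[OF H1_weak_deriv(1)[OF smooth_weak_deriv(1)[OF assms]]]
          sq_integrable_measurable[OF smooth_sq_integrable[OF smooth_deriv[OF assms]]] smooth_weak_deriv(2)[OF assms]])
  then show ?thesis by (simp add: h1_norm_def l2_norm_sq)
qed

text \<open>The approximation is built on the level of derivatives. F' times a cutoff has almost
  mean zero, because F' itself has mean F(1) - F(0) = 0. Subtracting a small multiple of a fixed
  test function of mass 1 makes the mean vanish exactly, so that the primitive is a test function.
  The Poincare inequality controls the remaining part of the norm.\<close>

lemma smooth_in_H10:
  assumes F: "smooth F" "F 0 = 0" "F 1 = 0"
  shows "F \<in> H10"
  unfolding H10_def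
proof (intro CollectI conjI allI impI)
  show "F \<in> H1" by (rule smooth_weak_deriv[OF F(1)])
  fix \<epsilon> :: real assume "\<epsilon> > 0"
  interpret finite_measure \<mu>I by (rule finite_measure_\<mu>I)
  obtain \<rho> where \<rho>: "\<rho> \<in> test_functions unit_iv" "(\<integral>x. \<rho> x \<partial>\<mu>I) = 1"
  proof -
    \<comment> \<open>A rescaled mollifier supported in [1/4, 3/4]; its mass 1/2 explains the factor
      2 below.\<close>
    have s: "smooth (\<lambda>x. mollifier (2 * x + (-1/2)))" by (intro smooth_affine smooth_mollifier)
    define K where "K = (\<integral>x. mollifier (2 * x + (-1/2)) \<partial>\<mu>I)"
    have D: "((\<lambda>x. smooth_step (2 * x + (-1/2)) / 2) has_real_derivative mollifier (2 * x + (-1/2))) (at x)" for x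
      by (auto intro!: derivative_eq_intros DERIV_chain2[OF smooth_step_has_deriv])
    have sm: "smooth (\<lambda>x. smooth_step (2 * x + (-1/2)) / 2)"
      by (rule smooth_antiderivative[OF s D])
    have "K = smooth_step (3/2) / 2 - smooth_step (-1/2) / 2"
      using integral_deriv_smooth[OF sm] unfolding deriv_eqI[OF D] K_def by simp
    then have "K = 1/2" by (simp add: smooth_step_0 smooth_step_1)
    moreover have "(\<lambda>x. mollifier (2 * x + (-1/2))) \<in> test_functions unit_iv"
    proof (rule test_functionsI[OF s])
      show "mollifier (2 * x + (-1/2)) = 0" if "x \<notin> {1/4..3/4}" for x
        using that by (intro mollifier_eq_0) auto
    qed auto
    ultimately show ?thesis
      using that[OF test_functions_cmult[of "\<lambda>x. mollifier (2 * x + (-1/2))" 0 1 2]] by (simp add: K_def)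
  qed
  define f where "f = deriv F"
  have sf: "smooth f" unfolding f_def by (rule smooth_deriv[OF F(1)])
  have sqf: "sq_integrable \<mu>I f" by (rule smooth_sq_integrable[OF sf])
  have fm: "f \<in> borel_measurable \<mu>I" and intf: "integrable \<mu>I f"
    by (rule sq_integrable_measurable[OF sqf], rule sq_integrable_integrable[OF finite_measure_\<mu>I sqf])
  have cm: "cutoff n \<in> borel_measurable \<mu>I" for n
    by (rule sq_integrable_measurable[OF smooth_sq_integrable[OF smooth_cutoff]])
  have lim: "AE x in \<mu>I. (\<lambda>n. f x * cutoff n x) \<longlonglongrightarrow> f x"
  proof (rule AE_I2)
    fix x assume "x \<in> space \<mu>I"
    then have "(\<lambda>n. cutoff n x) \<longlonglongrightarrow> 1" by (intro cutoff_tendsto) auto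
    from tendsto_mult[OF tendsto_const[of "f x"] this] show "(\<lambda>n. f x * cutoff n x) \<longlonglongrightarrow> f x" by simp
  qed
  define c where "c n = (\<integral>x. f x * cutoff n x \<partial>\<mu>I)" for n
  have "c \<longlonglongrightarrow> (\<integral>x. f x \<partial>\<mu>I)"
    unfolding c_def
  proof (rule integral_dominated_convergence)
    show "integrable \<mu>I (\<lambda>x. \<bar>f x\<bar>)" using intf by simp
    show "AE x in \<mu>I. norm (f x * cutoff n x) \<le> \<bar>f x\<bar>" for n
      using cutoff_bounds by (auto simp: abs_mult mult_left_le)
  qed (use fm cm lim in auto)
  then have c: "c \<longlonglongrightarrow> 0"
    using integral_deriv_smooth[OF F(1)] F by (simp add: f_def)
  have sq2: "sq_integrable \<mu>I (\<lambda>x. f x * cutoff n x)" for n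
    by (intro smooth_sq_integrable smooth_mult sf smooth_cutoff)
  have "(\<lambda>n. \<integral>x. (f x - f x * cutoff n x)\<^sup>2 \<partial>\<mu>I) \<longlonglongrightarrow> (\<integral>x. (f x - f x)\<^sup>2 \<partial>\<mu>I)"
  proof (rule integral_dominated_convergence)
    show "integrable \<mu>I (\<lambda>x. (f x)\<^sup>2)" using sqf by (simp add: sq_integrable_def)
    show "AE x in \<mu>I. (\<lambda>n. (f x - f x * cutoff n x)\<^sup>2) \<longlonglongrightarrow> (f x - f x)\<^sup>2"
      using lim by eventually_elim (intro tendsto_intros)
    show "AE x in \<mu>I. norm ((f x - f x * cutoff n x)\<^sup>2) \<le> (f x)\<^sup>2" for n
    proof (rule AE_I2)
      fix x
      have "(f x - f x * cutoff n x)\<^sup>2 = (f x)\<^sup>2 * (1 - cutoff n x)\<^sup>2"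
        by (simp add: power2_eq_square algebra_simps)
      also have "\<dots> \<le> (f x)\<^sup>2 * 1"
        using cutoff_bounds[of n x] by (intro mult_left_mono power_le_one) auto
      finally show "norm ((f x - f x * cutoff n x)\<^sup>2) \<le> (f x)\<^sup>2" by simp
    qed
  qed (use fm cm in auto)
  then have l1: "(\<lambda>n. \<integral>x. (f x - f x * cutoff n x)\<^sup>2 \<partial>\<mu>I) \<longlonglongrightarrow> 0" by simp
  \<comment> \<open>The outer factor 2 pays for the function next to its derivative, the inner ones
    for splitting the square of a sum.\<close>
  have "(\<lambda>n. 2 * (2 * (\<integral>x. (f x - f x * cutoff n x)\<^sup>2 \<partial>\<mu>I) + 2 * ((c n)\<^sup>2 * (\<integral>x. (\<rho> x)\<^sup>2 \<partial>\<mu>I))))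
     \<longlonglongrightarrow> 2 * (2 * 0 + 2 * (0\<^sup>2 * (\<integral>x. (\<rho> x)\<^sup>2 \<partial>\<mu>I)))"
    by (intro tendsto_intros l1 c)
  then have "\<forall>\<^sub>F n in sequentially.
      2 * (2 * (\<integral>x. (f x - f x * cutoff n x)\<^sup>2 \<partial>\<mu>I) + 2 * ((c n)\<^sup>2 * (\<integral>x. (\<rho> x)\<^sup>2 \<partial>\<mu>I))) < \<epsilon>\<^sup>2"
    using \<open>\<epsilon> > 0\<close> by (intro order_tendstoD) auto
  then obtain n where n:
    "2 * (2 * (\<integral>x. (f x - f x * cutoff n x)\<^sup>2 \<partial>\<mu>I) + 2 * ((c n)\<^sup>2 * (\<integral>x. (\<rho> x)\<^sup>2 \<partial>\<mu>I))) < \<epsilon>\<^sup>2"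
    by (meson eventually_sequentially order_refl)
  define w where "w x = f x * cutoff n x + (- c n) * \<rho> x" for x
  have wt: "w \<in> test_functions unit_iv"
    unfolding w_def by (intro test_functions_add test_functions_mult[OF cutoff_test] test_functions_cmult \<rho>(1) sf) auto
  have "integral {0..1} w = (\<integral>x. w x \<partial>\<mu>I)"
    by (rule integral_\<mu>I_eq_integral[symmetric, OF test_sq_integrable[OF wt]])
  also have "\<dots> = c n + (- c n) * (\<integral>x. \<rho> x \<partial>\<mu>I)"
    using sq_integrable_integrable[OF finite_measure_\<mu>I sq2]
      sq_integrable_integrable[OF finite_measure_\<mu>I test_sq_integrable[OF \<rho>(1)]]
    unfolding w_def c_def by simp
  finally have "integral {0..1} w = 0" using \<rho>(2) by simp
  then obtain \<phi> where \<phi>: "\<phi> \<in> test_functions unit_iv" "deriv \<phi> = w"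
    using test_function_antiderivative[OF wt] by auto
  define D where "D x = F x - \<phi> x" for x
  have sD: "smooth D" "D 0 = 0"
    using test_functions_boundary[OF \<phi>(1)] F unfolding D_def
    by (auto intro!: smooth_diff test_functions_smooth[OF \<phi>(1)])
  have dD: "deriv D x = (f x - f x * cutoff n x) + c n * \<rho> x" for x
    unfolding D_def deriv_diff_smooth[OF F(1) test_functions_smooth[OF \<phi>(1)]] by (simp add: \<phi>(2) w_def f_def)
  have "h1_norm D \<le> sqrt (2 * (\<integral>x. (deriv D x)\<^sup>2 \<partial>\<mu>I))"
    unfolding h1_norm_smooth[OF sD(1)] using Poincare_smooth[OF sD] by simp
  also have "\<dots> < sqrt (\<epsilon>\<^sup>2)"
  proof (rule real_sqrt_less_mono)
    have "(\<integral>x. (deriv D x)\<^sup>2 \<partial>\<mu>I) \<le> 2 * (\<integral>x. (f x - f x * cutoff n x)\<^sup>2 \<partial>\<mu>I) + 2 * (\<integral>x. (c n * \<rho> x)\<^sup>2 \<partial>\<mu>I)"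
      unfolding dD by (intro integral_sq_add_le sq_integrable_diff sq_integrable_cmult sqf sq2 test_sq_integrable[OF \<rho>(1)])
    then show "2 * (\<integral>x. (deriv D x)\<^sup>2 \<partial>\<mu>I) < \<epsilon>\<^sup>2"
      using n by (simp add: power_mult_distrib)
  qed
  also have "\<dots> = \<epsilon>" using \<open>\<epsilon> > 0\<close> by simp
  finally have "h1_norm (\<lambda>x. F x - \<phi> x) < \<epsilon>" by (simp add: D_def[abs_def])
  then show "\<exists>\<phi>\<in>test_functions unit_iv. h1_norm (\<lambda>x. F x - \<phi> x) < \<epsilon>" using \<phi>(1) by blast
qed

lemma H10_subset_H1: "f \<in> H10 \<Longrightarrow> f \<in> H1"
  by (simp add: H10_def)

text \<open>With a test function in place of \<open>g\<close> this is the definition of the weak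
  derivative, and the defect \<open>d\<close> changes by at most \<open>K\<close> times the H1
  distance. Approximating \<open>g\<close> within |d| / (K + 1) forces |d| < |d|.\<close>

lemma H1_H10_integral_by_parts:
  assumes f: "f \<in> H1" and g: "g \<in> H10"
  shows "l2_inner (weak_deriv f) g = - l2_inner f (weak_deriv g)"
proof (rule ccontr)
  have sq: "sq_integrable \<mu>I f" "sq_integrable \<mu>I (weak_deriv f)" "sq_integrable \<mu>I g" "sq_integrable \<mu>I (weak_deriv g)"
    using f H10_subset_H1[OF g] H1_weak_deriv by auto
  define d where "d = l2_inner (weak_deriv f) g + l2_inner f (weak_deriv g)"
  define K where "K = l2_norm f + l2_norm (weak_deriv f)"
  have K: "K \<ge> 0" by (simp add: K_def l2_norm_nonneg)
  assume "\<not> ?thesis"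
  then have "\<bar>d\<bar> > 0" by (auto simp: d_def)
  then have "\<bar>d\<bar> / (K + 1) > 0" using K by simp
  then obtain \<phi> where \<phi>: "\<phi> \<in> test_functions unit_iv"
    and n: "h1_norm (\<lambda>x. g x - \<phi> x) < \<bar>d\<bar> / (K + 1)"
    using g unfolding H10_def by blast
  have s\<phi>: "sq_integrable \<mu>I \<phi>" "sq_integrable \<mu>I (deriv \<phi>)"
    using test_sq_integrable[OF \<phi>] test_deriv_sq_integrable[OF \<phi>] by auto
  have \<phi>1: "\<phi> \<in> H1" "AE x in \<mu>I. weak_deriv \<phi> x = deriv \<phi> x"
    using smooth_weak_deriv[OF test_functions_smooth[OF \<phi>]] by auto
  let ?w = "weak_deriv (\<lambda>x. g x - \<phi> x)"
  have gw: "(\<lambda>x. g x - \<phi> x) \<in> H1" using H1_diff(1)[OF H10_subset_H1[OF g] \<phi>1(1)] .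
  have "AE x in \<mu>I. ?w x = weak_deriv g x - deriv \<phi> x"
    using H1_diff(2)[OF H10_subset_H1[OF g] \<phi>1(1)] \<phi>1(2) by eventually_elim simp
  then have "l2_inner ?w f = l2_inner (\<lambda>x. weak_deriv g x - deriv \<phi> x) f"
    using H1_weak_deriv[OF gw] sq s\<phi> by (intro l2_inner_cong_AE sq_integrable_diff)
  then have 1: "l2_inner f ?w = l2_inner f (weak_deriv g) - l2_inner f (deriv \<phi>)"
    using l2_inner_diff[OF sq(4) s\<phi>(2) sq(1)] by (simp add: l2_inner_commute)
  have 2: "l2_inner (weak_deriv f) (\<lambda>x. g x - \<phi> x) = l2_inner (weak_deriv f) g - l2_inner (weak_deriv f) \<phi>"
    using l2_inner_diff[OF sq(3) s\<phi>(1) sq(2)] by (simp add: l2_inner_commute)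
  have 3: "l2_inner f (deriv \<phi>) = - l2_inner (weak_deriv f) \<phi>"
    using H1_weak_deriv(2)[OF f] \<phi> by (simp add: is_weak_deriv_def)
  have "d = l2_inner (weak_deriv f) (\<lambda>x. g x - \<phi> x) + l2_inner f ?w"
    unfolding 1 2 d_def using 3 by simp
  then have "\<bar>d\<bar> \<le> l2_norm (weak_deriv f) * l2_norm (\<lambda>x. g x - \<phi> x) + l2_norm f * l2_norm ?w"
    using l2_inner_le[OF sq(2) H1_weak_deriv(3)[OF gw]] l2_inner_le[OF sq(1) H1_weak_deriv(1)[OF gw]] by linarith
  also have "\<dots> \<le> l2_norm (weak_deriv f) * h1_norm (\<lambda>x. g x - \<phi> x) + l2_norm f * h1_norm (\<lambda>x. g x - \<phi> x)"
    by (intro add_mono mult_left_mono l2_norm_nonneg)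
      (auto simp: h1_norm_def l2_norm_nonneg intro!: real_le_rsqrt)
  also have "\<dots> = K * h1_norm (\<lambda>x. g x - \<phi> x)" by (simp add: K_def algebra_simps)
  also have "\<dots> \<le> K * (\<bar>d\<bar> / (K + 1))" using n K by (intro mult_left_mono) auto
  also have "\<dots> < \<bar>d\<bar>" using K \<open>\<bar>d\<bar> > 0\<close> by (simp add: field_simps)
  finally show False by simp
qed

section \<open>Sines and cosines as weak eigenfunctions\<close>

lemma deriv_cosb: "deriv (cosb k) = (\<lambda>x. - (real k * pi) * sinb k x)"
  and deriv_sinb: "deriv (sinb k) = (\<lambda>x. (real k * pi) * cosb k x)"
  unfolding cosb_def[abs_def] sinb_def[abs_def]
  by (rule deriv_eqI, auto intro!: derivative_eq_intros)+

lemma sinb_boundary: "sinb k 0 = 0" "sinb k 1 = 0"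
  by (auto simp: sinb_def sin_npi)

lemma sinb_H10: "sinb k \<in> H10"
  by (intro smooth_in_H10 smooth_sinb sinb_boundary)

lemma cosb_H1: "cosb k \<in> H1"
  by (intro smooth_weak_deriv smooth_cosb)

lemma l2_inner_weak_deriv_smooth:
  assumes "smooth F" "sq_integrable \<mu>I h" shows "l2_inner (weak_deriv F) h = l2_inner (deriv F) h"
  by (rule l2_inner_cong_AE[OF H1_weak_deriv(1)[OF smooth_weak_deriv(1)[OF assms(1)]]
        smooth_sq_integrable[OF smooth_deriv[OF assms(1)]] assms(2) smooth_weak_deriv(2)[OF assms(1)]])

text \<open>The cosines do not vanish at the endpoints, so it is the Dirichlet condition on
  \<open>\<psi>\<close> that removes the boundary terms. The case k = 0 says that the weak
  derivative has mean zero, which is the source of the mean condition on the profile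
  \<open>p\<close>.\<close>

lemma H10_weak_deriv_cosb:
  assumes "\<psi> \<in> H10" shows "l2_inner (weak_deriv \<psi>) (cosb k) = real k * pi * l2_inner \<psi> (sinb k)"
proof -
  have "l2_inner (weak_deriv \<psi>) (cosb k) = - l2_inner (weak_deriv (cosb k)) \<psi>"
    using H1_H10_integral_by_parts[OF cosb_H1[of k] assms] by (simp add: l2_inner_commute[of "cosb k"])
  also have "\<dots> = - l2_inner (deriv (cosb k)) \<psi>"
    by (simp add: l2_inner_weak_deriv_smooth[OF smooth_cosb H1_weak_deriv(3)[OF H10_subset_H1[OF assms]]])
  also have "\<dots> = real k * pi * l2_inner \<psi> (sinb k)"
    unfolding deriv_cosb l2_inner_cmult by (simp add: l2_inner_commute[of "sinb k"])
  finally show ?thesis .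
qed

text \<open>Here the sines vanish at the endpoints, so \<open>\<psi>\<close> may be any element of
  \<open>H1\<close>; in this way the Neumann condition is the natural one.\<close>

lemma H1_weak_deriv_sinb:
  assumes "\<psi> \<in> H1" shows "l2_inner (weak_deriv \<psi>) (sinb k) = - (real k * pi * l2_inner \<psi> (cosb k))"
proof -
  have "l2_inner (weak_deriv \<psi>) (sinb k) = - l2_inner (weak_deriv (sinb k)) \<psi>"
    using H1_H10_integral_by_parts[OF assms sinb_H10[of k]] by (simp add: l2_inner_commute[of "weak_deriv (sinb k)"])
  also have "\<dots> = - l2_inner (deriv (sinb k)) \<psi>"
    by (simp add: l2_inner_weak_deriv_smooth[OF smooth_sinb H1_weak_deriv(3)[OF assms]])
  also have "\<dots> = - (real k * pi * l2_inner \<psi> (cosb k))"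
    unfolding deriv_sinb l2_inner_cmult by (simp add: l2_inner_commute[of "cosb k"])
  finally show ?thesis .
qed

text \<open>The weak eigenvalue equation, tested with the whole space: it decouples the weak
  formulation into one scalar equation per mode.\<close>

lemma H10_energy_sinb:
  assumes "\<psi> \<in> H10"
  shows "l2_inner (weak_deriv \<psi>) (weak_deriv (sinb k)) = (real k * pi)\<^sup>2 * l2_inner \<psi> (sinb k)"
proof -
  have "l2_inner (weak_deriv \<psi>) (weak_deriv (sinb k)) = l2_inner (deriv (sinb k)) (weak_deriv \<psi>)"
    using l2_inner_weak_deriv_smooth[OF smooth_sinb H1_weak_deriv(1)[OF H10_subset_H1[OF assms]], of k]
    by (simp add: l2_inner_commute[of "weak_deriv \<psi>" "weak_deriv (sinb k)"])
  also have "\<dots> = (real k * pi) * l2_inner (weak_deriv \<psi>) (cosb k)"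
    unfolding deriv_sinb l2_inner_cmult by (simp add: l2_inner_commute[of "cosb k"])
  finally show ?thesis
    unfolding H10_weak_deriv_cosb[OF assms] by (simp add: power2_eq_square algebra_simps)
qed

lemma H1_energy_cosb:
  assumes "\<psi> \<in> H1"
  shows "l2_inner (weak_deriv \<psi>) (weak_deriv (cosb k)) = (real k * pi)\<^sup>2 * l2_inner \<psi> (cosb k)"
proof -
  have "l2_inner (weak_deriv \<psi>) (weak_deriv (cosb k)) = l2_inner (deriv (cosb k)) (weak_deriv \<psi>)"
    using l2_inner_weak_deriv_smooth[OF smooth_cosb H1_weak_deriv(1)[OF assms], of k]
    by (simp add: l2_inner_commute[of "weak_deriv \<psi>" "weak_deriv (cosb k)"])
  also have "\<dots> = - (real k * pi) * l2_inner (weak_deriv \<psi>) (sinb k)"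
    unfolding deriv_cosb l2_inner_cmult by (simp add: l2_inner_commute[of "sinb k"])
  finally show ?thesis
    unfolding H1_weak_deriv_sinb[OF assms] by (simp add: power2_eq_square algebra_simps)
qed

section \<open>Periodic functions and characteristics\<close>

text \<open>The representative modulo 2 in [-1, 1). Centring at 0 makes the fold an absolute value
  and the exchange of labels a change of sign.\<close>

definition per :: "real \<Rightarrow> real"
  where "per s = s - 2 * of_int \<lfloor>(s + 1) / 2\<rfloor>"

lemma per_bounds: "-1 \<le> per s" "per s < 1"
proof -
  define n where "n = real_of_int \<lfloor>(s + 1) / 2\<rfloor>"
  have "n \<le> (s + 1) / 2" "(s + 1) / 2 < n + 1"
    using floor_correct[of "(s + 1) / 2"] by (simp_all add: n_def)
  then show "-1 \<le> per s" "per s < 1" by (simp_all add: per_def flip: n_def)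
qed

lemma per_eq: "-1 \<le> s \<Longrightarrow> s < 1 \<Longrightarrow> per s = s"
proof -
  assume "-1 \<le> s" "s < 1"
  then have "\<lfloor>(s + 1) / 2\<rfloor> = 0" by (intro floor_unique) auto
  then show "per s = s" by (simp add: per_def)
qed

lemma per_add_int: "per (s + 2 * of_int k) = per s"
proof -
  have "(s + 2 * of_int k + 1) / 2 = (s + 1) / 2 + of_int k" by (simp add: field_simps)
  then have "\<lfloor>(s + 2 * of_int k + 1) / 2\<rfloor> = \<lfloor>(s + 1) / 2\<rfloor> + k"
    using floor_add_int[of "(s + 1) / 2" k] by (simp only:)
  then show ?thesis by (simp add: per_def)
qed

lemma per_add2: "per (s + 2) = per s"
  using per_add_int[of s 1] by simp

lemma per_per: "per (per s + t) = per (s + t)"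
proof -
  have "s + t = per s + t + 2 * of_int \<lfloor>(s + 1) / 2\<rfloor>" by (simp add: per_def)
  then show ?thesis using per_add_int by metis
qed

lemma per_measurable [measurable]: "per \<in> borel_measurable borel"
  unfolding per_def[abs_def] by measurable

definition periodic :: "(real \<Rightarrow> 'a) \<Rightarrow> bool"
  where "periodic f \<longleftrightarrow> (\<forall>x. f (x + 2) = f x)"

lemma periodic_per:
  assumes "periodic f" shows "f (per x) = f x"
proof -
  have 1: "f (x + 2 * real n) = f x" for x n
  proof (induction n)
    case (Suc n)
    have "f (x + 2 * real (Suc n)) = f ((x + 2 * real n) + 2)" by (simp add: algebra_simps)
    then show ?case using Suc assms by (simp add: periodic_def)
  qed simp
  have 2: "f (x + 2 * of_int k) = f x" for k
  proof (cases "k \<ge> 0")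
    case True
    then show ?thesis using 1[of x "nat k"] by simp
  next
    case False
    then show ?thesis using 1[of "x + 2 * of_int k" "nat (- k)"] by simp
  qed
  show ?thesis using 2[of "- \<lfloor>(x + 1) / 2\<rfloor>"] by (simp add: per_def)
qed

lemma periodic_comp_per: "periodic (\<lambda>x. f (per x))"
  by (simp add: periodic_def per_add2)

lemma fold_unit_per: "fold_unit s = \<bar>per s\<bar>"
proof -
  define r where "r = s - 2 * of_int \<lfloor>s / 2\<rfloor>"
  have r: "0 \<le> r" "r < 2" unfolding r_def by linarith+
  have "per s = per r" using per_add_int[of r "\<lfloor>s / 2\<rfloor>"] by (simp add: r_def)
  also have "per r = (if r < 1 then r else r - 2)"
    using r per_eq[of r] per_eq[of "r - 2"] per_add2[of "r - 2"] by auto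
  finally show ?thesis using r by (auto simp: fold_unit_def Let_def r_def[symmetric])
qed

lemma fold_unit_measurable [measurable]: "fold_unit \<in> borel_measurable borel"
  using borel_measurable_abs[OF per_measurable] by (simp add: fold_unit_per[abs_def])

lemma fold_unit_add2: "fold_unit (s + 2) = fold_unit s"
  by (simp add: fold_unit_per per_add2)

text \<open>One period without its endpoints, so that its two halves are copies of the open unit
  interval. Borel sets are kept, for Fubini and for composition with \<open>per\<close>.\<close>

definition circ :: "real measure"
  where "circ = restrict_space lborel {-1<..<1}"

lemma space_circ [simp]: "space circ = {-1<..<1}"
  by (simp add: circ_def space_restrict_space)

lemma finite_measure_circ: "finite_measure circ"
  by (rule finite_measureI) (simp add: circ_def emeasure_restrict_space space_restrict_space)

lemma circ_measurable: "f \<in> borel_measurable borel \<Longrightarrow> f \<in> borel_measurable circ"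
  unfolding circ_def by (intro measurable_restrict_space1) simp

lemma nn_integral_circ: "(\<integral>\<^sup>+x. f x \<partial>circ) = (\<integral>\<^sup>+x. f x * indicator {-1<..<1} x \<partial>lborel)"
  unfolding circ_def by (rule nn_integral_restrict_space) simp

lemma AE_circ: "(AE x in circ. P x) \<longleftrightarrow> (AE x in lborel. -1 < x \<and> x < 1 \<longrightarrow> P x)"
  unfolding circ_def by (subst AE_restrict_space_iff) auto

lemma AE_\<mu>I: "(AE x in \<mu>I. P x) \<longleftrightarrow> (AE x in lborel. 0 < x \<and> x < 1 \<longrightarrow> P x)"
  by (subst AE_restrict_space_iff) (auto simp: AE_completion_iff)

lemma nn_integral_\<mu>I: "(\<integral>\<^sup>+x. f x \<partial>\<mu>I) = (\<integral>\<^sup>+x. f x * indicator {0<..<1} x \<partial>lborel)"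
  by (subst nn_integral_restrict_space) (auto simp: nn_integral_completion)

lemma nn_integral_lborel_shift:
  "f \<in> borel_measurable borel \<Longrightarrow> (\<integral>\<^sup>+x. f (x + t) \<partial>lborel) = (\<integral>\<^sup>+x. f x \<partial>lborel)" for t :: real
  using nn_integral_real_affine[of f 1 t] by (simp add: add.commute)

text \<open>The shift is first reduced to \<open>per t\<close>. The translated period is then the
  interval (\<tau> - 2, \<tau>); what sticks out of (-1, 1) on either side is moved back by 2 and
  fills the gap, up to finitely many points.\<close>

lemma nn_integral_circ_shift:
  assumes f [measurable]: "f \<in> borel_measurable borel" and p: "periodic f"
  shows "(\<integral>\<^sup>+x. f (x + t) \<partial>circ) = (\<integral>\<^sup>+x. f x \<partial>circ)"
proof -
  define \<tau> where "\<tau> = per t + 1"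
  have \<tau>: "0 \<le> \<tau>" "\<tau> < 2" using per_bounds[of t] by (auto simp: \<tau>_def)
  have "(\<integral>\<^sup>+x. f (x + t) \<partial>circ) = (\<integral>\<^sup>+x. f (x + per t) * indicator {-1<..<1} x \<partial>lborel)"
    unfolding nn_integral_circ
    by (intro nn_integral_cong) (metis add.commute p per_per periodic_per)
  also have "\<dots> = (\<integral>\<^sup>+x. f ((x + per t)) * indicator {-1 + per t<..<1 + per t} (x + per t) \<partial>lborel)"
    by (intro nn_integral_cong) (auto simp: indicator_def)
  also have "\<dots> = (\<integral>\<^sup>+x. f x * indicator {-1 + per t<..<1 + per t} x \<partial>lborel)"
    by (rule nn_integral_lborel_shift) measurable
  also have "\<dots> = (\<integral>\<^sup>+x. f x * indicator ({-2 + \<tau><..<\<tau>} \<inter> {..<-1}) x + f x * indicator ({-2 + \<tau><..<\<tau>} \<inter> {-1..1}) x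
       + f x * indicator ({-2 + \<tau><..<\<tau>} \<inter> {1<..}) x \<partial>lborel)"
    by (intro nn_integral_cong) (auto simp: indicator_def \<tau>_def)
  also have "\<dots> = (\<integral>\<^sup>+x. f x * indicator ({-2 + \<tau><..<\<tau>} \<inter> {..<-1}) x \<partial>lborel) +
       (\<integral>\<^sup>+x. f x * indicator ({-2 + \<tau><..<\<tau>} \<inter> {-1..1}) x \<partial>lborel)
       + (\<integral>\<^sup>+x. f x * indicator ({-2 + \<tau><..<\<tau>} \<inter> {1<..}) x \<partial>lborel)"
    by (simp add: nn_integral_add)
  also have "(\<integral>\<^sup>+x. f x * indicator ({-2 + \<tau><..<\<tau>} \<inter> {..<-1}) x \<partial>lborel)
      = (\<integral>\<^sup>+x. f (x + (-2)) * indicator ({-2 + \<tau><..<\<tau>} \<inter> {..<-1}) (x + (-2)) \<partial>lborel)"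
    by (rule nn_integral_lborel_shift[symmetric]) measurable
  also have "\<dots> = (\<integral>\<^sup>+x. f x * indicator ({\<tau><..<1}) x \<partial>lborel)"
  proof (intro nn_integral_cong)
    fix x
    have "f (x + (-2)) = f x" using p unfolding periodic_def by (metis add.assoc add.right_neutral neg_eq_iff_add_eq_0 add.commute)
    then show "f (x + (-2)) * indicator ({-2 + \<tau><..<\<tau>} \<inter> {..<-1}) (x + (-2)) = f x * indicator {\<tau><..<1} x"
      using \<tau> by (auto simp: indicator_def)
  qed
  also have "(\<integral>\<^sup>+x. f x * indicator ({-2 + \<tau><..<\<tau>} \<inter> {1<..}) x \<partial>lborel)
      = (\<integral>\<^sup>+x. f (x + 2) * indicator ({-2 + \<tau><..<\<tau>} \<inter> {1<..}) (x + 2) \<partial>lborel)"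
    by (rule nn_integral_lborel_shift[symmetric]) measurable
  also have "\<dots> = (\<integral>\<^sup>+x. f x * indicator ({-1<..<\<tau>-2}) x \<partial>lborel)"
    using p \<tau> by (intro nn_integral_cong) (auto simp: indicator_def periodic_def)
  also have "(\<integral>\<^sup>+x. f x * indicator {\<tau><..<1} x \<partial>lborel) +
       (\<integral>\<^sup>+x. f x * indicator ({-2 + \<tau><..<\<tau>} \<inter> {-1..1}) x \<partial>lborel)
       + (\<integral>\<^sup>+x. f x * indicator {-1<..<\<tau>-2} x \<partial>lborel) =
      (\<integral>\<^sup>+x. f x * indicator {\<tau><..<1} x + f x * indicator ({-2 + \<tau><..<\<tau>} \<inter> {-1..1}) x
       + f x * indicator ({-1<..<\<tau>-2}) x \<partial>lborel)"
    by (simp add: nn_integral_add)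
  also have "\<dots> = (\<integral>\<^sup>+x. f x * indicator {-1<..<1} x \<partial>lborel)"
  proof (rule nn_integral_cong_AE)
    have "AE x in lborel. x \<notin> {-1, 1, \<tau>, \<tau>-2::real}"
      by (intro AE_not_in) (simp add: finite_imp_null_set_lborel)
    then show "AE x in lborel. f x * indicator {\<tau><..<1} x + f x * indicator ({-2 + \<tau><..<\<tau>} \<inter> {-1..1}) x
       + f x * indicator ({-1<..<\<tau>-2}) x = f x * indicator {-1<..<1} x"
      by eventually_elim (use \<tau> in \<open>auto simp: indicator_def\<close>)
  qed
  finally show ?thesis by (simp add: nn_integral_circ)
qed

text \<open>Both integrands factor through \<open>per\<close>, so it suffices that two image
  measures agree, and these are compared on indicators by the nonnegative case.\<close>

lemma circ_shift:
  assumes f: "f \<in> borel_measurable borel" and p: "periodic f"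
  shows "integrable circ (\<lambda>x. f (x + t)) \<longleftrightarrow> integrable circ (f :: real \<Rightarrow> real)"
    "(\<integral>x. f (x + t) \<partial>circ) = (\<integral>x. f x \<partial>circ)"
proof -
  have m: "(\<lambda>x. per (x + t)) \<in> circ \<rightarrow>\<^sub>M borel" "per \<in> circ \<rightarrow>\<^sub>M borel"
    by (rule circ_measurable, measurable)+
  have d: "distr circ borel (\<lambda>x. per (x + t)) = distr circ borel per"
  proof (rule measure_eqI)
    fix A assume "A \<in> sets (distr circ borel (\<lambda>x. per (x + t)))"
    then have A [measurable]: "A \<in> sets borel" by simp
    have "(\<integral>\<^sup>+x. indicator A (per (x + t)) \<partial>circ) = (\<integral>\<^sup>+x. indicator A (per x) \<partial>circ)"
      by (rule nn_integral_circ_shift[of "\<lambda>x. indicator A (per x)"]) (auto simp: periodic_comp_per)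
    moreover have "(\<integral>\<^sup>+x. indicator A (per (x + t)) \<partial>circ) = emeasure (distr circ borel (\<lambda>x. per (x + t))) A"
      using nn_integral_distr[OF m(1), of "indicator A"] A by (simp add: nn_integral_indicator)
    moreover have "(\<integral>\<^sup>+x. indicator A (per x) \<partial>circ) = emeasure (distr circ borel per) A"
      using nn_integral_distr[OF m(2), of "indicator A"] A by (simp add: nn_integral_indicator)
    ultimately show "emeasure (distr circ borel (\<lambda>x. per (x + t))) A = emeasure (distr circ borel per) A" by simp
  qed simp
  show "integrable circ (\<lambda>x. f (x + t)) \<longleftrightarrow> integrable circ f"
    using integrable_distr_eq[OF m(1) f] integrable_distr_eq[OF m(2) f] by (simp add: d periodic_per[OF p])
  show "(\<integral>x. f (x + t) \<partial>circ) = (\<integral>x. f x \<partial>circ)"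
    using integral_distr[OF m(1) f] integral_distr[OF m(2) f] by (simp add: d periodic_per[OF p])
qed

section \<open>Folding the circle onto two copies of the unit interval\<close>

lemma AE_lborel_affine:
  fixes c t :: real
  assumes "AE x in lborel. P x" "c \<noteq> 0" shows "AE x in lborel. P (t + c * x)"
proof -
  obtain N where N: "N \<in> null_sets lborel" "{x \<in> space lborel. \<not> P x} \<subseteq> N"
    using assms(1) unfolding eventually_ae_filter by blast
  have [measurable]: "N \<in> sets borel" using N by auto
  have "AE x in lborel. x \<notin> N" using N(1) by (rule AE_not_in)
  then have "AE x in lborel. t + c * x \<notin> N" by (intro AE_borel_affine assms(2)) auto
  then show ?thesis by eventually_elim (use N(2) in auto)
qed

lemma AE_circ_fold:
  "(AE x in circ. P x) \<longleftrightarrow> (AE x in \<mu>I. P x \<and> P (- x))"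
proof
  assume "AE x in circ. P x"
  then have 1: "AE x in lborel. -1 < x \<and> x < 1 \<longrightarrow> P x" by (simp add: AE_circ)
  have 2: "AE x in lborel. -1 < - x \<and> - x < 1 \<longrightarrow> P (- x)" using AE_lborel_affine[OF 1, of "-1" 0] by simp
  show "AE x in \<mu>I. P x \<and> P (- x)" unfolding AE_\<mu>I using 1 2 by eventually_elim auto
next
  assume "AE x in \<mu>I. P x \<and> P (- x)"
  then have 1: "AE x in lborel. 0 < x \<and> x < 1 \<longrightarrow> P x \<and> P (- x)" unfolding AE_\<mu>I .
  have 2: "AE x in lborel. 0 < - x \<and> - x < 1 \<longrightarrow> P (- x) \<and> P (- (- x))" using AE_lborel_affine[OF 1, of "-1" 0] by simp
  have 3: "AE x in lborel. x \<noteq> (0::real)" by (rule AE_lborel_singleton)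
  show "AE x in circ. P x" unfolding AE_circ using 1 2 3
  proof eventually_elim
    case (elim x)
    then show ?case by (cases "x > 0") auto
  qed
qed

lemma nn_integral_circ_fold:
  assumes [measurable]: "f \<in> borel_measurable borel"
  shows "(\<integral>\<^sup>+x. f x \<partial>circ) = (\<integral>\<^sup>+x. f x + f (- x) \<partial>\<mu>I)"
proof -
  have "(\<integral>\<^sup>+x. f x \<partial>circ) = (\<integral>\<^sup>+x. f x * indicator {0<..<1} x + f x * indicator {-1<..<0} x \<partial>lborel)"
    unfolding nn_integral_circ
  proof (rule nn_integral_cong_AE)
    have 3: "AE x in lborel. x \<noteq> (0::real)" by (rule AE_lborel_singleton)
    then show "AE x in lborel. f x * indicator {-1<..<1} x = f x * indicator {0<..<1} x + f x * indicator {-1<..<0} x"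
      by eventually_elim (auto simp: indicator_def)
  qed
  also have "\<dots> = (\<integral>\<^sup>+x. f x * indicator {0<..<1} x \<partial>lborel) + (\<integral>\<^sup>+x. f x * indicator {-1<..<0} x \<partial>lborel)"
    by (intro nn_integral_add) auto
  also have "(\<integral>\<^sup>+x. f x * indicator {-1<..<0} x \<partial>lborel) = (\<integral>\<^sup>+x. f (- x) * indicator {-1<..<0} (- x) \<partial>lborel)"
    using nn_integral_real_affine[of "\<lambda>x. f x * indicator {-1<..<0} x" "-1" 0] by simp
  also have "\<dots> = (\<integral>\<^sup>+x. f (- x) * indicator {0<..<1} x \<partial>lborel)"
    by (intro nn_integral_cong) (auto simp: indicator_def)
  also have "(\<integral>\<^sup>+x. f x * indicator {0<..<1} x \<partial>lborel) + \<dots> = (\<integral>\<^sup>+x. f x * indicator {0<..<1} x + f (- x) * indicator {0<..<1} x \<partial>lborel)"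
    by (intro nn_integral_add[symmetric]) auto
  also have "\<dots> = (\<integral>\<^sup>+x. f x + f (- x) \<partial>\<mu>I)"
    unfolding nn_integral_\<mu>I by (simp add: distrib_right)
  finally show ?thesis .
qed

lemma integrable_circ_fold:
  fixes f :: "real \<Rightarrow> real"
  assumes f [measurable]: "f \<in> borel_measurable borel"
  shows "integrable circ f \<longleftrightarrow> integrable \<mu>I f \<and> integrable \<mu>I (\<lambda>x. f (- x))"
proof -
  have m: "f \<in> borel_measurable circ" "f \<in> borel_measurable \<mu>I" "(\<lambda>x. f (- x)) \<in> borel_measurable \<mu>I"
    by (rule circ_measurable borel_measurable_\<mu>I, measurable)+
  have "(\<integral>\<^sup>+x. ennreal (norm (f x)) \<partial>circ) = (\<integral>\<^sup>+x. ennreal (norm (f x)) + ennreal (norm (f (- x))) \<partial>\<mu>I)"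
    by (intro nn_integral_circ_fold) simp
  also have "\<dots> = (\<integral>\<^sup>+x. ennreal (norm (f x)) \<partial>\<mu>I) + (\<integral>\<^sup>+x. ennreal (norm (f (- x))) \<partial>\<mu>I)"
    using m by (intro nn_integral_add) auto
  finally show ?thesis
    unfolding integrable_iff_bounded using m by (auto simp: ennreal_add_eq_top less_top)
qed

lemma integral_circ_fold:
  fixes f :: "real \<Rightarrow> real"
  assumes f [measurable]: "f \<in> borel_measurable borel" and i: "integrable circ f"
  shows "(\<integral>x. f x \<partial>circ) = (\<integral>x. f x + f (- x) \<partial>\<mu>I)"
proof -
  have nn: "(\<integral>x. g x \<partial>circ) = (\<integral>x. g x + g (- x) \<partial>\<mu>I)"
    if g [measurable]: "g \<in> borel_measurable borel" and ig: "integrable circ g" and "\<And>x. g x \<ge> 0" for g :: "real \<Rightarrow> real"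
  proof -
    have "ennreal (\<integral>x. g x \<partial>circ) = (\<integral>\<^sup>+x. ennreal (g x) \<partial>circ)"
      using ig that by (intro nn_integral_eq_integral[symmetric]) auto
    also have "\<dots> = (\<integral>\<^sup>+x. ennreal (g x) + ennreal (g (- x)) \<partial>\<mu>I)"
      by (intro nn_integral_circ_fold) simp
    also have "\<dots> = (\<integral>\<^sup>+x. ennreal (g x + g (- x)) \<partial>\<mu>I)"
      using that by (simp add: ennreal_plus)
    also have "\<dots> = ennreal (\<integral>x. g x + g (- x) \<partial>\<mu>I)"
      using ig that by (intro nn_integral_eq_integral) (auto simp: integrable_circ_fold)
    finally show ?thesis
      by (subst (asm) ennreal_inj) (auto simp: that(3) intro!: Bochner_Integration.integral_nonneg)
  qed
  define P N where "P x = max 0 (f x)" and "N x = max 0 (- f x)" for x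
  have PN: "f x = P x - N x" for x by (simp add: P_def N_def max_def)
  have m [measurable]: "P \<in> borel_measurable borel" "N \<in> borel_measurable borel"
    unfolding P_def N_def by measurable
  have iPN: "integrable circ P" "integrable circ N"
    unfolding P_def N_def using i by (auto intro!: integrable_max)
  have "(\<integral>x. f x \<partial>circ) = (\<integral>x. P x \<partial>circ) - (\<integral>x. N x \<partial>circ)"
    unfolding PN using iPN by simp
  also have "\<dots> = (\<integral>x. P x + P (- x) \<partial>\<mu>I) - (\<integral>x. N x + N (- x) \<partial>\<mu>I)"
    using nn[OF m(1) iPN(1)] nn[OF m(2) iPN(2)] by (simp add: P_def N_def)
  also have "\<dots> = (\<integral>x. f x + f (- x) \<partial>\<mu>I)"
    unfolding PN using iPN by (simp add: integrable_circ_fold algebra_simps)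
  finally show ?thesis .
qed

lemma sq_integrable_circ_fold:
  assumes [measurable]: "f \<in> borel_measurable borel"
  shows "sq_integrable circ f \<longleftrightarrow> sq_integrable \<mu>I f \<and> sq_integrable \<mu>I (\<lambda>x. f (- x))"
proof -
  have m: "f \<in> borel_measurable circ" "f \<in> borel_measurable \<mu>I" "(\<lambda>x. f (- x)) \<in> borel_measurable \<mu>I"
    by (rule circ_measurable borel_measurable_\<mu>I, measurable)+
  then show ?thesis
    using integrable_circ_fold[of "\<lambda>x. (f x)\<^sup>2"] by (simp add: sq_integrable_def)
qed

lemma periodic_shift: "periodic f \<Longrightarrow> periodic (\<lambda>x. f (x + t))"
  unfolding periodic_def by (metis add.assoc add.commute)

lemma sq_integrable_circ_shift:
  assumes "f \<in> borel_measurable borel" "periodic f" "sq_integrable circ f"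
  shows "sq_integrable circ (\<lambda>x. f (x + t))"
proof -
  note [measurable] = assms(1)
  have "(\<lambda>x. f (x + t)) \<in> borel_measurable circ"
    by (intro circ_measurable) measurable
  then show ?thesis
    using circ_shift(1)[of "\<lambda>x. (f x)\<^sup>2" t] assms by (auto simp: sq_integrable_def periodic_def)
qed

text \<open>Since \<open>fold_unit\<close> is even, \<open>c < 0\<close> describes the right-moving characteristic from \<open>-c\<close>.\<close>

definition char_times :: "(real \<times> real) set \<Rightarrow> real \<Rightarrow> real set"
  where "char_times G c = {t. (t, fold_unit (c - t)) \<in> G}"

lemma fold_unit_minus: "fold_unit (- s) = fold_unit s"
\<comment> \<open>In the half-open period -1 is the one value at which \<open>per\<close> is not
  odd; both folds are 1 there.\<close>
proof (cases "per s = -1")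
  case True
  then have "- s = 1 + 2 * of_int (- \<lfloor>(s + 1) / 2\<rfloor>)" by (simp add: per_def)
  then have "per (- s) = per 1" using per_add_int by metis
  also have "per 1 = -1" using per_add2[of "-1"] per_eq[of "-1"] by simp
  finally show ?thesis using True by (simp add: fold_unit_per)
next
  case False
  have "- s = - per s + 2 * of_int (- \<lfloor>(s + 1) / 2\<rfloor>)" by (simp add: per_def)
  then have "per (- s) = per (- per s)" using per_add_int by metis
  also have "\<dots> = - per s" using per_bounds[of s] False by (intro per_eq) auto
  finally show ?thesis by (simp add: fold_unit_per)
qed

text \<open>At a fixed time t the two terms are the values at x and -x of one function on the
  circle. Unfolding and rotating by t turns the space integral into an integral over starting points
  c, and Fubini leaves the time that the characteristic from c spends in \<open>G\<close>. This
  computes the diagonal part of the observation.\<close>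

lemma nn_integral_characteristics:
  fixes f :: "real \<Rightarrow> ennreal"
  assumes G [measurable]: "G \<in> sets borel" and sub: "G \<subseteq> UNIV \<times> {0<..<1}"
    and f [measurable]: "f \<in> borel_measurable borel" and p: "periodic f"
  shows "(\<integral>\<^sup>+z. (f (fst z + snd z) + f (fst z - snd z)) * indicator G z \<partial>lborel)
       = (\<integral>\<^sup>+c. f c * emeasure lborel (char_times G c) \<partial>circ)"
proof -
  have G2 [measurable]: "G \<in> sets (borel \<Otimes>\<^sub>M borel)" by (subst borel_prod) (rule G)
  define g :: "real \<Rightarrow> real \<Rightarrow> ennreal" where "g t x = indicator G (t, x)" for t x
  have g [measurable]: "(\<lambda>(t, x). g t x) \<in> borel_measurable (borel \<Otimes>\<^sub>M borel)"
    unfolding g_def by measurable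
  have g0: "g t x = 0" if "x \<le> 0 \<or> x \<ge> 1" for t x
    using that sub by (auto simp: g_def indicator_def)
  have "(\<integral>\<^sup>+z. (f (fst z + snd z) + f (fst z - snd z)) * indicator G z \<partial>lborel)
      = (\<integral>\<^sup>+z. (f (fst z + snd z) + f (fst z - snd z)) * g (fst z) (snd z) \<partial>(lborel \<Otimes>\<^sub>M lborel))"
    unfolding lborel_prod by (simp add: g_def)
  also have "\<dots> = (\<integral>\<^sup>+t. \<integral>\<^sup>+x. (f (t + x) + f (t - x)) * g t x \<partial>lborel \<partial>lborel)"
    by (subst lborel.nn_integral_fst[symmetric]) (auto simp: case_prod_beta)
  also have "\<dots> = (\<integral>\<^sup>+t. \<integral>\<^sup>+c. f c * g t (fold_unit (c - t)) \<partial>circ \<partial>lborel)"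
  proof (intro nn_integral_cong)
    fix t :: real
    define h where "h y = f (t + y) * g t (fold_unit y)" for y
    have gm [measurable]: "g t \<in> borel_measurable borel"
      using measurable_compose_Pair1[OF _ g, of t] by simp
    have hm [measurable]: "h \<in> borel_measurable borel" unfolding h_def by measurable
    have hp: "periodic h"
      using p by (auto simp: h_def periodic_def fold_unit_add2 add.assoc[symmetric])
    have "(\<integral>\<^sup>+x. (f (t + x) + f (t - x)) * g t x \<partial>lborel) = (\<integral>\<^sup>+x. h x + h (- x) \<partial>\<mu>I)"
      unfolding nn_integral_\<mu>I
    proof (intro nn_integral_cong)
      fix x :: real
      show "(f (t + x) + f (t - x)) * g t x = (h x + h (- x)) * indicator unit_iv x"
      proof (cases "x \<in> unit_iv")
        case True
        then have "fold_unit x = x" by (simp add: fold_unit_per per_eq)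
        then show ?thesis using True by (simp add: h_def fold_unit_minus distrib_right)
      next
        case False
        then show ?thesis using g0 by auto
      qed
    qed
    also have "\<dots> = (\<integral>\<^sup>+x. h x \<partial>circ)"
      by (rule nn_integral_circ_fold[symmetric]) measurable
    also have "\<dots> = (\<integral>\<^sup>+x. h (x + (- t)) \<partial>circ)"
      by (rule nn_integral_circ_shift[symmetric, OF hm hp])
    also have "\<dots> = (\<integral>\<^sup>+c. f c * g t (fold_unit (c - t)) \<partial>circ)"
      by (simp add: h_def)
    finally show "(\<integral>\<^sup>+x. (f (t + x) + f (t - x)) * g t x \<partial>lborel) = (\<integral>\<^sup>+c. f c * g t (fold_unit (c - t)) \<partial>circ)" .
  qed
  also have "\<dots> = (\<integral>\<^sup>+c. \<integral>\<^sup>+t. f c * g t (fold_unit (c - t)) \<partial>lborel \<partial>circ)"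
  proof -
    interpret C: finite_measure circ by (rule finite_measure_circ)
    interpret P: pair_sigma_finite lborel circ by unfold_locales
    have s: "sets (lborel \<Otimes>\<^sub>M circ) = sets (borel \<Otimes>\<^sub>M restrict_space borel {-1<..<1})"
      by (intro sets_pair_measure_cong) (simp_all add: circ_def sets_restrict_space)
    have id: "(\<lambda>c. c) \<in> restrict_space borel {-1<..<1} \<rightarrow>\<^sub>M (borel :: real measure)"
      by (rule measurable_restrict_space1) simp
    have "(\<lambda>(t, c). f c * g t (fold_unit (c - t))) \<in> borel_measurable (borel \<Otimes>\<^sub>M (borel :: real measure))"
      unfolding g_def by measurable
    from measurable_compose[OF measurable_Pair[OF measurable_fst measurable_compose[OF measurable_snd id]] this]
    have "(\<lambda>z. case (fst z, snd z) of (t, c) \<Rightarrow> f c * g t (fold_unit (c - t))) \<in> borel_measurable (lborel \<Otimes>\<^sub>M circ)"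
      by (subst measurable_cong_sets[OF s refl])
    then show ?thesis
      by (intro P.Fubini'[symmetric]) (simp add: case_prod_beta)
  qed
  also have "\<dots> = (\<integral>\<^sup>+c. f c * emeasure lborel (char_times G c) \<partial>circ)"
  proof (intro nn_integral_cong)
    fix c :: real
    have "(\<lambda>t. (t, fold_unit (c - t))) \<in> borel \<rightarrow>\<^sub>M borel \<Otimes>\<^sub>M borel" by measurable
    from measurable_sets[OF this G2] have [measurable]: "char_times G c \<in> sets borel"
      by (simp add: char_times_def vimage_def)
    have "(\<integral>\<^sup>+t. f c * g t (fold_unit (c - t)) \<partial>lborel) = (\<integral>\<^sup>+t. f c * indicator (char_times G c) t \<partial>lborel)"
      by (intro nn_integral_cong) (auto simp: g_def char_times_def indicator_def)
    also have "\<dots> = f c * emeasure lborel (char_times G c)"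
      by (simp add: nn_integral_cmult nn_integral_indicator)
    finally show "(\<integral>\<^sup>+t. f c * g t (fold_unit (c - t)) \<partial>lborel) = f c * emeasure lborel (char_times G c)" .
  qed
  finally show ?thesis .
qed

section \<open>Fourier coefficients of weak solutions\<close>

lemma has_deriv_integral_by_parts:
  assumes F: "\<And>x. x \<in> {0..1} \<Longrightarrow> (F has_real_derivative f x) (at x within {0..1})"
    and f: "continuous_on {0..1} f"
  shows "is_weak_deriv F f"
  unfolding is_weak_deriv_def
proof
  fix \<phi> assume \<phi>: "\<phi> \<in> test_functions unit_iv"
  note s = test_functions_smooth[OF \<phi>]
  have Fc: "continuous_on {0..1} F"
    using F by (meson DERIV_continuous continuous_on_eq_continuous_within)
  have c: "continuous_on {0..1} (\<lambda>x. f x * \<phi> x + F x * deriv \<phi> x)"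
    by (intro continuous_intros f Fc smooth_continuous_on s smooth_deriv)
  have "((\<lambda>x. f x * \<phi> x + F x * deriv \<phi> x) has_integral F 1 * \<phi> 1 - F 0 * \<phi> 0) {0..1}"
  proof (intro fundamental_theorem_of_calculus)
    fix x :: real assume x: "x \<in> {0..1}"
    have "((\<lambda>x. F x * \<phi> x) has_real_derivative (f x * \<phi> x + deriv \<phi> x * F x)) (at x within {0..1})"
      by (rule DERIV_mult[OF F[OF x] smooth_has_deriv[OF s]])
    then show "((\<lambda>x. F x * \<phi> x) has_vector_derivative (f x * \<phi> x + F x * deriv \<phi> x)) (at x within {0..1})"
      by (simp add: has_real_derivative_iff_has_vector_derivative mult.commute)
  qed simp
  then have "(\<integral>x. f x * \<phi> x + F x * deriv \<phi> x \<partial>\<mu>I) = 0"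
    using integral_\<mu>I_eq_integral[OF continuous_on_sq_integrable[OF c]] test_functions_boundary[OF \<phi>]
    by (simp add: integral_unique)
  moreover have "integrable \<mu>I (\<lambda>x. f x * \<phi> x)" "integrable \<mu>I (\<lambda>x. F x * deriv \<phi> x)"
    by (intro sq_integrable_mult continuous_on_sq_integrable f Fc smooth_continuous_on s smooth_deriv)+
  ultimately show "l2_inner F (deriv \<phi>) = - l2_inner f \<phi>"
    by (simp add: l2_inner_def)
qed

lemma integral_sq_eq_0_continuous:
  assumes "continuous_on {0..1} f" "AE x in \<mu>I. f x = 0" "x \<in> {0..1}"
  shows "f x = (0::real)"
proof -
  have "integral {0..1} (\<lambda>x. (f x)\<^sup>2) = (\<integral>x. (f x)\<^sup>2 \<partial>\<mu>I)"
    by (rule integral_\<mu>I_eq_integral[symmetric, OF continuous_on_sq_integrable])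
      (intro continuous_intros assms)
  also have "\<dots> = 0"
    using assms(2) by (intro integral_eq_zero_AE) auto
  finally have "\<forall>x\<in>{0..1}. (f x)\<^sup>2 = 0"
    by (subst (asm) integral_eq_0_iff) (auto intro!: continuous_intros assms)
  then show ?thesis using assms(3) by simp
qed

text \<open>Integration by parts against the sines kills all cosine coefficients of \<open>f\<close>
  with k > 0, and subtracting the mean removes the remaining one; completeness and continuity then
  apply.\<close>

lemma weak_deriv_zero_imp_const:
  assumes f: "continuous_on {0..1} f" and w: "is_weak_deriv f (\<lambda>x. 0)"
  obtains c where "\<And>x. x \<in> {0..1} \<Longrightarrow> f x = c"
proof -
  have sf: "sq_integrable \<mu>I f" by (rule continuous_on_sq_integrable[OF f])
  have s0: "sq_integrable \<mu>I (\<lambda>x. 0)" by (simp add: sq_integrable_def)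
  note H = weak_deriv_AE_eq[OF sf s0 w]
  define c where "c = (\<integral>x. f x \<partial>\<mu>I)"
  have one: "(\<integral>x. (1::real) \<partial>\<mu>I) = 1" by (simp add: measure_restrict_space)
  have "(\<integral>x. (f x - c) * cosb k x \<partial>\<mu>I) = 0" for k
  proof (cases "k = 0")
    case True
    have "integrable \<mu>I f" by (rule sq_integrable_integrable[OF finite_measure_\<mu>I sf])
    moreover have "integrable \<mu>I (\<lambda>x. c)" using finite_measure.integrable_const[OF finite_measure_\<mu>I] .
    ultimately show ?thesis
      using True one by (simp add: cosb_def c_def measure_restrict_space)
  next
    case False
    have "l2_inner (weak_deriv f) (sinb k) = l2_inner (\<lambda>x. 0) (sinb k)"
      by (rule l2_inner_cong_AE[OF H1_weak_deriv(1)[OF H(1)] s0 smooth_sq_integrable[OF smooth_sinb] H(2)])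
    then have "l2_inner f (cosb k) = 0"
      using H1_weak_deriv_sinb[OF H(1), of k] False by (simp add: l2_inner_def)
    moreover have "(\<integral>x. cosb k x \<partial>\<mu>I) = 0"
    proof -
      have "deriv (\<lambda>x. sinb k x * inverse (real k * pi)) = cosb k"
        using False by (intro deriv_eqI) (auto simp: sinb_def cosb_def field_simps intro!: derivative_eq_intros)
      moreover have "smooth (\<lambda>x. sinb k x * inverse (real k * pi))"
        by (intro smooth_mult smooth_sinb smooth_const)
      ultimately show ?thesis using integral_deriv_smooth sinb_boundary by fastforce
    qed
    moreover have "integrable \<mu>I (\<lambda>x. f x * cosb k x)" "integrable \<mu>I (cosb k)"
      by (rule sq_integrable_mult[OF sf smooth_sq_integrable[OF smooth_cosb]],
        rule sq_integrable_integrable[OF finite_measure_\<mu>I smooth_sq_integrable[OF smooth_cosb]])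
    ultimately show ?thesis
      by (simp add: left_diff_distrib l2_inner_def)
  qed
  moreover have "integrable \<mu>I (\<lambda>x. f x - c)"
    by (intro sq_integrable_integrable[OF finite_measure_\<mu>I] continuous_on_sq_integrable continuous_intros f)
  ultimately have "AE x in \<mu>I. f x - c = 0" by (intro cos_complete)
  then have "f x = c" if "x \<in> {0..1}" for x
    using integral_sq_eq_0_continuous[OF continuous_on_diff[OF f continuous_on_const] _ that, of c] by simp
  then show ?thesis using that by blast
qed

text \<open>In the sense of distributions q' = -r on (0, T). After rescaling to the unit interval,
  \<open>q\<close> minus the classical primitive has weak derivative 0 and is constant, so the
  equation holds classically, endpoints included.\<close>

lemma du_Bois_Reymond:
  assumes "T > 0" and q: "continuous_on {0..T} q" and r: "continuous_on {0..T} r"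
    and w: "\<And>\<theta>. \<theta> \<in> test_functions {0<..<T} \<Longrightarrow>
        integral {0..T} (\<lambda>t. - q t * deriv \<theta> t + r t * \<theta> t) = 0"
    and t: "t \<in> {0..T}"
  shows "(q has_real_derivative - r t) (at t within {0..T})"
proof -
  define Q R where "Q x = q (T * x)" and "R x = - T * r (T * x)" for x
  have im: "(\<lambda>x. T * x) ` {0..1} \<subseteq> {0..T}" using \<open>T > 0\<close> by (auto simp: mult_left_le)
  have Qc: "continuous_on {0..1} Q" and Rc: "continuous_on {0..1} R"
    unfolding Q_def R_def
    by (intro continuous_intros continuous_on_compose2[OF q _ im] continuous_on_compose2[OF r _ im])+
  define F where "F x = integral {0..x} R" for x
  have FD: "(F has_real_derivative R x) (at x within {0..1})" if "x \<in> {0..1}" for x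
    unfolding F_def using integral_has_real_derivative[OF Rc that] .
  have Fc: "continuous_on {0..1} F"
    using FD by (meson DERIV_continuous continuous_on_eq_continuous_within)
  have "is_weak_deriv Q R"
    unfolding is_weak_deriv_def
  proof
    fix \<phi> assume \<phi>: "\<phi> \<in> test_functions unit_iv"
    obtain a b where ab: "0 < a" "a \<le> b" "b < 1" "\<And>x. x \<notin> {a..b} \<Longrightarrow> \<phi> x = 0"
      by (rule test_functions_support[OF \<phi>]) auto
    define \<theta> where "\<theta> t = \<phi> ((1/T) * t + 0)" for t
    have s: "smooth \<phi>" by (rule test_functions_smooth[OF \<phi>])
    have \<theta>: "\<theta> \<in> test_functions {0<..<T}"
    proof (rule test_functionsI[of _ "T * a" "T * b"])
      show "smooth \<theta>" unfolding \<theta>_def by (intro smooth_affine s)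
      show "\<theta> x = 0" if "x \<notin> {T * a..T * b}" for x
        unfolding \<theta>_def using that \<open>T > 0\<close> by (intro ab(4)) (auto simp: field_simps)
      have "0 < T * a" "T * b < T" using ab \<open>T > 0\<close> by auto
      then show "{T * a..T * b} \<subseteq> {0<..<T}" by auto
    qed
    have "deriv \<theta> = (\<lambda>t. deriv \<phi> (t / T) / T)"
    proof (rule deriv_eqI)
      fix t
      have "((\<lambda>t. \<phi> ((1/T) * t + 0)) has_real_derivative deriv \<phi> ((1/T) * t + 0) * (1/T)) (at t)"
        by (rule DERIV_chain2[OF smooth_has_deriv[OF s]]) (use \<open>T > 0\<close> in \<open>auto intro!: derivative_eq_intros\<close>)
      then show "(\<theta> has_real_derivative deriv \<phi> (t / T) / T) (at t)"
        by (simp add: \<theta>_def[abs_def])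
    qed
    then have "integral {0..T} (\<lambda>t. - q t * (deriv \<phi> (t / T) / T) + r t * \<phi> (t / T)) = 0"
      using w[OF \<theta>] by (simp add: \<theta>_def)
    moreover have "(\<lambda>t. - q t * (deriv \<phi> (t / T) / T) + r t * \<phi> (t / T)) integrable_on {0..T}"
      by (intro integrable_continuous_interval continuous_intros q r
          continuous_on_compose2[OF smooth_continuous_on[OF s, of UNIV]]
          continuous_on_compose2[OF smooth_continuous_on[OF smooth_deriv[OF s], of UNIV]])
        (use \<open>T > 0\<close> in auto)
    ultimately have "((\<lambda>t. - q t * (deriv \<phi> (t / T) / T) + r t * \<phi> (t / T)) has_integral 0) (cbox 0 T)"
      by (simp add: has_integral_integrable_integral)
    then have "((\<lambda>x. - q (T * x) * (deriv \<phi> (T * x / T) / T) + r (T * x) * \<phi> (T * x / T)) has_integral 0) (cbox 0 1)"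
      using has_integral_affinity'[of "\<lambda>t. - q t * (deriv \<phi> (t / T) / T) + r t * \<phi> (t / T)" 0 0 T T 0] \<open>T > 0\<close>
      by (simp add: divide_inverse)
    from has_integral_mult_right[OF this, of "-T"]
    have "((\<lambda>x. Q x * deriv \<phi> x + R x * \<phi> x) has_integral 0) {0..1}"
      using \<open>T > 0\<close> by (simp add: Q_def R_def algebra_simps)
    moreover have "sq_integrable \<mu>I (\<lambda>x. Q x * deriv \<phi> x + R x * \<phi> x)"
      by (intro continuous_on_sq_integrable continuous_intros Qc Rc smooth_continuous_on s smooth_deriv)
    ultimately have "(\<integral>x. Q x * deriv \<phi> x + R x * \<phi> x \<partial>\<mu>I) = 0"
      using integral_\<mu>I_eq_integral by (metis integral_unique)
    moreover have "integrable \<mu>I (\<lambda>x. Q x * deriv \<phi> x)" "integrable \<mu>I (\<lambda>x. R x * \<phi> x)"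
      by (intro sq_integrable_mult continuous_on_sq_integrable Rc Qc smooth_continuous_on s smooth_deriv)+
    ultimately show "l2_inner Q (deriv \<phi>) = - l2_inner R \<phi>"
      by (simp add: l2_inner_def)
  qed
  then have "is_weak_deriv (\<lambda>x. Q x - F x) (\<lambda>x. R x - R x)"
    by (rule is_weak_deriv_diff[OF continuous_on_sq_integrable[OF Qc] continuous_on_sq_integrable[OF Rc] _
          continuous_on_sq_integrable[OF Fc] continuous_on_sq_integrable[OF Rc] has_deriv_integral_by_parts[OF FD Rc]])
  then have "is_weak_deriv (\<lambda>x. Q x - F x) (\<lambda>x. 0)" by simp
  then obtain c where c: "\<And>x. x \<in> {0..1} \<Longrightarrow> Q x - F x = c"
    using weak_deriv_zero_imp_const[OF continuous_on_diff[OF Qc Fc]] by blast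
  define x where "x = t / T"
  have x: "x \<in> {0..1}" and tx: "t = T * x" using t \<open>T > 0\<close> by (auto simp: x_def)
  have "((\<lambda>y. F (y / T) + c) has_real_derivative R x * (1 / T)) (at t within {0..T})"
  proof -
    have "(F has_real_derivative R x) (at (t / T) within (\<lambda>y. y / T) ` {0..T})"
      using FD[OF x] \<open>T > 0\<close> by (simp add: x_def image_divide_atLeastAtMost)
    moreover have "((\<lambda>y. y / T) has_real_derivative 1 / T) (at t within {0..T})"
      using \<open>T > 0\<close> by (auto intro!: derivative_eq_intros)
    ultimately have "((\<lambda>y. F (y / T)) has_real_derivative R x * (1 / T)) (at t within {0..T})"
      using DERIV_image_chain[of F "R x" "\<lambda>y. y / T" t "{0..T}" "1 / T"] by (simp add: o_def)
    then show ?thesis by (auto intro!: derivative_eq_intros)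
  qed
  then have "(q has_real_derivative R x * (1 / T)) (at t within {0..T})"
  proof (rule has_field_derivative_transform_within[of _ _ _ _ 1])
    show "F (y / T) + c = q y" if "y \<in> {0..T}" for y
      using c[of "y / T"] that \<open>T > 0\<close> by (auto simp: Q_def)
  qed (use t in auto)
  moreover have "R x * (1 / T) = - r t" using \<open>T > 0\<close> by (simp add: R_def tx)
  ultimately show ?thesis by simp
qed

text \<open>Rotating the vector (b, \<omega> a) back by the angle \<omega> t gives two conserved
  quantities. There is no division by \<omega>, so the constant mode \<omega> = 0 is
  covered.\<close>

lemma harmonic_oscillator:
  assumes a: "\<And>t. t \<in> {0..T} \<Longrightarrow> (a has_real_derivative b t) (at t within {0..T})"
    and b: "\<And>t. t \<in> {0..T} \<Longrightarrow> (b has_real_derivative - (\<omega>\<^sup>2 * a t)) (at t within {0..T})"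
    and t: "t \<in> {0..T}"
  shows "b t = b 0 * cos (\<omega> * t) - \<omega> * a 0 * sin (\<omega> * t)"
proof -
  have "\<exists>c. \<forall>s\<in>{0..T}. b s * cos (\<omega> * s) + \<omega> * a s * sin (\<omega> * s) = c"
    by (rule has_field_derivative_zero_constant)
      (auto intro!: derivative_eq_intros a b simp: power2_eq_square algebra_simps)
  then have 1: "b t * cos (\<omega> * t) + \<omega> * a t * sin (\<omega> * t) = b 0"
    using t by force
  have "\<exists>c. \<forall>s\<in>{0..T}. b s * sin (\<omega> * s) - \<omega> * a s * cos (\<omega> * s) = c"
    by (rule has_field_derivative_zero_constant)
      (auto intro!: derivative_eq_intros a b simp: power2_eq_square algebra_simps)
  then have 2: "b t * sin (\<omega> * t) - \<omega> * a t * cos (\<omega> * t) = - (\<omega> * a 0)"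
    using t by force
  have "b t = b t * ((cos (\<omega> * t))\<^sup>2 + (sin (\<omega> * t))\<^sup>2)" by (simp only: sin_cos_squared_add2 mult_1_right)
  also have "\<dots> = (b t * cos (\<omega> * t) + \<omega> * a t * sin (\<omega> * t)) * cos (\<omega> * t)
      + (b t * sin (\<omega> * t) - \<omega> * a t * cos (\<omega> * t)) * sin (\<omega> * t)"
    by algebra
  finally show ?thesis unfolding 1 2 by simp
qed

text \<open>Pairing with the eigenfunction \<open>e\<close> yields a' = b from differentiability in
  L2, and b' = -\<omega>^2 a in the weak sense; the du Bois-Reymond lemma makes the second equation
  classical.\<close>

lemma weak_solution_coefficient:
  assumes "T > 0" and V: "V \<subseteq> H1" and sol: "weak_wave_solution V T u0 u1 u v"
    and e: "e \<in> V" and eig: "\<And>\<psi>. \<psi> \<in> V \<Longrightarrow> l2_inner (weak_deriv \<psi>) (weak_deriv e) = \<omega>\<^sup>2 * l2_inner \<psi> e"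
    and t: "t \<in> {0..T}"
  shows "l2_inner (v t) e = l2_inner u1 e * cos (\<omega> * t) - \<omega> * l2_inner u0 e * sin (\<omega> * t)"
proof -
  have u0: "u0 \<in> V" and u1: "u1 \<in> L2" and uV: "\<forall>t\<in>{0..T}. u t \<in> V" and vL: "\<forall>t\<in>{0..T}. v t \<in> L2"
    and cv: "continuous_curve l2_norm T v" and cu: "l2_curve_deriv T u v"
    and ini: "AE x in \<mu>I. u 0 x = u0 x" "AE x in \<mu>I. v 0 x = u1 x"
    and weak: "\<forall>\<psi>\<in>V. \<forall>\<theta>\<in>test_functions {0<..<T}.
              (\<integral>t. - l2_inner (v t) \<psi> * deriv \<theta> t
                   + l2_inner (weak_deriv (u t)) (weak_deriv \<psi>) * \<theta> t \<partial>lebesgue_on {0..T}) = 0"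
    using sol unfolding weak_wave_solution_def by simp_all
  have se: "sq_integrable \<mu>I e" by (rule H1_weak_deriv(3)[OF subsetD[OF V e]])
  have su: "sq_integrable \<mu>I (u s)" "u s \<in> V" if "s \<in> {0..T}" for s
    using H1_weak_deriv(3)[OF subsetD[OF V bspec[OF uV that]]] bspec[OF uV that] .
  have sv: "sq_integrable \<mu>I (v s)" if "s \<in> {0..T}" for s
    using bspec[OF vL that] unfolding L2_iff .
  have ev: "\<forall>\<^sub>F r in at s within {0..T}. r \<in> {0..T}" for s :: real
    by (rule eventually_at_topological[THEN iffD2]) auto
  define a b where "a s = l2_inner (u s) e" and "b s = l2_inner (v s) e" for s
  have a: "(a has_real_derivative b s) (at s within {0..T})" if s: "s \<in> {0..T}" for s
    unfolding has_field_derivative_iff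
  proof (rule LIM_zero_cancel)
    have lim: "((\<lambda>r. l2_norm (\<lambda>x. (u r x - u s x) / (r - s) - v s x) * l2_norm e) \<longlongrightarrow> 0) (at s within {0..T})"
      using cu s unfolding l2_curve_deriv_def by (intro tendsto_mult_left_zero) blast
    show "((\<lambda>r. (a r - a s) / (r - s) - b s) \<longlongrightarrow> 0) (at s within {0..T})"
    proof (rule Lim_null_comparison[OF _ lim])
      have bd: "norm ((a r - a s) / (r - s) - b s) \<le> l2_norm (\<lambda>x. (u r x - u s x) / (r - s) - v s x) * l2_norm e"
        if r: "r \<in> {0..T}" for r
      proof -
        let ?d = "\<lambda>x. inverse (r - s) * (u r x - u s x)"
        have d: "?d = (\<lambda>x. (u r x - u s x) / (r - s))"
          by (rule ext) (simp only: divide_inverse mult.commute)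
        have sd: "sq_integrable \<mu>I ?d"
          by (intro sq_integrable_cmult sq_integrable_diff su r s)
        have eq: "(a r - a s) / (r - s) - b s = l2_inner (\<lambda>x. ?d x - v s x) e"
          unfolding l2_inner_diff[OF sd sv[OF s] se] l2_inner_cmult l2_inner_diff[OF su(1)[OF r] su(1)[OF s] se]
          by (simp add: a_def b_def divide_inverse mult.commute[of "inverse (r - s)"])
        have "\<bar>l2_inner (\<lambda>x. ?d x - v s x) e\<bar> \<le> l2_norm (\<lambda>x. ?d x - v s x) * l2_norm e"
           by (intro l2_inner_le sq_integrable_diff sd sv[OF s] se)
        then show ?thesis unfolding eq real_norm_def fun_cong[OF d] .
      qed
      show "\<forall>\<^sub>F r in at s within {0..T}. norm ((a r - a s) / (r - s) - b s)
          \<le> l2_norm (\<lambda>x. (u r x - u s x) / (r - s) - v s x) * l2_norm e"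
        by (rule eventually_mono[OF ev]) (rule bd)
    qed
  qed
  have bc: "continuous_on {0..T} b"
    unfolding continuous_on_def
  proof
    fix s assume s: "s \<in> {0..T}"
    show "(b \<longlongrightarrow> b s) (at s within {0..T})"
    proof (rule LIM_zero_cancel)
      have lim: "((\<lambda>r. l2_norm (\<lambda>x. v r x - v s x) * l2_norm e) \<longlongrightarrow> 0) (at s within {0..T})"
        using cv s unfolding continuous_curve_def by (intro tendsto_mult_left_zero) blast
      show "((\<lambda>r. b r - b s) \<longlongrightarrow> 0) (at s within {0..T})"
      proof (rule Lim_null_comparison[OF _ lim])
        have bd: "norm (b r - b s) \<le> l2_norm (\<lambda>x. v r x - v s x) * l2_norm e" if r: "r \<in> {0..T}" for r
          unfolding b_def l2_inner_diff[OF sv[OF r] sv[OF s] se, symmetric] real_norm_def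
          by (intro l2_inner_le sq_integrable_diff sv r s se)
        show "\<forall>\<^sub>F r in at s within {0..T}. norm (b r - b s) \<le> l2_norm (\<lambda>x. v r x - v s x) * l2_norm e"
          by (rule eventually_mono[OF ev]) (rule bd)
      qed
    qed
  qed
  have ac: "continuous_on {0..T} a"
    using a by (meson DERIV_continuous continuous_on_eq_continuous_within)
  have b: "(b has_real_derivative - (\<omega>\<^sup>2 * a s)) (at s within {0..T})" if s: "s \<in> {0..T}" for s
  proof (rule du_Bois_Reymond[OF \<open>T > 0\<close> bc _ _ s])
    show "continuous_on {0..T} (\<lambda>s. \<omega>\<^sup>2 * a s)" by (intro continuous_intros ac)
    fix \<theta> assume \<theta>: "\<theta> \<in> test_functions {0<..<T}"
    have c: "continuous_on {0..T} (\<lambda>t. - b t * deriv \<theta> t + \<omega>\<^sup>2 * a t * \<theta> t)"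
      by (intro continuous_intros ac bc smooth_continuous_on test_functions_smooth[OF \<theta>] smooth_deriv)
    have "integral {0..T} (\<lambda>t. - b t * deriv \<theta> t + \<omega>\<^sup>2 * a t * \<theta> t)
       = (\<integral>t. - b t * deriv \<theta> t + \<omega>\<^sup>2 * a t * \<theta> t \<partial>lebesgue_on {0..T})"
      by (rule lebesgue_integral_eq_integral[symmetric, OF continuous_imp_integrable_real[OF c]]) simp
    also have "\<dots> = (\<integral>t. - l2_inner (v t) e * deriv \<theta> t
                   + l2_inner (weak_deriv (u t)) (weak_deriv e) * \<theta> t \<partial>lebesgue_on {0..T})"
      using eig su by (intro Bochner_Integration.integral_cong) (auto simp: a_def b_def)
    also have "\<dots> = 0" using weak e \<theta> by blast
    finally show "integral {0..T} (\<lambda>t. - b t * deriv \<theta> t + \<omega>\<^sup>2 * a t * \<theta> t) = 0" .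
  qed
  have "b t = b 0 * cos (\<omega> * t) - \<omega> * a 0 * sin (\<omega> * t)"
    by (rule harmonic_oscillator[OF a b t])
  moreover have 0: "0 \<in> {0..T}" using \<open>T > 0\<close> by simp
  moreover have "a 0 = l2_inner u0 e"
    unfolding a_def by (rule l2_inner_cong_AE[OF su(1)[OF 0] H1_weak_deriv(3)[OF subsetD[OF V u0]] se ini(1)])
  moreover have "b 0 = l2_inner u1 e"
    unfolding b_def by (rule l2_inner_cong_AE[OF sv[OF 0] u1[unfolded L2_iff] se ini(2)])
  ultimately show ?thesis by (simp add: b_def)
qed

section \<open>D'Alembert's formula\<close>

lemma sinb_minus: "sinb k (- x) = - sinb k x" and cosb_minus: "cosb k (- x) = cosb k x"
  by (simp_all add: sinb_def cosb_def)

lemma periodic_sinb: "periodic (sinb k)" and periodic_cosb: "periodic (cosb k)"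
proof -
  have "real k * pi * (x + 2) = real k * pi * x + 2 * real k * pi" for x by (simp add: algebra_simps)
  then show "periodic (sinb k)" "periodic (cosb k)"
    by (simp_all add: periodic_def sinb_def cosb_def sin_add cos_add)
qed

lemma sq_integrable_circ_smooth: "smooth f \<Longrightarrow> sq_integrable circ f"
proof -
  assume s: "smooth f"
  have "smooth (\<lambda>x. f (- x))" using smooth_affine[OF s, of "-1" 0] by simp
  then show "sq_integrable circ f"
    using smooth_sq_integrable[OF s] smooth_sq_integrable[of "\<lambda>x. f (- x)"]
    by (subst sq_integrable_circ_fold) (auto intro: smooth_borel s)
qed

definition periodic_L2 :: "(real \<Rightarrow> real) \<Rightarrow> bool"
  where "periodic_L2 p \<longleftrightarrow> p \<in> borel_measurable borel \<and> periodic p \<and> sq_integrable circ p"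

lemma periodic_L2_borel [measurable_dest]: "periodic_L2 p \<Longrightarrow> p \<in> borel_measurable borel"
  by (simp add: periodic_L2_def)

text \<open>This is the time derivative for the boundary sign \<epsilon>; the space derivative is
  the same expression with sign -\<epsilon>.\<close>

definition dalembert :: "real \<Rightarrow> (real \<Rightarrow> real) \<Rightarrow> real \<Rightarrow> real \<Rightarrow> real"
  where "dalembert \<epsilon> p t x = p (t + x) + \<epsilon> * p (t - x)"

lemma periodic_L2_shift:
  assumes "periodic_L2 p"
  shows "sq_integrable \<mu>I (\<lambda>x. p (t + x))" "sq_integrable \<mu>I (\<lambda>x. p (t - x))"
proof -
  note [measurable] = periodic_L2_borel[OF assms]
  have "sq_integrable circ (\<lambda>x. p (x + t))"
    using assms by (intro sq_integrable_circ_shift) (auto simp: periodic_L2_def)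
  moreover have "(\<lambda>x. p (x + t)) \<in> borel_measurable borel" by measurable
  ultimately show "sq_integrable \<mu>I (\<lambda>x. p (t + x))" "sq_integrable \<mu>I (\<lambda>x. p (t - x))"
    by (subst (asm) sq_integrable_circ_fold; simp add: add.commute)+
qed

lemma sq_integrable_dalembert: "periodic_L2 p \<Longrightarrow> sq_integrable \<mu>I (dalembert \<epsilon> p t)"
  unfolding dalembert_def[abs_def]
  by (intro sq_integrable_add sq_integrable_cmult periodic_L2_shift)

text \<open>Because \<open>e\<close> has parity \<epsilon>, the two travelling terms are the two
  halves of one integral over the circle, and a rotation by t moves the time dependence to
  \<open>e\<close>.\<close>

lemma l2_inner_dalembert:
  assumes p: "periodic_L2 p" and e: "smooth e" "periodic e" and \<epsilon>: "\<And>x. e (- x) = \<epsilon> * e x"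
  shows "l2_inner (dalembert \<epsilon> p t) e = (\<integral>y. p y * e (y - t) \<partial>circ)"
proof -
  note [measurable] = periodic_L2_borel[OF p] smooth_borel[OF e(1)]
  define F where "F x = p (x + t) * e x" for x
  have Fm [measurable]: "F \<in> borel_measurable borel" unfolding F_def by measurable
  have Fp: "periodic F"
    using periodic_shift[of p t] p e by (simp add: F_def periodic_L2_def periodic_def)
  have Fi: "integrable circ F"
    unfolding F_def using p
    by (intro sq_integrable_mult sq_integrable_circ_shift sq_integrable_circ_smooth[OF e(1)]) (simp_all add: periodic_L2_def)
  have "l2_inner (dalembert \<epsilon> p t) e = (\<integral>x. F x + F (- x) \<partial>\<mu>I)"
    unfolding l2_inner_def dalembert_def
    by (intro Bochner_Integration.integral_cong) (auto simp: F_def \<epsilon> algebra_simps)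
  also have "\<dots> = (\<integral>x. F x \<partial>circ)"
    by (rule integral_circ_fold[symmetric, OF Fm Fi])
  also have "\<dots> = (\<integral>x. F (x + (- t)) \<partial>circ)"
    by (rule circ_shift(2)[symmetric, OF Fm Fp])
  finally show ?thesis by (simp add: F_def)
qed

text \<open>The addition theorem reproduces the oscillator solution: sine coefficients of the
  initial velocity rotate together with cosine coefficients of the initial slope. The result is
  matched with \<open>weak_solution_coefficient\<close>.\<close>

lemma dalembert_coefficient_sin:
  assumes p: "periodic_L2 p"
  shows "l2_inner (dalembert (-1) p t) (sinb k) =
     cos (real k * pi * t) * l2_inner (dalembert (-1) p 0) (sinb k)
      - sin (real k * pi * t) * l2_inner (dalembert 1 p 0) (cosb k)"
proof -
  have i: "integrable circ (\<lambda>y. p y * sinb k y)" "integrable circ (\<lambda>y. p y * cosb k y)"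
    using p by (auto intro!: sq_integrable_mult sq_integrable_circ_smooth smooth_sinb smooth_cosb simp: periodic_L2_def)
  have "l2_inner (dalembert (-1) p t) (sinb k) = (\<integral>y. p y * sinb k (y - t) \<partial>circ)"
    by (intro l2_inner_dalembert p smooth_sinb periodic_sinb) (simp add: sinb_minus)
  also have "\<dots> = (\<integral>y. cos (real k * pi * t) * (p y * sinb k y) - sin (real k * pi * t) * (p y * cosb k y) \<partial>circ)"
    by (intro Bochner_Integration.integral_cong) (auto simp: sinb_def cosb_def sin_diff right_diff_distrib)
  also have "\<dots> = cos (real k * pi * t) * (\<integral>y. p y * sinb k y \<partial>circ) - sin (real k * pi * t) * (\<integral>y. p y * cosb k y \<partial>circ)"
    using i by simp
  also have "(\<integral>y. p y * sinb k y \<partial>circ) = l2_inner (dalembert (-1) p 0) (sinb k)"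
    by (subst l2_inner_dalembert[OF p smooth_sinb periodic_sinb]) (simp_all add: sinb_minus)
  also have "(\<integral>y. p y * cosb k y \<partial>circ) = l2_inner (dalembert 1 p 0) (cosb k)"
    by (subst l2_inner_dalembert[OF p smooth_cosb periodic_cosb]) (simp_all add: cosb_minus)
  finally show ?thesis .
qed

lemma dalembert_coefficient_cos:
  assumes p: "periodic_L2 p"
  shows "l2_inner (dalembert 1 p t) (cosb k) =
     cos (real k * pi * t) * l2_inner (dalembert 1 p 0) (cosb k)
      + sin (real k * pi * t) * l2_inner (dalembert (-1) p 0) (sinb k)"
proof -
  have i: "integrable circ (\<lambda>y. p y * sinb k y)" "integrable circ (\<lambda>y. p y * cosb k y)"
    using p by (auto intro!: sq_integrable_mult sq_integrable_circ_smooth smooth_sinb smooth_cosb simp: periodic_L2_def)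
  have "l2_inner (dalembert 1 p t) (cosb k) = (\<integral>y. p y * cosb k (y - t) \<partial>circ)"
    by (intro l2_inner_dalembert p smooth_cosb periodic_cosb) (simp add: cosb_minus)
  also have "\<dots> = (\<integral>y. cos (real k * pi * t) * (p y * cosb k y) + sin (real k * pi * t) * (p y * sinb k y) \<partial>circ)"
    by (intro Bochner_Integration.integral_cong) (auto simp: sinb_def cosb_def cos_diff right_diff_distrib distrib_left)
  also have "\<dots> = cos (real k * pi * t) * (\<integral>y. p y * cosb k y \<partial>circ) + sin (real k * pi * t) * (\<integral>y. p y * sinb k y \<partial>circ)"
    using i by simp
  also have "(\<integral>y. p y * sinb k y \<partial>circ) = l2_inner (dalembert (-1) p 0) (sinb k)"
    by (subst l2_inner_dalembert[OF p smooth_sinb periodic_sinb]) (simp_all add: sinb_minus)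
  also have "(\<integral>y. p y * cosb k y \<partial>circ) = l2_inner (dalembert 1 p 0) (cosb k)"
    by (subst l2_inner_dalembert[OF p smooth_cosb periodic_cosb]) (simp_all add: cosb_minus)
  finally show ?thesis .
qed

lemma sq_integrable_\<mu>I_borel_version:
  assumes "sq_integrable \<mu>I f"
  obtains g where "g \<in> borel_measurable borel" "AE x in \<mu>I. g x = f x" "sq_integrable \<mu>I g"
proof -
  have "(\<lambda>x. if x \<in> unit_iv then f x else 0) \<in> borel_measurable lebesgue"
    using sq_integrable_measurable[OF assms] by (subst borel_measurable_if) simp_all
  then obtain g where g: "g \<in> borel_measurable lborel" "AE x in lborel. (if x \<in> unit_iv then f x else 0) = g x"
    using completion_ex_borel_measurable_real by blast
  have gb: "g \<in> borel_measurable borel" using g(1) by simp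
  have ae: "AE x in \<mu>I. g x = f x"
    unfolding AE_\<mu>I using g(2) by eventually_elim (auto split: if_splits)
  have "sq_integrable \<mu>I g"
    by (rule sq_integrable_cong_AE[OF assms borel_measurable_\<mu>I[OF gb]]) (use ae in auto)
  then show ?thesis using that gb ae by blast
qed

lemma dalembert_data_exists:
  assumes f: "sq_integrable \<mu>I f" and g: "sq_integrable \<mu>I g" and \<epsilon>: "\<epsilon> = 1 \<or> \<epsilon> = -1"
  obtains p where "periodic_L2 p" "AE x in \<mu>I. dalembert \<epsilon> p 0 x = g x" "AE x in \<mu>I. dalembert (- \<epsilon>) p 0 x = f x"
proof -
  obtain f' where f': "f' \<in> borel_measurable borel" "AE x in \<mu>I. f' x = f x" "sq_integrable \<mu>I f'"
    using sq_integrable_\<mu>I_borel_version[OF f] .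
  obtain g' where g': "g' \<in> borel_measurable borel" "AE x in \<mu>I. g' x = g x" "sq_integrable \<mu>I g'"
    using sq_integrable_\<mu>I_borel_version[OF g] .
  note [measurable] = f'(1) g'(1)
  \<comment> \<open>Solution of the two linear equations p(x) + \<epsilon> p(-x) = g(x) and p(x) -
    \<epsilon> p(-x) = f(x) for 0 < x < 1.\<close>
  define q where "q s = (if s \<ge> 0 then (g' s + f' s) / 2 else \<epsilon> * (g' (- s) - f' (- s)) / 2)" for s
  have qm [measurable]: "q \<in> borel_measurable borel" unfolding q_def by measurable
  define p where "p s = q (per s)" for s
  have pm [measurable]: "p \<in> borel_measurable borel" unfolding p_def by measurable
  have pp: "periodic p" unfolding p_def by (rule periodic_comp_per)
  have p1: "p x = (1/2) * (g' x + f' x)" and p2: "p (- x) = (\<epsilon>/2) * (g' x - f' x)" if "x \<in> unit_iv" for x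
    using that by (simp_all add: p_def q_def per_eq)
  have s1: "sq_integrable \<mu>I p"
  proof (rule sq_integrable_cong_AE)
    show "sq_integrable \<mu>I (\<lambda>x. (1/2) * (g' x + f' x))" by (intro sq_integrable_cmult sq_integrable_add f' g')
    show "AE x in \<mu>I. (1/2) * (g' x + f' x) = p x" by (rule AE_I2) (use p1 in auto)
  qed (intro borel_measurable_\<mu>I pm)
  have s2: "sq_integrable \<mu>I (\<lambda>x. p (- x))"
  proof (rule sq_integrable_cong_AE)
    show "sq_integrable \<mu>I (\<lambda>x. (\<epsilon>/2) * (g' x - f' x))" by (intro sq_integrable_cmult sq_integrable_diff f' g')
    show "AE x in \<mu>I. (\<epsilon>/2) * (g' x - f' x) = p (- x)" by (rule AE_I2) (use p2 in auto)
    show "(\<lambda>x. p (- x)) \<in> borel_measurable \<mu>I" by (rule borel_measurable_\<mu>I) measurable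
  qed
  have "periodic_L2 p" unfolding periodic_L2_def using pm pp s1 s2 by (simp add: sq_integrable_circ_fold)
  moreover have "AE x in \<mu>I. x \<in> unit_iv" by (rule AE_I2) simp
  then have "AE x in \<mu>I. dalembert \<epsilon> p 0 x = g x" "AE x in \<mu>I. dalembert (- \<epsilon>) p 0 x = f x"
  proof -
    assume u: "AE x in \<mu>I. x \<in> unit_iv"
    show "AE x in \<mu>I. dalembert \<epsilon> p 0 x = g x"
      using u g'(2)
    proof eventually_elim
      case (elim x)
      then show ?case using \<epsilon> p1[of x] p2[of x] by (auto simp: dalembert_def field_simps)
    qed
    show "AE x in \<mu>I. dalembert (- \<epsilon>) p 0 x = f x"
      using u f'(2)
    proof eventually_elim
      case (elim x)
      then show ?case using \<epsilon> p1[of x] p2[of x] by (auto simp: dalembert_def field_simps)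
    qed
  qed
  ultimately show ?thesis using that by blast
qed

lemma dalembert_energy:
  assumes p: "periodic_L2 p" and \<epsilon>: "\<epsilon> = 1 \<or> \<epsilon> = -1"
  shows "(l2_norm (dalembert (- \<epsilon>) p 0))\<^sup>2 + (l2_norm (dalembert \<epsilon> p 0))\<^sup>2 = 2 * (\<integral>x. (p x)\<^sup>2 \<partial>circ)"
proof -
  note [measurable] = periodic_L2_borel[OF p]
  have i: "integrable circ (\<lambda>x. (p x)\<^sup>2)" using p by (simp add: periodic_L2_def sq_integrable_def)
  have "(l2_norm (dalembert (- \<epsilon>) p 0))\<^sup>2 + (l2_norm (dalembert \<epsilon> p 0))\<^sup>2 =
     (\<integral>x. (dalembert (- \<epsilon>) p 0 x)\<^sup>2 + (dalembert \<epsilon> p 0 x)\<^sup>2 \<partial>\<mu>I)"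
    unfolding l2_norm_sq by (intro Bochner_Integration.integral_add[symmetric] sq_integrable_sq sq_integrable_dalembert p)
  \<comment> \<open>Parallelogram identity: the cross terms of opposite sign cancel.\<close>
  also have "\<dots> = (\<integral>x. 2 * ((p x)\<^sup>2 + (p (- x))\<^sup>2) \<partial>\<mu>I)"
    using \<epsilon> by (intro Bochner_Integration.integral_cong) (auto simp: dalembert_def power2_eq_square algebra_simps)
  also have "\<dots> = 2 * (\<integral>x. (p x)\<^sup>2 \<partial>circ)"
    by (simp only: integral_mult_right_zero integral_circ_fold[OF borel_measurable_power[OF periodic_L2_borel[OF p]] i])
  finally show ?thesis .
qed

lemma integral_circ_eq_l2_inner:
  assumes "periodic_L2 p" shows "(\<integral>x. p x \<partial>circ) = l2_inner (dalembert 1 p 0) (cosb 0)"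
  by (subst l2_inner_dalembert[OF assms smooth_cosb periodic_cosb]) (simp_all add: cosb_def)

text \<open>The sign \<open>\<epsilon>\<close> encodes the boundary condition: \<open>-1\<close> for Dirichlet, \<open>1\<close> for Neumann.\<close>

lemma weak_solution_dalembert:
  assumes "T > 0" and sol: "weak_wave_solution V T u0 u1 u v"
    and V: "V = H10 \<and> \<epsilon> = -1 \<or> V = H1 \<and> \<epsilon> = 1"
  obtains p where "periodic_L2 p" "\<epsilon> = -1 \<Longrightarrow> (\<integral>x. p x \<partial>circ) = 0"
    "(l2_norm (weak_deriv u0))\<^sup>2 + (l2_norm u1)\<^sup>2 = 2 * (\<integral>x. (p x)\<^sup>2 \<partial>circ)"
    "\<And>t. t \<in> {0..T} \<Longrightarrow> AE x in \<mu>I. v t x = dalembert \<epsilon> p t x"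
proof -
  have u0: "u0 \<in> V" and u1: "sq_integrable \<mu>I u1" and "\<forall>t\<in>{0..T}. sq_integrable \<mu>I (v t)"
    using sol unfolding weak_wave_solution_def L2_iff by simp_all
  then have sv: "sq_integrable \<mu>I (v t)" if "t \<in> {0..T}" for t
    using that by blast
  have VH: "V \<subseteq> H1" using V H10_subset_H1 by blast
  have du: "sq_integrable \<mu>I (weak_deriv u0)" using H1_weak_deriv(1) VH u0 by blast
  obtain p where p: "periodic_L2 p" and pu1: "AE x in \<mu>I. dalembert \<epsilon> p 0 x = u1 x"
    and pu0: "AE x in \<mu>I. dalembert (- \<epsilon>) p 0 x = weak_deriv u0 x"
    by (rule dalembert_data_exists[OF du u1, of \<epsilon>]) (use V in auto)
  have i1: "l2_inner (dalembert \<epsilon> p 0) e = l2_inner u1 e" if "smooth e" for e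
    by (rule l2_inner_cong_AE[OF sq_integrable_dalembert[OF p] u1 smooth_sq_integrable[OF that] pu1])
  have i0: "l2_inner (dalembert (- \<epsilon>) p 0) e = l2_inner (weak_deriv u0) e" if "smooth e" for e
    by (rule l2_inner_cong_AE[OF sq_integrable_dalembert[OF p] du smooth_sq_integrable[OF that] pu0])
  have "(l2_norm (weak_deriv u0))\<^sup>2 + (l2_norm u1)\<^sup>2 = (l2_norm (dalembert (- \<epsilon>) p 0))\<^sup>2 + (l2_norm (dalembert \<epsilon> p 0))\<^sup>2"
    using l2_norm_cong_AE[OF sq_integrable_measurable[OF sq_integrable_dalembert[OF p]] sq_integrable_measurable[OF u1] pu1]
      l2_norm_cong_AE[OF sq_integrable_measurable[OF sq_integrable_dalembert[OF p]] sq_integrable_measurable[OF du] pu0]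
    by simp
  also have "\<dots> = 2 * (\<integral>x. (p x)\<^sup>2 \<partial>circ)" using V by (intro dalembert_energy p) auto
  finally have energy: "(l2_norm (weak_deriv u0))\<^sup>2 + (l2_norm u1)\<^sup>2 = 2 * (\<integral>x. (p x)\<^sup>2 \<partial>circ)" .
  \<comment> \<open>The integral of \<open>p\<close> is the zeroth cosine coefficient of the initial
    slope, which vanishes in \<open>H10\<close>.\<close>
  have mean: "(\<integral>x. p x \<partial>circ) = 0" if "\<epsilon> = -1"
  proof -
    have "V = H10" using V that by auto
    then have "l2_inner (weak_deriv u0) (cosb 0) = 0" using H10_weak_deriv_cosb[of u0 0] u0 by simp
    then show ?thesis using i0[OF smooth_cosb, of 0] that integral_circ_eq_l2_inner[OF p] by simp
  qed
  have rep: "AE x in \<mu>I. v t x = dalembert \<epsilon> p t x" if t: "t \<in> {0..T}" for t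
  proof -
    have sd: "sq_integrable \<mu>I (\<lambda>x. v t x - dalembert \<epsilon> p t x)"
      by (intro sq_integrable_diff sv t sq_integrable_dalembert p)
    note int = sq_integrable_integrable[OF finite_measure_\<mu>I sd]
    \<comment> \<open>At a fixed time both functions have the same coefficients in the system
      adapted to the boundary condition, since both evolve by the oscillator formula from the same
      data.\<close>
    have "AE x in \<mu>I. v t x - dalembert \<epsilon> p t x = 0"
      using V
    proof
      assume V: "V = H10 \<and> \<epsilon> = -1"
      show ?thesis
      proof (rule sin_complete[OF int])
        fix k
        have "l2_inner (v t) (sinb k) = l2_inner u1 (sinb k) * cos (real k * pi * t) - real k * pi * l2_inner u0 (sinb k) * sin (real k * pi * t)"
          using V by (intro weak_solution_coefficient[OF \<open>T > 0\<close> VH sol _ _ t]) (auto intro: sinb_H10 H10_energy_sinb)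
        also have "\<dots> = l2_inner (dalembert \<epsilon> p t) (sinb k)"
          using dalembert_coefficient_sin[OF p, of t k] i1[OF smooth_sinb, of k] i0[OF smooth_cosb, of k] V
            H10_weak_deriv_cosb[of u0 k] u0 by (simp add: mult.commute)
        finally show "(\<integral>x. (v t x - dalembert \<epsilon> p t x) * sinb k x \<partial>\<mu>I) = 0"
          using l2_inner_diff[OF sv[OF t] sq_integrable_dalembert[OF p] smooth_sq_integrable[OF smooth_sinb], of \<epsilon> t k]
          by (simp add: l2_inner_def)
      qed
    next
      assume V: "V = H1 \<and> \<epsilon> = 1"
      show ?thesis
      proof (rule cos_complete[OF int])
        fix k
        have "l2_inner (v t) (cosb k) = l2_inner u1 (cosb k) * cos (real k * pi * t) - real k * pi * l2_inner u0 (cosb k) * sin (real k * pi * t)"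
          using V by (intro weak_solution_coefficient[OF \<open>T > 0\<close> VH sol _ _ t]) (auto intro: cosb_H1 H1_energy_cosb)
        also have "\<dots> = l2_inner (dalembert \<epsilon> p t) (cosb k)"
          using dalembert_coefficient_cos[OF p, of t k] i1[OF smooth_cosb, of k] i0[OF smooth_sinb, of k] V
            H1_weak_deriv_sinb[of u0 k] u0 by (simp add: mult.commute)
        finally show "(\<integral>x. (v t x - dalembert \<epsilon> p t x) * cosb k x \<partial>\<mu>I) = 0"
          using l2_inner_diff[OF sv[OF t] sq_integrable_dalembert[OF p] smooth_sq_integrable[OF smooth_cosb], of \<epsilon> t k]
          by (simp add: l2_inner_def)
      qed
    qed
    then show ?thesis by simp
  qed
  show ?thesis using that[OF p mean energy rep] by blast
qed

lemma dalembert_measurable [measurable]: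
  assumes [measurable]: "p \<in> borel_measurable borel"
  shows "(\<lambda>(t, x). dalembert \<epsilon> p t x) \<in> borel_measurable borel"
proof -
  have "(\<lambda>z. dalembert \<epsilon> p (fst z) (snd z)) \<in> borel_measurable (borel \<Otimes>\<^sub>M borel)"
    unfolding dalembert_def by measurable
  then show ?thesis by (simp add: borel_prod case_prod_beta')
qed

text \<open>Fubini's theorem only applies to Borel sets of the plane, hence the detour through a Borel subset.\<close>

lemma AE_slices_null:
  assumes N: "N \<in> sets (lebesgue :: (real \<times> real) measure)"
    and slice: "\<And>t. AE x in lborel. (t, x) \<notin> N"
  shows "N \<in> null_sets lebesgue"
proof -
  obtain B Z where BZ: "B \<in> sets borel" "negligible Z" "B \<union> Z = N"
    using sets_lebesgue_almost_borel[OF N] .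
  have [measurable]: "B \<in> sets (borel \<Otimes>\<^sub>M borel)" by (subst borel_prod) (rule BZ)
  have "emeasure lborel B = emeasure (lborel \<Otimes>\<^sub>M lborel) B" by (simp add: lborel_prod)
  also have "\<dots> = (\<integral>\<^sup>+t. \<integral>\<^sup>+x. indicator B (t, x) \<partial>lborel \<partial>lborel)"
    by (rule lborel.emeasure_pair_measure) simp
  also have "\<dots> = (\<integral>\<^sup>+t. 0 \<partial>(lborel :: real measure))"
  proof (intro nn_integral_cong)
    fix t :: real
    have "(\<integral>\<^sup>+x. indicator B (t, x) \<partial>lborel) = (\<integral>\<^sup>+x. 0 \<partial>(lborel :: real measure))"
      by (rule nn_integral_cong_AE, rule AE_mp[OF slice[of t]], rule AE_I2) (use BZ(3) in \<open>auto simp: indicator_def\<close>)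
    then show "(\<integral>\<^sup>+x. indicator B (t, x) \<partial>lborel) = 0" by simp
  qed
  finally have "B \<in> null_sets lborel" using BZ(1) by (auto simp: null_sets_def)
  then have "B \<in> null_sets lebesgue" by (rule null_sets_completionI)
  moreover have "Z \<in> null_sets lebesgue" using BZ(2) by (simp add: negligible_iff_null_sets)
  ultimately show ?thesis using BZ(3) by blast
qed

text \<open>The d'Alembert formula holds at each time off a null set that depends on the time. Joint
  measurability of \<open>v\<close> makes the exceptional set measurable in the plane, and all its
  slices are null.\<close>

lemma weak_solution_observation:
  assumes v: "(\<lambda>(t, x). v t x) \<in> borel_measurable (lebesgue_on ({0..T} \<times> unit_iv))"
    and rep: "\<And>t. t \<in> {0..T} \<Longrightarrow> AE x in \<mu>I. v t x = dalembert \<epsilon> p t x"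
    and p: "p \<in> borel_measurable borel"
    and G: "G \<in> sets lebesgue" "G \<subseteq> {0..T} \<times> unit_iv"
  shows "(\<integral>(t, x). (v t x)\<^sup>2 \<partial>lebesgue_on G) = (\<integral>(t, x). (dalembert \<epsilon> p t x)\<^sup>2 \<partial>lebesgue_on G)"
proof -
  let ?R = "{0..T} \<times> unit_iv"
  have Rb: "?R \<in> sets borel"
  proof -
    have "?R \<in> sets (borel \<Otimes>\<^sub>M borel)" by (intro pair_measureI) auto
    then show ?thesis by (simp only: borel_prod)
  qed
  then have R: "?R \<in> sets lebesgue" by simp
  note dm = dalembert_measurable[OF p, of \<epsilon>]
  have dmR: "(\<lambda>(t, x). dalembert \<epsilon> p t x) \<in> borel_measurable (lebesgue_on S)" for S
    by (intro measurable_restrict_space1 measurable_completion) (use dm in simp)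
  define N where "N = {z \<in> ?R. v (fst z) (snd z) \<noteq> dalembert \<epsilon> p (fst z) (snd z)}"
  have "(\<lambda>z. v (fst z) (snd z) - dalembert \<epsilon> p (fst z) (snd z)) \<in> borel_measurable (lebesgue_on ?R)"
    using v dmR[of ?R] by (intro borel_measurable_diff) (simp_all add: case_prod_beta')
  from measurable_sets[OF this, of "- {0}"] have "N \<in> sets (lebesgue_on ?R)"
    by (auto simp: N_def vimage_def Int_def conj_commute)
  then have N: "N \<in> sets lebesgue" using R by (simp add: sets_restrict_space_iff)
  have "N \<in> null_sets lebesgue"
  proof (rule AE_slices_null[OF N])
    fix t :: real
    show "AE x in lborel. (t, x) \<notin> N"
    proof (cases "t \<in> {0..T}")
      case True
      from rep[OF this] show ?thesis
        unfolding AE_\<mu>I by (rule AE_mp) (auto simp: N_def)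
    next
      case False
      then show ?thesis by (auto simp: N_def)
    qed
  qed
  then have "AE z in lebesgue. z \<notin> N" by (rule AE_not_in)
  then have ae: "AE z in lebesgue_on G. v (fst z) (snd z) = dalembert \<epsilon> p (fst z) (snd z)"
    using G by (subst AE_restrict_space_iff) (auto simp: N_def elim!: eventually_mono)
  have vG: "(\<lambda>z. v (fst z) (snd z)) \<in> borel_measurable (lebesgue_on G)"
    using measurable_restrict_mono[OF v G(2)] by (simp add: case_prod_beta')
  show ?thesis
    unfolding case_prod_beta'
  proof (rule integral_cong_AE)
    show "(\<lambda>z. (v (fst z) (snd z))\<^sup>2) \<in> borel_measurable (lebesgue_on G)"
      by (intro borel_measurable_power vG)
    show "(\<lambda>z. (dalembert \<epsilon> p (fst z) (snd z))\<^sup>2) \<in> borel_measurable (lebesgue_on G)"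
      using dmR[of G] by (intro borel_measurable_power) (simp add: case_prod_beta')
    show "AE z in lebesgue_on G. (v (fst z) (snd z))\<^sup>2 = (dalembert \<epsilon> p (fst z) (snd z))\<^sup>2"
      using ae by eventually_elim simp
  qed
qed

section \<open>Trigonometric solutions\<close>

text \<open>The squared norm is a quadratic form in the finitely many coefficients, whose constants
  are the entries of the Gram matrix.\<close>

lemma l2_norm_sum_tendsto_0:
  assumes e: "\<And>k. smooth (e k)" and c: "\<And>k. k < N \<Longrightarrow> (c k \<longlongrightarrow> 0) F"
  shows "((\<lambda>s. l2_norm (\<lambda>x. \<Sum>k<N. c k s * e k x)) \<longlongrightarrow> 0) F"
proof -
  have "l2_norm (\<lambda>x. \<Sum>k<N. c k s * e k x) = sqrt (\<Sum>j<N. \<Sum>k<N. c j s * (c k s * l2_inner (e j) (e k)))" for s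
  proof -
    have "(\<integral>x. (\<Sum>k<N. c k s * e k x)\<^sup>2 \<partial>\<mu>I) = (\<integral>x. (\<Sum>j<N. \<Sum>k<N. c j s * (c k s * (e j x * e k x))) \<partial>\<mu>I)"
      by (intro Bochner_Integration.integral_cong) (auto simp: power2_eq_square sum_product algebra_simps)
    also have "\<dots> = (\<Sum>j<N. \<Sum>k<N. \<integral>x. c j s * (c k s * (e j x * e k x)) \<partial>\<mu>I)"
    proof -
      have i: "integrable \<mu>I (\<lambda>x. c j s * (c k s * (e j x * e k x)))" for j k
        by (intro integrable_mult_right sq_integrable_mult smooth_sq_integrable e)
      show ?thesis
        using i by (simp only: Bochner_Integration.integral_sum Bochner_Integration.integrable_sum)
    qed
    finally show ?thesis by (simp add: l2_norm_def l2_inner_def)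
  qed
  moreover have "((\<lambda>s. sqrt (\<Sum>j<N. \<Sum>k<N. c j s * (c k s * l2_inner (e j) (e k)))) \<longlongrightarrow>
      sqrt (\<Sum>j<N. \<Sum>k<N. 0 * (0 * l2_inner (e j) (e k)))) F"
    by (intro tendsto_intros c) auto
  ultimately show ?thesis by simp
qed

lemma deriv_sum_smooth:
  assumes "\<And>k. smooth (e k)"
  shows "deriv (\<lambda>x. \<Sum>k<N. c k * e k x) = (\<lambda>x. \<Sum>k<(N::nat). c k * deriv (e k) x)"
  by (intro deriv_eqI DERIV_sum DERIV_cmult smooth_has_deriv assms)

lemma smooth_lincomb: "(\<And>k. smooth (e k)) \<Longrightarrow> smooth (\<lambda>x. \<Sum>k\<in>A. c k * e k x)"
  by (intro smooth_sum smooth_cmult)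

lemma h1_norm_sum_tendsto_0:
  assumes e: "\<And>k. smooth (e k)" and c: "\<And>k. k < N \<Longrightarrow> (c k \<longlongrightarrow> 0) F"
  shows "((\<lambda>s. h1_norm (\<lambda>x. \<Sum>k<(N::nat). c k s * e k x)) \<longlongrightarrow> 0) F"
proof -
  have "h1_norm (\<lambda>x. \<Sum>k<N. c k s * e k x) =
    sqrt ((l2_norm (\<lambda>x. \<Sum>k<N. c k s * e k x))\<^sup>2 + (l2_norm (\<lambda>x. \<Sum>k<N. c k s * deriv (e k) x))\<^sup>2)" for s
    unfolding h1_norm_smooth[OF smooth_lincomb[OF e]] deriv_sum_smooth[OF e] by (simp add: l2_norm_sq)
  moreover have "((\<lambda>s. sqrt ((l2_norm (\<lambda>x. \<Sum>k<N. c k s * e k x))\<^sup>2 + (l2_norm (\<lambda>x. \<Sum>k<N. c k s * deriv (e k) x))\<^sup>2))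
     \<longlongrightarrow> sqrt (0\<^sup>2 + 0\<^sup>2)) F"
    by (intro tendsto_intros l2_norm_sum_tendsto_0 e smooth_deriv c)
  ultimately show ?thesis by simp
qed

text \<open>With finitely many modes, continuity and differentiability of the curves in both norms
  reduce to those of the scalar coefficients.\<close>

lemma modal_sum_weak_solution:
  fixes e :: "nat \<Rightarrow> real \<Rightarrow> real" and N :: nat
  assumes "T > 0" and V: "V \<subseteq> H1" and e: "\<And>k. smooth (e k)" and eV: "\<And>c. (\<lambda>x. \<Sum>k<N. c k * e k x) \<in> V"
    and eig: "\<And>\<psi> k. \<psi> \<in> V \<Longrightarrow> l2_inner (weak_deriv \<psi>) (weak_deriv (e k)) = (\<omega> k)\<^sup>2 * l2_inner \<psi> (e k)"
    and g: "\<And>k t. (g k has_real_derivative g' k t) (at t)"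
    and g': "\<And>k t. (g' k has_real_derivative - ((\<omega> k)\<^sup>2 * g k t)) (at t)"
    and u: "\<And>t x. u t x = (\<Sum>k<N. g k t * e k x)" and v: "\<And>t x. v t x = (\<Sum>k<N. g' k t * e k x)"
  shows "weak_wave_solution V T (u 0) (v 0) u v"
proof -
  have uf: "u t = (\<lambda>x. \<Sum>k<N. g k t * e k x)" and vf: "v t = (\<lambda>x. \<Sum>k<N. g' k t * e k x)" for t
    by (auto simp: u v)
  have uV: "u t \<in> V" for t unfolding uf by (rule eV)
  have vL: "v t \<in> L2" for t
    unfolding vf L2_iff by (intro smooth_sq_integrable smooth_lincomb e)
  have gc: "isCont (g k) t" "isCont (g' k) t" for k t
    using g g' DERIV_isCont by blast+
  have 1: "continuous_curve h1_norm T u"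
    unfolding continuous_curve_def
  proof
    fix t
    have "(\<lambda>x. u s x - u t x) = (\<lambda>x. \<Sum>k<N. (g k s - g k t) * e k x)" for s
      by (simp add: u left_diff_distrib sum_subtractf)
    moreover have "((\<lambda>s. h1_norm (\<lambda>x. \<Sum>k<N. (g k s - g k t) * e k x)) \<longlongrightarrow> 0) (at t within {0..T})"
      by (intro h1_norm_sum_tendsto_0 e LIM_zero)
        (use gc(1) in \<open>auto simp: isCont_def intro: tendsto_within_subset\<close>)
    ultimately show "((\<lambda>s. h1_norm (\<lambda>x. u s x - u t x)) \<longlongrightarrow> 0) (at t within {0..T})" by simp
  qed
  have 2: "continuous_curve l2_norm T v"
    unfolding continuous_curve_def
  proof
    fix t
    have "(\<lambda>x. v s x - v t x) = (\<lambda>x. \<Sum>k<N. (g' k s - g' k t) * e k x)" for s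
      by (simp add: v left_diff_distrib sum_subtractf)
    moreover have "((\<lambda>s. l2_norm (\<lambda>x. \<Sum>k<N. (g' k s - g' k t) * e k x)) \<longlongrightarrow> 0) (at t within {0..T})"
      by (intro l2_norm_sum_tendsto_0 e LIM_zero)
        (use gc(2) in \<open>auto simp: isCont_def intro: tendsto_within_subset\<close>)
    ultimately show "((\<lambda>s. l2_norm (\<lambda>x. v s x - v t x)) \<longlongrightarrow> 0) (at t within {0..T})" by simp
  qed
  have 3: "l2_curve_deriv T u v"
    unfolding l2_curve_deriv_def
  proof
    fix t
    have "(\<lambda>x. (u s x - u t x) / (s - t) - v t x) = (\<lambda>x. \<Sum>k<N. ((g k s - g k t) / (s - t) - g' k t) * e k x)" for s
      by (simp add: u v left_diff_distrib sum_subtractf diff_divide_distrib sum_divide_distrib)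
    moreover have "((\<lambda>s. l2_norm (\<lambda>x. \<Sum>k<N. ((g k s - g k t) / (s - t) - g' k t) * e k x)) \<longlongrightarrow> 0) (at t within {0..T})"
    proof (intro l2_norm_sum_tendsto_0 e LIM_zero)
      fix k
      show "((\<lambda>s. (g k s - g k t) / (s - t)) \<longlongrightarrow> g' k t) (at t within {0..T})"
        using has_field_derivative_at_within[OF g[of k t]] by (simp add: has_field_derivative_iff)
    qed
    ultimately show "((\<lambda>s. l2_norm (\<lambda>x. (u s x - u t x) / (s - t) - v t x)) \<longlongrightarrow> 0) (at t within {0..T})"
      by simp
  qed
  have 4: "(\<lambda>(t, x). v t x) \<in> borel_measurable (lebesgue_on ({0..T} \<times> unit_iv))"
  proof -
    have gm [measurable]: "g' k \<in> borel_measurable borel" for k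
      using gc(2) by (intro borel_measurable_continuous_onI continuous_at_imp_continuous_on) auto
    have em [measurable]: "e k \<in> borel_measurable borel" for k
      by (rule smooth_borel[OF e])
    have "(\<lambda>z. v (fst z) (snd z)) \<in> borel_measurable (borel \<Otimes>\<^sub>M borel)"
      unfolding v by measurable
    then have "(\<lambda>(t, x). v t x) \<in> borel_measurable lborel" by (simp add: borel_prod case_prod_beta')
    then show ?thesis by (intro measurable_restrict_space1 measurable_completion)
  qed
  have 5: "(\<integral>t. - l2_inner (v t) \<psi> * deriv \<theta> t
                   + l2_inner (weak_deriv (u t)) (weak_deriv \<psi>) * \<theta> t \<partial>lebesgue_on {0..T}) = 0"
    if \<psi>: "\<psi> \<in> V" and \<theta>: "\<theta> \<in> test_functions {0<..<T}" for \<psi> \<theta>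
  proof -
    define q where "q k = l2_inner (e k) \<psi>" for k
    have sp: "sq_integrable \<mu>I \<psi>" "sq_integrable \<mu>I (weak_deriv \<psi>)"
      using H1_weak_deriv[OF subsetD[OF V \<psi>]] by auto
    have st: "smooth \<theta>" by (rule test_functions_smooth[OF \<theta>])
    have a: "l2_inner (v t) \<psi> = (\<Sum>k<N. g' k t * q k)" for t
      unfolding vf q_def using l2_inner_sum[of "{..<N}" "\<lambda>k x. g' k t * e k x" \<psi>] sp
      by (simp add: sq_integrable_cmult smooth_sq_integrable e l2_inner_cmult)
    have b: "l2_inner (weak_deriv (u t)) (weak_deriv \<psi>) = (\<Sum>k<N. g k t * ((\<omega> k)\<^sup>2 * q k))" for t
    proof -
      have "l2_inner (weak_deriv (u t)) (weak_deriv \<psi>) = l2_inner (deriv (u t)) (weak_deriv \<psi>)"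
        unfolding uf by (intro l2_inner_weak_deriv_smooth smooth_lincomb e sp)
      also have "\<dots> = (\<Sum>k<N. g k t * l2_inner (deriv (e k)) (weak_deriv \<psi>))"
        unfolding uf deriv_sum_smooth[OF e]
        using l2_inner_sum[of "{..<N}" "\<lambda>k x. g k t * deriv (e k) x" "weak_deriv \<psi>"] sp
        by (simp add: sq_integrable_cmult smooth_sq_integrable smooth_deriv e l2_inner_cmult)
      also have "\<dots> = (\<Sum>k<N. g k t * ((\<omega> k)\<^sup>2 * q k))"
      proof (intro sum.cong refl)
        fix k
        have "l2_inner (deriv (e k)) (weak_deriv \<psi>) = l2_inner (weak_deriv \<psi>) (weak_deriv (e k))"
          using l2_inner_weak_deriv_smooth[OF e[of k] sp(2)] by (simp add: l2_inner_commute[of "weak_deriv \<psi>"])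
        then show "g k t * l2_inner (deriv (e k)) (weak_deriv \<psi>) = g k t * ((\<omega> k)\<^sup>2 * q k)"
          unfolding eig[OF \<psi>] q_def by (simp add: l2_inner_commute)
      qed
      finally show ?thesis .
    qed
    \<comment> \<open>The weak integrand is the derivative of minus the pairing of v and \<psi>
      times \<theta>, because the modal equation turns the second time derivative into the energy
      pairing; the compact support of \<theta> removes both endpoints.\<close>
    define H where "H t = - (\<Sum>k<N. q k * g' k t) * \<theta> t" for t
    define h where "h t = - l2_inner (v t) \<psi> * deriv \<theta> t + l2_inner (weak_deriv (u t)) (weak_deriv \<psi>) * \<theta> t" for t
    have hH: "(H has_real_derivative h t) (at t)" for t
      unfolding H_def h_def a b
      by (auto intro!: derivative_eq_intros g' smooth_has_deriv[OF st]
          simp: sum_negf sum_subtractf sum_distrib_left sum_distrib_right algebra_simps)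
    obtain \<alpha> \<beta> where \<alpha>: "0 < \<alpha>" "\<beta> < T" "\<And>x. x \<notin> {\<alpha>..\<beta>} \<Longrightarrow> \<theta> x = 0"
      by (rule test_functions_support[OF \<theta> \<open>T > 0\<close>]) auto
    have "(h has_integral H T - H 0) {0..T}"
      using \<open>T > 0\<close> hH
      by (intro fundamental_theorem_of_calculus)
        (auto simp flip: has_real_derivative_iff_has_vector_derivative intro: has_field_derivative_at_within)
    moreover have "H T = 0" "H 0 = 0" using \<alpha> by (auto simp: H_def)
    ultimately have "integral {0..T} h = 0" by (simp add: integral_unique)
    moreover have "continuous_on {0..T} h"
      unfolding h_def a b
      by (intro continuous_intros smooth_continuous_on st smooth_deriv continuous_at_imp_continuous_on) (use gc in auto)
    then have "integrable (lebesgue_on {0..T}) h" by (rule continuous_imp_integrable_real)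
    then have "(\<integral>t. h t \<partial>lebesgue_on {0..T}) = integral {0..T} h"
      by (rule lebesgue_integral_eq_integral) simp
    ultimately show ?thesis by (simp add: h_def)
  qed
  show ?thesis
    unfolding weak_wave_solution_def using uV vL 1 2 3 4 5 by simp
qed

section \<open>Solutions with a prescribed trigonometric profile\<close>

definition trig :: "nat \<Rightarrow> (nat \<Rightarrow> real) \<Rightarrow> (nat \<Rightarrow> real) \<Rightarrow> real \<Rightarrow> real"
  where "trig N \<alpha> \<beta> y = (\<Sum>k<N. \<alpha> k * cosb k y + \<beta> k * sinb k y)"

lemma smooth_trig: "smooth (trig N \<alpha> \<beta>)"
  unfolding trig_def[abs_def] by (intro smooth_sum smooth_add smooth_cmult smooth_cosb smooth_sinb)

lemma periodic_trig: "periodic (trig N \<alpha> \<beta>)"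
  using periodic_cosb periodic_sinb by (simp add: periodic_def trig_def)

lemma periodic_L2_trig: "periodic_L2 (trig N \<alpha> \<beta>)"
  by (simp add: periodic_L2_def periodic_trig smooth_borel smooth_trig sq_integrable_circ_smooth)

text \<open>A primitive in time of the modal velocity, with the constant of integration chosen so
  that it solves the oscillator equation itself; the mode k = 0 grows linearly instead.\<close>

definition osc :: "nat \<Rightarrow> real \<Rightarrow> real \<Rightarrow> real \<Rightarrow> real"
  where "osc k a b t = (if k = 0 then 2 * a * t
     else 2 * (a * sin (real k * pi * t) - b * cos (real k * pi * t)) / (real k * pi))"

lemma osc_has_deriv:
  "(osc k a b has_real_derivative 2 * (a * cos (real k * pi * t) + b * sin (real k * pi * t))) (at t)"
  unfolding osc_def[abs_def]
  by (cases "k = 0") (auto intro!: derivative_eq_intros simp: field_simps)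

lemma osc_has_deriv2:
  "((\<lambda>t. 2 * (a * cos (real k * pi * t) + b * sin (real k * pi * t))) has_real_derivative
     - ((real k * pi)\<^sup>2 * osc k a b t)) (at t)"
  unfolding osc_def
  by (cases "k = 0") (auto intro!: derivative_eq_intros simp: field_simps power2_eq_square)

lemma trig_weak_solution_Dirichlet:
  assumes "T > 0" "\<alpha> 0 = 0"
  obtains u0 u1 u v where "weak_wave_solution H10 T u0 u1 u v"
    "(l2_norm (weak_deriv u0))\<^sup>2 + (l2_norm u1)\<^sup>2 = 2 * (\<integral>x. (trig N \<alpha> \<beta> x)\<^sup>2 \<partial>circ)"
    "v = dalembert (-1) (trig N \<alpha> \<beta>)"
proof -
  \<comment> \<open>The coefficients \<beta> and -\<alpha> come from the addition theorems applied
    to p(t + x) - p(t - x), in which only sines of x survive.\<close>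
  define u where "u t x = (\<Sum>k<N. osc k (\<beta> k) (- \<alpha> k) t * sinb k x)" for t x
  define v where "v t x = (\<Sum>k<N. 2 * (\<beta> k * cos (real k * pi * t) + (- \<alpha> k) * sin (real k * pi * t)) * sinb k x)" for t x
  have sol: "weak_wave_solution H10 T (u 0) (v 0) u v"
  proof (rule modal_sum_weak_solution[OF \<open>T > 0\<close> _ _ _ _ osc_has_deriv osc_has_deriv2 u_def v_def])
    show "H10 \<subseteq> H1" using H10_subset_H1 by blast
    show "(\<lambda>x. \<Sum>k<N. c k * sinb k x) \<in> H10" for c
      by (intro smooth_in_H10 smooth_lincomb smooth_sinb) (simp_all add: sinb_boundary)
  qed (auto intro: smooth_sinb H10_energy_sinb)
  have vd: "v = dalembert (-1) (trig N \<alpha> \<beta>)"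
    by (auto simp: fun_eq_iff v_def dalembert_def trig_def cosb_def sinb_def sum_subtractf[symmetric]
        sin_add sin_diff cos_add cos_diff algebra_simps intro!: sum.cong)
  have "deriv (u 0) x = dalembert 1 (trig N \<alpha> \<beta>) 0 x" for x
  proof -
    have "deriv (u 0) x = (\<Sum>k<N. osc k (\<beta> k) (- \<alpha> k) 0 * (real k * pi * cosb k x))"
      unfolding u_def[abs_def] deriv_sum_smooth[OF smooth_sinb] deriv_sinb ..
    \<comment> \<open>On the left the constant mode carries the factor k = 0, so this is where
      \<open>\<alpha> 0 = 0\<close> enters.\<close>
    also have "\<dots> = (\<Sum>k<N. 2 * (\<alpha> k * cosb k x))"
      using assms(2) by (intro sum.cong) (auto simp: osc_def)
    also have "\<dots> = dalembert 1 (trig N \<alpha> \<beta>) 0 x"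
      by (simp add: dalembert_def trig_def cosb_minus sinb_minus flip: sum.distrib)
    finally show ?thesis .
  qed
  then have du: "deriv (u 0) = dalembert 1 (trig N \<alpha> \<beta>) 0" by blast
  have su: "smooth (u 0)" unfolding u_def[abs_def] by (intro smooth_lincomb smooth_sinb)
  have "l2_norm (weak_deriv (u 0)) = l2_norm (dalembert 1 (trig N \<alpha> \<beta>) 0)"
    unfolding du[symmetric]
    by (rule l2_norm_cong_AE[OF sq_integrable_measurable[OF H1_weak_deriv(1)[OF smooth_weak_deriv(1)[OF su]]]
          sq_integrable_measurable[OF smooth_sq_integrable[OF smooth_deriv[OF su]]] smooth_weak_deriv(2)[OF su]])
  then have "(l2_norm (weak_deriv (u 0)))\<^sup>2 + (l2_norm (v 0))\<^sup>2 = 2 * (\<integral>x. (trig N \<alpha> \<beta> x)\<^sup>2 \<partial>circ)"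
    using dalembert_energy[OF periodic_L2_trig, of "-1" N \<alpha> \<beta>] by (simp add: vd)
  then show ?thesis using that sol vd by blast
qed

lemma trig_weak_solution_Neumann:
  assumes "T > 0"
  obtains u0 u1 u v where "weak_wave_solution H1 T u0 u1 u v"
    "(l2_norm (weak_deriv u0))\<^sup>2 + (l2_norm u1)\<^sup>2 = 2 * (\<integral>x. (trig N \<alpha> \<beta> x)\<^sup>2 \<partial>circ)"
    "v = dalembert 1 (trig N \<alpha> \<beta>)"
proof -
  define u where "u t x = (\<Sum>k<N. osc k (\<alpha> k) (\<beta> k) t * cosb k x)" for t x
  define v where "v t x = (\<Sum>k<N. 2 * (\<alpha> k * cos (real k * pi * t) + \<beta> k * sin (real k * pi * t)) * cosb k x)" for t x
  have sol: "weak_wave_solution H1 T (u 0) (v 0) u v"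
  proof (rule modal_sum_weak_solution[OF \<open>T > 0\<close> _ _ _ _ osc_has_deriv osc_has_deriv2 u_def v_def])
    show "(\<lambda>x. \<Sum>k<N. c k * cosb k x) \<in> H1" for c
      by (intro smooth_weak_deriv smooth_lincomb smooth_cosb)
  qed (auto intro: smooth_cosb H1_energy_cosb)
  have vd: "v = dalembert 1 (trig N \<alpha> \<beta>)"
    by (auto simp: fun_eq_iff v_def dalembert_def trig_def cosb_def sinb_def sum.distrib[symmetric]
        sin_add sin_diff cos_add cos_diff algebra_simps intro!: sum.cong)
  have "deriv (u 0) x = dalembert (-1) (trig N \<alpha> \<beta>) 0 x" for x
  proof -
    have "deriv (u 0) x = (\<Sum>k<N. osc k (\<alpha> k) (\<beta> k) 0 * (- (real k * pi) * sinb k x))"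
      unfolding u_def[abs_def] deriv_sum_smooth[OF smooth_cosb] deriv_cosb ..
    also have "\<dots> = (\<Sum>k<N. 2 * (\<beta> k * sinb k x))"
      by (intro sum.cong) (auto simp: osc_def sinb_def)
    also have "\<dots> = dalembert (-1) (trig N \<alpha> \<beta>) 0 x"
      by (simp add: dalembert_def trig_def cosb_minus sinb_minus flip: sum_subtractf)
    finally show ?thesis .
  qed
  then have du: "deriv (u 0) = dalembert (-1) (trig N \<alpha> \<beta>) 0" by blast
  have su: "smooth (u 0)" unfolding u_def[abs_def] by (intro smooth_lincomb smooth_cosb)
  have "l2_norm (weak_deriv (u 0)) = l2_norm (dalembert (-1) (trig N \<alpha> \<beta>) 0)"
    unfolding du[symmetric]
    by (rule l2_norm_cong_AE[OF sq_integrable_measurable[OF H1_weak_deriv(1)[OF smooth_weak_deriv(1)[OF su]]]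
          sq_integrable_measurable[OF smooth_sq_integrable[OF smooth_deriv[OF su]]] smooth_weak_deriv(2)[OF su]])
  then have "(l2_norm (weak_deriv (u 0)))\<^sup>2 + (l2_norm (v 0))\<^sup>2 = 2 * (\<integral>x. (trig N \<alpha> \<beta> x)\<^sup>2 \<partial>circ)"
    using dalembert_energy[OF periodic_L2_trig, of 1 N \<alpha> \<beta>] by (simp add: vd)
  then show ?thesis using that sol vd by blast
qed

section \<open>Density of trigonometric profiles\<close>

lemma integral_cosb: "(\<integral>x. cosb k x \<partial>\<mu>I) = (if k = 0 then 1 else 0)"
proof (cases "k = 0")
  case True
  then show ?thesis by (simp add: cosb_def measure_restrict_space)
next
  case False
  have "deriv (\<lambda>x. sinb k x * inverse (real k * pi)) = cosb k"
    using False by (intro deriv_eqI) (auto simp: sinb_def cosb_def field_simps intro!: derivative_eq_intros)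
  moreover have "smooth (\<lambda>x. sinb k x * inverse (real k * pi))"
    by (intro smooth_mult smooth_sinb smooth_const)
  ultimately show ?thesis using integral_deriv_smooth[of "\<lambda>x. sinb k x * inverse (real k * pi)"] sinb_boundary False by simp
qed

lemma integral_trig: "(\<integral>x. trig N \<alpha> \<beta> x \<partial>circ) = (if N = 0 then 0 else 2 * \<alpha> 0)"
proof -
  have "(\<integral>x. trig N \<alpha> \<beta> x \<partial>circ) = (\<integral>x. trig N \<alpha> \<beta> x + trig N \<alpha> \<beta> (- x) \<partial>\<mu>I)"
    by (intro integral_circ_fold smooth_borel smooth_trig sq_integrable_integrable[OF finite_measure_circ]
        sq_integrable_circ_smooth)
  also have "\<dots> = (\<integral>x. (\<Sum>k<N. 2 * \<alpha> k * cosb k x) \<partial>\<mu>I)"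
    by (intro Bochner_Integration.integral_cong) (simp_all add: trig_def cosb_minus sinb_minus mult.assoc flip: sum.distrib)
  also have "\<dots> = (\<Sum>k<N. 2 * \<alpha> k * (\<integral>x. cosb k x \<partial>\<mu>I))"
    by (subst Bochner_Integration.integral_sum)
      (auto intro!: integrable_mult_right sq_integrable_integrable[OF finite_measure_\<mu>I] smooth_sq_integrable smooth_cosb)
  also have "\<dots> = (\<Sum>k<N. if k = 0 then 2 * \<alpha> 0 else 0)"
    by (intro sum.cong) (auto simp: integral_cosb)
  also have "\<dots> = (if N = 0 then 0 else 2 * \<alpha> 0)" by simp
  finally show ?thesis .
qed

lemma integral_const_circ: "(\<integral>x. c \<partial>circ) = 2 * (c :: real)"
  by (simp add: circ_def measure_restrict_space space_restrict_space)

lemma periodic_L2_bounded: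
  assumes "p \<in> borel_measurable borel" "periodic p" "\<And>x. \<bar>p x\<bar> \<le> B"
  shows "periodic_L2 p"
  using assms sq_integrable_bounded[OF finite_measure_circ circ_measurable[OF assms(1)], of B]
  by (simp add: periodic_L2_def)

text \<open>Even and odd parts are approximated separately, by cosines and by sines, and folding
  adds the two squared errors with factor 2. If \<open>p\<close> has mean zero, deleting the
  constant term changes the squared error by -2 (a 0)^2 and so does not worsen it.\<close>

lemma trig_L2_dense:
  assumes p [measurable]: "p \<in> borel_measurable borel" and per: "periodic p" and B: "\<And>x. \<bar>p x\<bar> \<le> B" and "e > 0"
  obtains N \<alpha> \<beta> where "(\<integral>x. (p x - trig N \<alpha> \<beta> x)\<^sup>2 \<partial>circ) < e" "(\<integral>x. p x \<partial>circ) = 0 \<Longrightarrow> \<alpha> 0 = 0"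
proof -
  have m: "(\<lambda>x. p x) \<in> borel_measurable \<mu>I" "(\<lambda>x. p (- x)) \<in> borel_measurable \<mu>I"
    by (rule borel_measurable_\<mu>I, measurable)+
  define Ev Od where "Ev x = (p x + p (- x)) / 2" and "Od x = (p x - p (- x)) / 2" for x
  have EO: "Ev \<in> borel_measurable \<mu>I" "Od \<in> borel_measurable \<mu>I"
    unfolding Ev_def Od_def using m by measurable
  have b: "\<bar>Ev x\<bar> \<le> B" "\<bar>Od x\<bar> \<le> B" for x using B[of x] B[of "- x"] by (auto simp: Ev_def Od_def)
  obtain q1 where q1: "q1 \<in> span_of cosb" "(\<integral>x. (Ev x - q1 x)\<^sup>2 \<partial>\<mu>I) < e / 4"
    using cos_span_L2_dense[OF EO(1) b(1), of "e / 4"] \<open>e > 0\<close> by auto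
  obtain q2 where q2: "q2 \<in> span_of sinb" "(\<integral>x. (Od x - q2 x)\<^sup>2 \<partial>\<mu>I) < e / 4"
    using sin_span_L2_dense[OF EO(2) b(2), of "e / 4"] \<open>e > 0\<close> by auto
  obtain N1 a where N1: "\<forall>M\<ge>N1. \<forall>x. q1 x = (\<Sum>k<M. a k * cosb k x)" using span_of_sum_form[OF q1(1)] by blast
  obtain N2 c where N2: "\<forall>M\<ge>N2. \<forall>x. q2 x = (\<Sum>k<M. c k * sinb k x)" using span_of_sum_form[OF q2(1)] by blast
  define N where "N = Suc (max N1 N2)"
  have q: "q1 x = (\<Sum>k<N. a k * cosb k x)" "q2 x = (\<Sum>k<N. c k * sinb k x)" for x
    using N1[rule_format, of N x] N2[rule_format, of N x] by (auto simp: N_def)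
  define r where "r = trig N a c"
  have r: "r x = q1 x + q2 x" for x by (simp add: r_def trig_def q sum.distrib)
  have rr: "r (- x) = q1 x - q2 x" for x
    by (simp add: r_def trig_def q cosb_minus sinb_minus sum_subtractf)
  have sp: "sq_integrable circ p" using periodic_L2_bounded[OF p per B] by (simp add: periodic_L2_def)
  have sr: "sq_integrable circ r" using periodic_L2_trig by (simp add: periodic_L2_def r_def)
  have spr: "sq_integrable circ (\<lambda>x. p x - r x)" by (rule sq_integrable_diff[OF sp sr])
  have rm: "r \<in> borel_measurable borel" unfolding r_def by (rule smooth_borel[OF smooth_trig])
  have s1: "sq_integrable \<mu>I (\<lambda>x. Ev x - q1 x)"
    by (intro sq_integrable_diff sq_integrable_bounded[OF finite_measure_\<mu>I EO(1), of B]
        smooth_sq_integrable[OF span_of_smooth[OF q1(1) smooth_cosb]]) (use b in auto)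
  have s2: "sq_integrable \<mu>I (\<lambda>x. Od x - q2 x)"
    by (intro sq_integrable_diff sq_integrable_bounded[OF finite_measure_\<mu>I EO(2), of B]
        smooth_sq_integrable[OF span_of_smooth[OF q2(1) smooth_sinb]]) (use b in auto)
  have "(\<integral>x. (p x - r x)\<^sup>2 \<partial>circ) = (\<integral>x. (p x - r x)\<^sup>2 + (p (- x) - r (- x))\<^sup>2 \<partial>\<mu>I)"
    using rm by (intro integral_circ_fold sq_integrable_sq spr) measurable
  also have "\<dots> = (\<integral>x. 2 * (Ev x - q1 x)\<^sup>2 + 2 * (Od x - q2 x)\<^sup>2 \<partial>\<mu>I)"
    unfolding rr unfolding r Ev_def Od_def
    by (intro Bochner_Integration.integral_cong) (auto simp: power2_eq_square field_simps)
  also have "\<dots> = 2 * (\<integral>x. (Ev x - q1 x)\<^sup>2 \<partial>\<mu>I) + 2 * (\<integral>x. (Od x - q2 x)\<^sup>2 \<partial>\<mu>I)"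
    using sq_integrable_sq[OF s1] sq_integrable_sq[OF s2] by simp
  also have "\<dots> < e" using q1(2) q2(2) by simp
  finally have lt: "(\<integral>x. (p x - r x)\<^sup>2 \<partial>circ) < e" .
  show ?thesis
  proof (cases "(\<integral>x. p x \<partial>circ) = 0")
    case False
    then show ?thesis using that lt by (auto simp: r_def)
  next
    case True
    define \<alpha> where "\<alpha> k = (if k = 0 then 0 else a k)" for k
    have t: "trig N \<alpha> c x = r x - a 0" for x
    proof -
      have "r x - trig N \<alpha> c x = (\<Sum>k<N. if k = 0 then a 0 else 0)"
        unfolding r_def trig_def sum_subtractf[symmetric] by (intro sum.cong) (auto simp: \<alpha>_def cosb_def)
      also have "\<dots> = a 0" by (simp add: N_def sum.delta' del: sum.lessThan_Suc)
      finally show ?thesis by simp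
    qed
    have i: "integrable circ (\<lambda>x. p x - r x)" "integrable circ p" "integrable circ r"
      by (intro sq_integrable_integrable[OF finite_measure_circ] spr sp sr)+
    have "(\<integral>x. p x - r x \<partial>circ) = - 2 * a 0"
      using i True integral_trig[of N a c] by (simp add: r_def N_def)
    moreover have "(\<integral>x. (p x - trig N \<alpha> c x)\<^sup>2 \<partial>circ) = (\<integral>x. (p x - r x)\<^sup>2 + 2 * a 0 * (p x - r x) + (a 0)\<^sup>2 \<partial>circ)"
      unfolding t by (intro Bochner_Integration.integral_cong) (auto simp: power2_eq_square algebra_simps)
    moreover have "\<dots> = (\<integral>x. (p x - r x)\<^sup>2 \<partial>circ) + 2 * a 0 * (\<integral>x. p x - r x \<partial>circ) + 2 * (a 0)\<^sup>2"
    proof -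
      have ic: "integrable circ (\<lambda>x. (a 0)\<^sup>2)" by (rule finite_measure.integrable_const[OF finite_measure_circ])
      have ip: "integrable circ (\<lambda>x. 2 * a 0 * (p x - r x))" using i(1) by (rule integrable_mult_right)
      have "(\<integral>x. (p x - r x)\<^sup>2 + 2 * a 0 * (p x - r x) + (a 0)\<^sup>2 \<partial>circ) =
         (\<integral>x. (p x - r x)\<^sup>2 \<partial>circ) + (\<integral>x. 2 * a 0 * (p x - r x) \<partial>circ) + (\<integral>x. (a 0)\<^sup>2 \<partial>circ)"
        using ic ip sq_integrable_sq[OF spr] by (simp only: Bochner_Integration.integral_add Bochner_Integration.integrable_add)
      then show ?thesis by (simp only: integral_mult_right_zero integral_const_circ)
    qed
    ultimately have "(\<integral>x. (p x - trig N \<alpha> c x)\<^sup>2 \<partial>circ) = (\<integral>x. (p x - r x)\<^sup>2 \<partial>circ) - 2 * (a 0)\<^sup>2"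
      by (simp add: power2_eq_square)
    then have "(\<integral>x. (p x - trig N \<alpha> c x)\<^sup>2 \<partial>circ) < e" using lt zero_le_power2[of "a 0"] by linarith
    then show ?thesis using that[of N \<alpha> c] by (simp add: \<alpha>_def)
  qed
qed

section \<open>Compactness of the cross term\<close>

lemma borel_pair_sets: "A \<in> sets borel \<Longrightarrow> A \<in> sets (borel \<Otimes>\<^sub>M (borel :: real measure))"
  for A :: "(real \<times> real) set"
  by (subst borel_prod)

lemma nn_integral_lborel_pair:
  assumes "F \<in> borel_measurable (borel :: (real \<times> real) measure)"
  shows "(\<integral>\<^sup>+z. F z \<partial>lborel) = (\<integral>\<^sup>+x. \<integral>\<^sup>+y. F (x, y) \<partial>lborel \<partial>lborel)"
proof -
  have "F \<in> borel_measurable (lborel \<Otimes>\<^sub>M lborel)" using assms by (simp add: lborel_prod)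
  from lborel.nn_integral_fst[OF this] show ?thesis by (simp add: lborel_prod)
qed

text \<open>The Jacobian determinant of the map to (t + x, t - x) is -2. Two one-dimensional
  substitutions realise it: a shift in t at fixed x, then a scaling by -2 in x at fixed a = t +
  x.\<close>

lemma nn_integral_characteristic_coordinates:
  assumes F: "F \<in> borel_measurable (borel :: (real \<times> real) measure)"
  shows "(\<integral>\<^sup>+z. F (fst z + snd z, fst z - snd z) \<partial>lborel) = ennreal (1/2) * (\<integral>\<^sup>+z. F z \<partial>lborel)"
proof -
  have F2 [measurable]: "F \<in> borel_measurable (borel \<Otimes>\<^sub>M borel)" using F by (simp add: borel_prod)
  have m: "(\<lambda>z. F (fst z + snd z, fst z - snd z)) \<in> borel_measurable (borel :: (real \<times> real) measure)"
    unfolding borel_prod[symmetric] by measurable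
  have "(\<integral>\<^sup>+z. F (fst z + snd z, fst z - snd z) \<partial>lborel) = (\<integral>\<^sup>+t. \<integral>\<^sup>+x. F (t + x, t - x) \<partial>lborel \<partial>lborel)"
    by (subst nn_integral_lborel_pair[OF m]) simp
  also have "\<dots> = (\<integral>\<^sup>+x. \<integral>\<^sup>+t. F (t + x, t - x) \<partial>lborel \<partial>lborel)"
    by (rule lborel_pair.Fubini'[symmetric]) measurable
  also have "\<dots> = (\<integral>\<^sup>+x. \<integral>\<^sup>+a. F (a, a - 2 * x) \<partial>lborel \<partial>lborel)"
  proof (rule nn_integral_cong)
    fix x :: real
    have "(\<integral>\<^sup>+t. F (t + x, t - x) \<partial>lborel) = (\<integral>\<^sup>+t. (\<lambda>a. F (a, a - 2 * x)) (t + x) \<partial>lborel)"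
      by (intro nn_integral_cong) simp
    also have "\<dots> = (\<integral>\<^sup>+a. F (a, a - 2 * x) \<partial>lborel)"
      by (rule nn_integral_lborel_shift) measurable
    finally show "(\<integral>\<^sup>+t. F (t + x, t - x) \<partial>lborel) = (\<integral>\<^sup>+a. F (a, a - 2 * x) \<partial>lborel)" .
  qed
  also have "\<dots> = (\<integral>\<^sup>+a. \<integral>\<^sup>+x. F (a, a - 2 * x) \<partial>lborel \<partial>lborel)"
    by (rule lborel_pair.Fubini') measurable
  also have "\<dots> = (\<integral>\<^sup>+a. ennreal (1/2) * (\<integral>\<^sup>+b. F (a, b) \<partial>lborel) \<partial>lborel)"
  proof (rule nn_integral_cong)
    fix a :: real
    have "(\<integral>\<^sup>+b. F (a, b) \<partial>lborel) = ennreal \<bar>-2\<bar> * (\<integral>\<^sup>+x. F (a, a + (-2) * x) \<partial>lborel)"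
      by (rule nn_integral_real_affine) auto
    then have "ennreal (1/2) * (\<integral>\<^sup>+b. F (a, b) \<partial>lborel) = ennreal (1/2) * ennreal 2 * (\<integral>\<^sup>+x. F (a, a - 2 * x) \<partial>lborel)"
      by (simp add: mult.assoc)
    also have "ennreal (1/2) * ennreal 2 = 1"
      using ennreal_mult[of "1/2" 2] by simp
    finally show "(\<integral>\<^sup>+x. F (a, a - 2 * x) \<partial>lborel) = ennreal (1/2) * (\<integral>\<^sup>+b. F (a, b) \<partial>lborel)" by simp
  qed
  also have "\<dots> = ennreal (1/2) * (\<integral>\<^sup>+a. \<integral>\<^sup>+b. F (a, b) \<partial>lborel \<partial>lborel)"
    by (rule nn_integral_cmult) measurable
  also have "\<dots> = ennreal (1/2) * (\<integral>\<^sup>+z. F z \<partial>lborel)"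
    by (simp add: nn_integral_lborel_pair[OF F])
  finally show ?thesis .
qed

lemma integral_characteristic_coordinates:
  fixes f :: "real \<times> real \<Rightarrow> real"
  assumes f: "f \<in> borel_measurable borel"
  shows "(\<integral>z. f (fst z + snd z, fst z - snd z) \<partial>lborel) = (1/2) * (\<integral>z. f z \<partial>lborel)"
proof -
  define L where "L z = (fst z + snd z, fst z - snd z)" for z :: "real \<times> real"
  have L: "L \<in> lborel \<rightarrow>\<^sub>M borel"
    unfolding L_def by (simp, intro borel_measurable_continuous_onI continuous_intros)
  have d: "distr lborel borel L = density lborel (\<lambda>_. ennreal (1/2))"
  proof (rule measure_eqI)
    fix A assume "A \<in> sets (distr lborel borel L)"
    then have A: "A \<in> sets borel" by simp
    have "emeasure (distr lborel borel L) A = (\<integral>\<^sup>+z. indicator A (L z) \<partial>lborel)"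
      using nn_integral_distr[OF L, of "indicator A"] A by (simp add: nn_integral_indicator)
    also have "\<dots> = ennreal (1/2) * emeasure lborel A"
      unfolding L_def using A by (subst nn_integral_characteristic_coordinates) auto
    also have "\<dots> = emeasure (density lborel (\<lambda>_. ennreal (1/2))) A"
      using A by (simp add: emeasure_density nn_integral_cmult_indicator)
    finally show "emeasure (distr lborel borel L) A = emeasure (density lborel (\<lambda>_. ennreal (1/2))) A" .
  qed simp
  have "(\<integral>z. f (L z) \<partial>lborel) = integral\<^sup>L (distr lborel borel L) f"
    by (rule integral_distr[symmetric, OF L f])
  also have "\<dots> = (\<integral>z. (1/2) *\<^sub>R f z \<partial>lborel)"
    unfolding d by (rule integral_density) (use f in auto)
  finally show ?thesis by (simp add: L_def)
qed

lemma integral_lborel_product: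
  fixes f g :: "real \<Rightarrow> real"
  assumes f: "integrable lborel f" and g: "integrable lborel g"
  shows "integrable lborel (\<lambda>z. f (fst z) * g (snd z))"
    "(\<integral>z. f (fst z) * g (snd z) \<partial>lborel) = (\<integral>x. f x \<partial>lborel) * (\<integral>x. g x \<partial>lborel)"
proof -
  have [measurable]: "f \<in> borel_measurable borel" "g \<in> borel_measurable borel" using f g by auto
  have i: "integrable (lborel \<Otimes>\<^sub>M lborel) (\<lambda>z. f (fst z) * g (snd z))"
  proof (rule lborel_pair.Fubini_integrable)
    have "(\<integral>y. norm (f x * g y) \<partial>lborel) = \<bar>f x\<bar> * (\<integral>y. \<bar>g y\<bar> \<partial>lborel)" for x
      by (simp add: abs_mult)
    then show "integrable lborel (\<lambda>x. \<integral>y. norm (f (fst (x, y)) * g (snd (x, y))) \<partial>lborel)"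
      using f by simp
  qed (use g in auto)
  then show "integrable lborel (\<lambda>z. f (fst z) * g (snd z))" by (simp add: lborel_prod)
  show "(\<integral>z. f (fst z) * g (snd z) \<partial>lborel) = (\<integral>x. f x \<partial>lborel) * (\<integral>x. g x \<partial>lborel)"
    using lborel_pair.integral_fst'[OF i] by (simp add: lborel_prod)
qed

text \<open>A countable cover by non-overlapping closed boxes exceeds the measure of
  \<open>S\<close> by at most \<eta>/3, and by continuity from above finitely many interiors miss
  less than another \<eta>/3 of the cover. Interiors cost only null frontiers and are disjoint, so
  that their indicators add up to the indicator of the union.\<close>

lemma approx_by_open_boxes:
  fixes S :: "(real \<times> real) set"
  assumes S: "S \<in> sets borel" "bounded S" and "\<eta> > 0"
  obtains \<F> where "finite \<F>" "pairwise disjnt \<F>" "\<And>K. K \<in> \<F> \<Longrightarrow> \<exists>c d. K = box c d"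
    "emeasure lborel ((S - \<Union>\<F>) \<union> (\<Union>\<F> - S)) < ennreal \<eta>"
proof -
  obtain a b where ab: "S \<subseteq> cbox a b" using bounded_subset_cbox_symmetric[OF S(2)] by blast
  have "S \<in> lmeasurable" using S by (intro bounded_set_imp_lmeasurable) auto
  then obtain \<D> where \<D>: "countable \<D>" "\<And>K. K \<in> \<D> \<Longrightarrow> K \<subseteq> cbox a b \<and> K \<noteq> {} \<and> (\<exists>c d. K = cbox c d)"
     "pairwise (\<lambda>A B. interior A \<inter> interior B = {}) \<D>" "S \<subseteq> \<Union>\<D>" "\<Union>\<D> \<in> lmeasurable"
     "measure lebesgue (\<Union>\<D>) \<le> measure lebesgue S + \<eta> / 3"
    using measurable_outer_intervals_bounded[of S a b "\<eta> / 3"] ab \<open>\<eta> > 0\<close> by (metis divide_pos_pos zero_less_numeral)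
  have Db: "K \<in> sets borel" if "K \<in> \<D>" for K using \<D>(2)[OF that] by auto
  have U: "\<Union>\<D> \<in> sets borel" using \<D>(1) Db by (intro sets.countable_Union) auto
  have Ufin: "emeasure lborel (\<Union>\<D>) < \<infinity>"
    using fmeasurableD2[OF \<D>(5)] U by (simp add: top.not_eq_extremum)
  have "emeasure lborel (\<Union>\<D> - S) \<le> ennreal (\<eta> / 3)"
  proof -
    have "measure lebesgue (\<Union>\<D> - S) = measure lebesgue (\<Union>\<D>) - measure lebesgue S"
      using \<D>(4,5) \<open>S \<in> lmeasurable\<close> by (intro measurable_measure_Diff) (auto dest: fmeasurableD)
    then have "measure lebesgue (\<Union>\<D> - S) \<le> \<eta> / 3" using \<D>(6) by linarith
    moreover have "\<Union>\<D> - S \<in> lmeasurable" using \<D>(5) \<open>S \<in> lmeasurable\<close> by (intro fmeasurable.Diff)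
    ultimately have "emeasure lebesgue (\<Union>\<D> - S) \<le> ennreal (\<eta> / 3)"
      by (simp add: emeasure_eq_measure2 ennreal_leI)
    then show ?thesis using U S by simp
  qed
  \<comment> \<open>Interiors of the boxes with index below \<open>n\<close> in a fixed enumeration:
    finite families that increase with \<open>n\<close>.\<close>
  define F where "F n = interior ` {K \<in> \<D>. \<exists>i<n. K = from_nat_into \<D> i}" for n
  have Ffin: "finite (F n)" for n
  proof -
    have "{K \<in> \<D>. \<exists>i<n. K = from_nat_into \<D> i} \<subseteq> from_nat_into \<D> ` {..<n}" by auto
    then show ?thesis unfolding F_def by (intro finite_imageI) (auto intro: finite_subset)
  qed
  have Fopen: "\<exists>c d. K = box c d" if "K \<in> F n" for K n
    using that \<D>(2) unfolding F_def by (auto simp: interior_cbox) (metis interior_cbox)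
  have Fb: "\<Union>(F n) \<in> sets borel" for n
    using Fopen by (intro borel_open open_Union) (metis open_box)
  have FU: "\<Union>(F n) \<subseteq> \<Union>\<D>" for n
    unfolding F_def using interior_subset by fastforce
  have "(\<lambda>n. emeasure lborel (\<Union>\<D> - \<Union>(F n))) \<longlonglongrightarrow> emeasure lborel (\<Inter>n. \<Union>\<D> - \<Union>(F n))"
  proof (rule Lim_emeasure_decseq)
    show "range (\<lambda>n. \<Union>\<D> - \<Union>(F n)) \<subseteq> sets lborel" using U Fb by auto
    show "decseq (\<lambda>n. \<Union>\<D> - \<Union>(F n))"
      unfolding decseq_def F_def by (auto intro: less_le_trans)
    show "emeasure lborel (\<Union>\<D> - \<Union>(F n)) \<noteq> \<infinity>" for n
    proof -
      have "emeasure lborel (\<Union>\<D> - \<Union>(F n)) \<le> emeasure lborel (\<Union>\<D>)" using U by (intro emeasure_mono) auto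
      then show ?thesis using Ufin by (auto simp: top_unique)
    qed
  qed
  also have "emeasure lborel (\<Inter>n. \<Union>\<D> - \<Union>(F n)) = 0"
  proof -
    have "(\<Inter>n. \<Union>\<D> - \<Union>(F n)) \<subseteq> (\<Union>K\<in>\<D>. frontier K)"
    proof
      fix z assume z: "z \<in> (\<Inter>n. \<Union>\<D> - \<Union>(F n))"
      then obtain K where K: "K \<in> \<D>" "z \<in> K" by blast
      then obtain i where i: "K = from_nat_into \<D> i" using from_nat_into_surj[OF \<D>(1)] by metis
      then have "interior K \<in> F (Suc i)" using K unfolding F_def by blast
      then have "z \<notin> interior K" using z by blast
      then have "z \<in> frontier K" using K(2) closure_subset unfolding frontier_def by blast
      then show "z \<in> (\<Union>K\<in>\<D>. frontier K)" using K by blast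
    qed
    moreover have "(\<Union>K\<in>\<D>. frontier K) \<in> null_sets lborel"
    proof (rule null_sets_UN'[OF \<D>(1)])
      fix K assume "K \<in> \<D>"
      then obtain c d where cd: "K = cbox c d" using \<D>(2) by blast
      have "negligible (frontier K)" unfolding cd by (intro negligible_convex_frontier) simp
      then have "frontier K \<in> null_sets lebesgue" by (simp add: negligible_iff_null_sets)
      moreover have "frontier K \<in> sets borel" by (intro borel_closed) simp
      ultimately show "frontier K \<in> null_sets lborel" by (simp add: null_sets_completion_iff)
    qed
    ultimately show ?thesis
      using emeasure_mono[of "(\<Inter>n. \<Union>\<D> - \<Union>(F n))" "\<Union>K\<in>\<D>. frontier K" lborel]
      by (auto simp: null_sets_def)
  qed
  finally have "\<forall>\<^sub>F n in sequentially. emeasure lborel (\<Union>\<D> - \<Union>(F n)) < ennreal (\<eta> / 3)"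
    using \<open>\<eta> > 0\<close> by (intro order_tendstoD) (auto simp: ennreal_less_zero_iff)
  then obtain n where n: "emeasure lborel (\<Union>\<D> - \<Union>(F n)) < ennreal (\<eta> / 3)"
    by (meson eventually_sequentially order_refl)
  have "emeasure lborel ((S - \<Union>(F n)) \<union> (\<Union>(F n) - S)) \<le> emeasure lborel ((\<Union>\<D> - \<Union>(F n)) \<union> (\<Union>\<D> - S))"
    using \<D>(4) FU[of n] U Fb S by (intro emeasure_mono) auto
  also have "\<dots> \<le> emeasure lborel (\<Union>\<D> - \<Union>(F n)) + emeasure lborel (\<Union>\<D> - S)"
    using U Fb S by (intro emeasure_subadditive) auto
  also have "\<dots> \<le> ennreal (\<eta> / 3) + ennreal (\<eta> / 3)"
    using n \<open>emeasure lborel (\<Union>\<D> - S) \<le> ennreal (\<eta> / 3)\<close> by (intro add_mono) auto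
  also have "\<dots> = ennreal (\<eta> / 3 + \<eta> / 3)" using \<open>\<eta> > 0\<close> by (simp flip: ennreal_plus)
  also have "\<dots> < ennreal \<eta>" using \<open>\<eta> > 0\<close> by (intro ennreal_lessI) auto
  finally have "emeasure lborel ((S - \<Union>(F n)) \<union> (\<Union>(F n) - S)) < ennreal \<eta>" .
  moreover have "pairwise disjnt (F n)"
  proof (rule pairwiseI)
    fix K K' assume K: "K \<in> F n" "K' \<in> F n" "K \<noteq> K'"
    from K(1) obtain X where X: "K = interior X" "X \<in> \<D>" unfolding F_def by (elim imageE) simp
    from K(2) obtain Y where Y: "K' = interior Y" "Y \<in> \<D>" unfolding F_def by (elim imageE) simp
    have "X \<noteq> Y" using X Y K(3) by auto
    with \<D>(3) X(2) Y(2) have "interior X \<inter> interior Y = {}" by (rule pairwiseD)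
    then show "disjnt K K'" by (simp add: disjnt_def X(1) Y(1))
  qed
  ultimately show ?thesis using that[OF Ffin[of n] _ Fopen[of _ n]] by simp
qed

text \<open>The operator with kernel \<open>indicator S\<close> is compact: up to a small form it has finite rank.\<close>

lemma finite_rank_approx:
  fixes S :: "(real \<times> real) set"
  assumes S: "S \<in> sets borel" "bounded S" and "\<eta> > 0"
  obtains \<R> :: "(real set \<times> real set) set" where "finite \<R>"
    "\<And>A B. (A, B) \<in> \<R> \<Longrightarrow> A \<in> sets borel \<and> B \<in> sets borel"
    "\<And>q. sq_integrable lborel q \<Longrightarrow> integrable lborel q \<Longrightarrow>
       \<bar>\<integral>z. indicator S z * (q (fst z) * q (snd z)) \<partial>lborel\<bar> \<le>
        (\<Sum>(A, B)\<in>\<R>. \<bar>\<integral>x. indicator A x * q x \<partial>lborel\<bar> * \<bar>\<integral>x. indicator B x * q x \<partial>lborel\<bar>)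
         + \<eta> * (\<integral>x. (q x)\<^sup>2 \<partial>lborel)"
proof -
  \<comment> \<open>The error is estimated by Cauchy-Schwarz, which takes the square root of the
    measure of the symmetric difference; hence the square of \<eta>.\<close>
  obtain \<F> where \<F>: "finite \<F>" "pairwise disjnt \<F>" "\<And>K. K \<in> \<F> \<Longrightarrow> \<exists>c d. K = box c d"
    "emeasure lborel ((S - \<Union>\<F>) \<union> (\<Union>\<F> - S)) < ennreal (\<eta>\<^sup>2)"
    using approx_by_open_boxes[OF S, of "\<eta>\<^sup>2"] \<open>\<eta> > 0\<close> by auto
  have "\<forall>K\<in>\<F>. \<exists>A B. K = A \<times> B \<and> A \<in> sets borel \<and> B \<in> sets borel"
  proof
    fix K assume "K \<in> \<F>"
    then obtain c d where "K = box c d" using \<F>(3) by blast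
    then have "K = box (fst c) (fst d) \<times> box (snd c) (snd d)" by (simp only: box_prod)
    then show "\<exists>A B. K = A \<times> B \<and> A \<in> sets borel \<and> B \<in> sets borel"
      using borel_open[OF open_box] by blast
  qed
  then obtain A B where AB: "\<And>K. K \<in> \<F> \<Longrightarrow> K = A K \<times> B K \<and> A K \<in> sets borel \<and> B K \<in> sets borel"
    by metis
  define \<R> where "\<R> = (\<lambda>K. (A K, B K)) ` \<F>"
  have inj: "inj_on (\<lambda>K. (A K, B K)) \<F>" using AB by (intro inj_onI) (metis prod.inject)
  define E where "E = \<Union>\<F>"
  have E: "E \<in> sets borel" unfolding E_def using \<F>(3) by (intro borel_open open_Union) (metis open_box)
  have indE: "indicator E z = (\<Sum>K\<in>\<F>. indicator (A K) (fst z) * indicator (B K) (snd z) :: real)" for z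
  proof -
    have "indicator E z = (\<Sum>K\<in>\<F>. indicator K z :: real)"
    proof (cases "z \<in> E")
      case True
      then obtain K where K: "K \<in> \<F>" "z \<in> K" by (auto simp: E_def)
      have "indicator K' z = (if K' = K then 1 else 0 :: real)" if "K' \<in> \<F>" for K'
        using K that \<F>(2) by (auto simp: pairwise_def disjnt_def indicator_def)
      then have "(\<Sum>K\<in>\<F>. indicator K z :: real) = (\<Sum>K'\<in>\<F>. if K' = K then 1 else 0)" by (intro sum.cong) auto
      then show ?thesis using True K \<F>(1) by simp
    next
      case False
      then have "(\<Sum>K\<in>\<F>. indicator K z :: real) = 0" by (intro sum.neutral) (auto simp: E_def indicator_def)
      then show ?thesis using False by simp
    qed
    also have "\<dots> = (\<Sum>K\<in>\<F>. indicator (A K) (fst z) * indicator (B K) (snd z))"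
    proof (intro sum.cong refl)
      fix K assume "K \<in> \<F>"
      then have "z \<in> K \<longleftrightarrow> fst z \<in> A K \<and> snd z \<in> B K" using AB[of K] by (metis mem_Times_iff)
      then show "indicator K z = (indicator (A K) (fst z) * indicator (B K) (snd z) :: real)"
        by (auto simp: indicator_def)
    qed
    finally show ?thesis .
  qed
  define D where "D = (S - E) \<union> (E - S)"
  have D: "D \<in> sets borel" unfolding D_def using S E by auto
  have Dm: "emeasure lborel D < ennreal (\<eta>\<^sup>2)" using \<F>(4) by (simp add: D_def E_def)
  have "\<bar>\<integral>z. indicator S z * (q (fst z) * q (snd z)) \<partial>lborel\<bar> \<le>
        (\<Sum>(A, B)\<in>\<R>. \<bar>\<integral>x. indicator A x * q x \<partial>lborel\<bar> * \<bar>\<integral>x. indicator B x * q x \<partial>lborel\<bar>)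
         + \<eta> * (\<integral>x. (q x)\<^sup>2 \<partial>lborel)" if q: "sq_integrable lborel q" and qi: "integrable lborel q" for q
  proof -
    have [measurable]: "q \<in> borel_measurable borel" using qi by auto
    define h where "h z = q (fst z) * q (snd z)" for z
    have hi: "integrable lborel h" unfolding h_def by (rule integral_lborel_product[OF qi qi])
    have hm: "h \<in> borel_measurable lborel" using hi by auto
    \<comment> \<open>The L2 norm of the tensor square of \<open>q\<close> is the squared norm of
      \<open>q\<close>, so the error comes out linear in the latter.\<close>
    have h2: "integrable lborel (\<lambda>z. (h z)\<^sup>2)" "(\<integral>z. (h z)\<^sup>2 \<partial>lborel) = (\<integral>x. (q x)\<^sup>2 \<partial>lborel)\<^sup>2"
      using integral_lborel_product[OF sq_integrable_sq[OF q] sq_integrable_sq[OF q]]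
      by (simp_all only: h_def power_mult_distrib power2_eq_square[of "integral\<^sup>L lborel (\<lambda>x. (q x)\<^sup>2)"])
    have ih: "integrable lborel (\<lambda>z. indicator X z * h z)" if "X \<in> sets borel" for X
      using integrable_real_mult_indicator[OF _ hi, of X] that by (simp add: mult.commute)
    have int: "(\<integral>z. indicator E z * h z \<partial>lborel) =
       (\<Sum>K\<in>\<F>. (\<integral>x. indicator (A K) x * q x \<partial>lborel) * (\<integral>x. indicator (B K) x * q x \<partial>lborel))"
    proof -
      have i: "integrable lborel (\<lambda>x. indicator (A K) x * q x)" "integrable lborel (\<lambda>x. indicator (B K) x * q x)" if "K \<in> \<F>" for K
        using AB[OF that] integrable_real_mult_indicator[OF _ qi] by (auto simp: mult.commute)
      have "(\<integral>z. indicator E z * h z \<partial>lborel) =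
         (\<integral>z. (\<Sum>K\<in>\<F>. (indicator (A K) (fst z) * q (fst z)) * (indicator (B K) (snd z) * q (snd z))) \<partial>lborel)"
        unfolding indE h_def
        by (intro Bochner_Integration.integral_cong refl) (simp add: sum_distrib_right sum_distrib_left mult_ac)
      also have "\<dots> = (\<Sum>K\<in>\<F>. \<integral>z. (indicator (A K) (fst z) * q (fst z)) * (indicator (B K) (snd z) * q (snd z)) \<partial>lborel)"
        by (rule Bochner_Integration.integral_sum, rule integral_lborel_product(1)[OF i])
      also have "\<dots> = (\<Sum>K\<in>\<F>. (\<integral>x. indicator (A K) x * q x \<partial>lborel) * (\<integral>x. indicator (B K) x * q x \<partial>lborel))"
        by (intro sum.cong refl integral_lborel_product(2)[OF i])
      finally show ?thesis .
    qed
    have "\<bar>\<integral>z. indicator D z * \<bar>h z\<bar> \<partial>lborel\<bar> \<le> \<eta> * (\<integral>x. (q x)\<^sup>2 \<partial>lborel)"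
    proof -
      have ind2: "(indicator D z :: real)\<^sup>2 = indicator D z" for z by (simp add: indicator_def)
      have sD: "sq_integrable lborel (indicator D :: _ \<Rightarrow> real)"
        unfolding sq_integrable_def ind2
        using D less_trans[OF Dm ennreal_less_top] by (auto intro!: integrable_real_indicator)
      have sh: "sq_integrable lborel (\<lambda>z. \<bar>h z\<bar>)"
        using hm h2 by (simp add: sq_integrable_def)
      have "(\<integral>z. (indicator D z :: real)\<^sup>2 \<partial>lborel) = measure lborel D"
        unfolding ind2 using D by simp
      also have "\<dots> \<le> \<eta>\<^sup>2"
        using Dm by (simp add: measure_def enn2real_leI)
      finally have "(\<integral>z. indicator D z * \<bar>h z\<bar> \<partial>lborel)\<^sup>2 \<le> \<eta>\<^sup>2 * (\<integral>x. (q x)\<^sup>2 \<partial>lborel)\<^sup>2"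
        using integral_Cauchy_Schwarz[OF sD sh] h2(2) by (simp add: order_trans[OF _ mult_right_mono])
      then have "\<bar>\<integral>z. indicator D z * \<bar>h z\<bar> \<partial>lborel\<bar> \<le> \<bar>\<eta> * (\<integral>x. (q x)\<^sup>2 \<partial>lborel)\<bar>"
        unfolding abs_le_square_iff power_mult_distrib .
      then show ?thesis using \<open>\<eta> > 0\<close> by simp
    qed
    moreover have "\<bar>(\<integral>z. indicator S z * h z \<partial>lborel) - (\<integral>z. indicator E z * h z \<partial>lborel)\<bar> \<le> \<bar>\<integral>z. indicator D z * \<bar>h z\<bar> \<partial>lborel\<bar>"
    proof -
      have "(\<integral>z. indicator S z * h z \<partial>lborel) - (\<integral>z. indicator E z * h z \<partial>lborel) = (\<integral>z. indicator S z * h z - indicator E z * h z \<partial>lborel)"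
        using ih S E by simp
      also have "\<bar>\<dots>\<bar> \<le> (\<integral>z. \<bar>indicator S z * h z - indicator E z * h z\<bar> \<partial>lborel)"
        by (rule integral_abs_bound)
      also have "\<dots> = (\<integral>z. indicator D z * \<bar>h z\<bar> \<partial>lborel)"
        by (intro Bochner_Integration.integral_cong) (auto simp: D_def indicator_def)
      finally show ?thesis by linarith
    qed
    moreover have "\<bar>\<integral>z. indicator E z * h z \<partial>lborel\<bar> \<le> (\<Sum>(A, B)\<in>\<R>. \<bar>\<integral>x. indicator A x * q x \<partial>lborel\<bar> * \<bar>\<integral>x. indicator B x * q x \<partial>lborel\<bar>)"
    proof -
      have "(\<Sum>(A, B)\<in>\<R>. \<bar>\<integral>x. indicator A x * q x \<partial>lborel\<bar> * \<bar>\<integral>x. indicator B x * q x \<partial>lborel\<bar>) =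
        (\<Sum>K\<in>\<F>. \<bar>(\<integral>x. indicator (A K) x * q x \<partial>lborel) * (\<integral>x. indicator (B K) x * q x \<partial>lborel)\<bar>)"
        unfolding \<R>_def by (subst sum.reindex[OF inj]) (simp add: abs_mult)
      then show ?thesis unfolding int by (simp add: sum_abs)
    qed
    ultimately show ?thesis unfolding h_def by linarith
  qed
  moreover have "finite \<R>" unfolding \<R>_def using \<F>(1) by simp
  moreover have "A' \<in> sets borel \<and> B' \<in> sets borel" if "(A', B') \<in> \<R>" for A' B'
    using that AB unfolding \<R>_def by auto
  ultimately show ?thesis using that by blast
qed

section \<open>Observation forms\<close>

lemma bounded_family_convergent_subsequence:
  fixes x :: "'i \<Rightarrow> nat \<Rightarrow> real"
  assumes "finite I" "\<And>i. i \<in> I \<Longrightarrow> bounded (range (x i))"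
  obtains r :: "nat \<Rightarrow> nat" where "strict_mono r" "\<And>i. i \<in> I \<Longrightarrow> convergent (\<lambda>n. x i (r n))"
proof -
  have "\<exists>r :: nat \<Rightarrow> nat. strict_mono r \<and> (\<forall>i\<in>I. convergent (\<lambda>n. x i (r n)))"
    using assms
  proof (induction I rule: finite_induct)
    case empty
    then show ?case using strict_mono_id by auto
  next
    case (insert i I)
    then obtain r :: "nat \<Rightarrow> nat" where r: "strict_mono r" "\<forall>i\<in>I. convergent (\<lambda>n. x i (r n))" by auto
    have "bounded (range (\<lambda>n. x i (r n)))"
      using bounded_subset[OF insert.prems[of i], of "range (\<lambda>n. x i (r n))"] by auto
    then obtain l s where s: "strict_mono s" "((\<lambda>n. x i (r n)) \<circ> s) \<longlonglongrightarrow> l"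
      using bounded_imp_convergent_subsequence by blast
    have "convergent (\<lambda>n. x j ((r \<circ> s) n))" if "j \<in> insert i I" for j
    proof (cases "j = i")
      case True
      then show ?thesis using s(2) by (auto simp: convergent_def o_def)
    next
      case False
      then have "convergent (\<lambda>n. x j (r n))" using r(2) that by auto
      from convergent_subseq_convergent[OF this s(1)] show ?thesis by (simp add: o_def)
    qed
    then show ?case using strict_mono_o[OF r(1) s(1)] by blast
  qed
  then show ?thesis using that by blast
qed

lemma periodic_L2_cmult: "periodic_L2 p \<Longrightarrow> periodic_L2 (\<lambda>x. c * p x)"
  unfolding periodic_L2_def by (auto simp: periodic_def intro: sq_integrable_cmult)

lemma periodic_L2_diff: "periodic_L2 p \<Longrightarrow> periodic_L2 q \<Longrightarrow> periodic_L2 (\<lambda>x. p x - q x)"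
  unfolding periodic_L2_def by (auto simp: periodic_def intro: sq_integrable_diff)

lemma periodic_L2_sq: "periodic_L2 p \<Longrightarrow> sq_integrable circ p"
  by (simp add: periodic_L2_def)

text \<open>Riesz-Fischer yields a limit on one period only; extension by 0 to the line and
  composition with \<open>per\<close> turn it into a Borel periodic function.\<close>

lemma periodic_L2_version:
  assumes g: "sq_integrable circ g"
  obtains p where "periodic_L2 p" "\<And>x. x \<in> {-1<..<1} \<Longrightarrow> p x = g x"
proof -
  have "(\<lambda>x. indicator {-1<..<1} x * g x) \<in> borel_measurable lborel"
    using sq_integrable_measurable[OF g] unfolding circ_def
    by (subst (asm) borel_measurable_restrict_space_iff) auto
  then have m: "(\<lambda>x. indicator {-1<..<1} x * g x) \<in> borel_measurable borel" by simp
  define p where "p x = indicator {-1<..<1} (per x) * g (per x)" for x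
  have pm: "p \<in> borel_measurable borel"
    unfolding p_def by (rule measurable_compose[OF per_measurable m])
  have eq: "p x = g x" if "x \<in> {-1<..<1}" for x using that by (simp add: p_def per_eq)
  have "sq_integrable circ p"
    by (rule sq_integrable_cong_AE[OF g circ_measurable[OF pm]]) (use eq in auto)
  then have "periodic_L2 p"
    unfolding periodic_L2_def using pm periodic_comp_per[of "\<lambda>x. indicator {-1<..<1} x * g x"] by (simp add: p_def[abs_def])
  then show ?thesis using that eq by blast
qed

definition obs_form :: "real \<Rightarrow> (real \<times> real) set \<Rightarrow> (real \<Rightarrow> real) \<Rightarrow> real"
  where "obs_form \<epsilon> G p = (\<integral>z. indicator G z * (dalembert \<epsilon> p (fst z) (snd z))\<^sup>2 \<partial>lborel)"

lemma obs_form_nonneg: "obs_form \<epsilon> G p \<ge> 0"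
  unfolding obs_form_def by (intro Bochner_Integration.integral_nonneg) simp

lemma obs_form_cmult: "obs_form \<epsilon> G (\<lambda>x. c * p x) = c\<^sup>2 * obs_form \<epsilon> G p"
proof -
  have "dalembert \<epsilon> (\<lambda>x. c * p x) t x = c * dalembert \<epsilon> p t x" for t x
    by (simp add: dalembert_def algebra_simps)
  then have "obs_form \<epsilon> G (\<lambda>x. c * p x) = (\<integral>z. c\<^sup>2 * (indicator G z * (dalembert \<epsilon> p (fst z) (snd z))\<^sup>2) \<partial>lborel)"
    unfolding obs_form_def by (simp add: power_mult_distrib mult_ac)
  then show ?thesis by (simp add: obs_form_def)
qed

locale observation_set =
  fixes T :: real and G :: "(real \<times> real) set"
  assumes T: "T > 0" and G: "G \<in> sets borel" and G_sub: "G \<subseteq> {0..T} \<times> {0<..<1}"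
begin

lemma G_sub': "G \<subseteq> UNIV \<times> {0<..<1}"
  using G_sub by auto

lemma measurable_coordinates:
  assumes "p \<in> borel_measurable borel"
  shows "(\<lambda>z. p (fst z + snd z)) \<in> borel_measurable (borel :: (real \<times> real) measure)"
    "(\<lambda>z. p (fst z - snd z)) \<in> borel_measurable (borel :: (real \<times> real) measure)"
proof -
  note [measurable] = assms
  show "(\<lambda>z. p (fst z + snd z)) \<in> borel_measurable (borel :: (real \<times> real) measure)"
    "(\<lambda>z. p (fst z - snd z)) \<in> borel_measurable (borel :: (real \<times> real) measure)"
    unfolding borel_prod[symmetric] by measurable
qed

lemma char_times_le: "emeasure lborel (char_times G c) \<le> ennreal T"
proof -
  have "char_times G c \<subseteq> {0..T}" using G_sub by (auto simp: char_times_def)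
  then have "emeasure lborel (char_times G c) \<le> emeasure lborel {0..T}" by (intro emeasure_mono) auto
  then show ?thesis using T by simp
qed

lemma nn_integral_sum_form:
  assumes p: "periodic_L2 p" and k: "k \<ge> 0"
  shows "(\<integral>\<^sup>+z. ennreal (k * (indicator G z * ((p (fst z + snd z))\<^sup>2 + (p (fst z - snd z))\<^sup>2))) \<partial>lborel)
    = (\<integral>\<^sup>+c. ennreal (k * (p c)\<^sup>2) * emeasure lborel (char_times G c) \<partial>circ)"
proof -
  note [measurable] = periodic_L2_borel[OF p]
  have "(\<integral>\<^sup>+z. ennreal (k * (indicator G z * ((p (fst z + snd z))\<^sup>2 + (p (fst z - snd z))\<^sup>2))) \<partial>lborel)
     = (\<integral>\<^sup>+z. (ennreal (k * (p (fst z + snd z))\<^sup>2) + ennreal (k * (p (fst z - snd z))\<^sup>2)) * indicator G z \<partial>lborel)"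
    using k by (intro nn_integral_cong) (auto simp: indicator_def distrib_left simp flip: ennreal_plus)
  also have "\<dots> = (\<integral>\<^sup>+c. ennreal (k * (p c)\<^sup>2) * emeasure lborel (char_times G c) \<partial>circ)"
    using p by (intro nn_integral_characteristics[OF G G_sub', of "\<lambda>c. ennreal (k * (p c)\<^sup>2)"])
      (auto simp: periodic_L2_def periodic_def)
  finally show ?thesis .
qed

lemma nn_integral_sq_circ:
  assumes "periodic_L2 p" "k \<ge> 0"
  shows "(\<integral>\<^sup>+c. ennreal (k * (p c)\<^sup>2) \<partial>circ) = ennreal (k * (\<integral>c. (p c)\<^sup>2 \<partial>circ))"
  using assms sq_integrable_sq[OF periodic_L2_sq[OF assms(1)]]
  by (subst nn_integral_eq_integral) auto

text \<open>The squares contribute the integral of \<tau> p^2, with \<tau> the time spent in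
  \<open>G\<close>. The alternative \<open>p c = 0\<close> serves profiles living on poorly observed
  characteristics; the choice \<delta> = T applies to every \<open>p\<close> and gives
  integrability.\<close>

lemma sum_form_bound:
  assumes p: "periodic_L2 p" and \<delta>: "\<delta> \<ge> 0"
    and small: "AE c in circ. p c = 0 \<or> emeasure lborel (char_times G c) \<le> ennreal \<delta>"
  shows "integrable lborel (\<lambda>z. indicator G z * ((p (fst z + snd z))\<^sup>2 + (p (fst z - snd z))\<^sup>2))"
    "(\<integral>z. indicator G z * ((p (fst z + snd z))\<^sup>2 + (p (fst z - snd z))\<^sup>2) \<partial>lborel) \<le> \<delta> * (\<integral>c. (p c)\<^sup>2 \<partial>circ)"
proof -
  note [measurable] = periodic_L2_borel[OF p] measurable_coordinates[OF periodic_L2_borel[OF p]] G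
  have "(\<integral>\<^sup>+z. ennreal (1 * (indicator G z * ((p (fst z + snd z))\<^sup>2 + (p (fst z - snd z))\<^sup>2))) \<partial>lborel)
     = (\<integral>\<^sup>+c. ennreal (1 * (p c)\<^sup>2) * emeasure lborel (char_times G c) \<partial>circ)"
    by (rule nn_integral_sum_form[OF p]) simp
  also have "\<dots> \<le> (\<integral>\<^sup>+c. ennreal (\<delta> * (p c)\<^sup>2) \<partial>circ)"
    using small
  proof (intro nn_integral_mono_AE, eventually_elim)
    case (elim c)
    show ?case
    proof (cases "p c = 0")
      case False
      then have "ennreal (1 * (p c)\<^sup>2) * emeasure lborel (char_times G c) \<le> ennreal ((p c)\<^sup>2) * ennreal \<delta>"
        using elim by (intro mult_mono) auto
      also have "\<dots> = ennreal (\<delta> * (p c)\<^sup>2)"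
        using ennreal_mult[of "(p c)\<^sup>2" \<delta>] \<delta> by (simp add: mult.commute)
      finally show ?thesis .
    qed simp
  qed
  also have "\<dots> = ennreal (\<delta> * (\<integral>c. (p c)\<^sup>2 \<partial>circ))" by (rule nn_integral_sq_circ[OF p \<delta>])
  finally have le: "(\<integral>\<^sup>+z. ennreal (indicator G z * ((p (fst z + snd z))\<^sup>2 + (p (fst z - snd z))\<^sup>2)) \<partial>lborel)
     \<le> ennreal (\<delta> * (\<integral>c. (p c)\<^sup>2 \<partial>circ))" by simp
  show i: "integrable lborel (\<lambda>z. indicator G z * ((p (fst z + snd z))\<^sup>2 + (p (fst z - snd z))\<^sup>2))"
  proof (rule integrableI_bounded)
    show "(\<integral>\<^sup>+z. ennreal (norm (indicator G z * ((p (fst z + snd z))\<^sup>2 + (p (fst z - snd z))\<^sup>2))) \<partial>lborel) < \<infinity>"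
      using le by (simp add: abs_mult order_le_less_trans[OF _ ennreal_less_top])
  qed measurable
  have "0 \<le> \<delta> * (\<integral>c. (p c)\<^sup>2 \<partial>circ)" using \<delta> by simp
  then show "(\<integral>z. indicator G z * ((p (fst z + snd z))\<^sup>2 + (p (fst z - snd z))\<^sup>2) \<partial>lborel) \<le> \<delta> * (\<integral>c. (p c)\<^sup>2 \<partial>circ)"
    using le by (subst (asm) nn_integral_eq_integral[OF i]) (auto simp: ennreal_le_iff)
qed

text \<open>The coercivity behind (GCC): the diagonal part of the observation dominates the squared
  norm.\<close>

lemma sum_form_ge:
  assumes p: "periodic_L2 p" and c0: "c0 \<ge> 0" "AE c in circ. ennreal c0 \<le> emeasure lborel (char_times G c)"
  shows "c0 * (\<integral>c. (p c)\<^sup>2 \<partial>circ) \<le> (\<integral>z. indicator G z * ((p (fst z + snd z))\<^sup>2 + (p (fst z - snd z))\<^sup>2) \<partial>lborel)"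
proof -
  have i: "integrable lborel (\<lambda>z. indicator G z * ((p (fst z + snd z))\<^sup>2 + (p (fst z - snd z))\<^sup>2))"
    using char_times_le T by (intro sum_form_bound(1)[OF p, of T]) auto
  have "ennreal (c0 * (\<integral>c. (p c)\<^sup>2 \<partial>circ)) = (\<integral>\<^sup>+c. ennreal (c0 * (p c)\<^sup>2) \<partial>circ)"
    by (rule nn_integral_sq_circ[symmetric, OF p c0(1)])
  also have "\<dots> \<le> (\<integral>\<^sup>+c. ennreal (1 * (p c)\<^sup>2) * emeasure lborel (char_times G c) \<partial>circ)"
    using c0(2)
  proof (intro nn_integral_mono_AE, eventually_elim)
    case (elim c)
    have "ennreal (c0 * (p c)\<^sup>2) = ennreal (1 * (p c)\<^sup>2) * ennreal c0" using ennreal_mult[of "(p c)\<^sup>2" c0] c0(1) by (simp add: mult.commute)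
    also have "\<dots> \<le> ennreal (1 * (p c)\<^sup>2) * emeasure lborel (char_times G c)" using elim by (intro mult_left_mono) auto
    finally show ?case .
  qed
  also have "\<dots> = (\<integral>\<^sup>+z. ennreal (1 * (indicator G z * ((p (fst z + snd z))\<^sup>2 + (p (fst z - snd z))\<^sup>2))) \<partial>lborel)"
    by (rule nn_integral_sum_form[symmetric, OF p]) simp
  also have "\<dots> = ennreal (\<integral>z. indicator G z * ((p (fst z + snd z))\<^sup>2 + (p (fst z - snd z))\<^sup>2) \<partial>lborel)"
    using i by (simp add: nn_integral_eq_integral)
  finally show ?thesis by (subst (asm) ennreal_le_iff) (auto intro!: Bochner_Integration.integral_nonneg)
qed

lemma integrable_sum_form:
  assumes "periodic_L2 p"
  shows "integrable lborel (\<lambda>z. indicator G z * ((p (fst z + snd z))\<^sup>2 + (p (fst z - snd z))\<^sup>2))"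
  using char_times_le T by (intro sum_form_bound(1)[OF assms, of T]) auto

lemma integrable_cross_form:
  assumes "periodic_L2 p"
  shows "integrable lborel (\<lambda>z. indicator G z * (p (fst z + snd z) * p (fst z - snd z)))"
proof (rule Bochner_Integration.integrable_bound[OF integrable_sum_form[OF assms]])
  note [measurable] = measurable_coordinates[OF periodic_L2_borel[OF assms]] G
  show "(\<lambda>z. indicator G z * (p (fst z + snd z) * p (fst z - snd z))) \<in> borel_measurable lborel" by measurable
  have "\<bar>a * b\<bar> \<le> a\<^sup>2 + b\<^sup>2" for a b :: real
  proof -
    have "2 * (\<bar>a\<bar> * \<bar>b\<bar>) \<le> a\<^sup>2 + b\<^sup>2"
      using sum_squares_bound[of "\<bar>a\<bar>" "\<bar>b\<bar>"] by (simp add: mult.assoc)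
    moreover have "\<bar>a\<bar> * \<bar>b\<bar> \<ge> 0" by simp
    ultimately show ?thesis unfolding abs_mult by linarith
  qed
  then show "AE z in lborel. norm (indicator G z * (p (fst z + snd z) * p (fst z - snd z)) :: real)
      \<le> norm (indicator G z * ((p (fst z + snd z))\<^sup>2 + (p (fst z - snd z))\<^sup>2) :: real)"
    by (intro AE_I2) (auto simp: indicator_def)
qed

lemma obs_form_eq:
  assumes p: "periodic_L2 p" and \<epsilon>: "\<epsilon> = 1 \<or> \<epsilon> = -1"
  shows "integrable lborel (\<lambda>z. indicator G z * (dalembert \<epsilon> p (fst z) (snd z))\<^sup>2)"
    "obs_form \<epsilon> G p = (\<integral>z. indicator G z * ((p (fst z + snd z))\<^sup>2 + (p (fst z - snd z))\<^sup>2) \<partial>lborel) +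
     2 * \<epsilon> * (\<integral>z. indicator G z * (p (fst z + snd z) * p (fst z - snd z)) \<partial>lborel)"
proof -
  have eq: "indicator G z * (dalembert \<epsilon> p (fst z) (snd z))\<^sup>2 = indicator G z * ((p (fst z + snd z))\<^sup>2 + (p (fst z - snd z))\<^sup>2)
     + 2 * \<epsilon> * (indicator G z * (p (fst z + snd z) * p (fst z - snd z)))" for z
    using \<epsilon> by (auto simp: dalembert_def power2_eq_square algebra_simps)
  note i = integrable_sum_form[OF p] integrable_mult_right[OF integrable_cross_form[OF p], of "2 * \<epsilon>"]
  show "integrable lborel (\<lambda>z. indicator G z * (dalembert \<epsilon> p (fst z) (snd z))\<^sup>2)"
    unfolding eq by (intro Bochner_Integration.integrable_add i)
  show "obs_form \<epsilon> G p = (\<integral>z. indicator G z * ((p (fst z + snd z))\<^sup>2 + (p (fst z - snd z))\<^sup>2) \<partial>lborel) +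
     2 * \<epsilon> * (\<integral>z. indicator G z * (p (fst z + snd z) * p (fst z - snd z)) \<partial>lborel)"
    unfolding obs_form_def eq by (simp only: Bochner_Integration.integral_add[OF i] integral_mult_right_zero)
qed

lemma obs_form_le:
  assumes p: "periodic_L2 p" and \<epsilon>: "\<epsilon> = 1 \<or> \<epsilon> = -1" and \<delta>: "\<delta> \<ge> 0"
    and small: "AE c in circ. p c = 0 \<or> emeasure lborel (char_times G c) \<le> ennreal \<delta>"
  shows "obs_form \<epsilon> G p \<le> 2 * \<delta> * (\<integral>c. (p c)\<^sup>2 \<partial>circ)"
proof -
  have *: "(dalembert \<epsilon> p (fst z) (snd z))\<^sup>2 \<le> 2 * ((p (fst z + snd z))\<^sup>2 + (p (fst z - snd z))\<^sup>2)" for z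
    using \<epsilon> sum_squares_bound[of "p (fst z + snd z)" "p (fst z - snd z)"] sum_squares_bound[of "p (fst z + snd z)" "- p (fst z - snd z)"]
    by (auto simp: dalembert_def power2_sum power2_diff)
  have "obs_form \<epsilon> G p \<le> (\<integral>z. 2 * (indicator G z * ((p (fst z + snd z))\<^sup>2 + (p (fst z - snd z))\<^sup>2)) \<partial>lborel)"
    unfolding obs_form_def
  proof (rule integral_mono[OF obs_form_eq(1)[OF p \<epsilon>]])
    show "indicator G z * (dalembert \<epsilon> p (fst z) (snd z))\<^sup>2 \<le> 2 * (indicator G z * ((p (fst z + snd z))\<^sup>2 + (p (fst z - snd z))\<^sup>2))" for z
      using *[of z] by (auto simp: indicator_def)
  qed (use integrable_sum_form[OF p] in simp)
  also have "\<dots> \<le> 2 * (\<delta> * (\<integral>c. (p c)\<^sup>2 \<partial>circ))"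
    using sum_form_bound(2)[OF p \<delta> small] by simp
  finally show ?thesis by simp
qed

lemma obs_form_le_T:
  assumes "periodic_L2 p" "\<epsilon> = 1 \<or> \<epsilon> = -1"
  shows "obs_form \<epsilon> G p \<le> 2 * T * (\<integral>c. (p c)\<^sup>2 \<partial>circ)"
  using char_times_le T by (intro obs_form_le[OF assms]) auto

lemma obs_form_add_le:
  assumes p: "periodic_L2 p" and q: "periodic_L2 q" and \<epsilon>: "\<epsilon> = 1 \<or> \<epsilon> = -1"
  shows "obs_form \<epsilon> G (\<lambda>x. p x - q x) \<le> 2 * obs_form \<epsilon> G p + 2 * obs_form \<epsilon> G q"
proof -
  note i = obs_form_eq(1)[OF p \<epsilon>] obs_form_eq(1)[OF q \<epsilon>] obs_form_eq(1)[OF periodic_L2_diff[OF p q] \<epsilon>]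
  have *: "(a - b)\<^sup>2 \<le> 2 * a\<^sup>2 + 2 * b\<^sup>2" for a b :: real
    using sum_squares_bound[of a "- b"] by (simp add: power2_diff)
  have "obs_form \<epsilon> G (\<lambda>x. p x - q x) \<le> (\<integral>z. 2 * (indicator G z * (dalembert \<epsilon> p (fst z) (snd z))\<^sup>2) + 2 * (indicator G z * (dalembert \<epsilon> q (fst z) (snd z))\<^sup>2) \<partial>lborel)"
    unfolding obs_form_def
  proof (rule integral_mono[OF i(3)])
    fix z
    have "dalembert \<epsilon> (\<lambda>x. p x - q x) (fst z) (snd z) = dalembert \<epsilon> p (fst z) (snd z) - dalembert \<epsilon> q (fst z) (snd z)"
      by (simp add: dalembert_def algebra_simps)
    then show "indicator G z * (dalembert \<epsilon> (\<lambda>x. p x - q x) (fst z) (snd z))\<^sup>2 \<le>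
       2 * (indicator G z * (dalembert \<epsilon> p (fst z) (snd z))\<^sup>2) + 2 * (indicator G z * (dalembert \<epsilon> q (fst z) (snd z))\<^sup>2)"
      using *[of "dalembert \<epsilon> p (fst z) (snd z)" "dalembert \<epsilon> q (fst z) (snd z)"] by (auto simp: indicator_def)
  qed (use i in simp)
  also have "\<dots> = 2 * obs_form \<epsilon> G p + 2 * obs_form \<epsilon> G q"
    using i by (simp add: obs_form_def)
  finally show ?thesis .
qed

text \<open>The coordinates t + x and t - x can run over several periods, so the cross term is
  treated as a form on a segment of \<open>M\<close> periods; this compares norms there with norms
  on the circle.\<close>

lemma nn_integral_periodic_interval:
  assumes f [measurable]: "f \<in> borel_measurable borel" and p: "periodic f"
  shows "(\<integral>\<^sup>+x. f x * indicator {-1..<2 * real M - 1} x \<partial>lborel) = of_nat M * (\<integral>\<^sup>+x. f x \<partial>circ)"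
proof (induction M)
  case 0
  then show ?case by simp
next
  case (Suc M)
  have "(\<integral>\<^sup>+x. f x * indicator {-1..<2 * real (Suc M) - 1} x \<partial>lborel) =
     (\<integral>\<^sup>+x. f x * indicator {-1..<2 * real M - 1} x + f x * indicator {2 * real M - 1..<2 * real M + 1} x \<partial>lborel)"
    by (intro nn_integral_cong) (auto simp: indicator_def)
  also have "\<dots> = (\<integral>\<^sup>+x. f x * indicator {-1..<2 * real M - 1} x \<partial>lborel) + (\<integral>\<^sup>+x. f x * indicator {2 * real M - 1..<2 * real M + 1} x \<partial>lborel)"
    by (rule nn_integral_add) auto
  also have "(\<integral>\<^sup>+x. f x * indicator {2 * real M - 1..<2 * real M + 1} x \<partial>lborel) =
     (\<integral>\<^sup>+x. f (x + 2 * real M) * indicator {2 * real M - 1..<2 * real M + 1} (x + 2 * real M) \<partial>lborel)"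
    by (rule nn_integral_lborel_shift[symmetric]) measurable
  also have "\<dots> = (\<integral>\<^sup>+x. f (x + 2 * real M) * indicator {-1<..<1} x \<partial>lborel)"
  proof (rule nn_integral_cong_AE)
    have "AE x in lborel. x \<noteq> (-1::real)" by (rule AE_lborel_singleton)
    then show "AE x in lborel. f (x + 2 * real M) * indicator {2 * real M - 1..<2 * real M + 1} (x + 2 * real M)
        = f (x + 2 * real M) * indicator {-1<..<1} x"
      by eventually_elim (auto simp: indicator_def)
  qed
  also have "\<dots> = (\<integral>\<^sup>+x. f x \<partial>circ)"
    using nn_integral_circ_shift[OF f p, of "2 * real M"] by (simp add: nn_integral_circ)
  finally show ?case using Suc.IH by (simp add: distrib_right add.commute)
qed

text \<open>The linear functionals that the finite-rank approximation of the cross term produces, on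
  a segment of \<open>M\<close> periods.\<close>

definition moment :: "nat \<Rightarrow> real set \<Rightarrow> (real \<Rightarrow> real) \<Rightarrow> real"
  where "moment M A p = (\<integral>x. indicator A x * (indicator {-1..<2 * real M - 1} x * p x) \<partial>lborel)"

lemma interval_restriction:
  assumes p: "periodic_L2 p"
  shows "sq_integrable lborel (\<lambda>x. indicator {-1..<2 * real M - 1} x * p x)"
    "integrable lborel (\<lambda>x. indicator {-1..<2 * real M - 1} x * p x)"
    "(\<integral>x. (indicator {-1..<2 * real M - 1} x * p x)\<^sup>2 \<partial>lborel) = real M * (\<integral>c. (p c)\<^sup>2 \<partial>circ)"
proof -
  note [measurable] = periodic_L2_borel[OF p]
  let ?q = "\<lambda>x. indicator {-1..<2 * real M - 1} x * p x"
  have "(\<integral>\<^sup>+x. ennreal ((?q x)\<^sup>2) \<partial>lborel) = (\<integral>\<^sup>+x. ennreal ((p x)\<^sup>2) * indicator {-1..<2 * real M - 1} x \<partial>lborel)"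
    by (intro nn_integral_cong) (auto simp: indicator_def)
  also have "\<dots> = of_nat M * (\<integral>\<^sup>+c. ennreal (1 * (p c)\<^sup>2) \<partial>circ)"
    using p by (subst nn_integral_periodic_interval) (auto simp: periodic_L2_def periodic_def)
  also have "\<dots> = ennreal (real M * (\<integral>c. (p c)\<^sup>2 \<partial>circ))"
    by (subst nn_integral_sq_circ[OF p]) (simp_all add: ennreal_mult ennreal_of_nat_eq_real_of_nat)
  finally have e: "(\<integral>\<^sup>+x. ennreal ((?q x)\<^sup>2) \<partial>lborel) = ennreal (real M * (\<integral>c. (p c)\<^sup>2 \<partial>circ))" .
  have i2: "integrable lborel (\<lambda>x. (?q x)\<^sup>2)"
    by (rule integrableI_nn_integral_finite[OF _ _ e]) auto
  show s: "sq_integrable lborel ?q" unfolding sq_integrable_def using i2 by simp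
  show "(\<integral>x. (?q x)\<^sup>2 \<partial>lborel) = real M * (\<integral>c. (p c)\<^sup>2 \<partial>circ)"
    using e by (subst (asm) nn_integral_eq_integral[OF i2]) (auto simp: ennreal_inj)
  have "sq_integrable lborel (indicator {-1..<2 * real M - 1} :: real \<Rightarrow> real)"
  proof -
    have "(indicator {-1..<2 * real M - 1} x :: real)\<^sup>2 = indicator {-1..<2 * real M - 1} x" for x by (simp add: indicator_def)
    then show ?thesis unfolding sq_integrable_def by (auto intro!: integrable_real_indicator simp: emeasure_lborel_Ico)
  qed
  from sq_integrable_mult[OF this s] show "integrable lborel ?q"
    by (rule Bochner_Integration.integrable_cong[THEN iffD1, rotated -1]) (auto simp: indicator_def)
qed

lemma integrable_moment:
  assumes "periodic_L2 p" "A \<in> sets borel"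
  shows "integrable lborel (\<lambda>x. indicator A x * (indicator {-1..<2 * real M - 1} x * p x))"
  using integrable_real_mult_indicator[OF _ interval_restriction(2)[OF assms(1)], of A M] assms(2) by (simp add: mult.commute)

lemma moment_diff:
  assumes "periodic_L2 p" "periodic_L2 q" "A \<in> sets borel"
  shows "moment M A (\<lambda>x. p x - q x) = moment M A p - moment M A q"
  unfolding moment_def
  by (subst Bochner_Integration.integral_diff[symmetric, OF integrable_moment[OF assms(1,3)] integrable_moment[OF assms(2,3)]])
    (simp add: right_diff_distrib)

lemma moment_bound:
  assumes p: "periodic_L2 p" and A: "A \<in> sets borel"
  shows "(moment M A p)\<^sup>2 \<le> 2 * real M * (real M * (\<integral>c. (p c)\<^sup>2 \<partial>circ))"
proof -
  let ?J = "{-1..<2 * real M - 1}" and ?q = "\<lambda>x. indicator {-1..<2 * real M - 1} x * p x"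
  have ind2: "(indicator (A \<inter> ?J) x :: real)\<^sup>2 = indicator (A \<inter> ?J) x" for x by (simp add: indicator_def)
  have le: "emeasure lborel (A \<inter> ?J) \<le> ennreal (2 * real M)"
  proof -
    have "emeasure lborel (A \<inter> ?J) \<le> emeasure lborel ?J" using A by (intro emeasure_mono) auto
    then show ?thesis by (cases "M = 0") (auto simp: emeasure_lborel_Ico)
  qed
  have s: "sq_integrable lborel (indicator (A \<inter> ?J) :: real \<Rightarrow> real)"
    unfolding sq_integrable_def ind2 using A le_less_trans[OF le ennreal_less_top]
    by (auto intro!: integrable_real_indicator)
  have "moment M A p = (\<integral>x. indicator (A \<inter> ?J) x * ?q x \<partial>lborel)"
    unfolding moment_def by (intro Bochner_Integration.integral_cong) (auto simp: indicator_def)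
  then have "(moment M A p)\<^sup>2 \<le> (\<integral>x. (indicator (A \<inter> ?J) x)\<^sup>2 \<partial>lborel) * (\<integral>x. (?q x)\<^sup>2 \<partial>lborel)"
    using integral_Cauchy_Schwarz[OF s interval_restriction(1)[OF p, of M]] by simp
  also have "\<dots> = measure lborel (A \<inter> ?J) * (real M * (\<integral>c. (p c)\<^sup>2 \<partial>circ))"
    unfolding ind2 interval_restriction(3)[OF p] using A by simp
  also have "\<dots> \<le> 2 * real M * (real M * (\<integral>c. (p c)\<^sup>2 \<partial>circ))"
    using le by (intro mult_right_mono) (auto simp: measure_def enn2real_leI)
  finally show ?thesis .
qed

text \<open>In characteristic coordinates the kernel of the cross term is the indicator of a bounded
  set, to which \<open>finite_rank_approx\<close> applies. The factor 2 compensates the Jacobian,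
  and the tolerance is divided by \<open>M\<close> because the segment carries \<open>M\<close>
  times the squared norm of one period.\<close>

lemma cross_form_compact:
  assumes "\<eta> > 0"
  obtains M \<R> where "finite \<R>" "\<And>A B. (A, B) \<in> \<R> \<Longrightarrow> A \<in> sets borel \<and> B \<in> sets borel"
    "\<And>p. periodic_L2 p \<Longrightarrow> 2 * \<bar>\<integral>z. indicator G z * (p (fst z + snd z) * p (fst z - snd z)) \<partial>lborel\<bar> \<le>
      (\<Sum>(A, B)\<in>\<R>. \<bar>moment M A p\<bar> * \<bar>moment M B p\<bar>) + \<eta> * (\<integral>c. (p c)\<^sup>2 \<partial>circ)"
proof -
  \<comment> \<open>Large enough for [-1, 2 M - 1) to contain both t + x and t - x whenever (t, x)
    lies in \<open>G\<close>.\<close>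
  obtain M :: nat where M: "T + 2 < real M" using reals_Archimedean2 by blast
  then have M0: "real M > 0" using T by simp
  let ?J = "{-1..<2 * real M - 1}"
  define S where "S = (\<lambda>w. ((fst w + snd w) / 2, (fst w - snd w) / 2)) -` G"
  have S: "S \<in> sets borel"
  proof -
    have "(\<lambda>w. ((fst w + snd w) / 2, (fst w - snd w) / 2)) \<in> borel \<rightarrow>\<^sub>M (borel :: (real \<times> real) measure)"
      by (intro borel_measurable_continuous_onI continuous_intros) auto
    from measurable_sets[OF this G] show ?thesis by (simp add: S_def)
  qed
  have SJ: "fst w \<in> ?J \<and> snd w \<in> ?J" if "w \<in> S" for w
    using that G_sub M T unfolding S_def by (cases w) (auto dest!: subsetD)
  have "S \<subseteq> cbox (-1, -1) (2 * real M - 1, 2 * real M - 1)"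
    using SJ by (auto simp: cbox_Pair_eq) fastforce+
  then have bS: "bounded S" using bounded_cbox bounded_subset by blast
  obtain \<R> where \<R>: "finite \<R>" "\<And>A B. (A, B) \<in> \<R> \<Longrightarrow> A \<in> sets borel \<and> B \<in> sets borel"
    "\<And>q. sq_integrable lborel q \<Longrightarrow> integrable lborel q \<Longrightarrow>
       \<bar>\<integral>z. indicator S z * (q (fst z) * q (snd z)) \<partial>lborel\<bar> \<le>
        (\<Sum>(A, B)\<in>\<R>. \<bar>\<integral>x. indicator A x * q x \<partial>lborel\<bar> * \<bar>\<integral>x. indicator B x * q x \<partial>lborel\<bar>)
         + \<eta> / real M * (\<integral>x. (q x)\<^sup>2 \<partial>lborel)"
    using finite_rank_approx[OF S bS, of "\<eta> / real M"] assms M0 by auto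
  have "2 * \<bar>\<integral>z. indicator G z * (p (fst z + snd z) * p (fst z - snd z)) \<partial>lborel\<bar> \<le>
      (\<Sum>(A, B)\<in>\<R>. \<bar>moment M A p\<bar> * \<bar>moment M B p\<bar>) + \<eta> * (\<integral>c. (p c)\<^sup>2 \<partial>circ)" if p: "periodic_L2 p" for p
  proof -
    let ?q = "\<lambda>x. indicator ?J x * p x"
    have m: "(\<lambda>w. indicator S w * (?q (fst w) * ?q (snd w))) \<in> borel_measurable borel"
    proof -
      note [measurable] = periodic_L2_borel[OF p] borel_pair_sets[OF S]
      show ?thesis unfolding borel_prod[symmetric] by measurable
    qed
    have "(\<integral>z. indicator G z * (p (fst z + snd z) * p (fst z - snd z)) \<partial>lborel) =
       (\<integral>z. (\<lambda>w. indicator S w * (?q (fst w) * ?q (snd w))) (fst z + snd z, fst z - snd z) \<partial>lborel)"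
    proof (intro Bochner_Integration.integral_cong refl)
      fix z :: "real \<times> real"
      have "(fst z + snd z, fst z - snd z) \<in> S \<longleftrightarrow> z \<in> G" by (simp add: S_def)
      then show "indicator G z * (p (fst z + snd z) * p (fst z - snd z)) =
         (\<lambda>w. indicator S w * (?q (fst w) * ?q (snd w))) (fst z + snd z, fst z - snd z)"
        using SJ[of "(fst z + snd z, fst z - snd z)"] by (cases "z \<in> G") (auto simp del: atLeastLessThan_iff)
    qed
    also have "\<dots> = (1/2) * (\<integral>w. indicator S w * (?q (fst w) * ?q (snd w)) \<partial>lborel)"
      by (rule integral_characteristic_coordinates[OF m])
    finally have "2 * \<bar>\<integral>z. indicator G z * (p (fst z + snd z) * p (fst z - snd z)) \<partial>lborel\<bar>
      = \<bar>\<integral>w. indicator S w * (?q (fst w) * ?q (snd w)) \<partial>lborel\<bar>" by simp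
    also have "\<dots> \<le> (\<Sum>(A, B)\<in>\<R>. \<bar>\<integral>x. indicator A x * ?q x \<partial>lborel\<bar> * \<bar>\<integral>x. indicator B x * ?q x \<partial>lborel\<bar>)
         + \<eta> / real M * (\<integral>x. (?q x)\<^sup>2 \<partial>lborel)"
      by (rule \<R>(3)[OF interval_restriction(1,2)[OF p]])
    also have "\<dots> = (\<Sum>(A, B)\<in>\<R>. \<bar>moment M A p\<bar> * \<bar>moment M B p\<bar>) + \<eta> * (\<integral>c. (p c)\<^sup>2 \<partial>circ)"
      unfolding interval_restriction(3)[OF p] moment_def using M0 by simp
    finally show ?thesis .
  qed
  then show ?thesis using that[OF \<R>(1,2)] by blast
qed

text \<open>Compactness-uniqueness argument. For normalised profiles with observation tending to 0,
  coercivity bounds c0 times the squared norm of a difference by its observation, finitely many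
  moments and half of the left side. Along a subsequence with convergent moments the profiles are
  Cauchy, and their norm limit is unobserved and not 0. The flag \<open>mean\<close> carries the
  Dirichlet constraint through the limit.\<close>

lemma observability_or_kernel:
  assumes \<epsilon>: "\<epsilon> = 1 \<or> \<epsilon> = -1" and c0: "c0 > 0" "AE c in circ. ennreal c0 \<le> emeasure lborel (char_times G c)"
    and no: "\<And>C. C > 0 \<Longrightarrow> \<exists>p. periodic_L2 p \<and> (mean \<longrightarrow> (\<integral>c. p c \<partial>circ) = 0) \<and> C * obs_form \<epsilon> G p < (\<integral>c. (p c)\<^sup>2 \<partial>circ)"
  obtains p where "periodic_L2 p" "mean \<Longrightarrow> (\<integral>c. p c \<partial>circ) = 0" "(\<integral>c. (p c)\<^sup>2 \<partial>circ) > 0" "obs_form \<epsilon> G p = 0"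
proof -
  define nq where "nq p = (\<integral>c. (p c)\<^sup>2 \<partial>circ)" for p :: "real \<Rightarrow> real"
  have "\<exists>p. periodic_L2 p \<and> (mean \<longrightarrow> (\<integral>c. p c \<partial>circ) = 0) \<and> nq p = 1 \<and> obs_form \<epsilon> G p < 1 / real (Suc n)" for n
  proof -
    obtain q where q: "periodic_L2 q" "mean \<longrightarrow> (\<integral>c. q c \<partial>circ) = 0" "real (Suc n) * obs_form \<epsilon> G q < nq q"
      using no[of "real (Suc n)"] by (auto simp: nq_def)
    have pos: "nq q > 0"
      using q(3) mult_nonneg_nonneg[of "real (Suc n)" "obs_form \<epsilon> G q"] obs_form_nonneg[of \<epsilon> G q] by linarith
    define k where "k = 1 / sqrt (nq q)"
    have k2: "k\<^sup>2 = 1 / nq q" using pos by (simp add: k_def power_divide)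
    have "nq (\<lambda>x. k * q x) = 1" unfolding nq_def power_mult_distrib k2 using pos by (simp add: nq_def)
    moreover have "obs_form \<epsilon> G (\<lambda>x. k * q x) < 1 / real (Suc n)"
      unfolding obs_form_cmult k2 using q(3) pos by (simp add: field_simps)
    moreover have "mean \<longrightarrow> (\<integral>c. k * q c \<partial>circ) = 0" using q(2) by simp
    ultimately show ?thesis using periodic_L2_cmult[OF q(1), of k] by blast
  qed
  then obtain P where P: "\<And>n. periodic_L2 (P n)" "\<And>n. mean \<longrightarrow> (\<integral>c. P n c \<partial>circ) = 0" "\<And>n. nq (P n) = 1"
    "\<And>n. obs_form \<epsilon> G (P n) < 1 / real (Suc n)" by metis
  \<comment> \<open>Tolerance c0/2, so that the remainder is absorbed by the lower bound c0 of the
    diagonal part.\<close>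
  obtain M \<R> where \<R>: "finite \<R>" "\<And>A B. (A, B) \<in> \<R> \<Longrightarrow> A \<in> sets borel \<and> B \<in> sets borel"
    "\<And>p. periodic_L2 p \<Longrightarrow> 2 * \<bar>\<integral>z. indicator G z * (p (fst z + snd z) * p (fst z - snd z)) \<partial>lborel\<bar> \<le>
      (\<Sum>(A, B)\<in>\<R>. \<bar>moment M A p\<bar> * \<bar>moment M B p\<bar>) + c0 / 2 * (\<integral>c. (p c)\<^sup>2 \<partial>circ)"
    by (rule cross_form_compact[of "c0 / 2"]) (use c0(1) in simp, rule that)
  define I where "I = fst ` \<R> \<union> snd ` \<R>"
  have I: "finite I" "\<And>A. A \<in> I \<Longrightarrow> A \<in> sets borel" using \<R>(1,2) by (auto simp: I_def)
  have "bounded (range (\<lambda>n. moment M A (P n)))" if "A \<in> I" for A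
  proof -
    have "norm (moment M A (P n)) \<le> sqrt (2 * real M * real M)" for n
      using moment_bound[OF P(1) I(2)[OF that], of M n] P(3)[of n] by (simp add: nq_def real_le_rsqrt)
    then show ?thesis by (auto simp: bounded_iff)
  qed
  then obtain r where r: "strict_mono r" "\<And>A. A \<in> I \<Longrightarrow> convergent (\<lambda>n. moment M A (P (r n)))"
    using bounded_family_convergent_subsequence[OF I(1), of "\<lambda>A n. moment M A (P n)"] by auto
  define Q where "Q n = P (r n)" for n
  have Q: "periodic_L2 (Q n)" "nq (Q n) = 1" "mean \<longrightarrow> (\<integral>c. Q n c \<partial>circ) = 0" for n
    using P by (auto simp: Q_def)
  have Qo: "(\<lambda>n. obs_form \<epsilon> G (Q n)) \<longlonglongrightarrow> 0"
  proof (rule Lim_null_comparison)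
    have "norm (obs_form \<epsilon> G (Q n)) \<le> inverse (real (Suc n))" for n
    proof -
      have "obs_form \<epsilon> G (Q n) \<le> 1 / real (Suc (r n))" unfolding Q_def using P(4)[of "r n"] by linarith
      also have "\<dots> \<le> 1 / real (Suc n)" using seq_suble[OF r(1), of n] by (intro divide_left_mono) auto
      finally show ?thesis using obs_form_nonneg[of \<epsilon> G "Q n"] by (simp add: divide_inverse)
    qed
    then show "\<forall>\<^sub>F n in sequentially. norm (obs_form \<epsilon> G (Q n)) \<le> inverse (real (Suc n))" by simp
  qed (rule LIMSEQ_inverse_real_of_nat)
  have key: "c0 / 2 * nq (\<lambda>x. Q m x - Q n x) \<le> 2 * obs_form \<epsilon> G (Q m) + 2 * obs_form \<epsilon> G (Q n) +
     (\<Sum>(A, B)\<in>\<R>. \<bar>moment M A (Q m) - moment M A (Q n)\<bar> * \<bar>moment M B (Q m) - moment M B (Q n)\<bar>)" for m n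
  proof -
    define d where "d x = Q m x - Q n x" for x
    have d: "periodic_L2 d" unfolding d_def by (rule periodic_L2_diff[OF Q(1) Q(1)])
    have md: "moment M A d = moment M A (Q m) - moment M A (Q n)" if "A \<in> sets borel" for A
      unfolding d_def by (rule moment_diff[OF Q(1) Q(1) that])
    have "c0 * nq d \<le> obs_form \<epsilon> G d + 2 * \<bar>\<integral>z. indicator G z * (d (fst z + snd z) * d (fst z - snd z)) \<partial>lborel\<bar>"
      using sum_form_ge[OF d _ c0(2)] c0(1) obs_form_eq(2)[OF d \<epsilon>] \<epsilon> by (auto simp: nq_def)
    also have "\<dots> \<le> obs_form \<epsilon> G d + ((\<Sum>(A, B)\<in>\<R>. \<bar>moment M A d\<bar> * \<bar>moment M B d\<bar>) + c0 / 2 * nq d)"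
      using \<R>(3)[OF d] by (simp add: nq_def)
    also have "(\<Sum>(A, B)\<in>\<R>. \<bar>moment M A d\<bar> * \<bar>moment M B d\<bar>) =
       (\<Sum>(A, B)\<in>\<R>. \<bar>moment M A (Q m) - moment M A (Q n)\<bar> * \<bar>moment M B (Q m) - moment M B (Q n)\<bar>)"
      by (intro sum.cong refl) (use \<R>(2) md in auto)
    also have "obs_form \<epsilon> G d \<le> 2 * obs_form \<epsilon> G (Q m) + 2 * obs_form \<epsilon> G (Q n)"
      unfolding d_def by (rule obs_form_add_le[OF Q(1) Q(1) \<epsilon>])
    finally show ?thesis unfolding d_def[symmetric] by simp
  qed
  have cauchy: "\<exists>N. \<forall>m\<ge>N. \<forall>n\<ge>N. (\<integral>x. (Q m x - Q n x)\<^sup>2 \<partial>circ) < e" if "e > 0" for e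
  proof -
    \<comment> \<open>Two observations with factor 2 each and one product of moments per element of
      \<open>\<R>\<close> give 4 plus the cardinality; the 5 makes the inequality strict.\<close>
    define \<delta> where "\<delta> = c0 / 2 * e / (5 + real (card \<R>))"
    have \<delta>: "\<delta> > 0" using c0(1) that by (auto simp: \<delta>_def intro!: divide_pos_pos)
    have "\<forall>\<^sub>F n in sequentially. obs_form \<epsilon> G (Q n) < \<delta>" using order_tendstoD(2)[OF Qo \<delta>] .
    then obtain N1 where N1: "\<And>n. n \<ge> N1 \<Longrightarrow> obs_form \<epsilon> G (Q n) < \<delta>" by (auto simp: eventually_sequentially)
    have "\<exists>N. \<forall>m\<ge>N. \<forall>n\<ge>N. \<bar>moment M A (Q m) - moment M A (Q n)\<bar> < sqrt \<delta>" if "A \<in> I" for A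
      using r(2)[OF that] \<delta> unfolding Q_def Cauchy_convergent_iff[symmetric] Cauchy_def dist_real_def by auto
    then obtain N2 where N2: "\<And>A m n. A \<in> I \<Longrightarrow> m \<ge> N2 A \<Longrightarrow> n \<ge> N2 A \<Longrightarrow> \<bar>moment M A (Q m) - moment M A (Q n)\<bar> < sqrt \<delta>" by metis
    define N where "N = max N1 (Max (insert 0 (N2 ` I)))"
    have N: "N \<ge> N1" "\<And>A. A \<in> I \<Longrightarrow> N \<ge> N2 A"
      using I(1) by (auto simp: N_def intro!: max.coboundedI2 Max_ge)
    have "(\<integral>x. (Q m x - Q n x)\<^sup>2 \<partial>circ) < e" if mn: "m \<ge> N" "n \<ge> N" for m n
    proof -
      have "(\<Sum>(A, B)\<in>\<R>. \<bar>moment M A (Q m) - moment M A (Q n)\<bar> * \<bar>moment M B (Q m) - moment M B (Q n)\<bar>) \<le> (\<Sum>(A, B)\<in>\<R>. \<delta>)"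
      proof (rule sum_mono, clarify)
        fix A B assume "(A, B) \<in> \<R>"
        then have AB: "A \<in> I" "B \<in> I" by (force simp: I_def)+
        have "\<bar>moment M A (Q m) - moment M A (Q n)\<bar> * \<bar>moment M B (Q m) - moment M B (Q n)\<bar> \<le> sqrt \<delta> * sqrt \<delta>"
          using N2[OF AB(1), of m n] N2[OF AB(2), of m n] N(2)[OF AB(1)] N(2)[OF AB(2)] mn \<delta> by (intro mult_mono) auto
        then show "\<bar>moment M A (Q m) - moment M A (Q n)\<bar> * \<bar>moment M B (Q m) - moment M B (Q n)\<bar> \<le> \<delta>" using \<delta> by simp
      qed
      also have "\<dots> = real (card \<R>) * \<delta>" by (simp add: case_prod_beta)
      finally have "c0 / 2 * nq (\<lambda>x. Q m x - Q n x) \<le> 2 * \<delta> + 2 * \<delta> + real (card \<R>) * \<delta>"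
        using key[of m n] N1[of m] N1[of n] N(1) mn by linarith
      also have "\<dots> < (5 + real (card \<R>)) * \<delta>" using \<delta> by (simp add: algebra_simps)
      also have "\<dots> = c0 / 2 * e"
      proof -
        have "5 + real (card \<R>) \<noteq> 0" by (rule less_imp_neq[symmetric], rule add_pos_nonneg) simp_all
        then show ?thesis unfolding \<delta>_def by (subst times_divide_eq_right) (rule nonzero_mult_div_cancel_left)
      qed
      finally show ?thesis using c0(1) by (simp add: nq_def)
    qed
    then show ?thesis by blast
  qed
  obtain g where g: "sq_integrable circ g" "(\<lambda>n. \<integral>x. (Q n x - g x)\<^sup>2 \<partial>circ) \<longlonglongrightarrow> 0"
    by (rule Riesz_Fischer[OF finite_measure_circ periodic_L2_sq[OF Q(1)] cauchy])
  obtain p where p: "periodic_L2 p" "\<And>x. x \<in> {-1<..<1} \<Longrightarrow> p x = g x" using periodic_L2_version[OF g(1)] by metis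
  have "(\<integral>x. (Q n x - g x)\<^sup>2 \<partial>circ) = nq (\<lambda>x. Q n x - p x)" for n
    unfolding nq_def using p(2) by (intro Bochner_Integration.integral_cong) auto
  then have lim: "(\<lambda>n. nq (\<lambda>x. Q n x - p x)) \<longlonglongrightarrow> 0" using g(2) by simp
  have sqQ: "sq_integrable circ (\<lambda>x. Q n x - p x)" for n by (rule periodic_L2_sq[OF periodic_L2_diff[OF Q(1) p(1)]])
  \<comment> \<open>The crude splitting of the square of Q = (Q - p) + p is enough, since only
    positivity of the norm of the limit is wanted.\<close>
  have "nq p \<ge> 1 / 2"
  proof -
    have "(\<lambda>n. 2 * nq (\<lambda>x. Q n x - p x) + 2 * nq p) \<longlonglongrightarrow> 2 * 0 + 2 * nq p" by (intro tendsto_intros lim)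
    from LIMSEQ_le_const[OF this, of 1] have "(\<And>n. 1 \<le> 2 * nq (\<lambda>x. Q n x - p x) + 2 * nq p) \<Longrightarrow> ?thesis" by auto
    moreover have "1 \<le> 2 * nq (\<lambda>x. Q n x - p x) + 2 * nq p" for n
      using integral_sq_add_le[OF sqQ[of n] periodic_L2_sq[OF p(1)]] Q(2)[of n] by (simp add: nq_def)
    ultimately show ?thesis by blast
  qed
  moreover have "obs_form \<epsilon> G p = 0"
  proof -
    have "(\<lambda>n. 2 * obs_form \<epsilon> G (Q n) + 2 * (2 * T * nq (\<lambda>x. Q n x - p x))) \<longlonglongrightarrow> 2 * 0 + 2 * (2 * T * 0)"
      by (intro tendsto_intros lim Qo)
    from LIMSEQ_le_const[OF this, of "obs_form \<epsilon> G p"]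
    have "(\<And>n. obs_form \<epsilon> G p \<le> 2 * obs_form \<epsilon> G (Q n) + 2 * (2 * T * nq (\<lambda>x. Q n x - p x))) \<Longrightarrow> obs_form \<epsilon> G p \<le> 0" by auto
    moreover have "obs_form \<epsilon> G p \<le> 2 * obs_form \<epsilon> G (Q n) + 2 * (2 * T * nq (\<lambda>x. Q n x - p x))" for n
      using obs_form_add_le[OF Q(1)[of n] periodic_L2_diff[OF Q(1)[of n] p(1)] \<epsilon>]
        obs_form_le_T[OF periodic_L2_diff[OF Q(1)[of n] p(1)] \<epsilon>] by (simp add: nq_def)
    ultimately have "obs_form \<epsilon> G p \<le> 0" by blast
    then show ?thesis using obs_form_nonneg[of \<epsilon> G p] by simp
  qed
  moreover have "(\<integral>c. p c \<partial>circ) = 0" if mean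
  proof -
    have "(\<lambda>n. nq (\<lambda>x. Q n x - p x) * 2) \<longlonglongrightarrow> 0 * 2" by (intro tendsto_intros lim)
    from LIMSEQ_le_const[OF this, of "(\<integral>c. p c \<partial>circ)\<^sup>2"]
    have "(\<And>n. (\<integral>c. p c \<partial>circ)\<^sup>2 \<le> nq (\<lambda>x. Q n x - p x) * 2) \<Longrightarrow> (\<integral>c. p c \<partial>circ)\<^sup>2 \<le> 0" by auto
    moreover have "(\<integral>c. p c \<partial>circ)\<^sup>2 \<le> nq (\<lambda>x. Q n x - p x) * 2" for n
    proof -
      have s1: "sq_integrable circ (\<lambda>x. 1)" by (rule sq_integrable_bounded[OF finite_measure_circ, of _ 1]) auto
      have "(\<integral>c. Q n c - p c \<partial>circ) = - (\<integral>c. p c \<partial>circ)"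
        using Q(3)[of n] that sq_integrable_integrable[OF finite_measure_circ periodic_L2_sq[OF Q(1)[of n]]]
          sq_integrable_integrable[OF finite_measure_circ periodic_L2_sq[OF p(1)]] by simp
      then show ?thesis
        using integral_Cauchy_Schwarz[OF sqQ[of n] s1] integral_const_circ[of 1] by (simp add: nq_def)
    qed
    ultimately have "(\<integral>c. p c \<partial>circ)\<^sup>2 \<le> 0" by blast
    then show ?thesis by simp
  qed
  ultimately show ?thesis using that[OF p(1)] by (simp add: nq_def)
qed

end

section \<open>Hausdorff measure along characteristics and the double cover\<close>

text \<open>The fold is the distance to the nearest even integer, that is, a minimum of functions
  with Lipschitz constant 1; this is the minimality half.\<close>

lemma fold_unit_le: "fold_unit s \<le> \<bar>s - 2 * of_int k\<bar>"
proof (cases "\<bar>s - 2 * of_int k\<bar> < 1")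
  case True
  have "per s = per (s - 2 * of_int k)" using per_add_int[of "s - 2 * of_int k" k] by simp
  also have "\<dots> = s - 2 * of_int k" using True by (intro per_eq) auto
  finally show ?thesis by (simp add: fold_unit_per)
next
  case False
  have "fold_unit s \<le> 1" using per_bounds[of s] by (auto simp: fold_unit_per)
  then show ?thesis using False by linarith
qed

lemma fold_unit_Lipschitz: "\<bar>fold_unit s - fold_unit s'\<bar> \<le> \<bar>s - s'\<bar>"
proof -
  have *: "fold_unit a \<le> fold_unit b + \<bar>a - b\<bar>" for a b
  proof -
    define k where "k = \<lfloor>(b + 1) / 2\<rfloor>"
    have "fold_unit b = \<bar>b - 2 * of_int k\<bar>" by (simp add: fold_unit_per per_def k_def)
    moreover have "fold_unit a \<le> \<bar>a - 2 * of_int k\<bar>" by (rule fold_unit_le)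
    ultimately show ?thesis by linarith
  qed
  show ?thesis using *[of s s'] *[of s' s] by linarith
qed

definition char_curve :: "real \<Rightarrow> real \<Rightarrow> real \<times> real"
  where "char_curve c t = (t, fold_unit (c - t))"

text \<open>Each component has Lipschitz constant 1, and the distance in the plane is at most the
  sum of the two. The exact constant is irrelevant for (GCC).\<close>

lemma dist_char_curve: "dist (char_curve c s) (char_curve c t) \<le> 2 * \<bar>s - t\<bar>"
proof -
  have "dist (char_curve c s) (char_curve c t) \<le> \<bar>s - t\<bar> + \<bar>fold_unit (c - s) - fold_unit (c - t)\<bar>"
    unfolding char_curve_def dist_Pair_Pair dist_real_def by (rule sqrt_sum_squares_le_sum_abs[THEN order_trans]) simp
  also have "\<bar>fold_unit (c - s) - fold_unit (c - t)\<bar> \<le> \<bar>s - t\<bar>"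
    using fold_unit_Lipschitz[of "c - s" "c - t"] by simp
  finally show ?thesis by simp
qed

text \<open>Projection to the time axis does not increase distances, so a cover of \<open>S\<close>
  yields a cover of \<open>B\<close> by intervals whose lengths are the diameters. The single scale
  1 suffices because the Hausdorff measure is a supremum over scales.\<close>

lemma hausdorff1_ge_projection:
  fixes S :: "(real \<times> real) set"
  assumes B: "B \<in> sets borel" and sub: "B \<subseteq> fst ` S"
  shows "emeasure lborel B \<le> hausdorff1 S"
proof -
  have "emeasure lborel B \<le> hausdorff1_pre 1 S"
    unfolding hausdorff1_pre_def
  proof (rule INF_greatest)
    fix U assume "U \<in> {U :: nat \<Rightarrow> (real \<times> real) set. (\<forall>i. bounded (U i) \<and> diameter (U i) \<le> 1) \<and> S \<subseteq> (\<Union>i. U i)}"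
    then have U: "\<And>i. bounded (U i)" "S \<subseteq> (\<Union>i. U i)" by auto
    define a where "a i = Inf (fst ` U i)" for i
    define I where "I i = (if U i = {} then {} else {a i..a i + diameter (U i)})" for i
    have UI: "fst ` U i \<subseteq> I i" for i
    proof
      fix x assume "x \<in> fst ` U i"
      then obtain u where u: "u \<in> U i" "x = fst u" by blast
      have "x - diameter (U i) \<le> y" if y: "y \<in> fst ` U i" for y
      proof -
        obtain v where v: "v \<in> U i" "y = fst v" using y by blast
        have "x - y \<le> dist u v" using dist_fst_le[of u v] u v by (simp add: dist_real_def)
        also have "\<dots> \<le> diameter (U i)" by (rule diameter_bounded_bound[OF U(1) u(1) v(1)])
        finally show ?thesis by simp
      qed
      then have "x - diameter (U i) \<le> a i" unfolding a_def using u by (intro cInf_greatest) auto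
      moreover have "a i \<le> x"
        unfolding a_def using u bounded_fst[OF U(1)] by (intro cInf_lower bounded_imp_bdd_below) auto
      ultimately show "x \<in> I i" using u by (auto simp: I_def)
    qed
    have BI: "B \<subseteq> (\<Union>i. I i)"
    proof
      fix x assume "x \<in> B"
      then obtain z where z: "z \<in> S" "x = fst z" using sub by blast
      then obtain i where "z \<in> U i" using U(2) by blast
      then have "x \<in> I i" using UI z(2) by (metis imageI subsetD)
      then show "x \<in> (\<Union>i. I i)" by (rule UN_I[OF UNIV_I])
    qed
    have Im: "range I \<subseteq> sets lborel" by (auto simp: I_def)
    then have "(\<Union>i. I i) \<in> sets lborel" by (intro sets.countable_UN)
    then have "emeasure lborel B \<le> emeasure lborel (\<Union>i. I i)" by (rule emeasure_mono[OF BI])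
    also have "\<dots> \<le> (\<Sum>i. emeasure lborel (I i))" by (rule emeasure_subadditive_countably[OF Im])
    also have "\<dots> \<le> (\<Sum>i. ennreal (diameter (U i)))"
      by (intro suminf_le) (use diameter_ge_0[OF U(1)] in \<open>auto simp: I_def\<close>)
    finally show "emeasure lborel B \<le> (\<Sum>i. ennreal (diameter (U i)))" .
  qed
  also have "\<dots> \<le> hausdorff1 S" unfolding hausdorff1_def by (rule SUP_upper) simp
  finally show ?thesis .
qed

text \<open>The interiors of a non-overlapping cover are disjoint, so the lengths add up to the
  measure of a set barely larger than \<open>B\<close>. A sequence of intervals is produced because
  the Hausdorff premeasure is taken over sequences.\<close>

lemma interval_cover:
  fixes B :: "real set"
  assumes B: "B \<in> sets lebesgue" "B \<subseteq> {l..u}" and "\<eta> > 0"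
  obtains a b :: "nat \<Rightarrow> real" where "\<And>i. a i \<le> b i" "\<And>i. b i - a i \<le> \<bar>u - l\<bar>" "B \<subseteq> (\<Union>i. {a i..b i})"
    "(\<Sum>i. ennreal (b i - a i)) \<le> emeasure lebesgue B + ennreal \<eta>"
proof (cases "l \<le> u")
  case False
  then show ?thesis using that[of "\<lambda>_. 0" "\<lambda>_. 0"] B by auto
next
  case lu: True
  have Bl: "B \<in> lmeasurable" using B by (intro bounded_set_imp_lmeasurable) (use bounded_subset[OF bounded_closed_interval] in auto)
  obtain \<D> where \<D>: "countable \<D>" "\<And>K. K \<in> \<D> \<Longrightarrow> K \<subseteq> cbox l u \<and> K \<noteq> {} \<and> (\<exists>c d. K = cbox c d)"
     "pairwise (\<lambda>A B. interior A \<inter> interior B = {}) \<D>" "B \<subseteq> \<Union>\<D>" "\<Union>\<D> \<in> lmeasurable"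
     "measure lebesgue (\<Union>\<D>) \<le> measure lebesgue B + \<eta>"
    using measurable_outer_intervals_bounded[of B l u \<eta>] B Bl \<open>\<eta> > 0\<close> by (metis cbox_interval)
  define used where "used = to_nat_on \<D> ` \<D>"
  \<comment> \<open>Indices that the enumeration leaves free receive a degenerate interval, which
    adds length 0.\<close>
  define K where "K i = (if i \<in> used then from_nat_into \<D> i else {l..l})" for i
  have Kin: "from_nat_into \<D> i \<in> \<D>" "to_nat_on \<D> (from_nat_into \<D> i) = i" if "i \<in> used" for i
    using that \<D>(1) by (auto simp: used_def)
  have "\<exists>c d. K i = {c..d} \<and> c \<le> d \<and> d - c \<le> u - l" for i
  proof (cases "i \<in> used")
    case True
    from \<D>(2)[OF Kin(1)[OF True]] obtain c d where "from_nat_into \<D> i = cbox c d" by blast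
    then have cd: "K i = {c..d}" "{c..d} \<subseteq> {l..u}" "{c..d} \<noteq> {}"
      using \<D>(2)[OF Kin(1)[OF True]] True by (simp_all add: K_def)
    then show ?thesis by (intro exI[of _ c] exI[of _ d]) auto
  next
    case False
    then show ?thesis using lu by (intro exI[of _ l]) (auto simp: K_def)
  qed
  then obtain a b where ab: "\<And>i. K i = {a i..b i}" "\<And>i. a i \<le> b i" "\<And>i. b i - a i \<le> u - l" by metis
  have cov: "B \<subseteq> (\<Union>i. K i)"
  proof
    fix x assume "x \<in> B"
    then obtain X where X: "X \<in> \<D>" "x \<in> X" using \<D>(4) by blast
    then have "K (to_nat_on \<D> X) = X" using \<D>(1) by (simp add: K_def used_def)
    then show "x \<in> (\<Union>i. K i)" using X by blast
  qed
  have disj: "disjoint_family (\<lambda>i. {a i<..<b i})"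
    unfolding disjoint_family_on_def
  proof (intro ballI impI)
    fix i j :: nat assume ij: "i \<noteq> j"
    show "{a i<..<b i} \<inter> {a j<..<b j} = {}"
    proof (cases "i \<in> used \<and> j \<in> used")
      case True
      then have "from_nat_into \<D> i \<noteq> from_nat_into \<D> j" using Kin(2) ij by metis
      then have "interior (K i) \<inter> interior (K j) = {}"
        using True pairwiseD[OF \<D>(3) Kin(1) Kin(1)] by (simp add: K_def)
      then show ?thesis unfolding ab(1) interior_atLeastAtMost_real .
    next
      case False
      then have "a i = b i \<or> a j = b j" using ab(1)[of i] ab(1)[of j] ab(2)[of i] ab(2)[of j]
        unfolding K_def by (metis Icc_eq_Icc order_refl)
      then show ?thesis by auto
    qed
  qed
  have "(\<Sum>i. ennreal (b i - a i)) = (\<Sum>i. emeasure lborel {a i<..<b i})" using ab(2) by simp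
  also have "\<dots> = emeasure lborel (\<Union>i. {a i<..<b i})" by (rule suminf_emeasure[OF _ disj]) auto
  also have "\<dots> = emeasure lebesgue (\<Union>i. {a i<..<b i})"
    by (simp add: borel_open open_UN)
  also have "\<dots> \<le> emeasure lebesgue (\<Union>\<D>)"
  proof (rule emeasure_mono)
    show "(\<Union>i. {a i<..<b i}) \<subseteq> \<Union>\<D>"
    proof
      fix x assume "x \<in> (\<Union>i. {a i<..<b i})"
      then obtain i where i: "a i < x" "x < b i" by auto
      then have xK: "x \<in> K i" unfolding ab(1) by simp
      have "i \<in> used"
      proof (rule ccontr)
        assume "i \<notin> used"
        then have "{a i..b i} = {l..l}" using ab(1)[of i] by (simp add: K_def)
        then show False using i ab(2)[of i] by (metis Icc_eq_Icc less_asym less_le_trans order_less_irrefl less_trans)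
      qed
      then show "x \<in> \<Union>\<D>" using xK Kin(1) by (auto simp: K_def)
    qed
    show "\<Union>\<D> \<in> sets lebesgue" using \<D>(5) by (rule fmeasurableD)
  qed
  also have "\<dots> \<le> emeasure lebesgue B + ennreal \<eta>"
    using \<D>(5,6) Bl \<open>\<eta> > 0\<close> by (simp add: emeasure_eq_measure2 ennreal_leI flip: ennreal_plus)
  finally have total: "(\<Sum>i. ennreal (b i - a i)) \<le> emeasure lebesgue B + ennreal \<eta>" .
  show ?thesis
  proof (rule that[OF ab(2) _ _ total])
    show "b i - a i \<le> \<bar>u - l\<bar>" for i using ab(3)[of i] lu by linarith
    show "B \<subseteq> (\<Union>i. {a i..b i})" using cov unfolding ab(1) .
  qed
qed

text \<open>\<open>B\<close> is covered by intervals of total length close to its measure, and each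
  is cut into \<open>m\<close> equal pieces to bring the images below the scale \<delta>. Cutting
  leaves the total length unchanged, and the Lipschitz constant of the curve gives the factor
  2.\<close>

lemma hausdorff1_char_curve_le:
  assumes B: "B \<in> sets lebesgue" "B \<subseteq> {0..T}"
  shows "hausdorff1 (char_curve c ` B) \<le> 2 * emeasure lebesgue B"
  unfolding hausdorff1_def
proof (rule SUP_least)
  fix \<delta> :: real assume "\<delta> \<in> {0<..}"
  then have \<delta>: "\<delta> > 0" by simp
  show "hausdorff1_pre \<delta> (char_curve c ` B) \<le> 2 * emeasure lebesgue B"
  proof (rule ennreal_le_epsilon)
    fix e :: real assume "e > 0"
    then have e2: "e / 2 > 0" by simp
    obtain a b :: "nat \<Rightarrow> real" where ab: "\<And>i. a i \<le> b i" "\<And>i. b i - a i \<le> \<bar>T - 0\<bar>" "B \<subseteq> (\<Union>i. {a i..b i})"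
      "(\<Sum>i. ennreal (b i - a i)) \<le> emeasure lebesgue B + ennreal (e / 2)"
      by (rule interval_cover[OF B e2]) (rule that)
    obtain m' :: nat where m': "2 * \<bar>T\<bar> / \<delta> < real m'" using reals_Archimedean2 by blast
    define m where "m = Suc m'"
    have m: "m > 0" "2 * \<bar>T\<bar> / real m \<le> \<delta>"
    proof -
      have "2 * \<bar>T\<bar> / \<delta> < real m" using m' by (simp add: m_def)
      then show "2 * \<bar>T\<bar> / real m \<le> \<delta>" using \<delta> by (simp add: m_def field_simps)
    qed (simp add: m_def)
    define V where "V = (\<lambda>(i, j). if j < m then char_curve c ` {a i + real j * ((b i - a i) / real m)..a i + real (Suc j) * ((b i - a i) / real m)} else {})"
    have Vd: "bounded (V (i, j)) \<and> diameter (V (i, j)) \<le> (if j < m then 2 * ((b i - a i) / real m) else 0)" for i j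
    proof (cases "j < m")
      case True
      have len: "0 \<le> (b i - a i) / real m" using ab(1)[of i] by simp
      have V_le: "dist x y \<le> 2 * ((b i - a i) / real m)" if xy: "x \<in> V (i, j)" "y \<in> V (i, j)" for x y
      proof -
        obtain s t where st: "x = char_curve c s" "y = char_curve c t"
          "s \<in> {a i + real j * ((b i - a i) / real m)..a i + real (Suc j) * ((b i - a i) / real m)}"
          "t \<in> {a i + real j * ((b i - a i) / real m)..a i + real (Suc j) * ((b i - a i) / real m)}"
          using xy True by (auto simp: V_def)
        have st_le: "\<bar>s - t\<bar> \<le> (b i - a i) / real m"
          using st(3,4) unfolding atLeastAtMost_iff of_nat_Suc distrib_right mult_1_left by linarith
        have "dist x y \<le> 2 * \<bar>s - t\<bar>" unfolding st(1,2) by (rule dist_char_curve)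
        also have "\<dots> \<le> 2 * ((b i - a i) / real m)" using st_le by (rule mult_left_mono) simp
        finally show ?thesis .
      qed
      have "bounded (V (i, j))" unfolding bounded_two_points using V_le by blast
      moreover have "diameter (V (i, j)) \<le> 2 * ((b i - a i) / real m)"
      proof (rule diameter_le)
        show "V (i, j) \<noteq> {} \<or> 0 \<le> 2 * ((b i - a i) / real m)" using len by linarith
        show "norm (x - y) \<le> 2 * ((b i - a i) / real m)" if "x \<in> V (i, j)" "y \<in> V (i, j)" for x y
          using V_le[OF that] unfolding dist_norm .
      qed
      ultimately show ?thesis using True by simp
    qed (simp add: V_def)
    have "char_curve c ` B \<subseteq> (\<Union>n. V (prod_decode n))"
    proof
      fix z assume "z \<in> char_curve c ` B"
      then obtain t where t: "t \<in> B" "z = char_curve c t" by blast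
      have "t \<in> (\<Union>i. {a i..b i})" using subsetD[OF ab(3) t(1)] .
      then obtain i where i: "a i \<le> t" "t \<le> b i" by auto
      define h where "h = (b i - a i) / real m"
      have "\<exists>j<m. t \<in> {a i + real j * h..a i + real (Suc j) * h}"
      \<comment> \<open>At the right endpoint of a nondegenerate interval the floor would be
        \<open>m\<close>, one past the last piece \<open>m'\<close>. This case also takes care of
        degenerate intervals, so that \<open>h\<close> is positive in the other one.\<close>
      proof (cases "t = b i")
        case True
        have "a i + real (Suc m') * h = b i" using m(1) by (simp add: h_def m_def)
        moreover have "h \<ge> 0" using ab(1)[of i] by (simp add: h_def)
        ultimately show ?thesis using True by (intro exI[of _ m']) (auto simp: m_def distrib_right)
      next
        case False
        then have h: "h > 0" using i m(1) by (simp add: h_def)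
        define j where "j = nat \<lfloor>(t - a i) / h\<rfloor>"
        have f: "0 \<le> (t - a i) / h" using i h by simp
        have j: "real j \<le> (t - a i) / h" "(t - a i) / h < real j + 1"
          using f unfolding j_def by (auto simp: of_nat_nat)
        have "(t - a i) / h < real m" using False i h m(1) by (simp add: h_def field_simps)
        then have "j < m" using j(1) by linarith
        moreover have "a i + real j * h \<le> t" "t \<le> a i + real (Suc j) * h"
          using j h by (auto simp: field_simps)
        ultimately show ?thesis by (intro exI[of _ j]) auto
      qed
      then obtain j where "j < m" "t \<in> {a i + real j * h..a i + real (Suc j) * h}" by blast
      then have "z \<in> V (prod_decode (prod_encode (i, j)))" using t(2) by (auto simp: V_def h_def)
      then show "z \<in> (\<Union>n. V (prod_decode n))" by blast
    qed
    moreover have "bounded (V (prod_decode n)) \<and> diameter (V (prod_decode n)) \<le> \<delta>" for n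
    proof -
      obtain i j where ij: "prod_decode n = (i, j)" by (cases "prod_decode n")
      have "2 * ((b i - a i) / real m) \<le> 2 * \<bar>T\<bar> / real m" using ab(2)[of i] m(1) by (simp add: divide_right_mono)
      then show ?thesis using Vd[of i j] m(2) \<delta> ij by (auto split: if_splits)
    qed
    ultimately have "hausdorff1_pre \<delta> (char_curve c ` B) \<le> (\<Sum>n. ennreal (diameter (V (prod_decode n))))"
      unfolding hausdorff1_pre_def by (intro INF_lower) auto
    also have "\<dots> = (\<Sum>i. \<Sum>j. ennreal (diameter (V (i, j))))"
      by (rule suminf_ennreal_2dimen[of "\<lambda>i. \<Sum>j. ennreal (diameter (V (i, j)))" "\<lambda>p. ennreal (diameter (V p))"]) simp
    also have "\<dots> \<le> (\<Sum>i. 2 * ennreal (b i - a i))"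
    proof (intro suminf_le)
      fix i
      have "(\<Sum>j. ennreal (diameter (V (i, j)))) = (\<Sum>j<m. ennreal (diameter (V (i, j))))"
        by (rule suminf_finite) (auto simp: V_def)
      also have "\<dots> \<le> (\<Sum>j<m. ennreal (2 * ((b i - a i) / real m)))"
      proof (rule sum_mono)
        fix j assume "j \<in> {..<m}"
        then have "diameter (V (i, j)) \<le> 2 * ((b i - a i) / real m)"
          using conjunct2[OF Vd[of i j]] by simp
        then show "ennreal (diameter (V (i, j))) \<le> ennreal (2 * ((b i - a i) / real m))"
          by (rule ennreal_leI)
      qed
      also have "\<dots> = ennreal (\<Sum>j<m. 2 * ((b i - a i) / real m))"
        using ab(1)[of i] by (intro sum_ennreal) auto
      also have "(\<Sum>j<m. 2 * ((b i - a i) / real m)) = 2 * (b i - a i)" using m(1) by simp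
      also have "ennreal (2 * (b i - a i)) = 2 * ennreal (b i - a i)"
        using ennreal_mult[of 2 "b i - a i"] ab(1)[of i] by simp
      finally show "(\<Sum>j. ennreal (diameter (V (i, j)))) \<le> 2 * ennreal (b i - a i)" .
    qed auto
    also have "\<dots> = 2 * (\<Sum>i. ennreal (b i - a i))" by (rule ennreal_suminf_cmult)
    also have "\<dots> \<le> 2 * (emeasure lebesgue B + ennreal (e / 2))" by (intro mult_left_mono ab(4)) simp
    also have "\<dots> = 2 * emeasure lebesgue B + ennreal e"
      using ennreal_mult[of 2 "e / 2"] \<open>e > 0\<close> by (simp add: distrib_left)
    finally show "hausdorff1_pre \<delta> (char_curve c ` B) \<le> 2 * emeasure lebesgue B + ennreal e" .
  qed
qed

text \<open>The label \<open>Eta\<close> marks the left-moving characteristics, which carry \<open>p (t + x)\<close>; unfolding the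
  reflections identifies the double cover with the circle of length 2, \<open>[x; Eta]\<close> being the point
  \<open>x\<close> and \<open>[x; Xi]\<close> the point \<open>-x\<close>.\<close>

fun pos :: "real \<times> label \<Rightarrow> real"
  where
    "pos (x, Eta) = x"
  | "pos (x, Xi) = - x"

text \<open>The inverse of \<open>pos\<close>, extended periodically to the line. At integers the
  first component is 0 or 1 and the value lies outside \<open>space cover\<close>; these points form
  a null set.\<close>

definition lab :: "real \<Rightarrow> real \<times> label"
  where "lab s = (fold_unit s, if per s \<ge> 0 then Eta else Xi)"

lemma pos_lab: "pos (lab s) = per s"
  by (auto simp: lab_def fold_unit_per)

lemma lab_per: "lab (per s) = lab s"
  using per_per[of s 0] by (simp add: lab_def fold_unit_per)

lemma lab_pos:
  assumes "y \<in> unit_iv \<times> UNIV" shows "lab (pos y) = y"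
proof -
  obtain x \<sigma> where y: "y = (x, \<sigma>)" "0 < x" "x < 1" using assms by (cases y) auto
  then show ?thesis by (cases \<sigma>) (auto simp: lab_def fold_unit_per per_eq)
qed

lemma pos_bounds: "y \<in> unit_iv \<times> UNIV \<Longrightarrow> -1 < pos y \<and> pos y < 1 \<and> pos y \<noteq> 0"
  by (cases y rule: pos.cases) auto

lemma char_point_eq: "char_point y s = char_curve (pos y) s"
proof (cases y rule: pos.cases)
  case (2 x)
  then show ?thesis using fold_unit_minus[of "x + s"] by (simp add: char_curve_def)
qed (simp add: char_curve_def)

lemma per_eq_iff: "per a = per b \<longleftrightarrow> (\<exists>k::int. a = b + 2 * of_int k)"
proof
  assume "per a = per b"
  then have "a = b + 2 * of_int (\<lfloor>(a + 1) / 2\<rfloor> - \<lfloor>(b + 1) / 2\<rfloor>)" by (simp add: per_def algebra_simps)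
  then show "\<exists>k::int. a = b + 2 * of_int k" by blast
next
  assume "\<exists>k::int. a = b + 2 * of_int k"
  then show "per a = per b" using per_add_int by auto
qed

lemma fold_unit_eq_iff:
  assumes "0 < x" "x < 1"
  shows "fold_unit (c - t) = x \<longleftrightarrow> per c = per (t + x) \<or> per c = per (t - x)"
proof -
  have "fold_unit (c - t) = x \<longleftrightarrow> per (c - t) = x \<or> per (c - t) = - x"
    using assms by (auto simp: fold_unit_per abs_if)
  also have "\<dots> \<longleftrightarrow> per (c - t) = per x \<or> per (c - t) = per (- x)"
    using assms by (simp add: per_eq)
  also have "\<dots> \<longleftrightarrow> per c = per (t + x) \<or> per c = per (t - x)"
    unfolding per_eq_iff by (auto simp: algebra_simps)
  finally show ?thesis .
qed

text \<open>Through an interior point pass the characteristics whose positions on the circle are t +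
  x and t - x modulo 2. This turns membership in an intersection set into a condition on two points
  of the circle.\<close>

lemma char_line_iff:
  assumes y: "y \<in> unit_iv \<times> UNIV" and "t \<ge> 0" "0 < x" "x < 1"
  shows "(t, x) \<in> char_line y \<longleftrightarrow> y = lab (t + x) \<or> y = lab (t - x)"
proof -
  have "(t, x) \<in> char_line y \<longleftrightarrow> fold_unit (pos y - t) = x"
    using assms by (auto simp: char_line_def char_point_eq char_curve_def)
  also have "\<dots> \<longleftrightarrow> pos y = per (t + x) \<or> pos y = per (t - x)"
    using fold_unit_eq_iff[OF assms(3,4)] pos_bounds[OF y] by (simp add: per_eq)
  also have "\<dots> \<longleftrightarrow> y = lab (t + x) \<or> y = lab (t - x)"
    using pos_lab lab_pos[OF y] lab_per by metis
  finally show ?thesis .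
qed

text \<open>The positions t + x and t - x agree modulo 2 only when x is an integer.\<close>

lemma lab_neq:
  assumes "0 < x" "x < 1" shows "lab (t + x) \<noteq> lab (t - x)"
proof
  assume "lab (t + x) = lab (t - x)"
  then have "per (t + x) = per (t - x)" using pos_lab by metis
  then obtain k :: int where "t + x = (t - x) + 2 * of_int k" unfolding per_eq_iff by blast
  then have "x = of_int k" by simp
  then show False using assms by simp
qed

lemma W_set_iff:
  assumes E: "E \<subseteq> unit_iv \<times> UNIV" and F: "F \<subseteq> unit_iv \<times> UNIV" and "t \<ge> 0" "0 < x" "x < 1"
  shows "(t, x) \<in> W_set E F \<longleftrightarrow> lab (t + x) \<in> E \<and> lab (t - x) \<in> F \<or> lab (t - x) \<in> E \<and> lab (t + x) \<in> F"
proof -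
  have e: "(t, x) \<in> char_line y \<longleftrightarrow> y = lab (t + x) \<or> y = lab (t - x)" if "y \<in> E \<or> y \<in> F" for y
    using that E F assms(3-5) by (intro char_line_iff) auto
  have "(t, x) \<in> W_set E F \<longleftrightarrow> (\<exists>y\<in>E. \<exists>z\<in>F. y \<noteq> z \<and> (y = lab (t + x) \<or> y = lab (t - x)) \<and> (z = lab (t + x) \<or> z = lab (t - x)))"
    using assms(3-5) e by (simp add: W_set_def)
  then show ?thesis using lab_neq[OF assms(4,5), of t] by metis
qed

lemma M_set_iff:
  assumes "A \<subseteq> unit_iv \<times> UNIV" "t \<ge> 0" "0 < x" "x < 1"
  shows "(t, x) \<in> M_set A \<longleftrightarrow> lab (t + x) \<in> A \<and> lab (t - x) \<in> A"
proof -
  have "M_set A = W_set A A" by (simp add: M_set_def W_set_def)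
  then show ?thesis using W_set_iff[OF assms(1,1-4)] by auto
qed

lemma null_sets_lebesgue_iff_AE: "N \<in> null_sets lebesgue \<longleftrightarrow> (AE z in lborel. z \<notin> N)"
  unfolding null_sets_completion_iff2 eventually_ae_filter by auto

context observation_set
begin

text \<open>Applied to the indicator of a null set of the circle,
  \<open>nn_integral_characteristics\<close> shows that almost no point of \<open>G\<close> lies on
  a characteristic starting there.\<close>

lemma AE_coordinates:
  assumes "AE c in circ. P c"
  shows "AE z in lborel. z \<in> G \<longrightarrow> P (per (fst z + snd z)) \<and> P (per (fst z - snd z))"
proof -
  have "AE c in lborel. -1 < c \<and> c < 1 \<longrightarrow> P c" using assms by (simp add: AE_circ)
  then obtain N where N: "N \<in> null_sets lborel" "{c. \<not> (-1 < c \<and> c < 1 \<longrightarrow> P c)} \<subseteq> N"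
    unfolding eventually_ae_filter by auto
  \<comment> \<open>\<open>circ\<close> does not see the point -1, but \<open>per\<close> takes this
    value.\<close>
  define N' where "N' = {-1} \<union> N"
  have "N' \<in> null_sets lborel"
    unfolding N'_def by (rule null_sets.Un[OF _ N(1)]) (simp add: finite_imp_null_set_lborel)
  then have N': "N' \<in> sets borel" "AE c in lborel. c \<notin> N'" by (auto intro: AE_not_in)
  have P: "P (per s)" if "per s \<notin> N'" for s
  proof -
    have "per s \<noteq> -1" "per s \<notin> N" using that by (auto simp: N'_def)
    then show ?thesis using N(2) per_bounds[of s] by force
  qed
  define f where "f c = (indicator N' (per c) :: ennreal)" for c
  have f: "f \<in> borel_measurable borel"
    unfolding f_def using N'(1) by measurable
  have fp: "periodic f" unfolding f_def by (rule periodic_comp_per)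
  have "(\<integral>\<^sup>+z. (f (fst z + snd z) + f (fst z - snd z)) * indicator G z \<partial>lborel)
       = (\<integral>\<^sup>+c. f c * emeasure lborel (char_times G c) \<partial>circ)"
    by (rule nn_integral_characteristics[OF G G_sub' f fp])
  also have "\<dots> = (\<integral>\<^sup>+c. 0 \<partial>circ)"
  proof (rule nn_integral_cong_AE)
    show "AE c in circ. f c * emeasure lborel (char_times G c) = 0"
      unfolding AE_circ using N'(2) by eventually_elim (auto simp: f_def per_eq)
  qed
  finally have z: "(\<integral>\<^sup>+z. (f (fst z + snd z) + f (fst z - snd z)) * indicator G z \<partial>lborel) = 0" by simp
  have m: "(\<lambda>z. (f (fst z + snd z) + f (fst z - snd z)) * indicator G z) \<in> borel_measurable lborel"
  proof -
    note [measurable] = f borel_pair_sets[OF G]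
    have "(\<lambda>z. (f (fst z + snd z) + f (fst z - snd z)) * indicator G z) \<in> borel_measurable (borel \<Otimes>\<^sub>M borel)"
      by measurable
    then show ?thesis by (simp add: borel_prod)
  qed
  have "AE z in lborel. (f (fst z + snd z) + f (fst z - snd z)) * indicator G z = 0"
    using z nn_integral_0_iff_AE[OF m] by simp
  then show ?thesis
  proof eventually_elim
    case (elim z)
    show ?case
    proof
      assume "z \<in> G"
      then have "f (fst z + snd z) = 0" "f (fst z - snd z) = 0" using elim by auto
      then show "P (per (fst z + snd z)) \<and> P (per (fst z - snd z))"
        using P by (auto simp: f_def indicator_def split: if_splits)
    qed
  qed
qed

lemma emeasure_char_times_measurable: "(\<lambda>c. emeasure lborel (char_times G c)) \<in> borel_measurable borel"
  and char_times_sets: "char_times G c \<in> sets borel"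
proof -
  note [measurable] = borel_pair_sets[OF G]
  have "(\<lambda>t. (t, fold_unit (c - t))) \<in> borel \<rightarrow>\<^sub>M borel \<Otimes>\<^sub>M borel" for c by measurable
  from measurable_sets[OF this borel_pair_sets[OF G]] have s: "char_times G c \<in> sets borel" for c
    by (simp add: char_times_def vimage_def)
  then show "char_times G c \<in> sets borel" .
  have "(\<lambda>c. \<integral>\<^sup>+t. indicator G (t, fold_unit (c - t)) \<partial>lborel) \<in> borel_measurable borel"
    by measurable
  moreover have "(\<integral>\<^sup>+t. indicator G (t, fold_unit (c - t)) \<partial>lborel) = emeasure lborel (char_times G c)" for c
  proof -
    have "(\<integral>\<^sup>+t. indicator G (t, fold_unit (c - t)) \<partial>lborel) = (\<integral>\<^sup>+t. indicator (char_times G c) t \<partial>lborel)"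
      by (intro nn_integral_cong) (auto simp: char_times_def indicator_def)
    then show ?thesis using s[of c] by simp
  qed
  ultimately show "(\<lambda>c. emeasure lborel (char_times G c)) \<in> borel_measurable borel" by simp
qed

lemma obs_form_eq_0_iff:
  assumes p: "periodic_L2 p" and \<epsilon>: "\<epsilon> = 1 \<or> \<epsilon> = -1"
  shows "obs_form \<epsilon> G p = 0 \<longleftrightarrow> (AE z in lborel. z \<in> G \<longrightarrow> dalembert \<epsilon> p (fst z) (snd z) = 0)"
proof -
  have "obs_form \<epsilon> G p = 0 \<longleftrightarrow> (AE z in lborel. indicator G z * (dalembert \<epsilon> p (fst z) (snd z))\<^sup>2 = 0)"
    unfolding obs_form_def by (rule integral_nonneg_eq_0_iff_AE[OF obs_form_eq(1)[OF p \<epsilon>]]) simp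
  also have "\<dots> \<longleftrightarrow> (AE z in lborel. z \<in> G \<longrightarrow> dalembert \<epsilon> p (fst z) (snd z) = 0)"
    by (intro AE_cong) (auto simp: indicator_def)
  finally show ?thesis .
qed

end

lemma sq_integral_circ_eq_0:
  assumes "periodic_L2 p" "(\<integral>c. (p c)\<^sup>2 \<partial>circ) \<le> 0"
  shows "AE c in circ. p c = 0"
proof -
  have "(\<integral>c. (p c)\<^sup>2 \<partial>circ) = 0"
    using assms(2) by (intro antisym) simp_all
  then have "AE c in circ. (p c)\<^sup>2 = 0"
    by (subst (asm) integral_nonneg_eq_0_iff_AE[OF sq_integrable_sq[OF periodic_L2_sq[OF assms(1)]]]) auto
  then show ?thesis by simp
qed

section \<open>Measurable sets of the double cover as sets on the circle\<close>

lemma lab_unit_iv: "x \<in> unit_iv \<Longrightarrow> lab x = (x, Eta) \<and> lab (- x) = (x, Xi)"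
  by (auto simp: lab_def fold_unit_per per_eq)

lemma AE_lab: "AE c in circ. lab c \<in> unit_iv \<times> UNIV"
  unfolding AE_circ_fold by (rule AE_I2) (auto simp: lab_unit_iv)

interpretation cover_pair: pair_sigma_finite \<mu>I "count_space (UNIV :: label set)"
proof -
  interpret A: finite_measure \<mu>I by (rule finite_measure_\<mu>I)
  interpret B: sigma_finite_measure "count_space (UNIV :: label set)"
    by (rule sigma_finite_measure_count_space)
  show "pair_sigma_finite \<mu>I (count_space (UNIV :: label set))" by unfold_locales
qed

text \<open>Under \<open>lab\<close> the two sheets are the two halves of the circle, so null sets
  correspond by folding.\<close>

lemma cover_null_iff:
  assumes A: "A \<in> sets cover"
  shows "emeasure cover A = 0 \<longleftrightarrow> (AE c in circ. lab c \<notin> A)"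
proof -
  have "emeasure cover A = 0 \<longleftrightarrow> A \<in> null_sets cover" using A by (auto simp: null_sets_def)
  also have "\<dots> \<longleftrightarrow> (AE y in cover. y \<notin> A)" by (rule AE_iff_null_sets[OF A])
  also have "\<dots> \<longleftrightarrow> (AE x in \<mu>I. AE \<sigma> in count_space UNIV. (x, \<sigma>) \<notin> A)"
  proof
    assume "AE y in cover. y \<notin> A"
    then show "AE x in \<mu>I. AE \<sigma> in count_space UNIV. (x, \<sigma>) \<notin> A"
      unfolding cover_def by (rule cover_pair.AE_pair)
  next
    assume "AE x in \<mu>I. AE \<sigma> in count_space UNIV. (x, \<sigma>) \<notin> A"
    then show "AE y in cover. y \<notin> A"
      unfolding cover_def using A by (intro cover_pair.AE_pair_measure) (auto simp: cover_def)
  qed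
  also have "\<dots> \<longleftrightarrow> (AE x in \<mu>I. (x, Eta) \<notin> A \<and> (x, Xi) \<notin> A)"
    by (intro AE_cong) (auto simp: AE_count_space UNIV_label)
  also have "\<dots> \<longleftrightarrow> (AE x in \<mu>I. lab x \<notin> A \<and> lab (- x) \<notin> A)"
    by (intro AE_cong) (simp add: lab_unit_iv)
  also have "\<dots> \<longleftrightarrow> (AE c in circ. lab c \<notin> A)"
    by (rule AE_circ_fold[symmetric])
  finally show ?thesis .
qed

lemma cover_full_iff:
  assumes A: "A \<in> sets cover"
  shows "emeasure cover A = 2 \<longleftrightarrow> (AE c in circ. lab c \<in> A)"
proof -
  have C: "space cover - A \<in> sets cover" using A by auto
  have "emeasure cover A + emeasure cover (space cover - A) = 2"
    using plus_emeasure[OF A C] sets.sets_into_space[OF A] emeasure_space_cover by (simp add: Un_absorb1)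
  then have "emeasure cover A = 2 \<longleftrightarrow> emeasure cover (space cover - A) = 0"
    by (cases "emeasure cover A"; cases "emeasure cover (space cover - A)")
       (auto simp: ennreal_plus[symmetric] top_add add_top simp flip: ennreal_numeral simp del: ennreal_plus)
  also have "\<dots> \<longleftrightarrow> (AE c in circ. lab c \<notin> space cover - A)" by (rule cover_null_iff[OF C])
  also have "\<dots> \<longleftrightarrow> (AE c in circ. lab c \<in> A)"
  proof
    assume "AE c in circ. lab c \<notin> space cover - A"
    with AE_lab show "AE c in circ. lab c \<in> A" by eventually_elim (auto simp: space_cover)
  next
    assume "AE c in circ. lab c \<in> A"
    then show "AE c in circ. lab c \<notin> space cover - A" by eventually_elim auto
  qed
  finally show ?thesis .
qed

text \<open>Sets of \<open>cover\<close> are Lebesgue measurable on each sheet, whereas the profiles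
  tested for observability are Borel and periodic. A Borel version may take arbitrary values on a
  null set, so the clamp to [0, 1] restores the bound.\<close>

lemma cover_borel_indicator:
  assumes A: "A \<in> sets cover"
  obtains q :: "real \<Rightarrow> real" where "q \<in> borel_measurable borel" "periodic q" "\<And>c. \<bar>q c\<bar> \<le> 1" "AE c in circ. q c = indicator A (lab c)"
proof -
  have m: "(\<lambda>x. indicator A (x, \<sigma>)) \<in> borel_measurable \<mu>I" for \<sigma>
  proof -
    have "(\<lambda>x. (x, \<sigma>)) \<in> \<mu>I \<rightarrow>\<^sub>M cover" unfolding cover_def by measurable
    from measurable_compose[OF this borel_measurable_indicator[OF A]] show ?thesis .
  qed
  have s: "sq_integrable \<mu>I (\<lambda>x. indicator A (x, \<sigma>))" for \<sigma>
    by (intro sq_integrable_bounded[OF finite_measure_\<mu>I m, of _ 1]) (auto simp: indicator_def)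
  obtain g1 :: "real \<Rightarrow> real" where g1: "g1 \<in> borel_measurable borel" "AE x in \<mu>I. g1 x = indicator A (x, Eta)"
    by (rule sq_integrable_\<mu>I_borel_version[OF s[of Eta]]) (rule that)
  obtain g2 :: "real \<Rightarrow> real" where g2: "g2 \<in> borel_measurable borel" "AE x in \<mu>I. g2 x = indicator A (x, Xi)"
    by (rule sq_integrable_\<mu>I_borel_version[OF s[of Xi]]) (rule that)
  note [measurable] = g1(1) g2(1)
  define q where "q s = max 0 (min 1 (if per s \<ge> 0 then g1 (per s) else g2 (- per s)))" for s
  have "q \<in> borel_measurable borel" unfolding q_def by measurable
  moreover have "periodic q" unfolding q_def by (rule periodic_comp_per)
  moreover have "\<bar>q c\<bar> \<le> 1" for c by (auto simp: q_def)
  moreover have "AE c in circ. q c = indicator A (lab c)"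
    unfolding AE_circ_fold
  proof -
    have "AE x in \<mu>I. x \<in> unit_iv" by (rule AE_I2) simp
    with g1(2) g2(2) show "AE x in \<mu>I. q x = indicator A (lab x) \<and> q (- x) = indicator A (lab (- x))"
    proof eventually_elim
      case (elim x)
      then show ?case using lab_unit_iv[of x] by (auto simp: q_def per_eq indicator_def)
    qed
  qed
  ultimately show ?thesis using that by blast
qed

lemma cover_level_set:
  assumes p: "p \<in> borel_measurable borel" "periodic p" and S: "S \<in> sets borel"
  defines "A \<equiv> {y \<in> unit_iv \<times> UNIV. p (pos y) \<in> S}"
  shows "A \<in> sets cover" "AE c in circ. lab c \<in> A \<longleftrightarrow> p c \<in> S"
proof -
  note [measurable] = p(1) S
  have "A = ({x. p x \<in> S} \<inter> unit_iv) \<times> {Eta} \<union> ({x. p (- x) \<in> S} \<inter> unit_iv) \<times> {Xi}"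
  proof (intro set_eqI)
    fix y show "y \<in> A \<longleftrightarrow> y \<in> ({x. p x \<in> S} \<inter> unit_iv) \<times> {Eta} \<union> ({x. p (- x) \<in> S} \<inter> unit_iv) \<times> {Xi}"
      by (cases y rule: pos.cases) (auto simp: A_def)
  qed
  moreover have "{x. p x \<in> S} \<inter> unit_iv \<in> sets \<mu>I" "{x. p (- x) \<in> S} \<inter> unit_iv \<in> sets \<mu>I"
  proof -
    have "{x. p x \<in> S} \<in> sets borel" "{x. p (- x) \<in> S} \<in> sets borel" by measurable
    then have "{x. p x \<in> S} \<in> sets lebesgue" "{x. p (- x) \<in> S} \<in> sets lebesgue" by auto
    then show "{x. p x \<in> S} \<inter> unit_iv \<in> sets \<mu>I" "{x. p (- x) \<in> S} \<inter> unit_iv \<in> sets \<mu>I"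
      by (auto simp: sets_restrict_space_iff)
  qed
  ultimately show "A \<in> sets cover" unfolding cover_def by (auto intro!: sets.Un pair_measureI)
  show "AE c in circ. lab c \<in> A \<longleftrightarrow> p c \<in> S"
    using AE_lab by eventually_elim (simp add: A_def pos_lab periodic_per[OF p(2)])
qed

section \<open>Borel versions of the observation set\<close>

text \<open>Keeps the given Lebesgue set \<open>G\<close> together with a Borel subset
  \<open>B\<close> of full measure: the geometric conditions and the inequality speak of
  \<open>G\<close>, the estimates are made for \<open>B\<close>.\<close>

locale observation_version = observation_set T B for T :: real and B :: "(real \<times> real) set" +
  fixes G :: "(real \<times> real) set"
  assumes G_lebesgue: "G \<in> sets lebesgue" and G_bounds: "G \<subseteq> {0..T} \<times> {0<..<1}"
    and B_sub: "B \<subseteq> G" and null_diff: "G - B \<in> null_sets lebesgue"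
begin

lemma AE_mem_version: "AE z in lborel. z \<in> G \<longleftrightarrow> z \<in> B"
proof -
  have "AE z in lborel. z \<notin> G - B" using null_diff by (simp add: null_sets_lebesgue_iff_AE)
  then show ?thesis by eventually_elim (use B_sub in auto)
qed

lemma AE_version: "(AE z in lborel. z \<in> G \<longrightarrow> P z) \<longleftrightarrow> (AE z in lborel. z \<in> B \<longrightarrow> P z)"
proof
  assume "AE z in lborel. z \<in> G \<longrightarrow> P z"
  with AE_mem_version show "AE z in lborel. z \<in> B \<longrightarrow> P z" by eventually_elim auto
next
  assume "AE z in lborel. z \<in> B \<longrightarrow> P z"
  with AE_mem_version show "AE z in lborel. z \<in> G \<longrightarrow> P z" by eventually_elim auto
qed

lemma integral_dalembert_version:
  assumes p: "p \<in> borel_measurable borel"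
  shows "(\<integral>(t, x). (dalembert \<epsilon> p t x)\<^sup>2 \<partial>lebesgue_on G) = obs_form \<epsilon> B p"
proof -
  define f where "f z = (dalembert \<epsilon> p (fst z) (snd z))\<^sup>2" for z
  have f: "f \<in> borel_measurable borel"
    unfolding f_def dalembert_def using measurable_coordinates[OF p] by measurable
  have m: "(\<lambda>z. indicator B z * f z) \<in> borel_measurable lborel"
    using f G by (intro borel_measurable_times borel_measurable_indicator) auto
  have "(\<integral>(t, x). (dalembert \<epsilon> p t x)\<^sup>2 \<partial>lebesgue_on G) = (\<integral>z. f z \<partial>lebesgue_on G)"
    by (rule Bochner_Integration.integral_cong) (auto simp: f_def split: prod.split)
  also have "\<dots> = (\<integral>z. indicator G z *\<^sub>R f z \<partial>lebesgue)"
    using G_lebesgue by (intro integral_restrict_space) simp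
  also have "\<dots> = (\<integral>z. indicator B z * f z \<partial>lebesgue)"
  proof (rule integral_cong_AE)
    show "(\<lambda>z. indicator G z *\<^sub>R f z) \<in> borel_measurable lebesgue"
      using f G_lebesgue by (intro borel_measurable_scaleR borel_measurable_indicator measurable_completion) simp_all
    show "(\<lambda>z. indicator B z * f z) \<in> borel_measurable lebesgue"
      by (rule measurable_completion[OF m])
    show "AE z in lebesgue. indicator G z *\<^sub>R f z = indicator B z * f z"
      using AE_completion[OF AE_mem_version] by eventually_elim (auto simp: indicator_def)
  qed
  also have "\<dots> = obs_form \<epsilon> B p"
    unfolding obs_form_def f_def[symmetric] by (rule integral_completion[OF m])
  finally show ?thesis .
qed

lemma observable_symmetric_iff:
  assumes A: "A \<in> sets cover"
  shows "observable_symmetric A T G \<longleftrightarrow>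
    (AE z in lborel. z \<in> B \<longrightarrow>
      (lab (fst z + snd z) \<in> A \<and> lab (fst z - snd z) \<in> A) \<or>
      (lab (fst z + snd z) \<in> space cover - A \<and> lab (fst z - snd z) \<in> space cover - A))" (is "_ \<longleftrightarrow> ?R")
proof -
  have A': "A \<subseteq> unit_iv \<times> UNIV" "space cover - A \<subseteq> unit_iv \<times> UNIV"
    using sets.sets_into_space[OF A] by (auto simp: space_cover)
  have "observable_symmetric A T G \<longleftrightarrow>
      (AE z in lborel. z \<in> G \<longrightarrow> z \<in> M_set_upto A T \<union> M_set_upto (space cover - A) T)"
    unfolding observable_symmetric_def null_sets_lebesgue_iff_AE by (intro AE_cong) auto
  also have "\<dots> \<longleftrightarrow> (AE z in lborel. z \<in> B \<longrightarrow> z \<in> M_set_upto A T \<union> M_set_upto (space cover - A) T)"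
    by (rule AE_version)
  also have "\<dots> \<longleftrightarrow> ?R"
  proof (rule AE_cong, rule imp_cong[OF refl])
    fix z assume "z \<in> B"
    then have "0 \<le> fst z" "fst z \<le> T" "0 < snd z" "snd z < 1" using G_sub by auto
    then show "z \<in> M_set_upto A T \<union> M_set_upto (space cover - A) T \<longleftrightarrow>
      (lab (fst z + snd z) \<in> A \<and> lab (fst z - snd z) \<in> A) \<or>
      (lab (fst z + snd z) \<in> space cover - A \<and> lab (fst z - snd z) \<in> space cover - A)"
      using M_set_iff[OF A'(1), of "fst z" "snd z"] M_set_iff[OF A'(2), of "fst z" "snd z"]
      by (cases z) (simp add: M_set_upto_def)
  qed
  finally show ?thesis .
qed

lemma observable_symmetric_pair_iff:
  assumes E: "E \<in> sets cover" and F: "F \<in> sets cover"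
  shows "observable_symmetric_pair E F T G \<longleftrightarrow>
    (AE z in lborel. z \<in> B \<longrightarrow>
      (lab (fst z + snd z) \<in> E \<and> lab (fst z - snd z) \<in> F) \<or>
      (lab (fst z - snd z) \<in> E \<and> lab (fst z + snd z) \<in> F) \<or>
      (lab (fst z + snd z) \<in> space cover - (E \<union> F) \<and> lab (fst z - snd z) \<in> space cover - (E \<union> F)))"
    (is "_ \<longleftrightarrow> ?R")
proof -
  have S: "E \<subseteq> unit_iv \<times> UNIV" "F \<subseteq> unit_iv \<times> UNIV" "space cover - (E \<union> F) \<subseteq> unit_iv \<times> UNIV"
    using sets.sets_into_space[OF E] sets.sets_into_space[OF F] by (auto simp: space_cover)
  have "observable_symmetric_pair E F T G \<longleftrightarrow>
      (AE z in lborel. z \<in> G \<longrightarrow> z \<in> W_set_upto E F T \<union> M_set_upto (space cover - (E \<union> F)) T)"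
    unfolding observable_symmetric_pair_def null_sets_lebesgue_iff_AE by (intro AE_cong) auto
  also have "\<dots> \<longleftrightarrow> (AE z in lborel. z \<in> B \<longrightarrow> z \<in> W_set_upto E F T \<union> M_set_upto (space cover - (E \<union> F)) T)"
    by (rule AE_version)
  also have "\<dots> \<longleftrightarrow> ?R"
  proof (rule AE_cong, rule imp_cong[OF refl])
    fix z assume "z \<in> B"
    then have "0 \<le> fst z" "fst z \<le> T" "0 < snd z" "snd z < 1" using G_sub by auto
    then show "z \<in> W_set_upto E F T \<union> M_set_upto (space cover - (E \<union> F)) T \<longleftrightarrow>
      (lab (fst z + snd z) \<in> E \<and> lab (fst z - snd z) \<in> F) \<or>
      (lab (fst z - snd z) \<in> E \<and> lab (fst z + snd z) \<in> F) \<or>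
      (lab (fst z + snd z) \<in> space cover - (E \<union> F) \<and> lab (fst z - snd z) \<in> space cover - (E \<union> F))"
      using W_set_iff[OF S(1,2), of "fst z" "snd z"] M_set_iff[OF S(3), of "fst z" "snd z"]
      by (cases z) (simp add: M_set_upto_def W_set_upto_def)
  qed
  finally show ?thesis .
qed

text \<open>By \<open>nn_integral_characteristics\<close> with f = 1, almost every characteristic
  spends time 0 in a Borel null set containing the difference of \<open>G\<close> and
  \<open>B\<close>. On such a characteristic the times spent in \<open>G\<close> and in
  \<open>B\<close> agree, and the two bounds on Hausdorff measure apply.\<close>

lemma AE_hausdorff1_comparable:
  "AE c in circ. emeasure lborel (char_times B c) \<le> hausdorff1 (G \<inter> char_curve c ` {0..T}) \<and>
     hausdorff1 (G \<inter> char_curve c ` {0..T}) \<le> 2 * emeasure lborel (char_times B c)"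
proof -
  obtain N where N: "N \<in> null_sets lborel" "G - B \<subseteq> N"
    using null_diff unfolding null_sets_completion_iff2 by auto
  define N' where "N' = N \<inter> {0..T} \<times> {0<..<1}"
  have box: "({0..T} \<times> {0<..<1} :: (real \<times> real) set) \<in> sets borel" by (intro borel_Times) auto
  have N': "N' \<in> null_sets lborel" "G - B \<subseteq> N'"
    using N G_bounds box by (auto simp: N'_def intro: null_set_Int2)
  interpret N: observation_set T N'
    using T N'(1) by unfold_locales (auto simp: N'_def null_sets_def)
  have "(\<integral>\<^sup>+c. 1 * emeasure lborel (char_times N' c) \<partial>circ) = (\<integral>\<^sup>+z. (1 + 1) * indicator N' z \<partial>lborel)"
    by (rule nn_integral_characteristics[OF N.G N.G_sub', symmetric]) (simp_all add: periodic_def)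
  also have "\<dots> = 2 * emeasure lborel N'"
    using N.G by (subst nn_integral_cmult_indicator) auto
  also have "\<dots> = 0" using N'(1) by (simp add: null_sets_def)
  finally have "(\<integral>\<^sup>+c. emeasure lborel (char_times N' c) \<partial>circ) = 0" by simp
  then have "AE c in circ. emeasure lborel (char_times N' c) = 0"
    using N.emeasure_char_times_measurable by (subst (asm) nn_integral_0_iff_AE) (auto intro: circ_measurable)
  then show ?thesis
  proof eventually_elim
    case (elim c)
    have sub: "char_times B c \<subseteq> char_times G c" "char_times G c - char_times B c \<subseteq> char_times N' c"
      using B_sub N'(2) by (auto simp: char_times_def)
    have "char_times N' c \<in> null_sets lborel"
      using elim N.char_times_sets by (simp add: null_sets_def)
    then have D: "char_times G c - char_times B c \<in> null_sets lebesgue"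
      unfolding null_sets_completion_iff2 using sub(2) by auto
    have b: "char_times B c \<in> sets lborel" using char_times_sets by simp
    then have bl: "char_times B c \<in> sets lebesgue" by (rule sets_completionI_sets)
    have un: "char_times G c = char_times B c \<union> (char_times G c - char_times B c)" using sub(1) by auto
    have gl: "char_times G c \<in> sets lebesgue"
      by (subst un) (rule sets.Un[OF bl null_setsD2[OF D]])
    have "emeasure lebesgue (char_times G c) = emeasure lebesgue (char_times B c)"
      by (subst un) (rule emeasure_Un_null_set[OF bl D])
    also have "\<dots> = emeasure lborel (char_times B c)" using b by simp
    finally have e: "emeasure lebesgue (char_times G c) = emeasure lborel (char_times B c)" .
    have gs: "char_times G c \<subseteq> {0..T}" using G_bounds by (auto simp: char_times_def)
    have im: "G \<inter> char_curve c ` {0..T} = char_curve c ` char_times G c"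
      using gs by (auto simp: char_times_def char_curve_def)
    have "emeasure lborel (char_times B c) \<le> hausdorff1 (char_curve c ` char_times G c)"
      by (rule hausdorff1_ge_projection[OF char_times_sets])
         (use sub(1) in \<open>auto simp: char_curve_def image_image\<close>)
    moreover have "hausdorff1 (char_curve c ` char_times G c) \<le> 2 * emeasure lebesgue (char_times G c)"
      by (rule hausdorff1_char_curve_le[OF gl gs])
    ultimately show ?case unfolding im e by simp
  qed
qed

text \<open>The two labels at x are the points x and -x of the circle, and trading Hausdorff measure
  for time costs at most half of the constant.\<close>

lemma GCC_iff: "GCC T G \<longleftrightarrow> (\<exists>c0>0. AE c in circ. ennreal c0 \<le> emeasure lborel (char_times B c))"
proof -
  define h where "h c = hausdorff1 (G \<inter> char_curve c ` {0..T})" for c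
  have "(AE x in lebesgue_on {0..1}.
          hausdorff1 (G \<inter> char_point (x, Eta) ` {0..T}) \<ge> ennreal c0 \<and>
          hausdorff1 (G \<inter> char_point (x, Xi) ` {0..T}) \<ge> ennreal c0) \<longleftrightarrow> (AE c in circ. ennreal c0 \<le> h c)" for c0
  proof -
    have eq: "char_point (x, Eta) = char_curve x" "char_point (x, Xi) = char_curve (- x)" for x
      by (auto simp: char_point_eq fun_eq_iff)
    have "(AE x in lebesgue_on {0..1}. ennreal c0 \<le> h x \<and> ennreal c0 \<le> h (- x)) \<longleftrightarrow>
        (AE x in lborel. 0 \<le> x \<and> x \<le> 1 \<longrightarrow> ennreal c0 \<le> h x \<and> ennreal c0 \<le> h (- x))"
      by (subst AE_restrict_space_iff) (auto simp: AE_completion_iff)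
    also have "\<dots> \<longleftrightarrow> (AE x in lborel. 0 < x \<and> x < 1 \<longrightarrow> ennreal c0 \<le> h x \<and> ennreal c0 \<le> h (- x))"
    proof
      assume "AE x in lborel. 0 < x \<and> x < 1 \<longrightarrow> ennreal c0 \<le> h x \<and> ennreal c0 \<le> h (- x)"
      with AE_lborel_singleton[of 0] AE_lborel_singleton[of 1]
      show "AE x in lborel. 0 \<le> x \<and> x \<le> 1 \<longrightarrow> ennreal c0 \<le> h x \<and> ennreal c0 \<le> h (- x)"
        by eventually_elim auto
    qed (auto elim!: eventually_mono)
    also have "\<dots> \<longleftrightarrow> (AE c in circ. ennreal c0 \<le> h c)"
      unfolding AE_circ_fold AE_\<mu>I ..
    finally show ?thesis by (simp add: eq h_def)
  qed
  then have "GCC T G \<longleftrightarrow> (\<exists>c0>0. AE c in circ. ennreal c0 \<le> h c)" by (simp add: GCC_def)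
  also have "\<dots> \<longleftrightarrow> (\<exists>c0>0. AE c in circ. ennreal c0 \<le> emeasure lborel (char_times B c))"
  proof safe
    fix c0 :: real assume "c0 > 0" "AE c in circ. ennreal c0 \<le> h c"
    have "AE c in circ. ennreal (c0 / 2) \<le> emeasure lborel (char_times B c)"
      using \<open>AE c in circ. ennreal c0 \<le> h c\<close> AE_hausdorff1_comparable
    proof eventually_elim
      case (elim c)
      have "emeasure lborel (char_times B c) < top"
        using char_times_le[of c] by (rule le_less_trans) simp
      then obtain r where r: "emeasure lborel (char_times B c) = ennreal r" "r \<ge> 0"
        by (cases "emeasure lborel (char_times B c)") auto
      have "ennreal c0 \<le> 2 * ennreal r" using elim unfolding h_def r(1) by (auto intro: order_trans)
      also have "\<dots> = ennreal (2 * r)" using r(2) by (simp add: ennreal_mult')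
      finally show ?case using r by (simp add: ennreal_le_iff)
    qed
    then show "\<exists>c0>0. AE c in circ. ennreal c0 \<le> emeasure lborel (char_times B c)"
      using \<open>c0 > 0\<close> by (intro exI[of _ "c0 / 2"]) simp
  next
    fix c0 :: real assume "c0 > 0" "AE c in circ. ennreal c0 \<le> emeasure lborel (char_times B c)"
    have "AE c in circ. ennreal c0 \<le> h c"
      using \<open>AE c in circ. ennreal c0 \<le> emeasure lborel (char_times B c)\<close> AE_hausdorff1_comparable
      by eventually_elim (auto simp: h_def)
    then show "\<exists>c0>0. AE c in circ. ennreal c0 \<le> h c" using \<open>c0 > 0\<close> by auto
  qed
  finally show ?thesis .
qed

end

section \<open>Observability\<close>

text \<open>Only bounded \<open>p\<close> are tested, so that density of trigonometric sums gives it from solutions.\<close>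

definition bounded_observability :: "real \<Rightarrow> (real \<times> real) set \<Rightarrow> real \<Rightarrow> bool"
  where "bounded_observability \<epsilon> B C \<longleftrightarrow>
    (\<forall>p b. p \<in> borel_measurable borel \<longrightarrow> periodic p \<longrightarrow> (\<forall>x. \<bar>p x\<bar> \<le> b) \<longrightarrow>
       (\<epsilon> = -1 \<longrightarrow> (\<integral>c. p c \<partial>circ) = 0) \<longrightarrow> (\<integral>c. (p c)\<^sup>2 \<partial>circ) \<le> C * obs_form \<epsilon> B p)"

lemma bounded_observabilityD:
  assumes "bounded_observability \<epsilon> B C" "p \<in> borel_measurable borel" "periodic p" "\<And>x. \<bar>p x\<bar> \<le> b"
    "\<epsilon> = -1 \<Longrightarrow> (\<integral>c. p c \<partial>circ) = 0"
  shows "(\<integral>c. (p c)\<^sup>2 \<partial>circ) \<le> C * obs_form \<epsilon> B p"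
  using assms unfolding bounded_observability_def by blast

context observation_version
begin

section \<open>Passing between weak solutions and profiles\<close>

lemma trig_observability:
  assumes obs: "\<And>u0 u1 u v. weak_wave_solution V T u0 u1 u v \<Longrightarrow>
      (l2_norm (weak_deriv u0))\<^sup>2 + (l2_norm u1)\<^sup>2 \<le> C * (\<integral>(t, x). (v t x)\<^sup>2 \<partial>lebesgue_on G)"
    and V: "V = H10 \<and> \<epsilon> = -1 \<or> V = H1 \<and> \<epsilon> = 1" and \<alpha>: "\<epsilon> = -1 \<Longrightarrow> \<alpha> 0 = 0"
  shows "2 * (\<integral>c. (trig N \<alpha> \<beta> c)\<^sup>2 \<partial>circ) \<le> C * obs_form \<epsilon> B (trig N \<alpha> \<beta>)"
proof -
  obtain u0 u1 u v where s: "weak_wave_solution V T u0 u1 u v"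
    "(l2_norm (weak_deriv u0))\<^sup>2 + (l2_norm u1)\<^sup>2 = 2 * (\<integral>x. (trig N \<alpha> \<beta> x)\<^sup>2 \<partial>circ)"
    "v = dalembert \<epsilon> (trig N \<alpha> \<beta>)"
  proof (cases "\<epsilon> = -1")
    case True
    then have "V = H10" using V by auto
    show thesis
      by (rule trig_weak_solution_Dirichlet[where \<alpha> = \<alpha>, OF T \<alpha>[OF True], of N \<beta>]) (rule that; simp add: \<open>V = H10\<close> True)
  next
    case False
    then have "V = H1" "\<epsilon> = 1" using V by auto
    show thesis
      by (rule trig_weak_solution_Neumann[OF T, of N \<alpha> \<beta>]) (rule that; simp add: \<open>V = H1\<close> \<open>\<epsilon> = 1\<close>)
  qed
  from obs[OF s(1)] show ?thesis
    unfolding s(2,3) integral_dalembert_version[OF periodic_L2_borel[OF periodic_L2_trig]] .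
qed

text \<open>The bounded profile p is replaced by a nearby trigonometric \<tau>. Splitting the
  squares of p = (p - \<tau>) + \<tau> and of the observation of \<tau> = p - (p - \<tau>) costs a
  factor 2 each, one of which is regained from the energy, twice the squared norm of \<tau>. The
  errors are multiples of \<eta>.\<close>

lemma bounded_observability_if_observable:
  assumes obs: "\<And>u0 u1 u v. weak_wave_solution V T u0 u1 u v \<Longrightarrow>
      (l2_norm (weak_deriv u0))\<^sup>2 + (l2_norm u1)\<^sup>2 \<le> C * (\<integral>(t, x). (v t x)\<^sup>2 \<partial>lebesgue_on G)"
    and V: "V = H10 \<and> \<epsilon> = -1 \<or> V = H1 \<and> \<epsilon> = 1" and C: "C > 0"
  shows "bounded_observability \<epsilon> B (2 * C)"
  unfolding bounded_observability_def
proof (intro allI impI)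
  fix p :: "real \<Rightarrow> real" and b assume p: "p \<in> borel_measurable borel" "periodic p" "\<forall>x. \<bar>p x\<bar> \<le> b"
    and mean: "\<epsilon> = -1 \<longrightarrow> (\<integral>c. p c \<partial>circ) = 0"
  have \<epsilon>: "\<epsilon> = 1 \<or> \<epsilon> = -1" using V by auto
  have P: "periodic_L2 p" using p by (intro periodic_L2_bounded[of p b]) auto
  have approx: "(\<integral>c. (p c)\<^sup>2 \<partial>circ) \<le> 2 * C * obs_form \<epsilon> B p + (2 + 4 * T * C) * \<eta>" if \<eta>: "\<eta> > 0" for \<eta>
  proof -
    obtain N \<alpha> \<beta> where tr: "(\<integral>x. (p x - trig N \<alpha> \<beta> x)\<^sup>2 \<partial>circ) < \<eta>"
      "(\<integral>x. p x \<partial>circ) = 0 \<Longrightarrow> \<alpha> 0 = 0"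
      by (rule trig_L2_dense[OF p(1,2) _ \<eta>, of b]) (use p(3) that in auto)
    define \<tau> where "\<tau> = trig N \<alpha> \<beta>"
    have \<tau>: "periodic_L2 \<tau>" unfolding \<tau>_def by (rule periodic_L2_trig)
    have d: "periodic_L2 (\<lambda>x. p x - \<tau> x)" by (rule periodic_L2_diff[OF P \<tau>])
    have e: "(\<integral>x. (p x - \<tau> x)\<^sup>2 \<partial>circ) < \<eta>" using tr(1) by (simp add: \<tau>_def)
    have "2 * (\<integral>c. (\<tau> c)\<^sup>2 \<partial>circ) \<le> C * obs_form \<epsilon> B \<tau>"
      unfolding \<tau>_def by (rule trig_observability[OF obs V]) (use tr(2) mean in auto)
    also have "obs_form \<epsilon> B \<tau> \<le> 2 * obs_form \<epsilon> B p + 2 * obs_form \<epsilon> B (\<lambda>x. p x - \<tau> x)"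
      using obs_form_add_le[OF P d \<epsilon>] by simp
    also have "obs_form \<epsilon> B (\<lambda>x. p x - \<tau> x) \<le> 2 * T * (\<integral>c. (p c - \<tau> c)\<^sup>2 \<partial>circ)"
      by (rule obs_form_le_T[OF d \<epsilon>])
    also have "2 * T * (\<integral>c. (p c - \<tau> c)\<^sup>2 \<partial>circ) \<le> 2 * T * \<eta>"
      using e T by (intro mult_left_mono) auto
    finally have t: "2 * (\<integral>c. (\<tau> c)\<^sup>2 \<partial>circ) \<le> C * (2 * obs_form \<epsilon> B p + 2 * (2 * T * \<eta>))"
      using C by simp
    have "(\<integral>c. (p c)\<^sup>2 \<partial>circ) \<le> 2 * (\<integral>c. (p c - \<tau> c)\<^sup>2 \<partial>circ) + 2 * (\<integral>c. (\<tau> c)\<^sup>2 \<partial>circ)"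
      using integral_sq_add_le[OF periodic_L2_sq[OF d] periodic_L2_sq[OF \<tau>]] by simp
    also have "\<dots> \<le> 2 * \<eta> + C * (2 * obs_form \<epsilon> B p + 2 * (2 * T * \<eta>))" using e t by simp
    finally show ?thesis by (simp add: algebra_simps)
  qed
  show "(\<integral>c. (p c)\<^sup>2 \<partial>circ) \<le> 2 * C * obs_form \<epsilon> B p"
  proof (rule field_le_epsilon)
    fix e :: real assume "e > 0"
    have "2 + 4 * T * C > 0" using T C by (simp add: add_pos_pos)
    then show "(\<integral>c. (p c)\<^sup>2 \<partial>circ) \<le> 2 * C * obs_form \<epsilon> B p + e"
      using approx[of "e / (2 + 4 * T * C)"] \<open>e > 0\<close> by simp
  qed
qed

lemma observable_if_L2_observable:
  assumes obs: "\<And>p. periodic_L2 p \<Longrightarrow> (\<epsilon> = -1 \<longrightarrow> (\<integral>c. p c \<partial>circ) = 0) \<Longrightarrow>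
      (\<integral>c. (p c)\<^sup>2 \<partial>circ) \<le> C * obs_form \<epsilon> B p"
    and V: "V = H10 \<and> \<epsilon> = -1 \<or> V = H1 \<and> \<epsilon> = 1"
    and sol: "weak_wave_solution V T u0 u1 u v"
  shows "(l2_norm (weak_deriv u0))\<^sup>2 + (l2_norm u1)\<^sup>2 \<le> 2 * C * (\<integral>(t, x). (v t x)\<^sup>2 \<partial>lebesgue_on G)"
proof -
  obtain p where p: "periodic_L2 p" "\<epsilon> = -1 \<Longrightarrow> (\<integral>x. p x \<partial>circ) = 0"
    "(l2_norm (weak_deriv u0))\<^sup>2 + (l2_norm u1)\<^sup>2 = 2 * (\<integral>x. (p x)\<^sup>2 \<partial>circ)"
    "\<And>t. t \<in> {0..T} \<Longrightarrow> AE x in \<mu>I. v t x = dalembert \<epsilon> p t x"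
    by (rule weak_solution_dalembert[OF T sol V]) (rule that)
  have v: "(\<lambda>(t, x). v t x) \<in> borel_measurable (lebesgue_on ({0..T} \<times> unit_iv))"
    using sol by (simp add: weak_wave_solution_def)
  have "(\<integral>(t, x). (v t x)\<^sup>2 \<partial>lebesgue_on G) = (\<integral>(t, x). (dalembert \<epsilon> p t x)\<^sup>2 \<partial>lebesgue_on G)"
    by (rule weak_solution_observation[OF v p(4) periodic_L2_borel[OF p(1)] G_lebesgue G_bounds])
  also have "\<dots> = obs_form \<epsilon> B p" by (rule integral_dalembert_version[OF periodic_L2_borel[OF p(1)]])
  finally show ?thesis using obs[OF p(1)] p(2) unfolding p(3) by simp
qed

section \<open>Necessity of the geometric conditions\<close>

lemma bounded_observability_imp_GCC:
  assumes obs: "bounded_observability \<epsilon> B C" and \<epsilon>: "\<epsilon> = 1 \<or> \<epsilon> = -1" and C: "C > 0"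
  shows "GCC T G"
proof -
  \<comment> \<open>Profiles carried by characteristics with observation time below \<delta> are
    observed with at most 2 \<delta> times the squared norm; after multiplication by C this is half
    of the squared norm, which forces the profile to vanish.\<close>
  define \<delta> where "\<delta> = 1 / (4 * C)"
  have \<delta>: "\<delta> > 0" using C by (simp add: \<delta>_def)
  define h :: "real \<Rightarrow> real" where "h c = (if emeasure lborel (char_times B (per c)) < ennreal \<delta> then 1 else 0)" for c
  note [measurable] = emeasure_char_times_measurable
  have hm [measurable]: "h \<in> borel_measurable borel" unfolding h_def by measurable
  have hb: "0 \<le> h c" "h c \<le> 1" "h c = 0 \<or> h c = 1" for c by (auto simp: h_def)
  have hi: "integrable circ h"
    using hb by (intro sq_integrable_integrable[OF finite_measure_circ] sq_integrable_bounded[OF finite_measure_circ, of _ 1]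
      circ_measurable hm) auto
  have hpi: "integrable circ (\<lambda>c. h c * per c)"
  proof (intro sq_integrable_integrable[OF finite_measure_circ] sq_integrable_bounded[OF finite_measure_circ, of _ 1] AE_I2)
    show "(\<lambda>c. h c * per c) \<in> borel_measurable circ" by (rule circ_measurable) measurable
    show "\<bar>h c * per c\<bar> \<le> 1" for c using hb(3)[of c] per_bounds[of c] by auto
  qed
  have "AE c in circ. h c = 0"
  proof (cases "(\<integral>c. h c \<partial>circ) = 0")
    case True
    then show ?thesis using hb by (subst (asm) integral_nonneg_eq_0_iff_AE[OF hi]) auto
  next
    case False
    \<comment> \<open>The Dirichlet case requires a profile of mean zero inside the support of
      \<open>h\<close>. The coordinate minus its average over that support is one, and apart from a
      single point it vanishes only where \<open>h\<close> does.\<close>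
    define a where "a = (\<integral>c. h c * per c \<partial>circ) / (\<integral>c. h c \<partial>circ)"
    define p where "p c = h c * (per c - a)" for c
    have pm: "p \<in> borel_measurable borel" unfolding p_def by measurable
    have "h (x + 2) = h x" for x by (simp add: h_def per_add2)
    then have pp: "periodic p" by (simp add: periodic_def p_def per_add2)
    have pb: "\<bar>p x\<bar> \<le> 1 + \<bar>a\<bar>" for x using hb(3)[of x] per_bounds[of x] by (auto simp: p_def)
    have "(\<integral>c. p c \<partial>circ) = (\<integral>c. h c * per c - a * h c \<partial>circ)"
      by (intro Bochner_Integration.integral_cong) (auto simp: p_def algebra_simps)
    also have "\<dots> = (\<integral>c. h c * per c \<partial>circ) - a * (\<integral>c. h c \<partial>circ)"
      using hi hpi by simp
    also have "\<dots> = 0" using False by (simp add: a_def)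
    finally have mean: "(\<integral>c. p c \<partial>circ) = 0" .
    have P: "periodic_L2 p" by (rule periodic_L2_bounded[OF pm pp pb])
    have "AE c in circ. p c = 0 \<or> emeasure lborel (char_times B c) \<le> ennreal \<delta>"
      unfolding AE_circ by (rule AE_I2) (auto simp: p_def h_def per_eq)
    then have "obs_form \<epsilon> B p \<le> 2 * \<delta> * (\<integral>c. (p c)\<^sup>2 \<partial>circ)"
      using \<delta> by (intro obs_form_le[OF P \<epsilon>]) auto
    then have "C * obs_form \<epsilon> B p \<le> C * (2 * \<delta> * (\<integral>c. (p c)\<^sup>2 \<partial>circ))"
      using C by (intro mult_left_mono) auto
    also have "\<dots> = (\<integral>c. (p c)\<^sup>2 \<partial>circ) / 2" using C by (simp add: \<delta>_def)
    finally have "(\<integral>c. (p c)\<^sup>2 \<partial>circ) \<le> 0"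
      using bounded_observabilityD[OF obs pm pp pb mean] by simp
    then have "AE c in circ. p c = 0" by (rule sq_integral_circ_eq_0[OF P])
    moreover have "AE c in circ. c \<noteq> a"
      unfolding AE_circ using AE_lborel_singleton[of a] by eventually_elim simp
    moreover have "AE c in circ. per c = c" unfolding AE_circ by (rule AE_I2) (auto simp: per_eq)
    ultimately show ?thesis by eventually_elim (auto simp: p_def)
  qed
  moreover have "AE c in circ. per c = c" unfolding AE_circ by (rule AE_I2) (auto simp: per_eq)
  ultimately have "AE c in circ. ennreal \<delta> \<le> emeasure lborel (char_times B c)"
    by eventually_elim (auto simp: h_def not_less split: if_splits)
  then show ?thesis unfolding GCC_iff using \<delta> by auto
qed

lemma bounded_observability_imp_OSC_D:
  assumes obs: "bounded_observability (-1) B C"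
  shows "OSC_D T G"
  unfolding OSC_D_def
proof (intro ballI impI notI)
  fix A assume A: "A \<in> sets cover" "\<not> trivial_set A" "observable_symmetric A T G"
  obtain q :: "real \<Rightarrow> real" where q: "q \<in> borel_measurable borel" "periodic q" "\<And>c. \<bar>q c\<bar> \<le> 1"
    "AE c in circ. q c = indicator A (lab c)"
    by (rule cover_borel_indicator[OF A(1)]) (rule that)
  define b where "b = (\<integral>c. q c \<partial>circ) / 2"
  define p where "p c = q c - b" for c
  have pm: "p \<in> borel_measurable borel" unfolding p_def using q(1) by measurable
  have pp: "periodic p" using q(2) by (simp add: periodic_def p_def)
  have pb: "\<bar>p x\<bar> \<le> 1 + \<bar>b\<bar>" for x using q(3)[of x] by (auto simp: p_def)
  have qi: "integrable circ q"
    using q by (intro sq_integrable_integrable[OF finite_measure_circ] sq_integrable_bounded[OF finite_measure_circ, of _ 1]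
      circ_measurable) auto
  have ci: "integrable circ (\<lambda>c. b)" by (rule finite_measure.integrable_const[OF finite_measure_circ])
  have mean: "(\<integral>c. p c \<partial>circ) = 0"
    unfolding p_def Bochner_Integration.integral_diff[OF qi ci] integral_const_circ by (simp add: b_def)
  have P: "periodic_L2 p" by (rule periodic_L2_bounded[OF pm pp pb])
  have "AE z in lborel. z \<in> B \<longrightarrow> dalembert (-1) p (fst z) (snd z) = 0"
    using A(3)[unfolded observable_symmetric_iff[OF A(1)]] AE_coordinates[OF q(4)]
    by eventually_elim (auto simp: dalembert_def p_def lab_per periodic_per[OF q(2)])
  then have "obs_form (-1) B p = 0" using obs_form_eq_0_iff[OF P] by simp
  then have "AE c in circ. p c = 0"
    using bounded_observabilityD[OF obs pm pp pb mean] by (intro sq_integral_circ_eq_0[OF P]) simp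
  with q(4) have ind: "AE c in circ. indicator A (lab c) = b" by eventually_elim (simp add: p_def)
  \<comment> \<open>An indicator that is almost everywhere equal to the constant \<open>b\<close> is
    almost everywhere 1 or almost everywhere 0.\<close>
  have "(AE c in circ. lab c \<in> A) \<or> (AE c in circ. lab c \<notin> A)"
  proof (cases "b = 1")
    case True
    have "AE c in circ. lab c \<in> A" using ind by eventually_elim (auto simp: True indicator_def split: if_splits)
    then show ?thesis ..
  next
    case False
    have "AE c in circ. lab c \<notin> A" using ind by eventually_elim (use False in \<open>auto simp: indicator_def split: if_splits\<close>)
    then show ?thesis ..
  qed
  with A(2) show False by (simp add: trivial_set_def cover_null_iff[OF A(1)] cover_full_iff[OF A(1)])
qed

lemma bounded_observability_imp_OSC_N:
  assumes obs: "bounded_observability 1 B C"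
  shows "OSC_N T G"
  unfolding OSC_N_def
proof (intro ballI impI notI)
  fix E F assume E: "E \<in> sets cover" and F: "F \<in> sets cover"
    and EF: "E \<inter> F = {} \<and> \<not> trivial_pair E F" and sym: "observable_symmetric_pair E F T G"
  obtain q :: "real \<Rightarrow> real" where q: "q \<in> borel_measurable borel" "periodic q" "\<And>c. \<bar>q c\<bar> \<le> 1"
    "AE c in circ. q c = indicator E (lab c)"
    by (rule cover_borel_indicator[OF E]) (rule that)
  obtain r :: "real \<Rightarrow> real" where r: "r \<in> borel_measurable borel" "periodic r" "\<And>c. \<bar>r c\<bar> \<le> 1"
    "AE c in circ. r c = indicator F (lab c)"
    by (rule cover_borel_indicator[OF F]) (rule that)
  define p where "p c = q c - r c" for c
  have pm: "p \<in> borel_measurable borel" unfolding p_def using q(1) r(1) by measurable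
  have pp: "periodic p" using q(2) r(2) by (simp add: periodic_def p_def)
  have pb: "\<bar>p x\<bar> \<le> 2" for x using q(3)[of x] r(3)[of x] by (auto simp: p_def)
  have P: "periodic_L2 p" by (rule periodic_L2_bounded[OF pm pp pb])
  have "AE z in lborel. z \<in> B \<longrightarrow> dalembert 1 p (fst z) (snd z) = 0"
    using sym[unfolded observable_symmetric_pair_iff[OF E F]] AE_coordinates[OF q(4)] AE_coordinates[OF r(4)]
    by eventually_elim (use EF in \<open>auto simp: dalembert_def p_def lab_per periodic_per[OF q(2)] periodic_per[OF r(2)] indicator_def
      split: if_splits\<close>)
  then have "obs_form 1 B p = 0" using obs_form_eq_0_iff[OF P] by simp
  then have "AE c in circ. p c = 0"
    using bounded_observabilityD[OF obs pm pp pb] by (intro sq_integral_circ_eq_0[OF P]) simp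
  with q(4) r(4) have "AE c in circ. lab c \<notin> E"
    by eventually_elim (use EF in \<open>auto simp: p_def indicator_def split: if_splits\<close>)
  with EF show False by (simp add: trivial_pair_def cover_null_iff[OF E])
qed

section \<open>Sufficiency of the geometric conditions\<close>

lemma OSC_D_imp_L2_observable:
  assumes osc: "OSC_D T G" and gcc: "GCC T G"
  obtains C where "C > 0" "\<And>p. periodic_L2 p \<Longrightarrow> (\<integral>c. p c \<partial>circ) = 0 \<Longrightarrow>
      (\<integral>c. (p c)\<^sup>2 \<partial>circ) \<le> C * obs_form (-1) B p"
proof (rule ccontr)
  note result = that
  assume neg: "\<not> thesis"
  obtain c0 where c0: "c0 > 0" "AE c in circ. ennreal c0 \<le> emeasure lborel (char_times B c)"
    using gcc unfolding GCC_iff by auto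
  \<comment> \<open>The premise \<open>True\<close> is the value of the flag \<open>mean\<close> in
    \<open>observability_or_kernel\<close>; the Neumann case uses \<open>False\<close>.\<close>
  have no: "\<exists>p. periodic_L2 p \<and> (True \<longrightarrow> (\<integral>c. p c \<partial>circ) = 0) \<and> C * obs_form (-1) B p < (\<integral>c. (p c)\<^sup>2 \<partial>circ)"
    if "C > 0" for C
  proof (rule ccontr)
    assume "\<not> ?thesis"
    then have "(\<integral>c. (p c)\<^sup>2 \<partial>circ) \<le> C * obs_form (-1) B p" if "periodic_L2 p" "(\<integral>c. p c \<partial>circ) = 0" for p
      using that by (meson not_less)
    with neg result[OF \<open>C > 0\<close>] show False by blast
  qed
  obtain p where p: "periodic_L2 p" "True \<Longrightarrow> (\<integral>c. p c \<partial>circ) = 0" "(\<integral>c. (p c)\<^sup>2 \<partial>circ) > 0" "obs_form (-1) B p = 0"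
    by (rule observability_or_kernel[OF _ c0 no]) (simp, assumption, rule that)
  have pp: "periodic p" using p(1) by (simp add: periodic_L2_def)
  have pi: "integrable circ p" by (rule sq_integrable_integrable[OF finite_measure_circ periodic_L2_sq[OF p(1)]])
  define A where "A = {y \<in> unit_iv \<times> UNIV. p (pos y) \<in> {0<..}}"
  have A: "A \<in> sets cover" "AE c in circ. lab c \<in> A \<longleftrightarrow> p c \<in> {0<..}"
    unfolding A_def by (rule cover_level_set[OF periodic_L2_borel[OF p(1)] pp]; simp)+
  have "AE z in lborel. z \<in> B \<longrightarrow> dalembert (-1) p (fst z) (snd z) = 0"
    using obs_form_eq_0_iff[OF p(1)] p(4) by simp
  \<comment> \<open>Where the two values of \<open>p\<close> coincide they have the same sign, so
    both starting points lie in \<open>A\<close> or both in its complement; \<open>AE_lab\<close>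
    keeps them inside the cover.\<close>
  with AE_coordinates[OF A(2)] AE_coordinates[OF AE_lab] have "observable_symmetric A T G"
    unfolding observable_symmetric_iff[OF A(1)]
    by eventually_elim (auto simp: dalembert_def lab_per periodic_per[OF pp] space_cover)
  with osc A(1) have "trivial_set A" unfolding OSC_D_def by auto
  then have "(AE c in circ. lab c \<notin> A) \<or> (AE c in circ. lab c \<in> A)"
    by (simp add: trivial_set_def cover_null_iff[OF A(1)] cover_full_iff[OF A(1)])
  then have "AE c in circ. p c = 0"
  proof
    assume "AE c in circ. lab c \<notin> A"
    with A(2) have "AE c in circ. 0 \<le> - p c" by eventually_elim auto
    then show ?thesis
      using integral_nonneg_eq_0_iff_AE[of circ "\<lambda>c. - p c"] pi p(2) by simp
  next
    assume "AE c in circ. lab c \<in> A"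
    with A(2) have "AE c in circ. 0 \<le> p c" by eventually_elim auto
    then show ?thesis
      using integral_nonneg_eq_0_iff_AE[of circ p] pi p(2) by simp
  qed
  then have "AE c in circ. (p c)\<^sup>2 = 0" by eventually_elim simp
  then have "(\<integral>c. (p c)\<^sup>2 \<partial>circ) = 0" by (rule integral_eq_zero_AE)
  with p(3) show False by simp
qed

lemma OSC_N_imp_L2_observable:
  assumes osc: "OSC_N T G" and gcc: "GCC T G"
  obtains C where "C > 0" "\<And>p. periodic_L2 p \<Longrightarrow> (\<integral>c. (p c)\<^sup>2 \<partial>circ) \<le> C * obs_form 1 B p"
proof (rule ccontr)
  note result = that
  assume neg: "\<not> thesis"
  obtain c0 where c0: "c0 > 0" "AE c in circ. ennreal c0 \<le> emeasure lborel (char_times B c)"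
    using gcc unfolding GCC_iff by auto
  have no: "\<exists>p. periodic_L2 p \<and> (False \<longrightarrow> (\<integral>c. p c \<partial>circ) = 0) \<and> C * obs_form 1 B p < (\<integral>c. (p c)\<^sup>2 \<partial>circ)"
    if "C > 0" for C
  proof (rule ccontr)
    assume "\<not> ?thesis"
    then have "(\<integral>c. (p c)\<^sup>2 \<partial>circ) \<le> C * obs_form 1 B p" if "periodic_L2 p" for p
      using that by (meson not_less)
    with neg result[OF \<open>C > 0\<close>] show False by blast
  qed
  obtain p where p: "periodic_L2 p" "(\<integral>c. (p c)\<^sup>2 \<partial>circ) > 0" "obs_form 1 B p = 0"
    by (rule observability_or_kernel[OF _ c0 no]) (simp, assumption, rule that)
  have pp: "periodic p" using p(1) by (simp add: periodic_L2_def)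
  define E where "E = {y \<in> unit_iv \<times> UNIV. p (pos y) \<in> {0<..}}"
  define F where "F = {y \<in> unit_iv \<times> UNIV. p (pos y) \<in> {..<0}}"
  have E: "E \<in> sets cover" "AE c in circ. lab c \<in> E \<longleftrightarrow> p c \<in> {0<..}"
    unfolding E_def by (rule cover_level_set[OF periodic_L2_borel[OF p(1)] pp]; simp)+
  have F: "F \<in> sets cover" "AE c in circ. lab c \<in> F \<longleftrightarrow> p c \<in> {..<0}"
    unfolding F_def by (rule cover_level_set[OF periodic_L2_borel[OF p(1)] pp]; simp)+
  have EF: "E \<inter> F = {}" by (auto simp: E_def F_def)
  have zero: "AE z in lborel. z \<in> B \<longrightarrow> dalembert 1 p (fst z) (snd z) = 0"
    using obs_form_eq_0_iff[OF p(1)] p(3) by simp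
  with AE_coordinates[OF E(2)] AE_coordinates[OF F(2)] AE_coordinates[OF AE_lab]
  have "observable_symmetric_pair E F T G"
    unfolding observable_symmetric_pair_iff[OF E(1) F(1)]
    by eventually_elim (auto simp: dalembert_def lab_per periodic_per[OF pp] space_cover)
  with osc E(1) F(1) EF have "trivial_pair E F" unfolding OSC_N_def by auto
  then have "(AE c in circ. lab c \<notin> E) \<or> (AE c in circ. lab c \<notin> F)"
    by (simp add: trivial_pair_def cover_null_iff[OF E(1)] cover_null_iff[OF F(1)])
  \<comment> \<open>Two numbers of one sign with sum 0 are both 0, so even the diagonal part of the
    observation vanishes, which coercivity excludes.\<close>
  then have "AE z in lborel. z \<in> B \<longrightarrow> p (fst z + snd z) = 0 \<and> p (fst z - snd z) = 0"
  proof
    assume "AE c in circ. lab c \<notin> E"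
    with E(2) have "AE c in circ. p c \<le> 0" by eventually_elim auto
    from AE_coordinates[OF this] zero show ?thesis
      by eventually_elim (auto simp: dalembert_def periodic_per[OF pp])
  next
    assume "AE c in circ. lab c \<notin> F"
    with F(2) have "AE c in circ. p c \<ge> 0" by eventually_elim auto
    from AE_coordinates[OF this] zero show ?thesis
      by eventually_elim (auto simp: dalembert_def periodic_per[OF pp])
  qed
  then have "AE z in lborel. indicator B z * ((p (fst z + snd z))\<^sup>2 + (p (fst z - snd z))\<^sup>2) = 0"
    by eventually_elim (auto simp: indicator_def)
  then have "(\<integral>z. indicator B z * ((p (fst z + snd z))\<^sup>2 + (p (fst z - snd z))\<^sup>2) \<partial>lborel) = 0"
    by (rule integral_eq_zero_AE)
  then have "c0 * (\<integral>c. (p c)\<^sup>2 \<partial>circ) \<le> 0"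
    using sum_form_ge[OF p(1) _ c0(2)] c0(1) by simp
  moreover have "c0 * (\<integral>c. (p c)\<^sup>2 \<partial>circ) > 0" using c0(1) p(2) by simp
  ultimately show False by simp
qed

end

theorem theorem1p1:
  fixes T :: real and G :: "(real \<times> real) set"
  assumes "T > 0" and "G \<in> sets lebesgue" and "G \<subseteq> {0..T} \<times> {0<..<1}"
  shows "((\<exists>C>0. \<forall>u0 u1 u v. weak_wave_solution H10 T u0 u1 u v \<longrightarrow>
             (l2_norm (weak_deriv u0))\<^sup>2 + (l2_norm u1)\<^sup>2
               \<le> C * (\<integral>(t, x). (v t x)\<^sup>2 \<partial>lebesgue_on G))
          \<longleftrightarrow> OSC_D T G \<and> GCC T G)
       \<and> ((\<exists>C>0. \<forall>u0 u1 u v. weak_wave_solution H1 T u0 u1 u v \<longrightarrow>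
             (l2_norm (weak_deriv u0))\<^sup>2 + (l2_norm u1)\<^sup>2
               \<le> C * (\<integral>(t, x). (v t x)\<^sup>2 \<partial>lebesgue_on G))
          \<longleftrightarrow> OSC_N T G \<and> GCC T G)"
proof -
  obtain B Z where B: "B \<in> sets borel" "Z \<in> null_sets lebesgue" "B \<union> Z = G"
    using sets_lebesgue_almost_borel[OF assms(2)] by (auto simp: negligible_iff_null_sets)
  have "G - B = Z - B" using B(3) by auto
  moreover have "Z - B \<in> null_sets lebesgue" using B(1,2) by (intro null_set_Diff) auto
  ultimately interpret observation_version T B G
    using assms B by unfold_locales auto
  show ?thesis
  proof (intro conjI iffI)
    assume "\<exists>C>0. \<forall>u0 u1 u v. weak_wave_solution H10 T u0 u1 u v \<longrightarrow>
      (l2_norm (weak_deriv u0))\<^sup>2 + (l2_norm u1)\<^sup>2 \<le> C * (\<integral>(t, x). (v t x)\<^sup>2 \<partial>lebesgue_on G)"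
    then obtain C where C: "C > 0" and "\<And>u0 u1 u v. weak_wave_solution H10 T u0 u1 u v \<Longrightarrow>
      (l2_norm (weak_deriv u0))\<^sup>2 + (l2_norm u1)\<^sup>2 \<le> C * (\<integral>(t, x). (v t x)\<^sup>2 \<partial>lebesgue_on G)" by auto
    from this(2) have "bounded_observability (-1) B (2 * C)"
      by (rule bounded_observability_if_observable) (use C in auto)
    then show "OSC_D T G" "GCC T G"
      using C by (auto intro: bounded_observability_imp_OSC_D bounded_observability_imp_GCC)
  next
    assume "OSC_D T G \<and> GCC T G"
    then obtain C where C: "C > 0" "\<And>p. periodic_L2 p \<Longrightarrow> (\<integral>c. p c \<partial>circ) = 0 \<Longrightarrow>
      (\<integral>c. (p c)\<^sup>2 \<partial>circ) \<le> C * obs_form (-1) B p"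
      using OSC_D_imp_L2_observable by metis
    show "\<exists>C>0. \<forall>u0 u1 u v. weak_wave_solution H10 T u0 u1 u v \<longrightarrow>
      (l2_norm (weak_deriv u0))\<^sup>2 + (l2_norm u1)\<^sup>2 \<le> C * (\<integral>(t, x). (v t x)\<^sup>2 \<partial>lebesgue_on G)"
    proof (intro exI[of _ "2 * C"] conjI allI impI)
      fix u0 u1 u v assume "weak_wave_solution H10 T u0 u1 u v"
      then show "(l2_norm (weak_deriv u0))\<^sup>2 + (l2_norm u1)\<^sup>2 \<le> 2 * C * (\<integral>(t, x). (v t x)\<^sup>2 \<partial>lebesgue_on G)"
        by (rule observable_if_L2_observable[where \<epsilon> = "-1", rotated 2]) (use C(2) in auto)
    qed (use C(1) in simp)
  next
    assume "\<exists>C>0. \<forall>u0 u1 u v. weak_wave_solution H1 T u0 u1 u v \<longrightarrow>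
      (l2_norm (weak_deriv u0))\<^sup>2 + (l2_norm u1)\<^sup>2 \<le> C * (\<integral>(t, x). (v t x)\<^sup>2 \<partial>lebesgue_on G)"
    then obtain C where C: "C > 0" and "\<And>u0 u1 u v. weak_wave_solution H1 T u0 u1 u v \<Longrightarrow>
      (l2_norm (weak_deriv u0))\<^sup>2 + (l2_norm u1)\<^sup>2 \<le> C * (\<integral>(t, x). (v t x)\<^sup>2 \<partial>lebesgue_on G)" by auto
    from this(2) have "bounded_observability 1 B (2 * C)"
      by (rule bounded_observability_if_observable) (use C in auto)
    then show "OSC_N T G" "GCC T G"
      using C by (auto intro: bounded_observability_imp_OSC_N bounded_observability_imp_GCC)
  next
    assume "OSC_N T G \<and> GCC T G"
    then obtain C where C: "C > 0" "\<And>p. periodic_L2 p \<Longrightarrow>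
      (\<integral>c. (p c)\<^sup>2 \<partial>circ) \<le> C * obs_form 1 B p"
      using OSC_N_imp_L2_observable by metis
    show "\<exists>C>0. \<forall>u0 u1 u v. weak_wave_solution H1 T u0 u1 u v \<longrightarrow>
      (l2_norm (weak_deriv u0))\<^sup>2 + (l2_norm u1)\<^sup>2 \<le> C * (\<integral>(t, x). (v t x)\<^sup>2 \<partial>lebesgue_on G)"
    proof (intro exI[of _ "2 * C"] conjI allI impI)
      fix u0 u1 u v assume "weak_wave_solution H1 T u0 u1 u v"
      then show "(l2_norm (weak_deriv u0))\<^sup>2 + (l2_norm u1)\<^sup>2 \<le> 2 * C * (\<integral>(t, x). (v t x)\<^sup>2 \<partial>lebesgue_on G)"
        by (rule observable_if_L2_observable[where \<epsilon> = 1, rotated 2]) (use C(2) in auto)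
    qed (use C(1) in simp)
  qed
qed

end
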